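(* Let $M$ be a compact $C^\infty$ manifold (possibly with boundary) of dimension $d<n$ and let $f\colon M\to\mathbb{C}^n$ be a totally real $C^\infty$ embedding. Let $K\subset\mathbb{C}^n$ be a compact polynomially convex set. Then for any $k\geq 1$ and for any $\varepsilon>0$ there exists a totally real $C^\infty$ embedding $f_\varepsilon\colon M\to\mathbb{C}^n$ such that (1) $\|f_\varepsilon-f\|_{C^k(M)}<\varepsilon$, (2) $f_\varepsilon-f=0$ on $f^{-1}(K)$, (3) $\widehat{K\cup f_\varepsilon(M)}=K\cup f_\varepsilon(M)$.
   Context: For a compact set $H\subset\mathbb{C}^n$, its polynomial hull is $\widehat H=\{z\in\mathbb{C}^n : |p(z)|\le \max_{H}|p| \text{ for every holomorphic polynomial } p\}$; $H$ is polynomially convex if $\widehat H=H$. An embedding $f\colon M\to\mathbb{C}^n$ is totally real if for each $x\in M$ the real subspace $V=df_x(T_xM)\subset\mathbb{C}^n$ satisfies $V\cap iV=\{0\}$. $\|\cdot\|_{C^k(M)}$ denotes a (fixed) $C^k$-norm on $C^k$ maps from the compact manifold $M$ to $\mathbb{C}^n$. *)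

theory Defs
  imports "HOL-Analysis.Analysis"
begin

section \<open>Polynomial convexity\<close>

text \<open>A holomorphic polynomial is a finite complex combination of monomials
  \<open>z\<^sub>1\<^sup>\<alpha>\<^sub>1 \<cdots> z\<^sub>n\<^sup>\<alpha>\<^sub>n\<close>, the multi-index \<open>\<alpha>\<close> being a function on the index type.\<close>

definition holomorphic_polynomial :: "(complex ^ 'n::finite \<Rightarrow> complex) \<Rightarrow> bool" where
  "holomorphic_polynomial p \<longleftrightarrow>
     (\<exists>(A :: ('n \<Rightarrow> nat) set) c. finite A \<and>
        p = (\<lambda>z. \<Sum>\<alpha>\<in>A. c \<alpha> * (\<Prod>j\<in>UNIV. (z $ j) ^ \<alpha> j)))"

text \<open>Intended for compact \<open>H\<close>, where the supremum is a maximum if \<open>H \<noteq> {}\<close>.  The supremum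
  of the empty set is a fixed (unspecified) real number, which is exceeded by the modulus of some
  constant polynomial; hence the hull of the empty set is empty, as shown below.\<close>

definition polynomial_hull :: "(complex ^ 'n::finite) set \<Rightarrow> (complex ^ 'n) set" where
  "polynomial_hull H =
     {z. \<forall>p. holomorphic_polynomial p \<longrightarrow> norm (p z) \<le> (SUP w\<in>H. norm (p w))}"

definition polynomially_convex :: "(complex ^ 'n::finite) set \<Rightarrow> bool" where
  "polynomially_convex H \<longleftrightarrow> polynomial_hull H = H"

lemma holomorphic_polynomial_const:
  "holomorphic_polynomial (\<lambda>z :: complex ^ 'n::finite. a)"
  unfolding holomorphic_polynomial_def
  by (rule exI[of _ "{\<lambda>_. 0}"], rule exI[of _ "\<lambda>_. a"]) simp

lemma polynomial_hull_empty: "polynomial_hull ({} :: (complex ^ 'n::finite) set) = {}"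
proof -
  let ?a = "complex_of_real (\<bar>Sup {}\<bar> + 1)"
  have "norm ?a = \<bar>Sup ({} :: real set)\<bar> + 1"
    unfolding norm_of_real by linarith
  then have "\<not> norm ?a \<le> Sup {}"
    by linarith
  then show ?thesis
    using holomorphic_polynomial_const[of ?a] unfolding polynomial_hull_def by fastforce
qed

section \<open>Calculus on subsets of Euclidean space and of the closed half-space\<close>

text \<open>The space \<open>\<real>\<^sup>d\<close> is \<^const>\<open>Euclidean_space\<close> \<open>d\<close>: sequences vanishing from index \<open>d\<close> on.
  For \<open>d = 0\<close> the half-space is the one-point space.\<close>

definition half_space :: "nat \<Rightarrow> (nat \<Rightarrow> real) topology" where
  "half_space d = subtopology (Euclidean_space d) {x. 0 \<le> x 0}"

text \<open>Partial derivatives are taken relative to \<open>S\<close>.  At a boundary point of a relatively open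
  subset of the half-space, the derivative in direction \<open>0\<close> is therefore one-sided; it agrees with
  the derivative of any smooth extension.\<close>

definition has_partial ::
  "(nat \<Rightarrow> real) set \<Rightarrow> nat \<Rightarrow> ((nat \<Rightarrow> real) \<Rightarrow> 'b::real_normed_vector) \<Rightarrow> (nat \<Rightarrow> real) \<Rightarrow> 'b \<Rightarrow> bool"
where
  "has_partial S i g x D \<longleftrightarrow>
     ((\<lambda>t. g (x(i := t))) has_vector_derivative D) (at (x i) within {t. x(i := t) \<in> S})"

definition partial ::
  "(nat \<Rightarrow> real) set \<Rightarrow> nat \<Rightarrow> ((nat \<Rightarrow> real) \<Rightarrow> 'b::real_normed_vector) \<Rightarrow> (nat \<Rightarrow> real) \<Rightarrow> 'b"
where
  "partial S i g x =
     vector_derivative (\<lambda>t. g (x(i := t))) (at (x i) within {t. x(i := t) \<in> S})"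

primrec iter_partial ::
  "(nat \<Rightarrow> real) set \<Rightarrow> nat list \<Rightarrow> ((nat \<Rightarrow> real) \<Rightarrow> 'b::real_normed_vector) \<Rightarrow> (nat \<Rightarrow> real) \<Rightarrow> 'b"
where
  "iter_partial S [] g = g"
| "iter_partial S (i # is) g = partial S i (iter_partial S is g)"

text \<open>\<open>C\<^sup>k\<close> on an open subset \<open>W\<close> of \<open>\<real>\<^sup>d\<close>.\<close>

primrec Ck_on ::
  "nat \<Rightarrow> (nat \<Rightarrow> real) set \<Rightarrow> nat \<Rightarrow> ((nat \<Rightarrow> real) \<Rightarrow> 'b::real_normed_vector) \<Rightarrow> bool"
where
  "Ck_on d W 0 g \<longleftrightarrow> continuous_on W g"
| "Ck_on d W (Suc k) g \<longleftrightarrow>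
     continuous_on W g \<and>
     (\<forall>i<d. (\<forall>x\<in>W. \<exists>D. has_partial W i g x D) \<and> Ck_on d W k (partial W i g))"

text \<open>\<open>C\<^sup>\<infinity>\<close> on an arbitrary subset \<open>S\<close> of \<open>\<real>\<^sup>d\<close>: locally the restriction of a \<open>C\<^sup>\<infinity>\<close>
  function defined on an open subset of \<open>\<real>\<^sup>d\<close>.\<close>

definition smooth_fun_on ::
  "nat \<Rightarrow> (nat \<Rightarrow> real) set \<Rightarrow> ((nat \<Rightarrow> real) \<Rightarrow> 'b::real_normed_vector) \<Rightarrow> bool"
where
  "smooth_fun_on d S g \<longleftrightarrow>
     (\<forall>x\<in>S. \<exists>W h. openin (Euclidean_space d) W \<and> x \<in> W \<and>
        (\<forall>k. Ck_on d W k h) \<and> (\<forall>y\<in>S \<inter> W. h y = g y))"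

section \<open>Manifolds with boundary\<close>

text \<open>A chart is a pair of its domain and its coordinate map; the values of the coordinate map
  outside the domain are irrelevant.\<close>

type_synonym 'a chart = "'a set \<times> ('a \<Rightarrow> nat \<Rightarrow> real)"

definition is_chart :: "nat \<Rightarrow> 'a topology \<Rightarrow> 'a chart \<Rightarrow> bool" where
  "is_chart d X = (\<lambda>(U, \<phi>). openin X U \<and> openin (half_space d) (\<phi> ` U) \<and>
     homeomorphic_map (subtopology X U) (subtopology (half_space d) (\<phi> ` U)) \<phi>)"

definition smoothly_compatible :: "nat \<Rightarrow> 'a chart \<Rightarrow> 'a chart \<Rightarrow> bool" where
  "smoothly_compatible d = (\<lambda>(U, \<phi>) (V, \<psi>).
     \<forall>i<d. smooth_fun_on d (\<phi> ` (U \<inter> V)) (\<lambda>x. \<psi> (inv_into U \<phi> x) i))"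

text \<open>A \<open>C\<^sup>\<infinity>\<close> manifold of dimension \<open>d\<close>, possibly with boundary, given by its topology and any
  smooth atlas (not necessarily maximal).  Quantifying over both orders of each pair of charts makes
  transition maps diffeomorphisms.\<close>

definition smooth_manifold_with_boundary :: "nat \<Rightarrow> 'a topology \<Rightarrow> 'a chart set \<Rightarrow> bool" where
  "smooth_manifold_with_boundary d X \<A> \<longleftrightarrow>
     Hausdorff_space X \<and> second_countable X \<and>
     (\<forall>c\<in>\<A>. is_chart d X c) \<and> (\<Union>c\<in>\<A>. fst c) = topspace X \<and>
     (\<forall>c\<in>\<A>. \<forall>c'\<in>\<A>. smoothly_compatible d c c')"

definition local_rep :: "'a chart \<Rightarrow> ('a \<Rightarrow> 'b) \<Rightarrow> (nat \<Rightarrow> real) \<Rightarrow> 'b" where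
  "local_rep = (\<lambda>(U, \<phi>) f. f \<circ> inv_into U \<phi>)"

definition smooth_map :: "nat \<Rightarrow> 'a chart set \<Rightarrow> ('a \<Rightarrow> 'b::real_normed_vector) \<Rightarrow> bool" where
  "smooth_map d \<A> f \<longleftrightarrow>
     (\<forall>(U, \<phi>)\<in>\<A>. smooth_fun_on d (\<phi> ` U) (local_rep (U, \<phi>) f))"

text \<open>The differential at \<open>x\<close>, where the tangent space at \<open>x\<close> is identified with \<open>\<real>\<^sup>d\<close> by means
  of the chart.  Its injectivity and its image do not depend on the chart.\<close>

definition differential ::
  "nat \<Rightarrow> 'a chart \<Rightarrow> ('a \<Rightarrow> 'b::real_normed_vector) \<Rightarrow> 'a \<Rightarrow> (nat \<Rightarrow> real) \<Rightarrow> 'b"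
where
  "differential d = (\<lambda>(U, \<phi>) f x v.
     \<Sum>i<d. v i *\<^sub>R partial (\<phi> ` U) i (local_rep (U, \<phi>) f) (\<phi> x))"

definition immersion :: "nat \<Rightarrow> 'a chart set \<Rightarrow> ('a \<Rightarrow> 'b::real_normed_vector) \<Rightarrow> bool" where
  "immersion d \<A> f \<longleftrightarrow>
     smooth_map d \<A> f \<and>
     (\<forall>c\<in>\<A>. \<forall>x\<in>fst c. inj_on (differential d c f x) (topspace (Euclidean_space d)))"

definition smooth_embedding ::
  "nat \<Rightarrow> 'a topology \<Rightarrow> 'a chart set \<Rightarrow> ('a \<Rightarrow> 'b::real_normed_vector) \<Rightarrow> bool"
where
  "smooth_embedding d X \<A> f \<longleftrightarrow> immersion d \<A> f \<and> embedding_map X euclidean f"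

definition totally_real ::
  "nat \<Rightarrow> 'a chart set \<Rightarrow> ('a \<Rightarrow> complex ^ 'n::finite) \<Rightarrow> bool"
where
  "totally_real d \<A> f \<longleftrightarrow>
     (\<forall>c\<in>\<A>. \<forall>x\<in>fst c.
        let V = differential d c f x ` topspace (Euclidean_space d)
        in V \<inter> (\<lambda>v. \<i> *s v) ` V = {0})"

section \<open>Norms of differentiability class k\<close>

text \<open>A \<open>C\<^sup>k\<close>-norm on a compact manifold depends on the choice of finitely many charts, together
  with compact subsets of their domains that cover the manifold.  Any two choices give
  equivalent norms.\<close>

definition compact_chart_cover :: "'a topology \<Rightarrow> 'a chart set \<Rightarrow> ('a chart \<times> 'a set) set \<Rightarrow> bool" where
  "compact_chart_cover X \<A> \<C> \<longleftrightarrow>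
     finite \<C> \<and> (\<forall>(c, L)\<in>\<C>. c \<in> \<A> \<and> compactin X L \<and> L \<subseteq> fst c) \<and>
     (\<Union>(c, L)\<in>\<C>. L) = topspace X"

text \<open>The element \<open>0\<close> only matters for the empty manifold, where no derivatives are collected.\<close>

definition Ck_norm ::
  "nat \<Rightarrow> ('a chart \<times> 'a set) set \<Rightarrow> nat \<Rightarrow> ('a \<Rightarrow> 'b::real_normed_vector) \<Rightarrow> real"
where
  "Ck_norm d \<C> k g =
     Sup (insert 0 {norm (iter_partial (\<phi> ` U) is (local_rep (U, \<phi>) g) (\<phi> x)) | U \<phi> L is x.
       ((U, \<phi>), L) \<in> \<C> \<and> x \<in> L \<and> length is \<le> k \<and> set is \<subseteq> {..<d}})"

end

theory Submission
  imports Defs "HOL-Library.Function_Algebras"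
begin

text \<open>The perturbed embedding is \<open>(id + E) \<circ> f\<close> for a smooth map \<open>E\<close> of \<open>\<complex>\<^sup>n\<close> that vanishes on \<open>K\<close> and is small
  in \<open>C\<^sup>k\<close>.  Near each of its points \<open>f(M)\<close> is the image of a map \<open>s\<close> of a coordinate subspace \<open>\<real>\<^sup>J\<close>, \<open>|J| = d\<close>, such
  that \<open>\<Lambda> \<circ> s\<close> is nearly the inclusion into \<open>\<complex>\<^sup>J\<close> for some complex matrix \<open>\<Lambda>\<close> with range in \<open>\<complex>\<^sup>J\<close>; call such a piece
  a cell.  Given \<open>z\<close> off a cell, let \<open>s y\<close> satisfy \<open>Re \<Lambda>(z - s y) = 0\<close>.  With \<open>q\<close> the sum of the squares of the
  coordinates and \<open>M\<close> large, \<open>1 - q(\<Lambda>(w - s y))/M\<close> has modulus at most 1 for \<open>w\<close> in the cell, since \<open>\<Lambda>\<close> maps the cell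
  almost into the reals, and is at least 1 at \<open>w = z\<close>.  This leads to a polynomial \<open>\<gamma>\<close> and a projection \<open>\<pi>\<close> along a
  direction \<open>e\<close> close to the kernel of \<open>\<Lambda>\<close> such that \<open>|\<gamma> \<circ> \<pi>| < 1\<close> on the cell and \<open>|\<gamma>(\<pi> z)| > 1\<close>.

  Approximate \<open>s\<close> by a polynomial map.  As \<open>d < n\<close>, the image satisfies \<open>F = 0\<close> for a polynomial \<open>F \<noteq> 0\<close>.  For large
  \<open>N\<close> the polynomial shear \<open>w \<mapsto> w + \<gamma>(\<pi> w)\<^sup>N e\<close> hardly moves the cell but moves \<open>z\<close> far away, so that the
  polynomial defining the sheared hypersurface vanishes on the perturbed cell but not near \<open>z\<close>.  A polynomial that
  vanishes on \<open>Q\<close> but not at \<open>z\<close> shows that \<open>z\<close> is not in the hull of \<open>P \<union> Q\<close> if \<open>P\<close> is polynomially convex and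
  \<open>z \<notin> P\<close>.  Applied to finitely many cells and points \<open>z\<close>, this yields a small perturbation for which the hull lies in
  a prescribed neighborhood; the limit of a rapidly converging sequence of such perturbations is polynomially convex.\<close>

section \<open>Holomorphic polynomials\<close>

text \<open>Equality of a compact set with its hull is not stable under small perturbations, but
  inclusion of the hull in a given neighborhood is. Hence each step secures only such an inclusion,
  with a margin that later corrections respect, and equality appears in the limit. Cells are treated
  one after another: a polynomially convex neighborhood of what has been treated takes the place of
  \<open>K\<close> when the next cell is added. The same device reconciles the shears with
  \<open>E = 0\<close> on \<open>K\<close>: a shear is cut off near \<open>K\<close>, and where the
  cutoff may differ from 1 the cell already lies in the interior of a polynomially convex
  neighborhood of \<open>K\<close>, which a small displacement cannot leave. Letting
  \<open>E\<close> act on the ambient space makes the perturbations of overlapping cells consistent,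
  and a Lipschitz constant that is small against the constants of the cells preserves injectivity,
  immersion and total reality. Since the maps \<open>s\<close> live on whole coordinate subspaces,
  cells at boundary points are treated like the others.\<close>

abbreviation monomial :: "('n \<Rightarrow> nat) \<Rightarrow> complex ^ 'n::finite \<Rightarrow> complex" where
  "monomial \<alpha> z \<equiv> \<Prod>j\<in>UNIV. (z $ j) ^ \<alpha> j"

lemma holomorphic_polynomialI:
  assumes "finite A" "\<And>z. p z = (\<Sum>\<alpha>\<in>A. c \<alpha> * monomial \<alpha> z)"
  shows "holomorphic_polynomial p"
  using assms unfolding holomorphic_polynomial_def by blast

lemma holomorphic_polynomial_coord: "holomorphic_polynomial (\<lambda>z :: complex ^ 'n::finite. z $ i)"
proof (rule holomorphic_polynomialI[where A = "{\<lambda>j. if j = i then 1 else 0}" and c = "\<lambda>_. 1"])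
  fix z :: "complex ^ 'n"
  have "monomial (\<lambda>j. if j = i then 1 else 0) z = (\<Prod>j\<in>UNIV. if j = i then z $ i else 1)"
    by (rule prod.cong) auto
  then show "z $ i = (\<Sum>\<alpha>\<in>{\<lambda>j. if j = i then 1 else 0}. 1 * monomial \<alpha> z)"
    by simp
qed simp

lemma holomorphic_polynomial_add:
  assumes "holomorphic_polynomial p" "holomorphic_polynomial q"
  shows "holomorphic_polynomial (\<lambda>z. p z + q z)"
proof -
  obtain A c where A: "finite A" "p = (\<lambda>z. \<Sum>\<alpha>\<in>A. c \<alpha> * monomial \<alpha> z)"
    using assms(1) unfolding holomorphic_polynomial_def by blast
  obtain B e where B: "finite B" "q = (\<lambda>z. \<Sum>\<alpha>\<in>B. e \<alpha> * monomial \<alpha> z)"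
    using assms(2) unfolding holomorphic_polynomial_def by blast
  let ?c = "\<lambda>\<alpha>. (if \<alpha> \<in> A then c \<alpha> else 0) + (if \<alpha> \<in> B then e \<alpha> else 0)"
  show ?thesis
  proof (rule holomorphic_polynomialI[where A = "A \<union> B" and c = ?c])
    fix z
    have "(\<Sum>\<alpha>\<in>A \<union> B. (if \<alpha> \<in> A then c \<alpha> else 0) * monomial \<alpha> z) = p z"
      unfolding A(2) using A(1) B(1) by (intro sum.mono_neutral_cong_right) auto
    moreover have "(\<Sum>\<alpha>\<in>A \<union> B. (if \<alpha> \<in> B then e \<alpha> else 0) * monomial \<alpha> z) = q z"
      unfolding B(2) using A(1) B(1) by (intro sum.mono_neutral_cong_right) auto
    ultimately show "p z + q z = (\<Sum>\<alpha>\<in>A \<union> B. ?c \<alpha> * monomial \<alpha> z)"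
      by (simp add: distrib_right sum.distrib)
  qed (use A B in auto)
qed

lemma holomorphic_polynomial_sum:
  assumes "\<And>i. i \<in> I \<Longrightarrow> holomorphic_polynomial (p i)"
  shows "holomorphic_polynomial (\<lambda>z. \<Sum>i\<in>I. p i z)"
  using assms
  by (induction I rule: infinite_finite_induct)
    (auto intro: holomorphic_polynomial_add holomorphic_polynomial_const)

lemma holomorphic_polynomial_mult:
  fixes p q :: "complex ^ 'n::finite \<Rightarrow> complex"
  assumes "holomorphic_polynomial p" "holomorphic_polynomial q"
  shows "holomorphic_polynomial (\<lambda>z. p z * q z)"
proof -
  obtain A c where A: "finite A" "p = (\<lambda>z. \<Sum>\<alpha>\<in>A. c \<alpha> * monomial \<alpha> z)"
    using assms(1) unfolding holomorphic_polynomial_def by blast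
  obtain B e where B: "finite B" "q = (\<lambda>z. \<Sum>\<alpha>\<in>B. e \<alpha> * monomial \<alpha> z)"
    using assms(2) unfolding holomorphic_polynomial_def by blast
  have "holomorphic_polynomial (\<lambda>z. (c \<alpha> * monomial \<alpha> z) * (e \<beta> * monomial \<beta> z))" for \<alpha> \<beta>
    by (rule holomorphic_polynomialI[where A = "{\<lambda>j. \<alpha> j + \<beta> j}" and c = "\<lambda>_. c \<alpha> * e \<beta>"])
      (auto simp: power_add prod.distrib)
  then have "holomorphic_polynomial (\<lambda>z. \<Sum>\<alpha>\<in>A. \<Sum>\<beta>\<in>B. (c \<alpha> * monomial \<alpha> z) * (e \<beta> * monomial \<beta> z))"
    by (intro holomorphic_polynomial_sum)
  then show ?thesis
    unfolding A(2) B(2) sum_product .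
qed

lemma holomorphic_polynomial_cmult:
  "holomorphic_polynomial p \<Longrightarrow> holomorphic_polynomial (\<lambda>z. a * p z)"
  by (intro holomorphic_polynomial_mult holomorphic_polynomial_const)

lemma holomorphic_polynomial_diff:
  assumes "holomorphic_polynomial p" "holomorphic_polynomial q"
  shows "holomorphic_polynomial (\<lambda>z. p z - q z)"
  using holomorphic_polynomial_add[OF assms(1) holomorphic_polynomial_cmult[OF assms(2), of "-1"]]
  by simp

lemma holomorphic_polynomial_power:
  "holomorphic_polynomial p \<Longrightarrow> holomorphic_polynomial (\<lambda>z. p z ^ k)"
  by (induction k) (auto intro: holomorphic_polynomial_mult holomorphic_polynomial_const)

lemma holomorphic_polynomial_prod:
  assumes "\<And>i. i \<in> I \<Longrightarrow> holomorphic_polynomial (p i)"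
  shows "holomorphic_polynomial (\<lambda>z. \<Prod>i\<in>I. p i z)"
  using assms
  by (induction I rule: infinite_finite_induct)
    (auto intro: holomorphic_polynomial_mult holomorphic_polynomial_const)

lemma holomorphic_polynomial_compose:
  fixes \<Phi> :: "complex ^ 'n::finite \<Rightarrow> complex ^ 'n"
  assumes "holomorphic_polynomial p" "\<And>j. holomorphic_polynomial (\<lambda>z. \<Phi> z $ j)"
  shows "holomorphic_polynomial (\<lambda>z. p (\<Phi> z))"
proof -
  obtain A c where A: "finite A" "p = (\<lambda>z. \<Sum>\<alpha>\<in>A. c \<alpha> * monomial \<alpha> z)"
    using assms(1) unfolding holomorphic_polynomial_def by blast
  show ?thesis
    unfolding A(2)
    by (intro holomorphic_polynomial_sum holomorphic_polynomial_cmult holomorphic_polynomial_prod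
        holomorphic_polynomial_power assms)
qed

lemma continuous_on_holomorphic_polynomial:
  assumes "holomorphic_polynomial p" shows "continuous_on S p"
proof -
  obtain A c where "finite A" "p = (\<lambda>z. \<Sum>\<alpha>\<in>A. c \<alpha> * monomial \<alpha> z)"
    using assms unfolding holomorphic_polynomial_def by blast
  then show ?thesis by (auto intro!: continuous_intros)
qed

text \<open>Reduces vanishing questions in several variables to the finiteness of the root set of a
  nonzero polynomial in one variable.\<close>

lemma holomorphic_polynomial_on_line:
  assumes "holomorphic_polynomial F"
  obtains P where "\<And>t. poly P t = F (a + t *s b)"
proof -
  obtain A c where A: "finite A" "F = (\<lambda>z. \<Sum>\<alpha>\<in>A. c \<alpha> * monomial \<alpha> z)"
    using assms unfolding holomorphic_polynomial_def by blast
  have "poly (\<Sum>\<alpha>\<in>A. Polynomial.smult (c \<alpha>) (\<Prod>j\<in>UNIV. [:a $ j, b $ j:] ^ \<alpha> j)) t = F (a + t *s b)" for t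
    unfolding A(2) by (simp add: poly_sum poly_prod)
  then show ?thesis using that by blast
qed

lemma of_real_smult: "complex_of_real t *s (x :: complex ^ 'n) = t *\<^sub>R x"
  unfolding vec_eq_iff vector_smult_component vector_scaleR_component
  by (simp add: scaleR_conv_of_real)

text \<open>Along the line through \<open>a\<close> and \<open>w\<close> only finitely many
  parameters are roots, so some small real parameter is not one.\<close>

lemma holomorphic_polynomial_nonzero_dense:
  assumes F: "holomorphic_polynomial F" "F w \<noteq> 0" and \<eta>: "\<eta> > 0"
  shows "\<exists>e. dist e a < \<eta> \<and> F e \<noteq> 0"
proof -
  obtain P where P: "\<And>t. poly P t = F (a + t *s (w - a))"
    using holomorphic_polynomial_on_line[OF F(1)] by blast
  have "poly P 1 \<noteq> 0" using P F(2) by simp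
  then have fin: "finite {t. poly P t = 0}"
    by (intro poly_roots_finite) auto
  \<comment> \<open>The summand 1 keeps the denominator positive when \<open>w = a\<close>;
    parameters below \<open>d\<close> move \<open>a\<close> by less than
    \<open>\<eta>\<close>.\<close>
  define d where "d = \<eta> / (norm (w - a) + 1)"
  have d: "d > 0" unfolding d_def using \<eta> by (smt (verit) divide_pos_pos norm_ge_zero)
  have "infinite (complex_of_real ` {0<..<d})"
    using d by (simp add: finite_image_iff inj_on_def)
  then obtain t where t: "t \<in> {0<..<d}" "poly P (complex_of_real t) \<noteq> 0"
    using fin by (smt (verit) finite_subset imageE mem_Collect_eq subsetI)
  have "norm (complex_of_real t *s (w - a)) = t * norm (w - a)"
  proof -
    have "complex_of_real t *s (w - a) = t *\<^sub>R (w - a)"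
      by (rule of_real_smult)
    then show ?thesis using t by simp
  qed
  also have "\<dots> \<le> t * (norm (w - a) + 1)"
    using t by (intro mult_left_mono) auto
  also have "\<dots> < d * (norm (w - a) + 1)"
    using t by (intro mult_strict_right_mono) (auto intro: add_nonneg_pos)
  also have "\<dots> = \<eta>"
    unfolding d_def by (smt (verit) nonzero_divide_eq_eq norm_ge_zero)
  finally have "dist (a + complex_of_real t *s (w - a)) a < \<eta>"
    by (simp add: dist_norm)
  moreover have "F (a + complex_of_real t *s (w - a)) \<noteq> 0"
    using t(2) P by simp
  ultimately show ?thesis by blast
qed

text \<open>Kronecker's substitution \<open>z\<^sub>j = t^(D^j)\<close> sends distinct monomials to distinct powers.\<close>
lemma nonzero_coefficients_imp_nonzero:
  fixes c :: "('n::finite \<Rightarrow> nat) \<Rightarrow> complex"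
  assumes A: "finite A" and \<alpha>0: "\<alpha>\<^sub>0 \<in> A" "c \<alpha>\<^sub>0 \<noteq> 0"
  shows "\<exists>w. (\<Sum>\<alpha>\<in>A. c \<alpha> * monomial \<alpha> w) \<noteq> 0"
proof -
  obtain h :: "'n \<Rightarrow> nat" where h: "bij_betw h UNIV {0..<CARD('n)}"
    using ex_bij_betw_finite_nat[of "UNIV :: 'n set"] by auto
  \<comment> \<open>\<open>D\<close> exceeds every exponent that occurs, so the exponents
    \<open>\<alpha> j\<close> are the base-\<open>D\<close> digits of
    \<open>N \<alpha>\<close>.\<close>
  define D where "D = Suc (Max ((\<lambda>(\<alpha>, j). \<alpha> j) ` (A \<times> UNIV)))"
  have D: "\<alpha> j < D" if "\<alpha> \<in> A" for \<alpha> j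
    unfolding D_def less_Suc_eq_le using A that by (intro Max_ge) force+
  define N where "N \<alpha> = (\<Sum>j\<in>UNIV. \<alpha> j * D ^ h j)" for \<alpha> :: "'n \<Rightarrow> nat"
  have uniq: "\<forall>i<k. a i = b i"
    if "\<forall>i<k. a i < D" "\<forall>i<k. b i < D" "(\<Sum>i<k. a i * D ^ i) = (\<Sum>i<k. b i * D ^ i)"
    for k and a b :: "nat \<Rightarrow> nat"
    using that
  proof (induction k)
    case (Suc k)
    have small: "(\<Sum>i<k. c i * D ^ i) < D ^ k" if "\<forall>i<k. c i < D" for c :: "nat \<Rightarrow> nat" and k
      using that
    proof (induction k)
      case (Suc k)
      have "(\<Sum>i<Suc k. c i * D ^ i) < D ^ k + c k * D ^ k" using Suc by simp
      also have "\<dots> = (c k + 1) * D ^ k" by simp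
      also have "\<dots> \<le> D * D ^ k" using Suc.prems by (intro mult_right_mono) (auto simp: Suc_le_eq)
      finally show ?case by simp
    qed simp
    let ?x = "\<Sum>i<k. a i * D ^ i" and ?y = "\<Sum>i<k. b i * D ^ i"
    have eq: "?x + a k * D ^ k = ?y + b k * D ^ k" using Suc.prems by simp
    have xy: "?x < D ^ k" "?y < D ^ k" using Suc.prems by (auto intro!: small)
    have divm: "(x + y * c) div c = y" if "x < c" for x y c :: nat using that by simp
    have "a k = (?x + a k * D ^ k) div D ^ k" by (rule divm[OF xy(1), symmetric])
    also have "\<dots> = b k" unfolding eq by (rule divm[OF xy(2)])
    finally have ab: "a k = b k" .
    have "?x = ?y" using eq unfolding ab by simp
    then have "\<forall>i<k. a i = b i"
      by (intro Suc.IH) (use Suc.prems in auto)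
    then show ?case using ab by (auto simp: less_Suc_eq)
  qed simp
  have Nh: "N \<alpha> = (\<Sum>i<CARD('n). \<alpha> (inv_into UNIV h i) * D ^ i)" for \<alpha>
  proof -
    have "bij_betw (inv_into UNIV h) {..<CARD('n)} UNIV"
      using bij_betw_inv_into[OF h] by (simp add: lessThan_atLeast0)
    then have "N \<alpha> = (\<Sum>i<CARD('n). \<alpha> (inv_into UNIV h i) * D ^ h (inv_into UNIV h i))"
      unfolding N_def by (rule sum.reindex_bij_betw[symmetric])
    also have "\<dots> = (\<Sum>i<CARD('n). \<alpha> (inv_into UNIV h i) * D ^ i)"
      using h by (intro sum.cong) (auto simp: bij_betw_def f_inv_into_f lessThan_atLeast0)
    finally show ?thesis .
  qed
  have inj: "inj_on N A"
  proof (rule inj_onI)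
    fix \<alpha> \<beta> assume *: "\<alpha> \<in> A" "\<beta> \<in> A" "N \<alpha> = N \<beta>"
    have "\<forall>i<CARD('n). \<alpha> (inv_into UNIV h i) = \<beta> (inv_into UNIV h i)"
      using * D unfolding Nh by (intro uniq) auto
    moreover have "inv_into UNIV h (h j) = j" "h j < CARD('n)" for j
      using h by (auto simp: bij_betw_def)
    ultimately show "\<alpha> = \<beta>" by (metis ext)
  qed
  \<comment> \<open>This is the given polynomial along the curve \<open>t ^ D ^ h j\<close>. As
    \<open>N\<close> is injective on \<open>A\<close>, only \<open>\<alpha>\<^sub>0\<close>
    contributes to the coefficient at \<open>N \<alpha>\<^sub>0\<close>.\<close>
  define P where "P = (\<Sum>\<alpha>\<in>A. Polynomial.monom (c \<alpha>) (N \<alpha>))"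
  have "coeff P (N \<alpha>\<^sub>0) = (\<Sum>\<alpha>\<in>A. if \<alpha> = \<alpha>\<^sub>0 then c \<alpha> else 0)"
    unfolding P_def coeff_sum coeff_monom using inj \<alpha>0 by (intro sum.cong) (auto dest: inj_onD)
  also have "\<dots> = c \<alpha>\<^sub>0" using A \<alpha>0 by simp
  finally have "P \<noteq> 0" using \<alpha>0 by force
  then obtain t where t: "poly P t \<noteq> 0" using poly_all_0_iff_0 by blast
  have "poly P t = (\<Sum>\<alpha>\<in>A. c \<alpha> * monomial \<alpha> (\<chi> j. t ^ D ^ h j))"
    unfolding P_def N_def by (simp add: poly_sum poly_monom power_sum mult.commute flip: power_mult)
  then show ?thesis using t by metis
qed

text \<open>Only the leading form \<open>F\<^sub>t\<^sub>o\<^sub>p\<close> of the polynomial matters far out in direction \<open>e\<close>.\<close>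
lemma holomorphic_polynomial_growth:
  fixes c :: "('n::finite \<Rightarrow> nat) \<Rightarrow> complex"
  assumes A: "finite A" and \<alpha>0: "\<alpha>\<^sub>0 \<in> A" "c \<alpha>\<^sub>0 \<noteq> 0"
  defines "F \<equiv> \<lambda>z. \<Sum>\<alpha>\<in>A. c \<alpha> * monomial \<alpha> z"
  obtains T where "holomorphic_polynomial T" "\<exists>w. T w \<noteq> 0"
    "\<And>e R. T e \<noteq> 0 \<Longrightarrow> \<exists>B>0. \<forall>z t. norm z \<le> R \<longrightarrow> B \<le> norm t \<longrightarrow> F (z - t *s e) \<noteq> 0"
proof -
  \<comment> \<open>Terms with coefficient 0 are dropped, so that the top degree \<open>m\<close> is
    attained by a term that is really present.\<close>
  define A' where "A' = {\<alpha>\<in>A. c \<alpha> \<noteq> 0}"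
  define dg where "dg \<alpha> = (\<Sum>j\<in>UNIV. \<alpha> j)" for \<alpha> :: "'n \<Rightarrow> nat"
  define m where "m = Max (dg ` A')"
  have A': "finite A'" "A' \<noteq> {}" unfolding A'_def using A \<alpha>0 by auto
  have dgm: "dg \<alpha> \<le> m" if "\<alpha> \<in> A'" for \<alpha> unfolding m_def using A' that by auto
  have "m \<in> dg ` A'" unfolding m_def using A' by (intro Max_in) auto
  then obtain \<alpha>1 where \<alpha>1: "\<alpha>1 \<in> A'" "dg \<alpha>1 = m" by auto
  define T where "T = (\<lambda>z. \<Sum>\<alpha>\<in>{\<alpha>\<in>A'. dg \<alpha> = m}. c \<alpha> * monomial \<alpha> z)"
  have FA': "F = (\<lambda>z. \<Sum>\<alpha>\<in>A'. c \<alpha> * monomial \<alpha> z)"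
    unfolding F_def A'_def using A by (intro ext sum.mono_neutral_right) auto
  have "holomorphic_polynomial T"
    unfolding T_def using A'
    by (intro holomorphic_polynomialI[where A = "{\<alpha>\<in>A'. dg \<alpha> = m}"]) auto
  moreover have "\<exists>w. T w \<noteq> 0"
    unfolding T_def
  proof (rule nonzero_coefficients_imp_nonzero[of _ \<alpha>1])
    show "finite {\<alpha>\<in>A'. dg \<alpha> = m}" "\<alpha>1 \<in> {\<alpha>\<in>A'. dg \<alpha> = m}" using A' \<alpha>1 by auto
    show "c \<alpha>1 \<noteq> 0" using \<alpha>1 by (simp add: A'_def)
  qed
  moreover have "\<exists>B>0. \<forall>z t. norm z \<le> R \<longrightarrow> B \<le> norm t \<longrightarrow> F (z - t *s e) \<noteq> 0" if e: "T e \<noteq> 0" for e R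
  proof -
    text \<open>With \<open>s = 1/t\<close>, \<open>s^m F (z - t e)\<close> extends continuously to \<open>s = 0\<close>, with value \<open>T (- e)\<close>.\<close>
    define \<Psi> where "\<Psi> = (\<lambda>(z, s). \<Sum>\<alpha>\<in>A'. c \<alpha> * s ^ (m - dg \<alpha>) * monomial \<alpha> (s *s z - e))"
    have scale: "monomial \<alpha> (s *s z) = s ^ dg \<alpha> * monomial \<alpha> z" for \<alpha> and s :: complex and z
      unfolding dg_def by (simp add: power_mult_distrib prod.distrib power_sum)
    have \<Psi>F: "\<Psi> (z, s) = s ^ m * F (z - (1 / s) *s e)" if "s \<noteq> 0" for z s
    proof -
      have "s *s z - e = s *s (z - (1 / s) *s e)" using that by (simp add: vec_eq_iff field_simps)
      then have *: "c \<alpha> * s ^ (m - dg \<alpha>) * monomial \<alpha> (s *s z - e)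
          = s ^ m * (c \<alpha> * monomial \<alpha> (z - (1 / s) *s e))" if "\<alpha> \<in> A'" for \<alpha>
      proof -
        have "s ^ m = s ^ (m - dg \<alpha>) * s ^ dg \<alpha>"
          using dgm[OF that] by (simp flip: power_add)
        then show ?thesis unfolding \<open>s *s z - e = _\<close> scale by simp
      qed
      show ?thesis unfolding \<Psi>_def FA' sum_distrib_left prod.case
        by (intro sum.cong refl *)
    qed
    \<comment> \<open>At \<open>s = 0\<close> the factor \<open>s ^ (m - dg \<alpha>)\<close> is 1
      if \<open>dg \<alpha> = m\<close> and 0 otherwise: exactly the leading form remains.\<close>
    have \<Psi>0: "\<Psi> (z, 0) \<noteq> 0" for z
    proof -
      have "\<Psi> (z, 0) = (\<Sum>\<alpha>\<in>A'. if dg \<alpha> = m then c \<alpha> * monomial \<alpha> (- e) else 0)"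
        unfolding \<Psi>_def using dgm by (simp, intro sum.cong) (auto simp: power_0_left, fastforce)
      also have "\<dots> = T (- e)" unfolding T_def using A' by (simp add: sum.If_cases Int_def)
      also have "\<dots> = (\<Sum>\<alpha>\<in>{\<alpha>\<in>A'. dg \<alpha> = m}. (-1) ^ m * (c \<alpha> * monomial \<alpha> e))"
        unfolding T_def using scale[where s = "-1" and z = e, folded vector_sneg_minus1]
        by (intro sum.cong) (auto simp del: vector_uminus_component)
      also have "\<dots> = (-1) ^ m * T e" unfolding T_def by (simp add: sum_distrib_left)
      finally show ?thesis using e by simp
    qed
    have cont: "continuous_on UNIV \<Psi>"
      unfolding \<Psi>_def case_prod_unfold by (auto intro!: continuous_intros)
    have "continuous_on UNIV (\<lambda>x. \<Psi> (snd x, fst x))"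
      by (rule continuous_on_compose2[OF cont]) (auto intro!: continuous_intros)
    then have op: "open {x. \<Psi> (snd x, fst x) \<noteq> 0}"
      by (intro open_Collect_neq) auto
    \<comment> \<open>The tube lemma makes the nonvanishing near \<open>s = 0\<close> uniform in
      \<open>z\<close>; a neighborhood of \<open>s = 0\<close> corresponds to all large
      \<open>t = 1 / s\<close>.\<close>
    have "{0} \<times> cball 0 R \<subseteq> {x. \<Psi> (snd x, fst x) \<noteq> 0}" using \<Psi>0 by auto
    from Elementary_Topology.tube_lemma[OF compact_cball op this]
    obtain W where W: "0 \<in> W" "open W" "W \<times> cball 0 R \<subseteq> {x. \<Psi> (snd x, fst x) \<noteq> 0}"
      by blast
    then obtain d where "d > 0" "ball 0 d \<subseteq> W"
      by (meson open_contains_ball)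
    with W have d: "d > 0" "ball 0 d \<times> cball 0 R \<subseteq> {x. \<Psi> (snd x, fst x) \<noteq> 0}"
      by blast+
    have "F (z - t *s e) \<noteq> 0" if "norm z \<le> R" "2 / d \<le> norm t" for z t
    proof -
      have "0 < 2 / d" using d by simp
      then have t: "0 < norm t" using that by linarith
      have "1 / norm t \<le> d / 2"
        using that(2) d(1) t by (simp add: field_simps)
      then have "norm (1 / t) < d" using d(1) by (simp add: norm_divide)
      then have "(1 / t, z) \<in> ball 0 d \<times> cball 0 R" using that(1) by (simp add: dist_norm)
      then have "\<Psi> (z, 1 / t) \<noteq> 0" using d(2) by force
      then show ?thesis using \<Psi>F[of "1 / t" z] t by auto
    qed
    then show ?thesis using d by (intro exI[of _ "2 / d"]) auto
  qed
  ultimately show ?thesis using that by blast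
qed

section \<open>Polynomial hulls\<close>

lemma bdd_above_norm_polynomial:
  assumes "compact H" "holomorphic_polynomial p"
  shows "bdd_above ((\<lambda>w. norm (p w)) ` H)"
  by (intro bounded_imp_bdd_above compact_imp_bounded compact_continuous_image assms
      continuous_on_norm continuous_on_holomorphic_polynomial)

text \<open>Nonemptiness is required because the supremum over the empty set is an unspecified
  number. In the converse rule below, the constant polynomial 1 and the bound 0 cover the empty
  set.\<close>

lemma not_in_polynomial_hullI:
  assumes "holomorphic_polynomial p" "H \<noteq> {}" "\<And>w. w \<in> H \<Longrightarrow> norm (p w) \<le> b" "b < norm (p z)"
  shows "z \<notin> polynomial_hull H"
proof -
  have "(SUP w\<in>H. norm (p w)) \<le> b" using assms by (intro cSUP_least) auto
  then show ?thesis using assms unfolding polynomial_hull_def by force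
qed

lemma not_in_polynomial_hullE:
  assumes "z \<notin> polynomial_hull H" "compact H"
  obtains p b where "holomorphic_polynomial p" "0 \<le> b" "\<And>w. w \<in> H \<Longrightarrow> norm (p w) \<le> b" "b < norm (p z)"
proof -
  obtain p where p: "holomorphic_polynomial p" "(SUP w\<in>H. norm (p w)) < norm (p z)"
    using assms unfolding polynomial_hull_def by fastforce
  show ?thesis
  proof (cases "H = {}")
    case True
    then show ?thesis using that[OF holomorphic_polynomial_const[of 1], of 0] by simp
  next
    case False
    have *: "norm (p w) \<le> (SUP w\<in>H. norm (p w))" if "w \<in> H" for w
      using that bdd_above_norm_polynomial[OF assms(2) p(1)] by (intro cSUP_upper)
    moreover have "0 \<le> (SUP w\<in>H. norm (p w))"
      using * False by (meson norm_ge_zero order_trans all_not_in_conv)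
    ultimately show ?thesis using that p by blast
  qed
qed

lemma subset_polynomial_hull: "compact H \<Longrightarrow> H \<subseteq> polynomial_hull H"
  unfolding polynomial_hull_def by (auto intro!: cSUP_upper bdd_above_norm_polynomial)

lemma polynomial_hull_mono:
  assumes "compact H" "compact H'" "H \<subseteq> H'"
  shows "polynomial_hull H \<subseteq> polynomial_hull H'"
proof (rule ccontr)
  assume "\<not> ?thesis"
  then obtain z where z: "z \<in> polynomial_hull H" "z \<notin> polynomial_hull H'" by blast
  then have "H \<noteq> {}" using polynomial_hull_empty by auto
  obtain p b where "holomorphic_polynomial p" "\<And>w. w \<in> H' \<Longrightarrow> norm (p w) \<le> b" "b < norm (p z)"
    using not_in_polynomial_hullE[OF z(2) assms(2)] by metis
  then show False using not_in_polynomial_hullI[of p H b z] z(1) assms(3) \<open>H \<noteq> {}\<close> by blast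
qed

lemma closed_polynomial_hull: "closed (polynomial_hull H)"
proof -
  have "polynomial_hull H = (\<Inter>p\<in>{p. holomorphic_polynomial p}. {z. norm (p z) \<le> (SUP w\<in>H. norm (p w))})"
    unfolding polynomial_hull_def by auto
  moreover have "closed {z. norm (p z) \<le> (SUP w\<in>H. norm (p w))}" if "holomorphic_polynomial p" for p
    using that by (intro closed_Collect_le continuous_on_norm continuous_on_holomorphic_polynomial) auto
  ultimately show ?thesis by auto
qed

lemma norm_vec_le_coords:
  fixes z :: "complex ^ 'n::finite" and R :: real
  assumes "\<And>i. norm (z $ i) \<le> R"
  shows "norm z \<le> CARD('n) * R"
proof -
  have "norm z \<le> (\<Sum>i\<in>UNIV. norm (z $ i))"
    unfolding norm_vec_def by (rule L2_set_le_sum) auto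
  also have "\<dots> \<le> (\<Sum>i\<in>(UNIV::'n set). R)" using assms by (intro sum_mono)
  finally show ?thesis by simp
qed

text \<open>The coordinates are themselves test polynomials. This is the source of the boundedness,
  and so of the compactness, of hulls.\<close>

lemma polynomial_hull_coords:
  fixes H :: "(complex ^ 'n::finite) set"
  assumes "\<And>z i. z \<in> H \<Longrightarrow> norm (z $ i) \<le> R" "z \<in> polynomial_hull H"
  shows "norm (z $ i) \<le> R"
proof (rule ccontr)
  assume "\<not> ?thesis"
  then have "H \<noteq> {}" "R < norm (z $ i)" using assms polynomial_hull_empty by auto
  then show False
    using not_in_polynomial_hullI[OF holomorphic_polynomial_coord[of i], of H R z] assms by blast
qed

lemma bounded_polynomial_hull:
  fixes H :: "(complex ^ 'n::finite) set"
  assumes "bounded H" shows "bounded (polynomial_hull H)"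
proof -
  obtain R where R: "\<And>z. z \<in> H \<Longrightarrow> norm z \<le> R" using assms bounded_iff by blast
  have *: "norm (z $ i) \<le> R" if "z \<in> H" for z i
    using R[OF that] Finite_Cartesian_Product.norm_nth_le[of z i] by simp
  have "norm z \<le> CARD('n) * R" if "z \<in> polynomial_hull H" for z
    using polynomial_hull_coords[OF * that] by (rule norm_vec_le_coords)
  then show ?thesis using bounded_iff by blast
qed

lemma compact_polynomial_hull: "compact H \<Longrightarrow> compact (polynomial_hull H)"
  by (simp add: compact_eq_bounded_closed bounded_polynomial_hull closed_polynomial_hull)

text \<open>A bound for a polynomial on \<open>H\<close> also holds on the hull, so passing to the
  hull a second time imposes the same inequalities.\<close>

lemma polynomially_convex_polynomial_hull:
  assumes "compact H" shows "polynomially_convex (polynomial_hull H)"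
proof -
  have "z \<in> polynomial_hull H" if z: "z \<in> polynomial_hull (polynomial_hull H)" for z
  proof (rule ccontr)
    assume "z \<notin> polynomial_hull H"
    then obtain p b where p: "holomorphic_polynomial p" "\<And>w. w \<in> H \<Longrightarrow> norm (p w) \<le> b" "b < norm (p z)"
      using not_in_polynomial_hullE[OF _ assms] by metis
    have "H \<noteq> {}" using z by (auto simp: polynomial_hull_empty)
    then have "norm (p w) \<le> b" if "w \<in> polynomial_hull H" for w
      using not_in_polynomial_hullI[of p H b w] p that by force
    moreover have "polynomial_hull H \<noteq> {}" using z polynomial_hull_empty by auto
    ultimately show False using not_in_polynomial_hullI[of p "polynomial_hull H" b z] p z by blast
  qed
  then show ?thesis
    unfolding polynomially_convex_def
    using subset_polynomial_hull[OF compact_polynomial_hull[OF assms]] by auto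
qed

lemma polynomial_hull_minimal:
  assumes "compact H" "compact P" "polynomially_convex P" "H \<subseteq> P"
  shows "polynomial_hull H \<subseteq> P"
  using polynomial_hull_mono[OF assms(1,2,4)] assms(3) unfolding polynomially_convex_def by simp

text \<open>The neighborhood is a polynomial polyhedron.\<close>
lemma polynomially_convex_neighborhood:
  fixes X U :: "(complex ^ 'n::finite) set"
  assumes X: "compact X" "polynomially_convex X" and U: "open U" "X \<subseteq> U"
  obtains P where "compact P" "polynomially_convex P" "X \<subseteq> interior P" "P \<subseteq> U"
proof -
  \<comment> \<open>The strict inequality puts \<open>X\<close> into the interior of the polydisc of
    radius \<open>R\<close>.\<close>
  obtain R where R: "0 < R" "\<And>z. z \<in> X \<Longrightarrow> norm z < R"
    using compact_imp_bounded[OF X(1)] bounded_pos_less by metis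
  define Y where "Y = {z :: complex ^ 'n. \<forall>i. norm (z $ i) \<le> R} - U"
  have cl: "closed {z :: complex ^ 'n. \<forall>i. norm (z $ i) \<le> R}"
    by (intro closed_Collect_all closed_Collect_le continuous_intros)
  have "bounded {z :: complex ^ 'n. \<forall>i. norm (z $ i) \<le> R}"
    unfolding bounded_iff using norm_vec_le_coords by blast
  then have compY: "compact Y"
    unfolding Y_def using cl U by (intro compact_diff) (auto simp: compact_eq_bounded_closed)
  have sep: "\<exists>q. holomorphic_polynomial q \<and> (\<forall>w\<in>X. norm (q w) < 1) \<and> 1 < norm (q z)" if "z \<in> Y" for z
  proof -
    have "z \<notin> polynomial_hull X" using that U X unfolding Y_def polynomially_convex_def by auto
    then obtain p b where p: "holomorphic_polynomial p" "0 \<le> b" "\<And>w. w \<in> X \<Longrightarrow> norm (p w) \<le> b" "b < norm (p z)"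
      using not_in_polynomial_hullE[OF _ X(1)] by metis
    \<comment> \<open>Dividing by a number strictly between the two bounds gives all separating
      polynomials the common threshold 1, strict on both sides.\<close>
    obtain b' where b': "b < b'" "b' < norm (p z)" using p dense by blast
    have "holomorphic_polynomial (\<lambda>z. of_real (1 / b') * p z)"
      using p by (intro holomorphic_polynomial_cmult)
    moreover have "norm (of_real (1 / b') * p w) = norm (p w) / b'" for w
      using p b' by (simp add: norm_mult norm_divide)
    moreover have "norm (p w) / b' < 1" if "w \<in> X" for w
      using p(2) p(3)[OF that] b' by (simp add: divide_simps)
    moreover have "1 < norm (p z) / b'"
      using p(2) b' by (simp add: divide_simps)
    ultimately show ?thesis
      by (intro exI[of _ "\<lambda>z. of_real (1 / b') * p z"]) simp
  qed
  then obtain q where q: "\<And>z. z \<in> Y \<Longrightarrow> holomorphic_polynomial (q z)"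
    "\<And>z w. z \<in> Y \<Longrightarrow> w \<in> X \<Longrightarrow> norm (q z w) < 1" "\<And>z. z \<in> Y \<Longrightarrow> 1 < norm (q z z)"
    by metis
  have "\<exists>C. C \<subseteq> Y \<and> finite C \<and> Y \<subseteq> (\<Union>z\<in>C. {w. 1 < norm (q z w)})"
    using compY
  proof (rule compactE_image[of Y Y "\<lambda>z. {w. 1 < norm (q z w)}"])
    show "open {w. 1 < norm (q z w)}" if "z \<in> Y" for z
      using q that by (intro open_Collect_less continuous_on_norm continuous_on_holomorphic_polynomial) auto
    show "Y \<subseteq> (\<Union>z\<in>Y. {w. 1 < norm (q z w)})" using q by auto
  qed auto
  then obtain C where C: "C \<subseteq> Y" "finite C" "Y \<subseteq> (\<Union>z\<in>C. {w. 1 < norm (q z w)})" by blast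
  \<comment> \<open>A point of the polydisc outside \<open>U\<close> lies in \<open>Y\<close>, where
    some \<open>q z\<close> with \<open>z \<in> C\<close> exceeds 1 in modulus; hence
    \<open>P \<subseteq> U\<close>.\<close>
  define P where "P = {w. (\<forall>i. norm (w $ i) \<le> R) \<and> (\<forall>z\<in>C. norm (q z w) \<le> 1)}"
  have P_eq: "P = {w. \<forall>i. norm (w $ i) \<le> R} \<inter> (\<Inter>z\<in>C. {w. norm (q z w) \<le> 1})" unfolding P_def by auto
  have "compact P"
    unfolding compact_eq_bounded_closed
  proof
    show "bounded P" by (rule bounded_subset[OF \<open>bounded {z. \<forall>i. norm (z $ i) \<le> R}\<close>]) (auto simp: P_def)
    show "closed P" unfolding P_eq using q C
      by (intro closed_Int cl closed_INT ballI closed_Collect_le continuous_on_norm continuous_on_holomorphic_polynomial) auto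
  qed
  moreover have "polynomially_convex P"
    unfolding polynomially_convex_def
  proof
    show "P \<subseteq> polynomial_hull P" by (rule subset_polynomial_hull[OF \<open>compact P\<close>])
    show "polynomial_hull P \<subseteq> P"
    proof
      fix w assume w: "w \<in> polynomial_hull P"
      then have "P \<noteq> {}" using polynomial_hull_empty by auto
      have "norm (w $ i) \<le> R" for i by (rule polynomial_hull_coords[OF _ w]) (auto simp: P_def)
      moreover have "norm (q z w) \<le> 1" if "z \<in> C" for z
        using not_in_polynomial_hullI[of "q z" P 1 w] q C that w \<open>P \<noteq> {}\<close> by (force simp: P_def)
      ultimately show "w \<in> P" unfolding P_def by blast
    qed
  qed
  moreover have "X \<subseteq> interior P"
  proof -
    let ?O = "(\<Inter>i. {w. norm (w $ i) < R}) \<inter> (\<Inter>z\<in>C. {w. norm (q z w) < 1})"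
    have "?O \<subseteq> P" unfolding P_def by (auto intro: less_imp_le)
    moreover have "open ?O" using q C
      by (intro open_Int open_INT ballI open_Collect_less continuous_on_norm
          continuous_on_holomorphic_polynomial continuous_intros) auto
    moreover have "X \<subseteq> ?O"
      using q(2) C(1) R by (auto intro: le_less_trans[OF Finite_Cartesian_Product.norm_nth_le])
    ultimately show "X \<subseteq> interior P" by (meson interior_maximal order_trans)
  qed
  ultimately show ?thesis using that C unfolding Y_def P_def by force
qed

lemma compact_subset_open_margin:
  fixes X U :: "'a::heine_borel set"
  assumes "compact X" "open U" "X \<subseteq> U"
  obtains \<delta> where "\<delta> > 0" "\<And>x y. x \<in> X \<Longrightarrow> dist x y < \<delta> \<Longrightarrow> y \<in> U"
proof -
  obtain \<delta> where "\<delta> > 0" "(\<Union>x\<in>X. ball x \<delta>) \<subseteq> U"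
    using compact_subset_open_imp_ball_epsilon_subset[OF assms] by blast
  then show ?thesis using that[of \<delta>] by (auto simp: subset_iff)
qed

text \<open>The hull has a polynomially convex neighborhood that misses \<open>Z\<close>. Every
  compact set close to \<open>X\<close> lies in it, and then so does the hull of that set. This lets
  a later perturbation keep what an earlier one has achieved.\<close>

lemma polynomial_hull_avoids_stable:
  fixes X Z :: "(complex ^ 'n::finite) set"
  assumes X: "compact X" and Z: "closed Z" "polynomial_hull X \<inter> Z = {}"
  obtains \<delta> where "\<delta> > 0"
    "\<And>X'. compact X' \<Longrightarrow> (\<And>y. y \<in> X' \<Longrightarrow> \<exists>x\<in>X. dist x y < \<delta>) \<Longrightarrow> polynomial_hull X' \<inter> Z = {}"
proof -
  obtain P where P: "compact P" "polynomially_convex P" "polynomial_hull X \<subseteq> interior P" "P \<subseteq> - Z"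
    using polynomially_convex_neighborhood[OF compact_polynomial_hull polynomially_convex_polynomial_hull, of X "- Z"]
      X Z by (metis open_Compl disjoint_eq_subset_Compl)
  have "X \<subseteq> interior P" using subset_polynomial_hull[OF X] P by blast
  then obtain \<delta> where \<delta>: "\<delta> > 0" "\<And>x y. x \<in> X \<Longrightarrow> dist x y < \<delta> \<Longrightarrow> y \<in> interior P"
    using compact_subset_open_margin[OF X open_interior] by blast
  have "polynomial_hull X' \<inter> Z = {}"
    if X': "compact X'" "\<And>y. y \<in> X' \<Longrightarrow> \<exists>x\<in>X. dist x y < \<delta>" for X'
  proof -
    have "X' \<subseteq> P" using X'(2) \<delta>(2) interior_subset by blast
    then show ?thesis using polynomial_hull_minimal[OF X'(1) P(1,2)] P(4) by blast
  qed
  then show ?thesis using that \<delta>(1) by blast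
qed

text \<open>The test polynomial is \<open>F * q ^ l\<close>: it vanishes on \<open>Q\<close>, and on
  \<open>P\<close> a high power of a polynomial \<open>q\<close> separating \<open>z\<close> from
  \<open>P\<close> outweighs the bounded factor \<open>F\<close>.\<close>

lemma not_in_polynomial_hull_Un:
  assumes P: "compact P" "polynomially_convex P" and F: "holomorphic_polynomial F" "\<And>w. w \<in> Q \<Longrightarrow> F w = 0"
    and z: "z \<notin> P" "F z \<noteq> 0"
  shows "z \<notin> polynomial_hull (P \<union> Q)"
proof (cases "P \<union> Q = {}")
  case True
  then show ?thesis by (simp add: polynomial_hull_empty)
next
  case ne: False
  obtain q b where q: "holomorphic_polynomial q" "0 \<le> b" "\<And>w. w \<in> P \<Longrightarrow> norm (q w) \<le> b" "b < norm (q z)"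
    using not_in_polynomial_hullE[of z P] P z(1) unfolding polynomially_convex_def by metis
  have "bounded (F ` P)"
    by (intro compact_imp_bounded compact_continuous_image P continuous_on_holomorphic_polynomial F)
  then obtain C where C: "C > 0" "\<And>w. w \<in> P \<Longrightarrow> norm (F w) \<le> C"
    unfolding bounded_pos by blast
  have "(\<lambda>l. (b / norm (q z)) ^ l) \<longlonglongrightarrow> 0"
    using q by (intro LIMSEQ_realpow_zero) (auto simp: divide_simps)
  moreover have "norm (F z) / C > 0" using z C by simp
  ultimately obtain l where "(b / norm (q z)) ^ l < norm (F z) / C"
    by (metis (no_types, lifting) order_tendstoD(2) eventually_happens sequentially_bot)
  moreover have "0 < norm (q z) ^ l" using le_less_trans[OF q(2,4)] by (rule zero_less_power)
  ultimately have l: "C * b ^ l < norm (F z * q z ^ l)"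
    using q C by (simp add: divide_simps norm_mult norm_power mult.commute power_divide split: if_splits)
  have "holomorphic_polynomial (\<lambda>w. F w * q w ^ l)"
    by (intro holomorphic_polynomial_mult holomorphic_polynomial_power q F)
  moreover have "norm (F w * q w ^ l) \<le> C * b ^ l" if "w \<in> P \<union> Q" for w
  proof (cases "w \<in> Q")
    case True
    then show ?thesis using F(2) C q by simp
  next
    case False
    then have "w \<in> P" using that by blast
    then show ?thesis unfolding norm_mult norm_power using C q
      by (intro mult_mono power_mono) auto
  qed
  ultimately show ?thesis using not_in_polynomial_hullI[of "\<lambda>w. F w * q w ^ l", OF _ ne _ l] by blast
qed

section \<open>Smooth functions on Euclidean spaces\<close>

definition dd :: "'a::euclidean_space \<Rightarrow> ('a \<Rightarrow> 'b::real_normed_vector) \<Rightarrow> 'a \<Rightarrow> 'b" where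
  "dd v f x = frechet_derivative f (at x) v"

text \<open>Asking for Frechet derivatives instead of partial ones makes continuity automatic and
  gives direct access to the chain rule. The derivatives are taken at the points of
  \<open>U\<close>, not within \<open>U\<close>.\<close>

primrec Ck :: "nat \<Rightarrow> 'a::euclidean_space set \<Rightarrow> ('a \<Rightarrow> 'b::real_normed_vector) \<Rightarrow> bool" where
  "Ck 0 U f \<longleftrightarrow> continuous_on U f"
| "Ck (Suc k) U f \<longleftrightarrow> (\<forall>x\<in>U. f differentiable (at x)) \<and> (\<forall>b\<in>Basis. Ck k U (dd b f))"

definition smooth_on :: "'a::euclidean_space set \<Rightarrow> ('a \<Rightarrow> 'b::real_normed_vector) \<Rightarrow> bool" where
  "smooth_on U f \<longleftrightarrow> (\<forall>k. Ck k U f)"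

lemma dd_eqI: "(f has_derivative f') (at x) \<Longrightarrow> dd v f x = f' v"
  unfolding dd_def using frechet_derivative_at by metis

lemma has_derivative_dd: "f differentiable (at x) \<Longrightarrow> (f has_derivative (\<lambda>v. dd v f x)) (at x)"
  unfolding dd_def using frechet_derivative_works by blast

lemma dd_basis_sum:
  assumes "f differentiable (at x)"
  shows "dd v f x = (\<Sum>i\<in>Basis. (v \<bullet> i) *\<^sub>R dd i f x)"
proof -
  interpret bounded_linear "\<lambda>v. dd v f x"
    using has_derivative_dd[OF assms] by (rule has_derivative_bounded_linear)
  have "dd v f x = dd (\<Sum>i\<in>Basis. (v \<bullet> i) *\<^sub>R i) f x" by (simp add: euclidean_representation)
  also have "\<dots> = (\<Sum>i\<in>Basis. (v \<bullet> i) *\<^sub>R dd i f x)" by (simp add: sum scaleR)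
  finally show ?thesis .
qed

lemma has_derivative_cong_open:
  assumes "open U" "x \<in> U" "\<And>y. y \<in> U \<Longrightarrow> f y = g y"
  shows "(f has_derivative f') (at x) \<longleftrightarrow> (g has_derivative f') (at x)"
  using has_derivative_transform_within_open[of f f' x UNIV U g]
    has_derivative_transform_within_open[of g f' x UNIV U f] assms by auto

lemma dd_cong_open:
  assumes "open U" "x \<in> U" "\<And>y. y \<in> U \<Longrightarrow> f y = g y"
  shows "dd v f x = dd v g x"
  unfolding dd_def frechet_derivative_def using has_derivative_cong_open[OF assms] by simp

lemma differentiable_cong_open:
  assumes "open U" "x \<in> U" "\<And>y. y \<in> U \<Longrightarrow> f y = g y"
  shows "f differentiable (at x) \<longleftrightarrow> g differentiable (at x)"
  unfolding differentiable_def using has_derivative_cong_open[OF assms] by simp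

lemma Ck_cong:
  assumes "open U" "\<And>y. y \<in> U \<Longrightarrow> f y = g y"
  shows "Ck k U f \<longleftrightarrow> Ck k U g"
  using assms(2)
proof (induction k arbitrary: f g)
  case 0
  then show ?case by (auto cong: continuous_on_cong)
next
  case (Suc k)
  have "Ck k U (dd b f) \<longleftrightarrow> Ck k U (dd b g)" for b
    by (rule Suc.IH) (rule dd_cong_open[OF assms(1) _ Suc.prems])
  then show ?case using differentiable_cong_open[OF assms(1) _ Suc.prems] by simp
qed

lemma smooth_on_cong:
  assumes "open U" "\<And>y. y \<in> U \<Longrightarrow> f y = g y"
  shows "smooth_on U f \<longleftrightarrow> smooth_on U g"
  unfolding smooth_on_def using Ck_cong[OF assms] by simp

lemma Ck_imp_continuous_on: "Ck k U f \<Longrightarrow> continuous_on U f"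
  by (cases k) (auto intro!: continuous_at_imp_continuous_on differentiable_imp_continuous_within)

lemma Ck_Suc_imp_Ck: "Ck (Suc k) U f \<Longrightarrow> Ck k U f"
proof (induction k arbitrary: f)
  case 0
  then show ?case using Ck_imp_continuous_on[OF 0] by simp
qed auto

lemma Ck_subset: "Ck k U f \<Longrightarrow> V \<subseteq> U \<Longrightarrow> Ck k V f"
  by (induction k arbitrary: f) (auto intro: continuous_on_subset)

lemma smooth_on_subset: "smooth_on U f \<Longrightarrow> V \<subseteq> U \<Longrightarrow> smooth_on V f"
  unfolding smooth_on_def using Ck_subset by blast

lemma smooth_on_imp_continuous_on: "smooth_on U f \<Longrightarrow> continuous_on U f"
  unfolding smooth_on_def using Ck_imp_continuous_on by blast

lemma smooth_on_imp_differentiable: "smooth_on U f \<Longrightarrow> x \<in> U \<Longrightarrow> f differentiable (at x)"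
  unfolding smooth_on_def using Ck.simps(2) by blast

lemma smooth_on_dd:
  assumes "smooth_on U f" "b \<in> Basis" shows "smooth_on U (dd b f)"
  unfolding smooth_on_def
proof
  fix k
  have "Ck (Suc k) U f" using assms(1) unfolding smooth_on_def by blast
  then show "Ck k U (dd b f)" using assms(2) by simp
qed

lemma Ck_const: "Ck k U (\<lambda>x. c)"
proof (induction k arbitrary: c)
  case (Suc k)
  have "dd b (\<lambda>x. c) = (\<lambda>x. 0)" for b :: 'a by (auto intro!: ext dd_eqI[OF has_derivative_const])
  then show ?case using Suc by simp
qed simp

lemma Ck_add:
  assumes "open U" "Ck k U f" "Ck k U g" shows "Ck k U (\<lambda>x. f x + g x)"
  using assms(2,3)
proof (induction k arbitrary: f g)
  case 0
  then show ?case by (auto intro!: continuous_intros)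
next
  case (Suc k)
  have "dd b (\<lambda>x. f x + g x) x = dd b f x + dd b g x" if "x \<in> U" for b x
    using Suc.prems that by (intro dd_eqI has_derivative_add has_derivative_dd) auto
  then have "Ck k U (dd b (\<lambda>x. f x + g x)) \<longleftrightarrow> Ck k U (\<lambda>x. dd b f x + dd b g x)" for b
    by (intro Ck_cong assms)
  then show ?case using Suc by (auto intro!: differentiable_add)
qed

lemma Ck_bounded_linear_compose:
  assumes "open U" "bounded_linear L" "Ck k U f" shows "Ck k U (\<lambda>x. L (f x))"
  using assms(3)
proof (induction k arbitrary: f)
  case 0
  then show ?case using bounded_linear.continuous_on[OF assms(2)] by simp
next
  case (Suc k)
  have *: "((\<lambda>x. L (f x)) has_derivative (\<lambda>v. L (dd v f x))) (at x)" if "x \<in> U" for x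
    using Suc.prems that by (intro bounded_linear.has_derivative[OF assms(2)] has_derivative_dd) auto
  have "Ck k U (dd b (\<lambda>x. L (f x))) \<longleftrightarrow> Ck k U (\<lambda>x. L (dd b f x))" for b
    by (intro Ck_cong assms dd_eqI *)
  then show ?case using Suc differentiableI[OF *] by auto
qed

lemma Ck_bilinear:
  assumes "open U" "bounded_bilinear H" "Ck k U f" "Ck k U g" shows "Ck k U (\<lambda>x. H (f x) (g x))"
  using assms(3,4)
proof (induction k arbitrary: f g)
  case 0
  then show ?case using bounded_bilinear.continuous_on[OF assms(2)] by simp
next
  case (Suc k)
  have *: "((\<lambda>x. H (f x) (g x)) has_derivative (\<lambda>v. H (f x) (dd v g x) + H (dd v f x) (g x))) (at x)"
    if "x \<in> U" for x
    using Suc.prems that by (intro bounded_bilinear.FDERIV[OF assms(2)] has_derivative_dd) auto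
  have "Ck k U (dd b (\<lambda>x. H (f x) (g x))) \<longleftrightarrow> Ck k U (\<lambda>x. H (f x) (dd b g x) + H (dd b f x) (g x))" for b
    by (intro Ck_cong assms dd_eqI *)
  moreover have "Ck k U (\<lambda>x. H (f x) (dd b g x) + H (dd b f x) (g x))" if "b \<in> Basis" for b
    using Suc.prems that Ck_Suc_imp_Ck[OF Suc.prems(1)] Ck_Suc_imp_Ck[OF Suc.prems(2)]
    by (intro Ck_add assms Suc.IH) auto
  ultimately show ?case using differentiableI[OF *] by auto
qed

lemma Ck_sum:
  assumes "open U" "\<And>i. i \<in> I \<Longrightarrow> Ck k U (f i)" shows "Ck k U (\<lambda>x. \<Sum>i\<in>I. f i x)"
  using assms(2) by (induction I rule: infinite_finite_induct) (auto intro: Ck_const Ck_add assms(1))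

lemma Ck_compose:
  assumes "open U" "open V" "Ck k V g" "Ck k U f" "f ` U \<subseteq> V" shows "Ck k U (\<lambda>x. g (f x))"
  using assms(3,4)
proof (induction k arbitrary: g)
  case 0
  then show ?case using continuous_on_compose2 assms(5) by auto
next
  case (Suc k)
  have *: "((\<lambda>x. g (f x)) has_derivative (\<lambda>v. \<Sum>i\<in>Basis. (dd v f x \<bullet> i) *\<^sub>R dd i g (f x))) (at x)"
    if "x \<in> U" for x
  proof -
    have g: "g differentiable (at (f x))" using Suc.prems assms(5) that by auto
    have "((\<lambda>x. g (f x)) has_derivative (\<lambda>v. dd (dd v f x) g (f x))) (at x)"
      using has_derivative_compose[where f = f and x = x and s = UNIV, OF has_derivative_dd has_derivative_dd[OF g]]
        Suc.prems that by auto
    then show ?thesis unfolding dd_basis_sum[OF g, of "dd _ f x"] .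
  qed
  have "Ck k U (dd b (\<lambda>x. g (f x)))
      \<longleftrightarrow> Ck k U (\<lambda>x. \<Sum>i\<in>Basis. (dd b f x \<bullet> i) *\<^sub>R dd i g (f x))" for b
    by (intro Ck_cong assms dd_eqI *)
  moreover have "Ck k U (\<lambda>x. \<Sum>i\<in>Basis. (dd b f x \<bullet> i) *\<^sub>R dd i g (f x))" if "b \<in> Basis" for b
    using Suc.prems that Ck_Suc_imp_Ck[OF Suc.prems(2)]
    by (intro Ck_sum Ck_bilinear[OF assms(1) bounded_bilinear_scaleR] assms Suc.IH
        Ck_bounded_linear_compose[OF assms(1) bounded_linear_inner_left]) auto
  ultimately show ?case using differentiableI[OF *] by auto
qed

text \<open>A family of differentiable functions that is closed under partial differentiation, up to
  equality on \<open>U\<close>, consists of smooth functions: membership in the family replaces a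
  formula for the higher derivatives.\<close>

lemma smooth_on_coinduct:
  assumes "f \<in> \<F>" "open U" "\<And>f x. f \<in> \<F> \<Longrightarrow> x \<in> U \<Longrightarrow> f differentiable (at x)"
    "\<And>f b. f \<in> \<F> \<Longrightarrow> b \<in> Basis \<Longrightarrow> \<exists>g\<in>\<F>. \<forall>x\<in>U. dd b f x = g x"
  shows "smooth_on U f"
proof -
  have "\<forall>f\<in>\<F>. Ck k U f" for k
  proof (induction k)
    case 0
    then show ?case using assms(3)
      by (auto intro!: continuous_at_imp_continuous_on differentiable_imp_continuous_within)
  next
    case (Suc k)
    show ?case
    proof
      fix f assume f: "f \<in> \<F>"
      have "Ck k U (dd b f)" if b: "b \<in> Basis" for b
      proof -
        obtain g where g: "g \<in> \<F>" "\<forall>x\<in>U. dd b f x = g x" using assms(4)[OF f b] by blast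
        then have "Ck k U (dd b f) \<longleftrightarrow> Ck k U g" by (intro Ck_cong assms) auto
        then show ?thesis using Suc g by simp
      qed
      then show "Ck (Suc k) U f" using assms(3) f by simp
    qed
  qed
  then show ?thesis unfolding smooth_on_def using assms(1) by blast
qed

section \<open>Closure properties of smooth functions\<close>

lemma smooth_on_const: "smooth_on U (\<lambda>x. c)"
  unfolding smooth_on_def by (intro allI Ck_const)

lemma smooth_on_bounded_linear:
  assumes "bounded_linear L" "open U" shows "smooth_on U L"
proof (rule smooth_on_coinduct[of _ "insert L (range (\<lambda>c x. c))"])
  show "\<exists>g\<in>insert L (range (\<lambda>c x. c)). \<forall>x\<in>U. dd b f x = g x"
    if "f \<in> insert L (range (\<lambda>c x. c))" for f b
  proof -
    have "dd b L x = L b" for x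
      by (rule dd_eqI) (rule bounded_linear_imp_has_derivative[OF assms(1)])
    moreover have "dd b (\<lambda>x. c) x = 0" for x and c :: 'b by (rule dd_eqI) simp
    ultimately show ?thesis using that by auto
  qed
qed (use assms in \<open>auto intro: bounded_linear_imp_differentiable\<close>)

lemma smooth_on_add:
  "open U \<Longrightarrow> smooth_on U f \<Longrightarrow> smooth_on U g \<Longrightarrow> smooth_on U (\<lambda>x. f x + g x)"
  unfolding smooth_on_def using Ck_add by blast

lemma smooth_on_sum:
  "open U \<Longrightarrow> (\<And>i. i \<in> I \<Longrightarrow> smooth_on U (f i)) \<Longrightarrow> smooth_on U (\<lambda>x. \<Sum>i\<in>I. f i x)"
  unfolding smooth_on_def using Ck_sum[of U I _ f] by blast

lemma smooth_on_bounded_linear_compose: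
  "open U \<Longrightarrow> bounded_linear L \<Longrightarrow> smooth_on U f \<Longrightarrow> smooth_on U (\<lambda>x. L (f x))"
  unfolding smooth_on_def using Ck_bounded_linear_compose by blast

lemma smooth_on_bilinear:
  "open U \<Longrightarrow> bounded_bilinear H \<Longrightarrow> smooth_on U f \<Longrightarrow> smooth_on U g \<Longrightarrow> smooth_on U (\<lambda>x. H (f x) (g x))"
  unfolding smooth_on_def using Ck_bilinear by blast

lemmas smooth_on_scaleR = smooth_on_bilinear[OF _ bounded_bilinear_scaleR]
lemmas smooth_on_mult = smooth_on_bilinear[OF _ bounded_bilinear_mult]

lemma smooth_on_diff:
  assumes "open U" "smooth_on U f" "smooth_on U g" shows "smooth_on U (\<lambda>x. f x - g x)"
  using smooth_on_add[OF assms(1,2)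
      smooth_on_bounded_linear_compose[OF assms(1) bounded_linear_minus[OF bounded_linear_ident] assms(3)]] by simp

lemma smooth_on_power:
  fixes f :: "'a::euclidean_space \<Rightarrow> 'b::real_normed_field"
  shows "open U \<Longrightarrow> smooth_on U f \<Longrightarrow> smooth_on U (\<lambda>x. f x ^ k)"
  by (induction k) (auto intro: smooth_on_const smooth_on_mult)

lemma smooth_on_prod:
  fixes f :: "'i \<Rightarrow> 'a::euclidean_space \<Rightarrow> 'b::real_normed_field"
  assumes "open U" "\<And>i. i \<in> I \<Longrightarrow> smooth_on U (f i)" shows "smooth_on U (\<lambda>x. \<Prod>i\<in>I. f i x)"
  using assms(2)
  by (induction I rule: infinite_finite_induct) (auto intro: smooth_on_const smooth_on_mult assms(1))

lemma smooth_on_compose: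
  "open U \<Longrightarrow> open V \<Longrightarrow> smooth_on V g \<Longrightarrow> smooth_on U f \<Longrightarrow> f ` U \<subseteq> V \<Longrightarrow> smooth_on U (\<lambda>x. g (f x))"
  unfolding smooth_on_def using Ck_compose by blast

lemma smooth_on_vec_nth:
  assumes "open U" "smooth_on U f" shows "smooth_on U (\<lambda>x. f x $ i)"
  by (rule smooth_on_bounded_linear_compose[OF assms(1) bounded_linear_vec_nth assms(2)])

lemma smooth_on_componentwise:
  fixes f :: "'a::euclidean_space \<Rightarrow> 'b::euclidean_space"
  assumes "open U" "\<And>i. i \<in> Basis \<Longrightarrow> smooth_on U (\<lambda>x. f x \<bullet> i)" shows "smooth_on U f"
proof -
  have "smooth_on U (\<lambda>x. \<Sum>i\<in>Basis. (f x \<bullet> i) *\<^sub>R i)"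
    by (intro smooth_on_sum smooth_on_scaleR smooth_on_const assms)
  then show ?thesis by (simp add: euclidean_representation)
qed

lemma Ck_inverse:
  fixes f :: "'a::euclidean_space \<Rightarrow> real"
  assumes "open U" "Ck k U f" "\<And>x. x \<in> U \<Longrightarrow> f x \<noteq> 0" shows "Ck k U (\<lambda>x. inverse (f x))"
  using assms(2)
proof (induction k)
  case 0
  then show ?case using assms(3) by (auto intro!: continuous_intros)
next
  case (Suc k)
  have *: "((\<lambda>x. inverse (f x)) has_derivative (\<lambda>v. - (inverse (f x) * dd v f x * inverse (f x)))) (at x)"
    if "x \<in> U" for x
    using Suc.prems that assms(3) by (intro Deriv.has_derivative_inverse has_derivative_dd) auto
  have "Ck k U (dd b (\<lambda>x. inverse (f x))) \<longleftrightarrow> Ck k U (\<lambda>x. - (inverse (f x) * dd b f x * inverse (f x)))" for b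
    by (intro Ck_cong assms dd_eqI *)
  moreover have "Ck k U (\<lambda>x. - (inverse (f x) * dd b f x * inverse (f x)))" if "b \<in> Basis" for b
    using Suc Ck_Suc_imp_Ck[OF Suc.prems] that
    by (intro Ck_bounded_linear_compose[OF assms(1) bounded_linear_minus[OF bounded_linear_ident]]
        Ck_bilinear[OF assms(1) bounded_bilinear_mult]) auto
  ultimately show ?case using differentiableI[OF *] by auto
qed

lemma smooth_on_inverse:
  fixes f :: "'a::euclidean_space \<Rightarrow> real"
  shows "open U \<Longrightarrow> smooth_on U f \<Longrightarrow> (\<And>x. x \<in> U \<Longrightarrow> f x \<noteq> 0) \<Longrightarrow> smooth_on U (\<lambda>x. inverse (f x))"
  unfolding smooth_on_def using Ck_inverse by blast

lemma smooth_on_divide: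
  fixes f g :: "'a::euclidean_space \<Rightarrow> real"
  assumes "open U" "smooth_on U f" "smooth_on U g" "\<And>x. x \<in> U \<Longrightarrow> g x \<noteq> 0"
  shows "smooth_on U (\<lambda>x. f x / g x)"
  unfolding divide_inverse by (intro smooth_on_mult smooth_on_inverse assms)

text \<open>Smoothness is a local property; this allows a function to be extended by 0 beyond its
  original domain.\<close>

lemma smooth_on_UN:
  assumes "\<And>x. x \<in> U \<Longrightarrow> \<exists>V. open V \<and> x \<in> V \<and> smooth_on V f" shows "smooth_on U f"
proof -
  have *: "Ck k U f" if "\<And>x. x \<in> U \<Longrightarrow> \<exists>V. open V \<and> x \<in> V \<and> Ck k V f" for k f
    using that
  proof (induction k arbitrary: f)
    case 0
    have "isCont f x" if x: "x \<in> U" for x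
    proof -
      obtain V where "open V" "x \<in> V" "continuous_on V f" using 0[OF x] by auto
      then show ?thesis using continuous_on_eq_continuous_at by blast
    qed
    then show ?case by (simp add: continuous_at_imp_continuous_on)
  next
    case (Suc k)
    have "f differentiable (at x)" if x: "x \<in> U" for x
    proof -
      obtain V where "x \<in> V" "Ck (Suc k) V f" using Suc.prems[OF x] by blast
      then show ?thesis by simp
    qed
    moreover have "Ck k U (dd b f)" if "b \<in> Basis" for b
    proof (rule Suc.IH)
      fix x assume x: "x \<in> U"
      obtain V where "open V" "x \<in> V" "Ck (Suc k) V f" using Suc.prems[OF x] by blast
      then show "\<exists>V. open V \<and> x \<in> V \<and> Ck k V (dd b f)" using that by (intro exI[of _ V]) simp
    qed
    ultimately show ?case by simp
  qed
  show ?thesis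
    unfolding smooth_on_def
  proof (intro allI *)
    fix k x assume "x \<in> U"
    then obtain V where "open V" "x \<in> V" "smooth_on V f" using assms by blast
    then show "\<exists>V. open V \<and> x \<in> V \<and> Ck k V f" unfolding smooth_on_def by blast
  qed
qed

subsection \<open>Bounds for all derivatives up to a given order\<close>

text \<open>A bound for all derivatives up to order \<open>k\<close> in basis directions. Carrying a
  bound instead of a supremum avoids side conditions on boundedness. The set \<open>B\<close> may be
  arbitrary, because the derivatives are those of \<open>f\<close> in the ambient space.\<close>

primrec Cbd :: "nat \<Rightarrow> 'a::euclidean_space set \<Rightarrow> real \<Rightarrow> ('a \<Rightarrow> 'b::real_normed_vector) \<Rightarrow> bool" where
  "Cbd 0 B M f \<longleftrightarrow> (\<forall>x\<in>B. norm (f x) \<le> M)"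
| "Cbd (Suc k) B M f \<longleftrightarrow> (\<forall>x\<in>B. norm (f x) \<le> M) \<and> (\<forall>b\<in>Basis. Cbd k B M (dd b f))"

lemma Cbd_norm_le: "Cbd k B M f \<Longrightarrow> x \<in> B \<Longrightarrow> norm (f x) \<le> M"
  by (cases k) auto

lemma Cbd_mono: "Cbd k B M f \<Longrightarrow> M \<le> M' \<Longrightarrow> B' \<subseteq> B \<Longrightarrow> Cbd k B' M' f"
proof (induction k arbitrary: f)
  case 0
  then show ?case by fastforce
next
  case (Suc k)
  then have "\<forall>x\<in>B'. norm (f x) \<le> M'" by fastforce
  then show ?case using Suc by simp
qed

lemma Cbd_le: "Cbd k B M f \<Longrightarrow> l \<le> k \<Longrightarrow> Cbd l B M f"
proof (induction k arbitrary: l f)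
  case (Suc k)
  then show ?case by (cases l) auto
qed auto

lemma Cbd_cong:
  assumes "open U" "B \<subseteq> U" "\<And>y. y \<in> U \<Longrightarrow> f y = g y"
  shows "Cbd k B M f \<longleftrightarrow> Cbd k B M g"
  using assms(3)
proof (induction k arbitrary: f g)
  case 0
  then show ?case unfolding Cbd.simps using assms(2) by (metis in_mono)
next
  case (Suc k)
  have "Cbd k B M (dd b f) \<longleftrightarrow> Cbd k B M (dd b g)" for b
    by (rule Suc.IH) (rule dd_cong_open[OF assms(1) _ Suc.prems])
  moreover have "(\<forall>x\<in>B. norm (f x) \<le> M) \<longleftrightarrow> (\<forall>x\<in>B. norm (g x) \<le> M)"
    using assms(2) Suc.prems by (metis in_mono)
  ultimately show ?case by simp
qed

lemma Cbd_zero: "0 \<le> M \<Longrightarrow> Cbd k B M (\<lambda>x. 0)"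
proof (induction k)
  case (Suc k)
  have "dd b (\<lambda>x. 0) = (\<lambda>x. 0 :: 'b)" for b :: 'a by (auto intro!: ext dd_eqI[OF has_derivative_const])
  then show ?case using Suc by simp
qed simp

lemma Cbd_Un: "Cbd k A M f \<Longrightarrow> Cbd k B M f \<Longrightarrow> Cbd k (A \<union> B) M f"
  by (induction k arbitrary: f) auto

lemma Cbd_add:
  assumes "open U" "B \<subseteq> U" "smooth_on U f" "smooth_on U g" "Cbd k B M f" "Cbd k B N g"
  shows "Cbd k B (M + N) (\<lambda>x. f x + g x)"
  using assms(3-)
proof (induction k arbitrary: f g)
  case 0
  then show ?case by (auto intro!: norm_triangle_mono)
next
  case (Suc k)
  have "Cbd k B (M + N) (dd b (\<lambda>x. f x + g x)) \<longleftrightarrow> Cbd k B (M + N) (\<lambda>x. dd b f x + dd b g x)" for b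
    using Suc.prems smooth_on_imp_differentiable
    by (intro Cbd_cong[OF assms(1,2)] dd_eqI has_derivative_add has_derivative_dd) blast+
  moreover have "Cbd k B (M + N) (\<lambda>x. dd b f x + dd b g x)" if "b \<in> Basis" for b
    using Suc.prems that by (intro Suc.IH smooth_on_dd) auto
  ultimately show ?case using Suc.prems by (auto intro!: norm_triangle_mono)
qed

lemma Cbd_sum:
  assumes "open U" "B \<subseteq> U" "\<And>i. i \<in> I \<Longrightarrow> smooth_on U (f i)" "\<And>i. i \<in> I \<Longrightarrow> Cbd k B (M i) (f i)"
  shows "Cbd k B (\<Sum>i\<in>I. M i) (\<lambda>x. \<Sum>i\<in>I. f i x)"
  using assms(3,4)
proof (induction I rule: infinite_finite_induct)
  case (insert i I)
  then show ?case by (auto intro!: Cbd_add[OF assms(1,2)] smooth_on_sum assms(1))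
qed (auto intro: Cbd_zero)

lemma Cbd_scaleR_const:
  assumes "open U" "B \<subseteq> U" "0 \<le> a" "Cbd k B M f" "smooth_on U f"
  shows "Cbd k B (a * M) (\<lambda>x. a *\<^sub>R f x)"
  using assms(4,5)
proof (induction k arbitrary: f)
  case 0
  then show ?case using assms(3) by (auto intro!: mult_left_mono)
next
  case (Suc k)
  have "dd b (\<lambda>x. a *\<^sub>R f x) x = a *\<^sub>R dd b f x" if "x \<in> U" for b x
    using smooth_on_imp_differentiable[OF Suc.prems(2) that]
    by (intro dd_eqI has_derivative_scaleR_right has_derivative_dd)
  then have "Cbd k B (a * M) (dd b (\<lambda>x. a *\<^sub>R f x)) \<longleftrightarrow> Cbd k B (a * M) (\<lambda>x. a *\<^sub>R dd b f x)" for b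
    by (intro Cbd_cong[OF assms(1,2)])
  moreover have "Cbd k B (a * M) (\<lambda>x. a *\<^sub>R dd b f x)" if "b \<in> Basis" for b
    using Suc.prems that by (intro Suc.IH smooth_on_dd) auto
  ultimately show ?case using Suc.prems assms(3) by (auto intro!: mult_left_mono)
qed

lemma compact_bound_pos:
  assumes "compact B" "continuous_on B f"
  obtains C where "C > 0" "\<And>x. x \<in> B \<Longrightarrow> norm (f x) \<le> C"
  using compact_imp_bounded[OF compact_continuous_image[OF assms(2,1)]] unfolding bounded_pos by blast

text \<open>The auxiliary factor \<open>\<theta>\<close> makes the class of functions closed under differentiation.\<close>
lemma Cbd_scaleR_compose:
  fixes \<theta> :: "'a::euclidean_space \<Rightarrow> real" and Y :: "'a \<Rightarrow> 'c::euclidean_space"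
  assumes U: "open U" "compact B" "B \<subseteq> U" "smooth_on U \<theta>" "smooth_on U Y" and V: "open V" "Y ` U \<subseteq> V"
  shows "\<exists>C>0. \<forall>(E :: 'c \<Rightarrow> 'b::real_normed_vector) M. smooth_on V E \<longrightarrow> 0 \<le> M \<longrightarrow> Cbd k (Y ` B) M E \<longrightarrow>
    Cbd k B (C * M) (\<lambda>x. \<theta> x *\<^sub>R E (Y x))"
  using U(4)
proof (induction k arbitrary: \<theta>)
  case (0 \<theta>)
  obtain C where C: "C > 0" "\<And>x. x \<in> B \<Longrightarrow> norm (\<theta> x) \<le> C"
    using compact_bound_pos[OF U(2)] smooth_on_imp_continuous_on[OF 0] U(3) continuous_on_subset by metis
  have "Cbd 0 B (C * M) (\<lambda>x. \<theta> x *\<^sub>R E (Y x))" if "Cbd 0 (Y ` B) M E" "0 \<le> M" for E :: "'c \<Rightarrow> 'b" and M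
    using that C by (auto intro!: mult_mono)
  then show ?case using C by blast
next
  case (Suc k \<theta>)
  \<comment> \<open>The chain rule produces the derivatives of \<open>E\<close> with these weights,
    so the induction hypothesis is applied with \<open>\<psi> b i\<close> and
    \<open>dd b \<theta>\<close> in place of \<open>\<theta>\<close>.\<close>
  define \<psi> where "\<psi> b i x = \<theta> x * (dd b Y x \<bullet> i)" for b i x
  have sm1: "smooth_on U (dd b \<theta>)" if "b \<in> Basis" for b using smooth_on_dd Suc.prems that by blast
  have sm2: "smooth_on U (\<psi> b i)" if "b \<in> Basis" for b i
    unfolding \<psi>_def using that U Suc.prems smooth_on_dd
    by (intro smooth_on_mult smooth_on_bounded_linear_compose[OF U(1) bounded_linear_inner_left]) auto
  define P where "P C \<theta> \<longleftrightarrow> C > 0 \<and> (\<forall>(E :: 'c \<Rightarrow> 'b) M. smooth_on V E \<longrightarrow> 0 \<le> M \<longrightarrow> Cbd k (Y ` B) M E \<longrightarrow>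
    Cbd k B (C * M) (\<lambda>x. \<theta> x *\<^sub>R E (Y x)))" for C and \<theta> :: "'a \<Rightarrow> real"
  have IH: "\<exists>C. P C \<theta>" if "smooth_on U \<theta>" for \<theta> unfolding P_def using Suc.IH[OF that] by blast
  obtain C0 where C0: "C0 > 0" "\<And>x. x \<in> B \<Longrightarrow> norm (\<theta> x) \<le> C0"
    using compact_bound_pos[OF U(2)] smooth_on_imp_continuous_on[OF Suc.prems] U(3) continuous_on_subset by metis
  obtain C1 where C1: "P (C1 b) (dd b \<theta>)" if "b \<in> Basis" for b using IH[OF sm1] by metis
  obtain C2 where C2: "P (C2 b i) (\<psi> b i)" if "b \<in> Basis" for b i using IH[OF sm2] by metis
  define C where "C = C0 + (\<Sum>b\<in>Basis. C1 b + (\<Sum>i\<in>Basis. C2 b i))"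
  have nn: "0 \<le> C1 b + (\<Sum>i\<in>Basis. C2 b i)" if "b \<in> Basis" for b
    using C1[OF that] C2[OF that] unfolding P_def by (intro add_nonneg_nonneg sum_nonneg) (auto intro: less_imp_le)
  have CC0: "C0 \<le> C" unfolding C_def using nn by (simp add: sum_nonneg)
  have Cb: "C1 b + (\<Sum>i\<in>Basis. C2 b i) \<le> C" if "b \<in> Basis" for b
    unfolding C_def using member_le_sum[OF that, of "\<lambda>b. C1 b + (\<Sum>i\<in>Basis. C2 b i)"] nn C0 by auto
  have "Cbd (Suc k) B (C * M) (\<lambda>x. \<theta> x *\<^sub>R E (Y x))"
    if E: "smooth_on V E" "0 \<le> M" "Cbd (Suc k) (Y ` B) M E" for E :: "'c \<Rightarrow> 'b" and M
  proof -
    have "norm (\<theta> x *\<^sub>R E (Y x)) \<le> C * M" if x: "x \<in> B" for x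
    proof -
      have "norm (\<theta> x *\<^sub>R E (Y x)) = norm (\<theta> x) * norm (E (Y x))" by simp
      also have "\<dots> \<le> C * M" using C0(2)[OF x] CC0 E x C0(1) by (intro mult_mono) auto
      finally show ?thesis .
    qed
    moreover have "Cbd k B (C * M) (dd b (\<lambda>x. \<theta> x *\<^sub>R E (Y x)))" if b: "b \<in> Basis" for b
    proof -
      have eq: "dd b (\<lambda>x. \<theta> x *\<^sub>R E (Y x)) x
        = dd b \<theta> x *\<^sub>R E (Y x) + (\<Sum>i\<in>Basis. \<psi> b i x *\<^sub>R dd i E (Y x))" if x: "x \<in> U" for x
      proof (rule dd_eqI)
        have dE: "E differentiable (at (Y x))" using smooth_on_imp_differentiable[OF E(1)] V(2) x by auto
        have "((\<lambda>x. E (Y x)) has_derivative (\<lambda>v. dd (dd v Y x) E (Y x))) (at x)"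
          using has_derivative_compose[where f = Y and x = x and s = UNIV, OF has_derivative_dd has_derivative_dd[OF dE]]
            smooth_on_imp_differentiable[OF U(5) x] by auto
        then have dEY: "((\<lambda>x. E (Y x)) has_derivative (\<lambda>v. \<Sum>i\<in>Basis. (dd v Y x \<bullet> i) *\<^sub>R dd i E (Y x))) (at x)"
          unfolding dd_basis_sum[OF dE, of "dd _ Y x"] .
        have "((\<lambda>x. \<theta> x *\<^sub>R E (Y x)) has_derivative
          (\<lambda>v. \<theta> x *\<^sub>R (\<Sum>i\<in>Basis. (dd v Y x \<bullet> i) *\<^sub>R dd i E (Y x)) + dd v \<theta> x *\<^sub>R E (Y x))) (at x)"
          using smooth_on_imp_differentiable[OF Suc.prems x]
          by (intro has_derivative_scaleR has_derivative_dd dEY)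
        then show "((\<lambda>x. \<theta> x *\<^sub>R E (Y x)) has_derivative
          (\<lambda>v. dd v \<theta> x *\<^sub>R E (Y x) + (\<Sum>i\<in>Basis. \<psi> v i x *\<^sub>R dd i E (Y x)))) (at x)"
          unfolding \<psi>_def by (simp add: scaleR_sum_right add.commute)
      qed
      have smE: "smooth_on U (\<lambda>x. F (Y x))" if "smooth_on V F" for F :: "'c \<Rightarrow> 'b"
        using smooth_on_compose[OF U(1) V(1) that U(5) V(2)] .
      have *: "Cbd k B (C1 b * M + (\<Sum>i\<in>Basis. C2 b i * M))
        (\<lambda>x. dd b \<theta> x *\<^sub>R E (Y x) + (\<Sum>i\<in>Basis. \<psi> b i x *\<^sub>R dd i E (Y x)))"
      proof (intro Cbd_add[OF U(1,3)] Cbd_sum[OF U(1,3)] smooth_on_sum smooth_on_scaleR smE sm1[OF b] sm2[OF b] U(1))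
        show "Cbd k B (C1 b * M) (\<lambda>x. dd b \<theta> x *\<^sub>R E (Y x))"
          using C1[OF b] E Cbd_le[OF E(3), of k] unfolding P_def by auto
        show "Cbd k B (C2 b i * M) (\<lambda>x. \<psi> b i x *\<^sub>R dd i E (Y x))" if "i \<in> Basis" for i
          using C2[OF b] E smooth_on_dd[OF E(1) that] that unfolding P_def by auto
      qed (use E smooth_on_dd in auto)
      have "Cbd k B (C1 b * M + (\<Sum>i\<in>Basis. C2 b i * M)) (dd b (\<lambda>x. \<theta> x *\<^sub>R E (Y x)))"
        by (rule iffD2[OF Cbd_cong[OF U(1,3)]], erule eq, rule *)
      moreover have "C1 b * M + (\<Sum>i\<in>Basis. C2 b i * M) \<le> C * M"
        using Cb[OF b] E(2) by (simp flip: sum_distrib_right distrib_right add: mult_right_mono)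
      ultimately show ?thesis using Cbd_mono by blast
    qed
    ultimately show ?thesis by simp
  qed
  then show ?case using C0 CC0 by (intro exI[of _ C]) auto
qed

lemma Cbd_compose:
  fixes Y :: "'a::euclidean_space \<Rightarrow> 'c::euclidean_space"
  assumes "open U" "compact B" "B \<subseteq> U" "smooth_on U Y" "open V" "Y ` U \<subseteq> V"
  shows "\<exists>C>0. \<forall>(E :: 'c \<Rightarrow> 'b::real_normed_vector) M. smooth_on V E \<longrightarrow> 0 \<le> M \<longrightarrow> Cbd k (Y ` B) M E \<longrightarrow>
    Cbd k B (C * M) (\<lambda>x. E (Y x))"
  using Cbd_scaleR_compose[OF assms(1-3) smooth_on_const[of U "1::real"] assms(4-), where k = k and 'b = 'b] by simp

text \<open>The sequence is the \<open>k\<close>-th power of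
  \<open>real N * root k \<rho> ^ N\<close>, which tends to 0.\<close>

lemma polynomial_times_power_limit:
  fixes \<rho> :: real
  assumes "0 \<le> \<rho>" "\<rho> < 1"
  shows "(\<lambda>N. real N ^ k * \<rho> ^ N) \<longlonglongrightarrow> 0"
proof (cases "k = 0")
  case True
  then show ?thesis using assms by (simp add: LIMSEQ_realpow_zero)
next
  case False
  have "root k \<rho> < 1" "0 \<le> root k \<rho>" using assms False by auto
  then have "(\<lambda>N. real N * root k \<rho> ^ N) \<longlonglongrightarrow> 0"
    by (intro powser_times_n_limit_0) auto
  then have "(\<lambda>N. (real N * root k \<rho> ^ N) ^ k) \<longlonglongrightarrow> 0 ^ k" by (rule tendsto_power)
  moreover have "(real N * root k \<rho> ^ N) ^ k = real N ^ k * \<rho> ^ N" for N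
  proof -
    have "(root k \<rho> ^ N) ^ k = (root k \<rho> ^ k) ^ N" by (simp add: mult.commute flip: power_mult)
    then show ?thesis using False assms by (simp add: power_mult_distrib)
  qed
  ultimately show ?thesis using False by (simp add: zero_power)
qed

text \<open>Each differentiation costs a factor \<open>N\<close> and one power of
  \<open>\<gamma>\<close>. On the compact set \<open>B\<close> the modulus of
  \<open>\<gamma>\<close> stays below some \<open>\<rho> < 1\<close>, so the geometric decay
  wins.\<close>

lemma Cbd_power_small:
  fixes \<gamma> :: "'a::euclidean_space \<Rightarrow> complex"
  assumes U: "open U" "compact B" "B \<subseteq> U" and \<gamma>: "smooth_on U \<gamma>" "\<And>x. x \<in> B \<Longrightarrow> norm (\<gamma> x) < 1" and \<epsilon>: "\<epsilon> > 0"
  shows "\<exists>N\<^sub>0. \<forall>N\<ge>N\<^sub>0. Cbd k B \<epsilon> (\<lambda>x. \<gamma> x ^ N)"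
proof -
  \<comment> \<open>Positivity of \<open>\<rho>\<close> matters because the final estimate is
    rewritten with a division by \<open>\<rho> ^ k\<close>.\<close>
  have "\<exists>\<rho>. 0 < \<rho> \<and> \<rho> < 1 \<and> (\<forall>x\<in>B. norm (\<gamma> x) \<le> \<rho>)"
  proof (cases "B = {}")
    case True
    then show ?thesis by (intro exI[of _ "1/2"]) auto
  next
    case False
    have "continuous_on B (\<lambda>x. norm (\<gamma> x))"
      using smooth_on_imp_continuous_on[OF \<gamma>(1)] U(3) continuous_on_subset by (intro continuous_on_norm) blast
    then obtain x where x: "x \<in> B" "\<forall>y\<in>B. norm (\<gamma> y) \<le> norm (\<gamma> x)"
      using continuous_attains_sup[OF U(2) False] by blast
    obtain \<rho> where "norm (\<gamma> x) < \<rho>" "\<rho> < 1" using dense[OF \<gamma>(2)[OF x(1)]] by blast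
    then show ?thesis using x by (intro exI[of _ \<rho>]) (auto intro: le_less_trans[OF norm_ge_zero] order_trans)
  qed
  then obtain \<rho> where \<rho>: "0 < \<rho>" "\<rho> < 1" "\<And>x. x \<in> B \<Longrightarrow> norm (\<gamma> x) \<le> \<rho>" by blast
  \<comment> \<open>The factor \<open>\<psi>\<close> absorbs the derivatives of
    \<open>\<gamma>\<close>, which makes the statement inductive. The exponent \<open>N - k\<close>
    reflects that \<open>k\<close> differentiations use up at most \<open>k\<close> powers.\<close>
  have main: "\<exists>C\<ge>0. \<forall>N\<ge>k. Cbd k B (C * real N ^ k * \<rho> ^ (N - k)) (\<lambda>x. \<psi> x * \<gamma> x ^ N)"
    if "smooth_on U \<psi>" for \<psi> :: "'a \<Rightarrow> complex" and k
    using that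
  proof (induction k arbitrary: \<psi>)
    case (0 \<psi>)
    obtain C where C: "C > 0" "\<And>x. x \<in> B \<Longrightarrow> norm (\<psi> x) \<le> C"
      using compact_bound_pos[OF U(2)] smooth_on_imp_continuous_on[OF 0] U(3) continuous_on_subset by metis
    have "norm (\<psi> x * \<gamma> x ^ N) \<le> C * \<rho> ^ N" if "x \<in> B" for x N
      unfolding norm_mult norm_power using C \<rho> that by (intro mult_mono power_mono) auto
    then show ?case using C by (intro exI[of _ C]) auto
  next
    case (Suc k \<psi>)
    obtain C0 where C0: "C0 > 0" "\<And>x. x \<in> B \<Longrightarrow> norm (\<psi> x) \<le> C0"
      using compact_bound_pos[OF U(2)] smooth_on_imp_continuous_on[OF Suc.prems] U(3) continuous_on_subset by metis
    obtain C1 where C1: "0 \<le> C1 b" "\<forall>N\<ge>k. Cbd k B (C1 b * real N ^ k * \<rho> ^ (N - k)) (\<lambda>x. dd b \<psi> x * \<gamma> x ^ N)"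
      if "b \<in> Basis" for b
      using Suc.IH[OF smooth_on_dd[OF Suc.prems]] by metis
    have sm: "smooth_on U (\<lambda>x. \<psi> x * dd b \<gamma> x)" if "b \<in> Basis" for b
      using U \<gamma> Suc.prems that by (intro smooth_on_mult smooth_on_dd) auto
    obtain C2 where C2: "0 \<le> C2 b" "\<forall>N\<ge>k.
        Cbd k B (C2 b * real N ^ k * \<rho> ^ (N - k)) (\<lambda>x. \<psi> x * dd b \<gamma> x * \<gamma> x ^ N)"
      if "b \<in> Basis" for b
      using Suc.IH[OF sm] by metis
    define C where "C = C0 + (\<Sum>b\<in>Basis. C1 b + C2 b)"
    have nn: "0 \<le> C1 b + C2 b" if "b \<in> Basis" for b using C1(1) C2(1) that by simp
    have CC0: "C0 \<le> C" unfolding C_def using nn by (simp add: sum_nonneg)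
    have Cb: "C1 b + C2 b \<le> C" if "b \<in> Basis" for b
      unfolding C_def using member_le_sum[OF that, of "\<lambda>b. C1 b + C2 b"] nn C0 by auto
    have "Cbd (Suc k) B (C * real N ^ Suc k * \<rho> ^ (N - Suc k)) (\<lambda>x. \<psi> x * \<gamma> x ^ N)" if N: "Suc k \<le> N" for N
    proof -
      have N1: "1 \<le> real N" using N by simp
      then have N2: "1 \<le> real N ^ Suc k" "real N ^ k \<le> real N ^ Suc k"
        by (rule one_le_power) (use N1 in \<open>auto intro: power_increasing simp del: power_Suc\<close>)
      have R: "\<rho> ^ N \<le> \<rho> ^ (N - Suc k)" "\<rho> ^ (N - k) \<le> \<rho> ^ (N - Suc k)"
        using \<rho> N by (auto intro!: power_decreasing)
      have "norm (\<psi> x * \<gamma> x ^ N) \<le> C * real N ^ Suc k * \<rho> ^ (N - Suc k)" if x: "x \<in> B" for x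
      proof -
        have "norm (\<psi> x * \<gamma> x ^ N) \<le> C0 * \<rho> ^ N"
          unfolding norm_mult norm_power using C0 \<rho> x by (intro mult_mono power_mono) auto
        also have "\<dots> \<le> (C * real N ^ Suc k) * \<rho> ^ (N - Suc k)"
        proof (intro mult_mono R)
          show "C0 \<le> C * real N ^ Suc k" using mult_mono[OF CC0 N2(1)] C0(1) CC0 by simp
        qed (use C0 CC0 \<rho> in auto)
        finally show ?thesis .
      qed
      moreover have "Cbd k B (C * real N ^ Suc k * \<rho> ^ (N - Suc k)) (dd b (\<lambda>x. \<psi> x * \<gamma> x ^ N))" if b: "b \<in> Basis" for b
      proof -
        obtain N' where N': "N = Suc N'" "k \<le> N'" using N by (cases N) auto
        have eq: "dd b (\<lambda>x. \<psi> x * \<gamma> x ^ N) x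
           = dd b \<psi> x * \<gamma> x ^ N + of_nat N *\<^sub>R (\<psi> x * dd b \<gamma> x * \<gamma> x ^ N')" if "x \<in> U" for x
        proof (rule dd_eqI)
          have "((\<lambda>x. \<psi> x * \<gamma> x ^ N) has_derivative
            (\<lambda>v. \<psi> x * (of_nat N * dd v \<gamma> x * \<gamma> x ^ (N - 1)) + dd v \<psi> x * \<gamma> x ^ N)) (at x)"
            using smooth_on_imp_differentiable[OF Suc.prems that] smooth_on_imp_differentiable[OF \<gamma>(1) that]
            by (intro has_derivative_mult has_derivative_power has_derivative_dd)
          then show "((\<lambda>x. \<psi> x * \<gamma> x ^ N) has_derivative
            (\<lambda>v. dd v \<psi> x * \<gamma> x ^ N + of_nat N *\<^sub>R (\<psi> x * dd v \<gamma> x * \<gamma> x ^ N'))) (at x)"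
            unfolding N'(1) by (simp add: scaleR_conv_of_real algebra_simps)
        qed
        have *: "Cbd k B (C1 b * real N ^ k * \<rho> ^ (N - k) + real N * (C2 b * real N' ^ k * \<rho> ^ (N' - k)))
          (\<lambda>x. dd b \<psi> x * \<gamma> x ^ N + of_nat N *\<^sub>R (\<psi> x * dd b \<gamma> x * \<gamma> x ^ N'))"
          using U \<gamma> Suc.prems b N C1(2)[OF b] C2(2)[OF b] N'(2)
          by (intro Cbd_add[OF U(1,3)] Cbd_scaleR_const[OF U(1,3)] smooth_on_mult smooth_on_power smooth_on_dd
              smooth_on_scaleR smooth_on_const) auto
        have "Cbd k B (C1 b * real N ^ k * \<rho> ^ (N - k) + real N * (C2 b * real N' ^ k * \<rho> ^ (N' - k)))
           (dd b (\<lambda>x. \<psi> x * \<gamma> x ^ N))"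
          by (rule iffD2[OF Cbd_cong[OF U(1,3)]], erule eq, rule *)
        moreover have "C1 b * real N ^ k * \<rho> ^ (N - k) + real N * (C2 b * real N' ^ k * \<rho> ^ (N' - k))
          \<le> C * real N ^ Suc k * \<rho> ^ (N - Suc k)"
        proof -
          let ?X = "real N ^ Suc k * \<rho> ^ (N - Suc k)"
          have "real N ^ k * \<rho> ^ (N - k) \<le> ?X"
            using N2 R \<rho> by (intro mult_mono) auto
          then have A: "C1 b * (real N ^ k * \<rho> ^ (N - k)) \<le> C1 b * ?X"
            by (rule mult_left_mono) (rule C1(1)[OF b])
          have "real N' ^ k * \<rho> ^ (N' - k) \<le> real N ^ k * \<rho> ^ (N' - k)"
            using \<rho> N' by (intro mult_right_mono power_mono) auto
          then have "C2 b * (real N' ^ k * \<rho> ^ (N' - k)) \<le> C2 b * (real N ^ k * \<rho> ^ (N' - k))"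
            by (rule mult_left_mono) (rule C2(1)[OF b])
          then have "real N * (C2 b * (real N' ^ k * \<rho> ^ (N' - k))) \<le> real N * (C2 b * (real N ^ k * \<rho> ^ (N' - k)))"
            by (rule mult_left_mono) simp
          also have "\<dots> = C2 b * ?X" unfolding N' by simp
          finally have "C1 b * (real N ^ k * \<rho> ^ (N - k)) + real N * (C2 b * (real N' ^ k * \<rho> ^ (N' - k)))
            \<le> C1 b * ?X + C2 b * ?X"
            using A by (rule add_mono[rotated])
          also have "\<dots> = (C1 b + C2 b) * ?X" by (rule distrib_right[symmetric])
          also have "\<dots> \<le> C * ?X" using Cb[OF b] \<rho> by (intro mult_right_mono) auto
          finally show ?thesis unfolding mult.assoc .
        qed
        ultimately show ?thesis using Cbd_mono by blast
      qed
      ultimately show ?thesis by simp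
    qed
    then show ?case using C0 CC0 by (intro exI[of _ C]) auto
  qed
  obtain C where C: "C \<ge> 0" "\<And>N. N \<ge> k \<Longrightarrow> Cbd k B (C * real N ^ k * \<rho> ^ (N - k)) (\<lambda>x. \<gamma> x ^ N)"
    using main[OF smooth_on_const[of U 1], of k] by auto
  have "(\<lambda>N. C / \<rho> ^ k * (real N ^ k * \<rho> ^ N)) \<longlonglongrightarrow> C / \<rho> ^ k * 0"
    using \<rho> by (intro tendsto_mult polynomial_times_power_limit tendsto_const) auto
  then have "\<forall>\<^sub>F N in sequentially. C / \<rho> ^ k * (real N ^ k * \<rho> ^ N) < \<epsilon>"
    using \<epsilon> by (intro order_tendstoD(2)) auto
  then obtain N0 where N0: "\<And>N. N \<ge> N0 \<Longrightarrow> C / \<rho> ^ k * (real N ^ k * \<rho> ^ N) < \<epsilon>"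
    unfolding eventually_sequentially by blast
  have "Cbd k B \<epsilon> (\<lambda>x. \<gamma> x ^ N)" if "N \<ge> max N0 k" for N
  proof -
    have "C * real N ^ k * \<rho> ^ (N - k) = C / \<rho> ^ k * (real N ^ k * \<rho> ^ N)"
      using \<rho> that by (simp add: power_diff)
    then show ?thesis using C(2)[of N] N0[of N] that Cbd_mono[of k B _ "\<lambda>x. \<gamma> x ^ N" \<epsilon> B] by auto
  qed
  then show ?thesis by blast
qed

text \<open>The mean value inequality. The factor \<open>DIM('a)\<close> appears because the
  operator norm of the derivative is estimated by the sum of the basis derivatives.\<close>

lemma convex_dd_bound_Lipschitz:
  fixes f :: "'a::euclidean_space \<Rightarrow> 'b::real_normed_vector" and M :: real
  assumes "convex S" "\<And>x. x \<in> S \<Longrightarrow> f differentiable (at x)" "\<And>x b. x \<in> S \<Longrightarrow> b \<in> Basis \<Longrightarrow> norm (dd b f x) \<le> M" "x \<in> S" "y \<in> S"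
  shows "norm (f x - f y) \<le> (DIM('a) * M) * norm (x - y)"
proof (rule differentiable_bound[where S = S and f' = "\<lambda>x v. dd v f x"])
  show "(f has_derivative (\<lambda>v. dd v f x)) (at x within S)" if "x \<in> S" for x
    using has_derivative_at_withinI[OF has_derivative_dd[OF assms(2)[OF that]]] .
  show "onorm (\<lambda>v. dd v f x) \<le> DIM('a) * M" if x: "x \<in> S" for x
  proof (rule onorm_le)
    fix v
    have "norm (dd v f x) \<le> (\<Sum>i\<in>Basis. \<bar>v \<bullet> i\<bar> * norm (dd i f x))"
      by (subst dd_basis_sum[OF assms(2)[OF x]]) (rule order_trans[OF norm_sum], simp)
    also have "\<dots> \<le> (\<Sum>i\<in>(Basis :: 'a set). norm v * M)"
      by (intro sum_mono mult_mono assms(3)[OF x] Basis_le_norm) auto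
    finally show "norm (dd v f x) \<le> DIM('a) * M * norm v"
      by (simp add: mult.commute mult.left_commute)
  qed
qed (use assms in auto)

lemma Cbd_imp_Lipschitz:
  fixes f :: "'a::euclidean_space \<Rightarrow> 'b::real_normed_vector" and M :: real
  assumes "smooth_on UNIV f" "Cbd 1 UNIV M f"
  shows "norm (f x - f y) \<le> (DIM('a) * M) * norm (x - y)"
  by (rule convex_dd_bound_Lipschitz[OF convex_UNIV])
    (use assms smooth_on_imp_differentiable[OF assms(1)] in auto)

subsection \<open>Smooth cutoff functions\<close>

text \<open>Derivatives of members of this family are linear combinations of members with larger
  \<open>j\<close>, so the smoothness of all of them, also at 0, follows by one induction.\<close>

definition exp_flat :: "nat \<Rightarrow> real \<Rightarrow> real" where
  "exp_flat j t = (if t > 0 then exp (- inverse t) * inverse t ^ j else 0)"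

lemma exp_flat_tendsto_0: "(exp_flat j \<longlongrightarrow> 0) (at_right 0)"
proof -
  have *: "((\<lambda>x :: real. x ^ j / exp x) \<longlongrightarrow> 0) at_top" by (rule tendsto_power_div_exp_0)
  have "((\<lambda>t. inverse t ^ j / exp (inverse t)) \<longlongrightarrow> (0::real)) (at_right 0)"
    by (rule filterlim_compose[OF * filterlim_inverse_at_top_right])
  then show ?thesis
  proof (rule Lim_transform_eventually)
    show "\<forall>\<^sub>F t in at_right 0. inverse t ^ j / exp (inverse t) = exp_flat j t"
      unfolding eventually_at_right_field
      by (intro exI[of _ 1]) (auto simp: exp_flat_def exp_minus divide_inverse)
  qed
qed

lemma exp_flat_has_derivative:
  "(exp_flat j has_real_derivative (- real j * exp_flat (j + 1) t + exp_flat (j + 2) t)) (at t)"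
proof -
  consider "t > 0" | "t < 0" | "t = 0" by linarith
  then show ?thesis
  proof cases
    case 1
    have *: "((\<lambda>t. exp (- inverse t) * inverse t ^ j) has_real_derivative
       exp (- inverse t) * (inverse t)\<^sup>2 * inverse t ^ j
       + real j * inverse t ^ (j - 1) * (- (inverse t)\<^sup>2) * exp (- inverse t)) (at t)"
      using 1 by (auto intro!: derivative_eq_intros simp: power2_eq_square)
    define u where "u = inverse t"
    have A: "real j * u ^ (j - 1) * u\<^sup>2 = real j * u ^ (j + 1)"
      by (cases j) (simp_all add: power2_eq_square)
    have E: "exp_flat i t = exp (- u) * u ^ i" for i using 1 by (simp add: exp_flat_def u_def)
    have C: "exp (- u) * u\<^sup>2 * u ^ j + real j * u ^ (j - 1) * (- u\<^sup>2) * exp (- u)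
      = exp (- u) * u ^ (j + 2) - (real j * u ^ (j - 1) * u\<^sup>2) * exp (- u)"
      by (simp add: power_add power2_eq_square)
    have **: "exp (- inverse t) * (inverse t)\<^sup>2 * inverse t ^ j
       + real j * inverse t ^ (j - 1) * (- (inverse t)\<^sup>2) * exp (- inverse t)
       = - real j * exp_flat (j + 1) t + exp_flat (j + 2) t"
      unfolding u_def[symmetric] C A E by simp
    have "((\<lambda>t. exp (- inverse t) * inverse t ^ j) has_real_derivative
       (- real j * exp_flat (j + 1) t + exp_flat (j + 2) t)) (at t)"
      by (rule DERIV_cong[OF * **])
    moreover have "(exp_flat j has_real_derivative D) (at t)
        \<longleftrightarrow> ((\<lambda>t. exp (- inverse t) * inverse t ^ j) has_real_derivative D) (at t)" for D
      using 1 eventually_nhds_in_open[of "{0<..}" t]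
      by (intro DERIV_cong_ev refl) (auto elim!: eventually_mono simp: exp_flat_def)
    ultimately show ?thesis by blast
  next
    case 2
    have "(exp_flat j has_real_derivative D) (at t) \<longleftrightarrow> ((\<lambda>t. 0) has_real_derivative D) (at t)" for D
      using 2 eventually_nhds_in_open[of "{..<0}" t]
      by (intro DERIV_cong_ev refl) (auto elim!: eventually_mono simp: exp_flat_def)
    then show ?thesis using 2 by (simp add: exp_flat_def)
  next
    case 3
    \<comment> \<open>Since \<open>exp_flat j 0 = 0\<close>, this is the difference quotient at 0;
      to the right of 0 it equals \<open>exp_flat (j + 1)\<close>.\<close>
    have "((\<lambda>h. exp_flat j h / h) \<longlongrightarrow> 0) (at_right 0)"
    proof (rule Lim_transform_eventually[OF exp_flat_tendsto_0[of "j + 1"]])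
      show "\<forall>\<^sub>F t in at_right 0. exp_flat (j + 1) t = exp_flat j t / t"
        unfolding eventually_at_right_field by (intro exI[of _ 1]) (auto simp: exp_flat_def divide_inverse)
    qed
    moreover have "((\<lambda>h. exp_flat j h / h) \<longlongrightarrow> 0) (at_left 0)"
    proof (rule Lim_transform_eventually[OF tendsto_const])
      show "\<forall>\<^sub>F t in at_left 0. 0 = exp_flat j t / t"
        unfolding eventually_at_left_field by (intro exI[of _ "-1"]) (auto simp: exp_flat_def)
    qed
    ultimately have "((\<lambda>h. exp_flat j h / h) \<longlongrightarrow> 0) (at 0)"
      by (simp add: filterlim_split_at)
    then show ?thesis using 3 by (simp add: DERIV_def exp_flat_def)
  qed
qed

lemma smooth_on_exp_flat: "smooth_on UNIV (exp_flat j)"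
proof -
  have "\<forall>j. Ck k UNIV (exp_flat j)" for k
  proof (induction k)
    case 0
    show ?case
      using exp_flat_has_derivative by (auto intro!: continuous_at_imp_continuous_on DERIV_isCont)
  next
    case (Suc k)
    show ?case
    proof
      fix j
      have *: "(exp_flat j has_derivative (*) (- real j * exp_flat (j + 1) t + exp_flat (j + 2) t)) (at t)" for t
        using exp_flat_has_derivative[of j t] by (simp only: has_field_derivative_def)
      have "dd 1 (exp_flat j) = (\<lambda>t. (- real j) * exp_flat (j + 1) t + exp_flat (j + 2) t)"
      proof (rule ext)
        show "dd 1 (exp_flat j) t = (- real j) * exp_flat (j + 1) t + exp_flat (j + 2) t" for t
          by (rule trans[OF dd_eqI[OF *[of t]]]) (rule mult_1_right)
      qed
      moreover have "Ck k UNIV (\<lambda>t. (- real j) * exp_flat (j + 1) t + exp_flat (j + 2) t)"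
        using Suc by (intro Ck_add[OF open_UNIV Ck_bounded_linear_compose[OF open_UNIV bounded_linear_mult_right]]) auto
      ultimately show "Ck (Suc k) UNIV (exp_flat j)"
        using differentiableI[OF *] by simp
    qed
  qed
  then show ?thesis unfolding smooth_on_def by blast
qed

definition smooth_step :: "real \<Rightarrow> real" where
  "smooth_step t = exp_flat 0 t / (exp_flat 0 t + exp_flat 0 (1 - t))"

lemma exp_flat_nonneg: "0 \<le> exp_flat 0 t" and exp_flat_pos: "0 < t \<Longrightarrow> 0 < exp_flat 0 t"
  by (auto simp: exp_flat_def)

lemma smooth_step_denominator: "0 < exp_flat 0 t + exp_flat 0 (1 - t)"
  using exp_flat_nonneg[of t] exp_flat_nonneg[of "1 - t"] exp_flat_pos[of t] exp_flat_pos[of "1 - t"] by linarith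

lemma smooth_step_0: "t \<le> 0 \<Longrightarrow> smooth_step t = 0"
  by (simp add: smooth_step_def exp_flat_def)

lemma smooth_step_1: "1 \<le> t \<Longrightarrow> smooth_step t = 1"
  by (simp add: smooth_step_def exp_flat_def)

lemma smooth_step_nonneg: "0 \<le> smooth_step t"
  unfolding smooth_step_def by (intro divide_nonneg_nonneg add_nonneg_nonneg exp_flat_nonneg)

lemma smooth_step_le_1: "smooth_step t \<le> 1"
  unfolding smooth_step_def divide_le_eq_1_pos[OF smooth_step_denominator] by (simp add: exp_flat_nonneg)

lemma smooth_on_smooth_step: "smooth_on UNIV smooth_step"
proof -
  have "smooth_on UNIV (\<lambda>t. exp_flat 0 (1 - t))"
    by (rule smooth_on_compose[OF open_UNIV open_UNIV smooth_on_exp_flat smooth_on_diff[OF open_UNIV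
            smooth_on_const smooth_on_bounded_linear[OF bounded_linear_ident open_UNIV]]]) auto
  then have "smooth_on UNIV (\<lambda>t. exp_flat 0 t + exp_flat 0 (1 - t))"
    by (rule smooth_on_add[OF open_UNIV smooth_on_exp_flat])
  then have "smooth_on UNIV (\<lambda>t. exp_flat 0 t / (exp_flat 0 t + exp_flat 0 (1 - t)))"
    by (rule smooth_on_divide[OF open_UNIV smooth_on_exp_flat])
      (use smooth_step_denominator[THEN less_imp_neq, symmetric] in auto)
  then show ?thesis unfolding smooth_step_def[abs_def] .
qed

lemma smooth_bump_ball:
  fixes a :: "'a::euclidean_space"
  assumes "r > 0"
  obtains \<theta> :: "'a \<Rightarrow> real" where "smooth_on UNIV \<theta>" "\<And>x. 0 \<le> \<theta> x" "\<And>x. \<theta> x \<le> 1"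
    "\<And>x. dist a x \<le> r \<Longrightarrow> \<theta> x = 1" "\<And>x. 2 * r \<le> dist a x \<Longrightarrow> \<theta> x = 0"
proof -
  \<comment> \<open>Affine in the squared distance, hence smooth at \<open>a\<close> as well, with
    the value 0 at distance \<open>r\<close> and 1 at distance \<open>2 * r\<close>.\<close>
  define t where "t x = ((x - a) \<bullet> (x - a) - r\<^sup>2) / (3 * r\<^sup>2)" for x
  have "smooth_on UNIV (\<lambda>x :: 'a. x - a)"
    by (rule smooth_on_diff[OF open_UNIV smooth_on_bounded_linear[OF bounded_linear_ident open_UNIV] smooth_on_const])
  then have "smooth_on UNIV (\<lambda>x. (x - a) \<bullet> (x - a))"
    using smooth_on_bilinear[OF open_UNIV bounded_bilinear_inner] by blast
  then have "smooth_on UNIV (\<lambda>x. (x - a) \<bullet> (x - a) - r\<^sup>2)"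
    by (rule smooth_on_diff[OF open_UNIV _ smooth_on_const])
  then have "smooth_on UNIV t"
    unfolding t_def[abs_def] divide_inverse by (rule smooth_on_mult[OF open_UNIV _ smooth_on_const])
  then have "smooth_on UNIV (\<lambda>x. smooth_step (t x))"
    by (rule smooth_on_compose[OF open_UNIV open_UNIV smooth_on_smooth_step]) auto
  then have "smooth_on UNIV (\<lambda>x. 1 - smooth_step (t x))"
    by (rule smooth_on_diff[OF open_UNIV smooth_on_const])
  moreover have "t x \<le> 0" if "dist a x \<le> r" for x
  proof -
    have "(x - a) \<bullet> (x - a) \<le> r\<^sup>2"
      unfolding dot_square_norm using that by (intro power_mono) (auto simp: dist_norm norm_minus_commute)
    then show ?thesis using assms unfolding t_def by (simp add: divide_simps)
  qed
  moreover have "1 \<le> t x" if "2 * r \<le> dist a x" for x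
  proof -
    have "(2 * r)\<^sup>2 \<le> (x - a) \<bullet> (x - a)"
      unfolding dot_square_norm using that assms by (intro power_mono) (auto simp: dist_norm norm_minus_commute)
    then show ?thesis using assms unfolding t_def by (simp add: field_simps)
  qed
  ultimately show ?thesis
    using that[of "\<lambda>x. 1 - smooth_step (t x)"]
    by (auto simp: smooth_step_0 smooth_step_1 smooth_step_nonneg smooth_step_le_1)
qed

lemma smooth_cutoff:
  fixes C W :: "'a::euclidean_space set"
  assumes C: "compact C" and W: "open W" "C \<subseteq> W"
  obtains \<theta> :: "'a \<Rightarrow> real" and N S where "smooth_on UNIV \<theta>" "\<And>x. 0 \<le> \<theta> x" "\<And>x. \<theta> x \<le> 1"
    "open N" "C \<subseteq> N" "\<And>x. x \<in> N \<Longrightarrow> \<theta> x = 1" "compact S" "S \<subseteq> W" "\<And>x. x \<notin> S \<Longrightarrow> \<theta> x = 0"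
proof -
  have "\<exists>r>0. cball x (2 * r) \<subseteq> W" if x: "x \<in> C" for x
  proof -
    obtain e where "e > 0" "cball x e \<subseteq> W" using W x open_contains_cball by blast
    then show ?thesis by (intro exI[of _ "e / 2"]) auto
  qed
  then obtain r where r: "\<And>x. x \<in> C \<Longrightarrow> r x > 0" "\<And>x. x \<in> C \<Longrightarrow> cball x (2 * r x) \<subseteq> W" by metis
  have "\<exists>D. D \<subseteq> C \<and> finite D \<and> C \<subseteq> (\<Union>x\<in>D. ball x (r x))"
    by (rule compactE_image[OF C, of C "\<lambda>x. ball x (r x)"]) (use r in auto)
  then obtain D where D: "D \<subseteq> C" "finite D" "C \<subseteq> (\<Union>x\<in>D. ball x (r x))" by blast
  have "\<exists>\<theta> :: 'a \<Rightarrow> real. smooth_on UNIV \<theta> \<and> (\<forall>y. 0 \<le> \<theta> y \<and> \<theta> y \<le> 1) \<and>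
    (\<forall>y. dist x y \<le> r x \<longrightarrow> \<theta> y = 1) \<and> (\<forall>y. 2 * r x \<le> dist x y \<longrightarrow> \<theta> y = 0)" if "x \<in> C" for x
    by (rule smooth_bump_ball[OF r(1)[OF that], of x]) blast
  then obtain \<beta> :: "'a \<Rightarrow> 'a \<Rightarrow> real" where \<beta>: "\<And>x. x \<in> C \<Longrightarrow> smooth_on UNIV (\<beta> x)"
    "\<And>x y. x \<in> C \<Longrightarrow> 0 \<le> \<beta> x y \<and> \<beta> x y \<le> 1" "\<And>x y. x \<in> C \<Longrightarrow> dist x y \<le> r x \<Longrightarrow> \<beta> x y = 1"
    "\<And>x y. x \<in> C \<Longrightarrow> 2 * r x \<le> dist x y \<Longrightarrow> \<beta> x y = 0"
    by metis
  \<comment> \<open>This is 1 wherever one of the bumps is 1, 0 wherever all of them vanish, and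
    between 0 and 1 everywhere.\<close>
  define \<theta> where "\<theta> y = 1 - (\<Prod>x\<in>D. 1 - \<beta> x y)" for y
  show ?thesis
  proof
    show "smooth_on UNIV \<theta>" unfolding \<theta>_def using \<beta> D
      by (intro smooth_on_diff smooth_on_const open_UNIV smooth_on_prod) auto
    have "0 \<le> (\<Prod>x\<in>D. 1 - \<beta> x y)" "(\<Prod>x\<in>D. 1 - \<beta> x y) \<le> 1" for y
      using \<beta>(2) D by (auto intro!: prod_nonneg prod_le_1 dest!: subsetD)
    then show "0 \<le> \<theta> y" "\<theta> y \<le> 1" for y unfolding \<theta>_def by auto
    show "open (\<Union>x\<in>D. ball x (r x))" by auto
    show "C \<subseteq> (\<Union>x\<in>D. ball x (r x))" by fact
    show "\<theta> y = 1" if "y \<in> (\<Union>x\<in>D. ball x (r x))" for y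
      unfolding \<theta>_def using that D \<beta>(3) by (force simp: prod_zero_iff)
    show "compact (\<Union>x\<in>D. cball x (2 * r x))" using D by (intro compact_UN) auto
    show "(\<Union>x\<in>D. cball x (2 * r x)) \<subseteq> W" using D r by blast
    show "\<theta> y = 0" if "y \<notin> (\<Union>x\<in>D. cball x (2 * r x))" for y
    proof -
      have "\<beta> x y = 0" if "x \<in> D" for x
        using \<open>y \<notin> _\<close> that \<beta>(4)[of x y] D by force
      then show ?thesis unfolding \<theta>_def by simp
    qed
  qed
qed

text \<open>The complement of \<open>S\<close> is open and \<open>f\<close> vanishes there, hence
  all its derivatives do.\<close>

lemma smooth_on_cutoff_Cbd_UNIV:
  fixes f :: "'a::euclidean_space \<Rightarrow> 'b::real_normed_vector"
  assumes "compact S" "\<And>x. x \<notin> S \<Longrightarrow> f x = 0" "Cbd k S M f" "0 \<le> M"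
  shows "Cbd k UNIV M f"
proof -
  have S: "open (- S)" using assms(1) by (simp add: compact_imp_closed open_Compl)
  have "Cbd k (- S) M f \<longleftrightarrow> Cbd k (- S) M (\<lambda>x. 0 :: 'b)"
    by (rule Cbd_cong[OF S order_refl]) (use assms in auto)
  then have "Cbd k (- S) M f" using Cbd_zero[OF assms(4)] by blast
  from Cbd_Un[OF assms(3) this] show ?thesis by simp
qed

subsection \<open>Polynomial approximation of all derivatives\<close>

lemma integrable_on_cbox_conv:
  fixes f :: "'a::euclidean_space \<Rightarrow> 'b::euclidean_space" and \<kappa> :: "'a \<Rightarrow> real"
  assumes "continuous_on UNIV \<kappa>" "continuous_on UNIV f"
  shows "(\<lambda>y. \<kappa> y *\<^sub>R f (x + y)) integrable_on cbox a b"
proof -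
  have "continuous_on UNIV (\<lambda>y. f (x + y))"
    by (rule continuous_on_compose2[OF assms(2)]) (auto intro!: continuous_intros)
  then show ?thesis using assms(1)
    by (intro integrable_continuous continuous_on_scaleR) (auto intro: continuous_on_subset)
qed

text \<open>In this form of the convolution the variable \<open>x\<close> occurs in \<open>f\<close>
  alone, so the derivative falls on \<open>f\<close> and the kernel is merely continuous.\<close>

lemma convolution_has_derivative:
  fixes f :: "'a::euclidean_space \<Rightarrow> 'b::euclidean_space" and \<kappa> :: "'a \<Rightarrow> real" and a b :: 'a
  assumes \<kappa>: "continuous_on UNIV \<kappa>" and f: "smooth_on UNIV f"
  defines "F \<equiv> \<lambda>x. integral (cbox a b) (\<lambda>y. \<kappa> y *\<^sub>R f (x + y))"
  shows "F differentiable (at x)" "dd v F x = integral (cbox a b) (\<lambda>y. \<kappa> y *\<^sub>R dd v f (x + y))"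
proof -
  \<comment> \<open>The derivative bundled as a bounded linear map, the form in which
    differentiation under the integral sign is available.\<close>
  define L where "L x t = Blinfun (\<lambda>v. \<kappa> t *\<^sub>R dd v f (x + t))" for x t
  have df: "(f has_derivative (\<lambda>v. dd v f x)) (at x)" for x
    using smooth_on_imp_differentiable[OF f] by (intro has_derivative_dd) auto
  then have bl: "bounded_linear (\<lambda>v. \<kappa> t *\<^sub>R dd v f (x + t))" for x t
    using has_derivative_bounded_linear by (intro bounded_linear_intros) blast
  have L: "blinfun_apply (L x t) v = \<kappa> t *\<^sub>R dd v f (x + t)" for x t v
    unfolding L_def using bounded_linear_Blinfun_apply[OF bl] by simp
  have contL: "continuous_on S (\<lambda>(x, t). L x t)" for S
  proof (rule continuous_on_blinfun_componentwise)
    fix i :: 'a assume i: "i \<in> Basis"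
    have c1: "continuous_on S (\<lambda>p. dd i f (fst p + snd p))"
      by (rule continuous_on_compose2[OF smooth_on_imp_continuous_on[OF smooth_on_dd[OF f i]]])
        (auto intro!: continuous_intros)
    have c2: "continuous_on S (\<lambda>p. \<kappa> (snd p))"
      by (rule continuous_on_compose2[OF \<kappa>]) (auto intro!: continuous_intros)
    show "continuous_on S (\<lambda>x. blinfun_apply (case x of (x, t) \<Rightarrow> L x t) i)"
      unfolding case_prod_unfold L by (rule continuous_on_scaleR[OF c2 c1])
  qed
  have der: "(F has_derivative blinfun_apply (integral (cbox a b) (L x))) (at x within UNIV)"
    unfolding F_def
  proof (rule leibniz_rule)
    fix x t
    have "((\<lambda>x. f (x + t)) has_derivative (\<lambda>v. dd v f (x + t))) (at x)"
    proof -
      have "((\<lambda>x. x + t) has_derivative (\<lambda>v. v)) (at x)" by (auto intro!: derivative_eq_intros)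
      from has_derivative_compose[OF this df] show ?thesis .
    qed
    then have "((\<lambda>x. \<kappa> t *\<^sub>R f (x + t)) has_derivative (\<lambda>v. \<kappa> t *\<^sub>R dd v f (x + t))) (at x within UNIV)"
      by (rule has_derivative_scaleR_right)
    then show "((\<lambda>x. \<kappa> t *\<^sub>R f (x + t)) has_derivative blinfun_apply (L x t)) (at x within UNIV)"
      unfolding L[abs_def] .
  qed (auto intro!: integrable_on_cbox_conv \<kappa> smooth_on_imp_continuous_on f contL)
  then show "F differentiable (at x)" using differentiableI by auto
  have "dd v F x = blinfun_apply (integral (cbox a b) (L x)) v" using dd_eqI der by auto
  also have "\<dots> = integral (cbox a b) (\<lambda>y. blinfun_apply (L x y) v)"
  proof (rule blinfun_apply_integral)
    have "continuous_on (cbox a b) (\<lambda>t. case (x, t) of (x, t) \<Rightarrow> L x t)"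
      by (rule continuous_on_compose2[OF contL[of UNIV]]) (auto intro!: continuous_intros)
    then show "L x integrable_on cbox a b" by (intro integrable_continuous) simp
  qed
  finally show "dd v F x = integral (cbox a b) (\<lambda>y. \<kappa> y *\<^sub>R dd v f (x + y))" unfolding L .
qed

text \<open>The powers of \<open>\<kappa>\<close>, normalized over a cube, concentrate at 0.
  Nonnegativity is demanded on the cube only, which admits polynomials that become negative far
  away.\<close>

locale approximate_identity =
  fixes \<kappa> :: "'a::euclidean_space \<Rightarrow> real" and r :: real
  assumes r: "r > 0" and \<kappa>: "continuous_on UNIV \<kappa>" "\<kappa> 0 = 1"
    "\<And>y. y \<in> cbox (- r *\<^sub>R One) (r *\<^sub>R One) \<Longrightarrow> 0 \<le> \<kappa> y"
    "\<And>\<delta>. \<delta> > 0 \<Longrightarrow> \<exists>a<1. \<forall>y. \<delta> \<le> norm y \<longrightarrow> \<kappa> y \<le> a"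
begin

abbreviation "Q \<equiv> cbox (- r *\<^sub>R One) (r *\<^sub>R One :: 'a)"

definition "Z N = integral Q (\<lambda>y. \<kappa> y ^ N)"

definition conv :: "nat \<Rightarrow> ('a \<Rightarrow> 'b::euclidean_space) \<Rightarrow> 'a \<Rightarrow> 'b" where
  "conv N f x = integral Q (\<lambda>y. (\<kappa> y ^ N / Z N) *\<^sub>R f (x + y))"

lemma cont_\<kappa>_power: "continuous_on S (\<lambda>y. \<kappa> y ^ N)"
  using \<kappa>(1) by (intro continuous_on_power) (auto intro: continuous_on_subset)

text \<open>By continuity \<open>\<kappa> \<ge> a\<close> on a small cube about 0, and the volume of
  that cube serves as \<open>v\<close>. So the normalization decays more slowly than any prescribed
  geometric sequence.\<close>

lemma Z_lower:
  assumes a: "0 \<le> a" "a < 1"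
  obtains v where "v > 0" "\<And>N. v * a ^ N \<le> Z N"
proof -
  have "isCont \<kappa> 0" using \<kappa>(1) by (simp add: continuous_on_eq_continuous_at)
  then obtain s where s: "s > 0" "\<And>y. dist y 0 < s \<Longrightarrow> dist (\<kappa> y) (\<kappa> 0) < 1 - a"
    unfolding continuous_at_eps_delta using a by (metis diff_gt_0_iff_gt)
  \<comment> \<open>A cube of this half side lies in the ball of radius \<open>s\<close>, by
    comparison with the sum norm.\<close>
  define t where "t = min r (s / (2 * DIM('a)))"
  have t: "t > 0" "t \<le> r" unfolding t_def using r s by auto
  let ?q = "cbox (- t *\<^sub>R One) (t *\<^sub>R One :: 'a)"
  have qQ: "?q \<subseteq> Q" using t by (intro subset_box_imp) auto
  have \<kappa>q: "a \<le> \<kappa> y" if "y \<in> ?q" for y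
  proof -
    have "norm y \<le> (\<Sum>b\<in>Basis. \<bar>y \<bullet> b\<bar>)" by (rule norm_le_l1)
    also have "\<dots> \<le> (\<Sum>b\<in>(Basis::'a set). t)"
      using that by (intro sum_mono) (auto simp: mem_box abs_le_iff)
    also have "\<dots> = DIM('a) * t" by simp
    also have "\<dots> \<le> DIM('a) * (s / (2 * DIM('a)))" unfolding t_def by (intro mult_left_mono) auto
    also have "\<dots> < s" using s by simp
    finally have "dist (\<kappa> y) (\<kappa> 0) < 1 - a" using s by simp
    then show ?thesis unfolding \<kappa>(2) dist_real_def by linarith
  qed
  have "measure lborel ?q * a ^ N \<le> Z N" for N
  proof -
    have "measure lborel ?q * a ^ N = integral ?q (\<lambda>y. a ^ N)" by simp
    also have "\<dots> \<le> integral ?q (\<lambda>y. \<kappa> y ^ N)"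
      using \<kappa>q a by (intro integral_le integrable_continuous cont_\<kappa>_power power_mono continuous_on_const) auto
    also have "\<dots> \<le> Z N"
      unfolding Z_def using \<kappa>(3) qQ
      by (intro integral_subset_le integrable_continuous cont_\<kappa>_power) auto
    finally show ?thesis .
  qed
  moreover have "measure lborel ?q > 0" using t by (intro content_pos_lt) auto
  ultimately show ?thesis using that by blast
qed

lemma Z_pos: "Z N > 0"
proof -
  obtain v where "v > 0" "\<And>N. v * (1 / 2) ^ N \<le> Z N" using Z_lower[of "1/2"] by auto
  then show ?thesis by (metis less_le_trans mult_pos_pos half_gt_zero_iff zero_less_one zero_less_power)
qed

lemma conv_tendsto:
  fixes h :: "'a \<Rightarrow> 'b::euclidean_space"
  assumes h: "uniformly_continuous_on UNIV h" "\<And>x. norm (h x) \<le> A" and \<epsilon>: "\<epsilon> > 0"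
  shows "\<exists>N\<^sub>0. \<forall>N\<ge>N\<^sub>0. \<forall>x. norm (conv N h x - h x) \<le> \<epsilon>"
proof -
  have conth: "continuous_on UNIV h" using h(1) by (rule uniformly_continuous_imp_continuous)
  obtain \<delta> where \<delta>: "\<delta> > 0" "\<And>x y. norm y < \<delta> \<Longrightarrow> norm (h (x + y) - h x) < \<epsilon> / 2"
  proof -
    obtain \<delta> where "\<delta> > 0" "\<forall>x x'. dist x' x < \<delta> \<longrightarrow> dist (h x') (h x) < \<epsilon> / 2"
      using h(1) \<epsilon> unfolding uniformly_continuous_on_def by (metis UNIV_I half_gt_zero)
    then show ?thesis using that[of \<delta>] by (simp add: dist_norm)
  qed
  obtain a0 where a0: "a0 < 1" "\<And>y. \<delta> \<le> norm y \<Longrightarrow> \<kappa> y \<le> a0" using \<kappa>(4)[OF \<delta>(1)] by blast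
  define a where "a = max a0 0"
  have a: "a < 1" "0 \<le> a" "\<And>y. \<delta> \<le> norm y \<Longrightarrow> \<kappa> y \<le> a" using a0 unfolding a_def by (auto intro: max.coboundedI1)
  \<comment> \<open>Away from 0 the kernel is at most \<open>a\<close>, while \<open>Z N\<close> is
    at least a multiple of \<open>a' ^ N\<close>; the far part of the integral is thus of order
    \<open>(a / a') ^ N\<close>.\<close>
  obtain a' where a': "a < a'" "a' < 1" using dense[OF a(1)] by blast
  obtain v where v: "v > 0" "\<And>N. v * a' ^ N \<le> Z N" by (rule Z_lower[OF order_trans[OF a(2) less_imp_le[OF a'(1)]] a'(2)], rule that)
  have A: "0 \<le> A" using order_trans[OF norm_ge_zero h(2)] .
  have bound: "norm (conv N h x - h x) \<le> \<epsilon> / 2 + 2 * A * measure lborel Q / v * (a / a') ^ N" for N x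
  proof -
    note integ = integrable_continuous[OF cont_\<kappa>_power]
    have k: "continuous_on UNIV (\<lambda>y. \<kappa> y ^ N / Z N)"
      by (intro continuous_on_divide cont_\<kappa>_power continuous_on_const) (use Z_pos[of N] in auto)
    have i1: "(\<lambda>y. (\<kappa> y ^ N / Z N) *\<^sub>R h (x + y)) integrable_on Q"
      by (rule integrable_on_cbox_conv[OF k conth])
    have i2: "(\<lambda>y. (\<kappa> y ^ N / Z N) *\<^sub>R h x) integrable_on Q"
      by (intro integrable_continuous continuous_on_scaleR continuous_on_const continuous_on_subset[OF k]) auto
    have int1: "integral Q (\<lambda>y. \<kappa> y ^ N / Z N) = 1"
      unfolding integral_divide Z_def[symmetric] using Z_pos[of N] by simp
    have hx: "h x = integral Q (\<lambda>y. (\<kappa> y ^ N / Z N) *\<^sub>R h x)"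
      using integral_linear[OF integrable_continuous[OF continuous_on_subset[OF k]] bounded_linear_scaleR_left, of "- r *\<^sub>R One" "r *\<^sub>R One" "h x"]
      unfolding o_def int1 by simp
    have eq: "conv N h x - h x = integral Q (\<lambda>y. (\<kappa> y ^ N / Z N) *\<^sub>R h (x + y) - (\<kappa> y ^ N / Z N) *\<^sub>R h x)"
      unfolding conv_def integral_diff[OF i1 i2] hx[symmetric] ..
    have "norm (conv N h x - h x) \<le> integral Q (\<lambda>y. (\<epsilon> / 2) * (\<kappa> y ^ N / Z N) + 2 * A * a ^ N / Z N)"
      unfolding eq
    proof (rule integral_norm_bound_integral)
      show "(\<lambda>y. (\<kappa> y ^ N / Z N) *\<^sub>R h (x + y) - (\<kappa> y ^ N / Z N) *\<^sub>R h x) integrable_on Q"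
        by (rule integrable_diff[OF i1 i2])
      show "(\<lambda>y. (\<epsilon> / 2) * (\<kappa> y ^ N / Z N) + 2 * A * a ^ N / Z N) integrable_on Q"
        by (intro integrable_continuous continuous_on_add continuous_on_mult continuous_on_const continuous_on_subset[OF k]) auto
      fix y assume y: "y \<in> Q"
      have ky: "0 \<le> \<kappa> y ^ N / Z N" using \<kappa>(3)[OF y] Z_pos[of N] by simp
      have "norm ((\<kappa> y ^ N / Z N) *\<^sub>R h (x + y) - (\<kappa> y ^ N / Z N) *\<^sub>R h x)
          = (\<kappa> y ^ N / Z N) * norm (h (x + y) - h x)"
        unfolding scaleR_diff_right[symmetric] norm_scaleR using ky by (simp only: abs_of_nonneg)
      also have "\<dots> \<le> (\<epsilon> / 2) * (\<kappa> y ^ N / Z N) + 2 * A * a ^ N / Z N"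
      proof (cases "norm y < \<delta>")
        case True
        have "(\<kappa> y ^ N / Z N) * norm (h (x + y) - h x) \<le> (\<kappa> y ^ N / Z N) * (\<epsilon> / 2)"
          using \<delta>(2)[OF True] ky by (intro mult_left_mono) (auto intro: less_imp_le)
        moreover have "0 \<le> 2 * A * a ^ N / Z N" using A a(2) Z_pos[of N] by simp
        ultimately show ?thesis by (simp add: mult.commute)
      next
        case False
        have "norm (h (x + y) - h x) \<le> 2 * A" using norm_triangle_ineq4[of "h (x + y)" "h x"] h(2)[of "x + y"] h(2)[of x] by linarith
        moreover have "\<kappa> y ^ N / Z N \<le> a ^ N / Z N"
          using a(3) False \<kappa>(3)[OF y] Z_pos[of N] by (intro divide_right_mono power_mono) auto
        ultimately have "(\<kappa> y ^ N / Z N) * norm (h (x + y) - h x) \<le> (a ^ N / Z N) * (2 * A)"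
          using ky A a(2) Z_pos[of N] by (intro mult_mono) auto
        moreover have "0 \<le> (\<epsilon> / 2) * (\<kappa> y ^ N / Z N)" using \<epsilon> ky by (intro mult_nonneg_nonneg) auto
        ultimately show ?thesis by (simp add: mult.commute mult.left_commute)
      qed
      finally show "norm ((\<kappa> y ^ N / Z N) *\<^sub>R h (x + y) - (\<kappa> y ^ N / Z N) *\<^sub>R h x)
        \<le> (\<epsilon> / 2) * (\<kappa> y ^ N / Z N) + 2 * A * a ^ N / Z N" .
    qed
    also have "\<dots> = integral Q (\<lambda>y. (\<epsilon> / 2) * (\<kappa> y ^ N / Z N)) + integral Q (\<lambda>y. 2 * A * a ^ N / Z N)"
      by (intro integral_add integrable_continuous continuous_on_mult continuous_on_const continuous_on_subset[OF k]) auto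
    also have "\<dots> = \<epsilon> / 2 + 2 * A * measure lborel Q * (a ^ N / Z N)"
      unfolding integral_mult_right int1 integral_const by (simp del: content_cbox_if)
    also have "\<dots> \<le> \<epsilon> / 2 + 2 * A * measure lborel Q * (a ^ N / (v * a' ^ N))"
      using A a a' v Z_pos[of N]
      by (intro add_left_mono mult_left_mono divide_left_mono mult_pos_pos) (auto intro!: mult_nonneg_nonneg zero_less_power)
    also have "\<dots> = \<epsilon> / 2 + 2 * A * measure lborel Q / v * (a / a') ^ N" by (simp add: power_divide)
    finally show ?thesis .
  qed
  have "(\<lambda>N. 2 * A * measure lborel Q / v * (a / a') ^ N) \<longlonglongrightarrow> 2 * A * measure lborel Q / v * 0"
    using a a' by (intro tendsto_mult LIMSEQ_realpow_zero tendsto_const) auto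
  then have "\<forall>\<^sub>F N in sequentially. 2 * A * measure lborel Q / v * (a / a') ^ N < \<epsilon> / 2"
    using \<epsilon> by (intro order_tendstoD(2)) auto
  then obtain N0 where "\<And>N. N \<ge> N0 \<Longrightarrow> 2 * A * measure lborel Q / v * (a / a') ^ N < \<epsilon> / 2"
    unfolding eventually_sequentially by blast
  then have "norm (conv N h x - h x) \<le> \<epsilon>" if "N \<ge> N0" for N x using bound[of N x] that by force
  then show ?thesis by blast
qed

lemma conv_derivative:
  fixes h :: "'a \<Rightarrow> 'b::euclidean_space"
  assumes "smooth_on UNIV h"
  shows "conv N h differentiable (at x)" "dd v (conv N h) x = conv N (dd v h) x"
proof -
  have k: "continuous_on UNIV (\<lambda>y. \<kappa> y ^ N / Z N)"
    by (intro continuous_on_divide cont_\<kappa>_power continuous_on_const) (use Z_pos[of N] in auto)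
  show "conv N h differentiable (at x)" "dd v (conv N h) x = conv N (dd v h) x"
    unfolding conv_def[abs_def]
    by (rule convolution_has_derivative(1)[OF k assms], rule convolution_has_derivative(2)[OF k assms])
qed

text \<open>Convolution commutes with differentiation, so uniform convergence for every smooth
  function supported in \<open>S\<close> yields convergence of all derivatives.\<close>

lemma conv_Cbd:
  fixes h :: "'a \<Rightarrow> 'b::euclidean_space"
  assumes "smooth_on UNIV h" "compact S" "\<And>x. x \<notin> S \<Longrightarrow> h x = 0" "\<epsilon> > 0"
  shows "\<exists>N\<^sub>0. \<forall>N\<ge>N\<^sub>0. Cbd k UNIV \<epsilon> (\<lambda>x. conv N h x - h x)"
proof -
  have base: "\<exists>N\<^sub>0. \<forall>N\<ge>N\<^sub>0. \<forall>x. norm (conv N h x - h x) \<le> \<epsilon>"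
    if h: "smooth_on UNIV h" "\<And>x. x \<notin> S \<Longrightarrow> h x = 0" for h :: "'a \<Rightarrow> 'b"
  proof -
    obtain A where "A > 0" "\<And>x. x \<in> S \<Longrightarrow> norm (h x) \<le> A"
      using compact_bound_pos[OF assms(2)] smooth_on_imp_continuous_on[OF h(1)] continuous_on_subset by (metis subset_UNIV)
    then have "norm (h x) \<le> A" for x using h(2) by (cases "x \<in> S") auto
    moreover have "uniformly_continuous_on UNIV h"
      unfolding uniformly_continuous_on_def
    proof (intro allI impI)
      fix e :: real assume e: "e > 0"
      \<comment> \<open>The compact unit neighborhood of \<open>S\<close>: two points at distance
        below 1, one of them in \<open>S\<close>, both lie in it.\<close>
      define S' where "S' = {x + y |x y. x \<in> S \<and> y \<in> cball 0 1}"
      have "compact S'" unfolding S'_def by (rule compact_sums[OF assms(2) compact_cball])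
      then have "uniformly_continuous_on S' h"
        using smooth_on_imp_continuous_on[OF h(1)] continuous_on_subset
        by (intro compact_uniformly_continuous) blast+
      then obtain d where d: "d > 0" "\<And>x y. x \<in> S' \<Longrightarrow> y \<in> S' \<Longrightarrow> dist y x < d \<Longrightarrow> dist (h y) (h x) < e"
        unfolding uniformly_continuous_on_def using e by metis
      have "dist (h y) (h x) < e" if xy: "dist y x < min d 1" for x y
      proof (cases "x \<in> S \<or> y \<in> S")
        case True
        have "x \<in> S' \<and> y \<in> S'"
          using True
        proof
          assume "x \<in> S"
          then have "x = x + 0 \<and> x \<in> S \<and> (0::'a) \<in> cball 0 1" "y = x + (y - x) \<and> x \<in> S \<and> y - x \<in> cball 0 1"
            using xy by (auto simp: dist_norm norm_minus_commute[of x y])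
          then show "x \<in> S' \<and> y \<in> S'" unfolding S'_def by blast
        next
          assume "y \<in> S"
          then have "y = y + 0 \<and> y \<in> S \<and> (0::'a) \<in> cball 0 1" "x = y + (x - y) \<and> y \<in> S \<and> x - y \<in> cball 0 1"
            using xy by (auto simp: dist_norm norm_minus_commute)
          then show "x \<in> S' \<and> y \<in> S'" unfolding S'_def by blast
        qed
        then show ?thesis using d(2) xy by simp
      next
        case False
        then show ?thesis using h(2) e by simp
      qed
      then show "\<exists>d>0. \<forall>x\<in>UNIV. \<forall>x'\<in>UNIV. dist x' x < d \<longrightarrow> dist (h x') (h x) < e"
        using d(1) by (intro exI[of _ "min d 1"]) auto
    qed
    ultimately show ?thesis using conv_tendsto assms(4) by blast
  qed
  show ?thesis
    using assms(1,3)
  proof (induction k arbitrary: h)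
    case 0
    then show ?case using base by simp
  next
    case (Suc k)
    obtain N1 where N1: "\<forall>N\<ge>N1. \<forall>x. norm (conv N h x - h x) \<le> \<epsilon>" using base[OF Suc.prems] by blast
    have dz: "dd b h x = 0" if "x \<notin> S" for b x
    proof -
      have "dd b h x = dd b (\<lambda>x. 0) x"
        using Suc.prems(2) that assms(2)
        by (intro dd_cong_open[of "- S"]) (auto simp: compact_imp_closed open_Compl)
      then show ?thesis using dd_eqI[OF has_derivative_const] by metis
    qed
    have "\<exists>N\<^sub>0. \<forall>N\<ge>N\<^sub>0. Cbd k UNIV \<epsilon> (\<lambda>x. conv N (dd b h) x - dd b h x)" if "b \<in> Basis" for b
      by (rule Suc.IH[OF smooth_on_dd[OF Suc.prems(1) that] dz])
    then obtain M where M: "\<And>b N. b \<in> Basis \<Longrightarrow> N \<ge> M b \<Longrightarrow> Cbd k UNIV \<epsilon> (\<lambda>x. conv N (dd b h) x - dd b h x)"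
      by metis
    have ddc: "dd b (\<lambda>x. conv N h x - h x) = (\<lambda>x. conv N (dd b h) x - dd b h x)" for b N
    proof
      fix x
      have "((\<lambda>x. conv N h x - h x) has_derivative (\<lambda>v. dd v (conv N h) x - dd v h x)) (at x)"
        using conv_derivative(1)[OF Suc.prems(1)] smooth_on_imp_differentiable[OF Suc.prems(1)]
        by (intro has_derivative_diff has_derivative_dd) auto
      from dd_eqI[OF this] show "dd b (\<lambda>x. conv N h x - h x) x = conv N (dd b h) x - dd b h x"
        using conv_derivative(2)[OF Suc.prems(1)] by metis
    qed
    have "Cbd (Suc k) UNIV \<epsilon> (\<lambda>x. conv N h x - h x)" if N: "N \<ge> max N1 (Max (M ` Basis))" for N
    proof -
      have "M b \<le> N" if "b \<in> Basis" for b
        using N that by (meson Max_ge finite_Basis finite_imageI imageI max.boundedE order_trans)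
      then show ?thesis using M N1 N unfolding Cbd.simps ddc by auto
    qed
    then show ?case by blast
  qed
qed

end

text \<open>A polynomial in \<open>u - x\<close> is a finite sum of products of a function of \<open>u\<close> and a polynomial in \<open>x\<close>.\<close>
lemma real_polynomial_function_separate:
  assumes "real_polynomial_function q"
  shows "\<exists>L. (\<forall>(a, b)\<in>set L. continuous_on UNIV a \<and> real_polynomial_function b) \<and>
    (\<forall>x u. q (u - x) = (\<Sum>(a, b)\<leftarrow>L. a u * b x))"
  using assms
proof induction
  case (linear f)
  show ?case
  proof (intro exI conjI)
    show "\<forall>(a, b)\<in>set [(f, \<lambda>_. 1), (\<lambda>_. 1, \<lambda>x. - f x)]. continuous_on UNIV a \<and> real_polynomial_function b"
      using linear bounded_linear.continuous_on[OF linear continuous_on_id]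
      by (auto intro!: real_polynomial_function_minus)
    show "\<forall>x u. f (u - x) = (\<Sum>(a, b)\<leftarrow>[(f, \<lambda>_. 1), (\<lambda>_. 1, \<lambda>x. - f x)]. a u * b x)"
      using linear by (simp add: linear_diff bounded_linear.linear)
  qed
next
  case (const c)
  show ?case by (rule exI[of _ "[(\<lambda>_. c, \<lambda>_. 1)]"]) auto
next
  case (add f g)
  then obtain L M where
    L: "\<forall>(a, b)\<in>set L. continuous_on UNIV a \<and> real_polynomial_function b" "\<forall>x u. f (u - x) = (\<Sum>(a, b)\<leftarrow>L. a u * b x)" and
    M: "\<forall>(a, b)\<in>set M. continuous_on UNIV a \<and> real_polynomial_function b" "\<forall>x u. g (u - x) = (\<Sum>(a, b)\<leftarrow>M. a u * b x)"
    by blast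
  show ?case by (rule exI[of _ "L @ M"]) (use L M in auto)
next
  case (mult f g)
  then obtain L M where
    L: "\<forall>(a, b)\<in>set L. continuous_on UNIV a \<and> real_polynomial_function b" "\<forall>x u. f (u - x) = (\<Sum>(a, b)\<leftarrow>L. a u * b x)" and
    M: "\<forall>(a, b)\<in>set M. continuous_on UNIV a \<and> real_polynomial_function b" "\<forall>x u. g (u - x) = (\<Sum>(a, b)\<leftarrow>M. a u * b x)"
    by blast
  define pr where "pr p q = (\<lambda>u. fst p u * fst q u :: real, \<lambda>x. snd p x * snd q x :: real)" for p q :: "('a \<Rightarrow> real) \<times> ('a \<Rightarrow> real)"
  have 1: "(\<Sum>(a, b)\<leftarrow>map (pr p) M'. a u * b x) = (fst p u * snd p x) * (\<Sum>(a, b)\<leftarrow>M'. a u * b x)" for p M' and u x :: 'a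
    by (induction M') (auto simp: pr_def algebra_simps)
  have 2: "(\<Sum>(a, b)\<leftarrow>concat (map (\<lambda>p. map (pr p) M) L'). a u * b x)
    = (\<Sum>(a, b)\<leftarrow>L'. a u * b x) * (\<Sum>(a, b)\<leftarrow>M. a u * b x)" for L' and u x :: 'a
    by (induction L') (auto simp: 1 algebra_simps simp del: map_map)
  have "continuous_on UNIV (fst (pr p q)) \<and> real_polynomial_function (snd (pr p q))" if "p \<in> set L" "q \<in> set M" for p q
    using bspec[OF L(1) that(1)] bspec[OF M(1) that(2)] unfolding pr_def
    by (auto simp: case_prod_unfold intro: continuous_on_mult)
  then have "\<forall>(a, b)\<in>set (concat (map (\<lambda>p. map (pr p) M) L)). continuous_on UNIV a \<and> real_polynomial_function b"
    by (auto simp: case_prod_unfold)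
  moreover have "\<forall>x u. f (u - x) * g (u - x) = (\<Sum>(a, b)\<leftarrow>concat (map (\<lambda>p. map (pr p) M) L). a u * b x)"
    unfolding 2 using L(2) M(2) by simp
  ultimately show ?case by blast
qed

lemma polynomial_function_scaleR_const:
  "real_polynomial_function b \<Longrightarrow> polynomial_function (\<lambda>x. b x *\<^sub>R c)"
  unfolding polynomial_function_def
proof (intro allI impI)
  fix f :: "'b \<Rightarrow> real" assume b: "real_polynomial_function b" and f: "bounded_linear f"
  have "f \<circ> (\<lambda>x. b x *\<^sub>R c) = (\<lambda>x. b x * f c)"
    using f by (auto simp: bounded_linear.linear linear_cmul)
  then show "real_polynomial_function (f \<circ> (\<lambda>x. b x *\<^sub>R c))" using b by auto
qed

text \<open>In this form of the convolution \<open>x\<close> enters through the polynomial kernel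
  alone; after separating the variables, the integrals become constant coefficients.\<close>

lemma polynomial_function_convolution:
  fixes f :: "'a::euclidean_space \<Rightarrow> 'b::euclidean_space"
  assumes "real_polynomial_function q" "continuous_on UNIV f"
  shows "polynomial_function (\<lambda>x. integral (cbox l r) (\<lambda>u. q (u - x) *\<^sub>R f u))"
proof -
  obtain L where L: "\<forall>(a, b)\<in>set L. continuous_on UNIV a \<and> real_polynomial_function b"
    "\<forall>x u. q (u - x) = (\<Sum>(a, b)\<leftarrow>L. a u * b x)"
    using real_polynomial_function_separate[OF assms(1)] by blast
  have "(\<forall>x. continuous_on UNIV (\<lambda>u. \<Sum>(a, b)\<leftarrow>L. a u * b x)) \<and>
     polynomial_function (\<lambda>x. integral (cbox l r) (\<lambda>u. (\<Sum>(a, b)\<leftarrow>L. a u * b x) *\<^sub>R f u))"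
    using L(1)
  proof (induction L)
    case Nil
    then show ?case by simp
  next
    case (Cons ab L)
    obtain a b where ab: "ab = (a, b)" by force
    have a: "continuous_on UNIV a" "real_polynomial_function b" using Cons.prems ab by auto
    have IH: "continuous_on UNIV (\<lambda>u. \<Sum>(a, b)\<leftarrow>L. a u * b x)"
      "polynomial_function (\<lambda>x. integral (cbox l r) (\<lambda>u. (\<Sum>(a, b)\<leftarrow>L. a u * b x) *\<^sub>R f u))" for x
      using Cons by auto
    have int: "(\<lambda>u. g u *\<^sub>R f u) integrable_on cbox l r" if "continuous_on UNIV g" for g :: "'a \<Rightarrow> real"
      using continuous_on_scaleR[OF that assms(2)] by (intro integrable_continuous) (auto intro: continuous_on_subset)
    have "integral (cbox l r) (\<lambda>u. (\<Sum>(a, b)\<leftarrow>ab # L. a u * b x) *\<^sub>R f u)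
      = b x *\<^sub>R integral (cbox l r) (\<lambda>u. a u *\<^sub>R f u) + integral (cbox l r) (\<lambda>u. (\<Sum>(a, b)\<leftarrow>L. a u * b x) *\<^sub>R f u)" for x
    proof -
      have "integral (cbox l r) (\<lambda>u. (\<Sum>(a, b)\<leftarrow>ab # L. a u * b x) *\<^sub>R f u)
        = integral (cbox l r) (\<lambda>u. b x *\<^sub>R (a u *\<^sub>R f u) + (\<Sum>(a, b)\<leftarrow>L. a u * b x) *\<^sub>R f u)"
        unfolding ab by (simp add: scaleR_add_left mult.commute)
      also have "\<dots> = integral (cbox l r) (\<lambda>u. b x *\<^sub>R (a u *\<^sub>R f u)) + integral (cbox l r) (\<lambda>u. (\<Sum>(a, b)\<leftarrow>L. a u * b x) *\<^sub>R f u)"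
        by (rule integral_add[OF integrable_cmul[OF int[OF a(1)]] int[OF IH(1)]])
      finally show ?thesis by (simp only: integral_cmul)
    qed
    moreover have "polynomial_function (\<lambda>x. b x *\<^sub>R integral (cbox l r) (\<lambda>u. a u *\<^sub>R f u)
      + integral (cbox l r) (\<lambda>u. (\<Sum>(a, b)\<leftarrow>L. a u * b x) *\<^sub>R f u))"
      by (intro polynomial_function_add polynomial_function_scaleR_const a IH(2))
    moreover have "continuous_on UNIV (\<lambda>u. \<Sum>(a, b)\<leftarrow>ab # L. a u * b x)" for x
      unfolding ab using IH(1) a(1) by (auto intro!: continuous_intros)
    ultimately show ?case by presburger
  qed
  then show ?thesis using L(2) by simp
qed

text \<open>Links the two forms of the convolution: the one with \<open>f (x + y)\<close> exposes
  derivatives, the one with the kernel at \<open>u - x\<close> exposes polynomial dependence on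
  \<open>x\<close>.\<close>

lemma integral_translate_compact_support:
  fixes g :: "'a::euclidean_space \<Rightarrow> 'b::euclidean_space"
  assumes "continuous_on UNIV g" "compact S" "\<And>u. u \<notin> S \<Longrightarrow> g u = 0" "S \<subseteq> T" "(\<lambda>u. u - x) ` S \<subseteq> T'"
  shows "integral T' (\<lambda>y. g (x + y)) = integral T g"
proof -
  have restrict: "integral T h = integral UNIV h" if "\<And>u. u \<notin> T \<Longrightarrow> h u = 0" for T and h :: "'a \<Rightarrow> 'b"
  proof -
    have "(\<lambda>u. if u \<in> T then h u else 0) = h" using that by auto
    then show ?thesis using integral_restrict_UNIV[of T h] by simp
  qed
  have lint: "integrable lborel h" if "continuous_on UNIV h" "compact S" "\<And>u. u \<notin> S \<Longrightarrow> h u = 0" for h :: "'a \<Rightarrow> 'b" and S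
  proof -
    have "(\<lambda>u. indicator S u *\<^sub>R h u) = h" using that(3) by (auto simp: indicator_def)
    then show ?thesis using borel_integrable_compact[OF that(2), of h] that(1) continuous_on_subset by (metis subset_UNIV)
  qed
  have g': "continuous_on UNIV (\<lambda>y. g (x + y))"
    by (rule continuous_on_compose2[OF assms(1)]) (auto intro!: continuous_intros)
  have S': "compact ((\<lambda>u. u - x) ` S)"
    using compact_translation[OF assms(2), of "- x"] by (simp add: image_image)
  have z: "g (x + y) = 0" if "y \<notin> (\<lambda>u. u - x) ` S" for y
    using that assms(3)[of "x + y"] by (force simp: image_iff)
  have "integral T' (\<lambda>y. g (x + y)) = integral UNIV (\<lambda>y. g (x + y))"
    by (rule restrict) (use z assms(5) in blast)
  also have "\<dots> = integral\<^sup>L lborel (\<lambda>y. g (x + y))"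
    by (rule integral_lborel[OF lint[OF g' S' z]])
  also have "\<dots> = integral\<^sup>L (distr lborel borel ((+) x)) g"
    using borel_measurable_continuous_onI[OF assms(1)] by (intro integral_distr[symmetric]) auto
  also have "\<dots> = integral\<^sup>L lborel g" by (simp add: lborel_distr_plus)
  also have "\<dots> = integral UNIV g" by (rule integral_lborel[OF lint[OF assms(1-3)], symmetric])
  also have "\<dots> = integral T g" by (rule restrict[symmetric]) (use assms(3,4) in blast)
  finally show ?thesis .
qed

text \<open>Weierstrass approximation including derivatives, with the kernel
  \<open>1 - (y \<bullet> y) / c\<close>. It is a polynomial, so convolution with its powers turns a
  compactly supported function into a polynomial on the relevant ball.\<close>

theorem smooth_polynomial_approximation:
  fixes f :: "'a::euclidean_space \<Rightarrow> 'b::euclidean_space"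
  assumes f: "smooth_on UNIV f" and B: "compact B" and \<epsilon>: "\<epsilon> > 0"
  obtains p where "polynomial_function p" "Cbd k B \<epsilon> (\<lambda>x. p x - f x)"
proof -
  obtain \<theta> :: "'a \<Rightarrow> real" and N S where \<theta>: "smooth_on UNIV \<theta>" "open N" "B \<subseteq> N" "\<And>x. x \<in> N \<Longrightarrow> \<theta> x = 1"
    "compact S" "\<And>x. x \<notin> S \<Longrightarrow> \<theta> x = 0"
    using smooth_cutoff[OF B open_UNIV subset_UNIV] by metis
  define h where "h x = \<theta> x *\<^sub>R f x" for x
  have h: "smooth_on UNIV h" "\<And>x. x \<notin> S \<Longrightarrow> h x = 0"
    unfolding h_def[abs_def] using \<theta> f smooth_on_scaleR[OF open_UNIV] by auto
  obtain R where R: "R > 0" "\<And>x. x \<in> B \<union> S \<Longrightarrow> norm x < R"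
    using compact_imp_bounded[OF compact_Un[OF B \<theta>(5)]] bounded_pos_less by metis
  \<comment> \<open>Differences of points of norm below \<open>R\<close> then have norm below
    \<open>r\<close>, so they lie in the cube; \<open>c\<close> is so large that the kernel is
    nonnegative on the whole cube.\<close>
  define r where "r = 2 * R"
  define c where "c = 2 * (DIM('a) * r)\<^sup>2"
  have rc: "r > 0" "c > 0" unfolding r_def c_def using R by auto
  define \<kappa> where "\<kappa> y = 1 - (y \<bullet> y) / c" for y :: 'a
  interpret approximate_identity \<kappa> r
  proof
    show "r > 0" by fact
    show "continuous_on UNIV \<kappa>" unfolding \<kappa>_def divide_inverse by (intro continuous_intros)
    show "\<kappa> 0 = 1" unfolding \<kappa>_def by simp
    show "0 \<le> \<kappa> y" if "y \<in> cbox (- r *\<^sub>R One) (r *\<^sub>R One)" for y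
    proof -
      have "norm y \<le> (\<Sum>b\<in>Basis. \<bar>y \<bullet> b\<bar>)" by (rule norm_le_l1)
      also have "\<dots> \<le> (\<Sum>b\<in>(Basis::'a set). r)"
        using that by (intro sum_mono) (auto simp: mem_box abs_le_iff)
      finally have "norm y \<le> DIM('a) * r" by simp
      then have "y \<bullet> y \<le> (DIM('a) * r)\<^sup>2" unfolding dot_square_norm by (intro power_mono) auto
      also have "\<dots> \<le> c" unfolding c_def by simp
      finally show ?thesis using rc unfolding \<kappa>_def by simp
    qed
    show "\<exists>a<1. \<forall>y. \<delta> \<le> norm y \<longrightarrow> \<kappa> y \<le> a" if "\<delta> > 0" for \<delta>
    proof (intro exI[of _ "1 - \<delta>\<^sup>2 / c"] conjI allI impI)
      show "1 - \<delta>\<^sup>2 / c < 1" using that rc by simp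
      fix y :: 'a assume "\<delta> \<le> norm y"
      then have "\<delta>\<^sup>2 \<le> y \<bullet> y" unfolding dot_square_norm using that by (intro power_mono) auto
      then show "\<kappa> y \<le> 1 - \<delta>\<^sup>2 / c" unfolding \<kappa>_def using rc by (simp add: divide_right_mono)
    qed
  qed
  obtain M where M: "Cbd k UNIV \<epsilon> (\<lambda>x. conv M h x - h x)"
    using conv_Cbd[OF h(1) \<theta>(5) h(2) \<epsilon>, of k] by auto
  have "real_polynomial_function \<kappa>"
  proof -
    have "real_polynomial_function (\<lambda>y :: 'a. y \<bullet> y)"
    proof -
      have "(\<lambda>y :: 'a. y \<bullet> y) = (\<lambda>y. \<Sum>b\<in>Basis. (y \<bullet> b) * (y \<bullet> b))"
        by (rule ext) (rule euclidean_inner)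
      moreover have "real_polynomial_function (\<lambda>y :: 'a. \<Sum>b\<in>Basis. (y \<bullet> b) * (y \<bullet> b))"
        by (intro real_polynomial_function_sum real_polynomial_function.intros(4) real_polynomial_function.intros(1)
            bounded_linear_inner_left) auto
      ultimately show ?thesis by simp
    qed
    then show ?thesis unfolding \<kappa>_def[abs_def]
      by (intro real_polynomial_function_diff real_polynomial_function_divide real_polynomial_function.intros(2))
  qed
  then have q: "real_polynomial_function (\<lambda>y. \<kappa> y ^ M / Z M)"
    by (intro real_polynomial_function_divide real_polynomial_function_power)
  define p where "p x = integral Q (\<lambda>u. (\<kappa> (u - x) ^ M / Z M) *\<^sub>R h u)" for x
  have conth: "continuous_on UNIV h" using h smooth_on_imp_continuous_on by blast
  have p: "polynomial_function p"
    unfolding p_def using polynomial_function_convolution[OF q conth] by simp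
  have SQ: "y \<in> Q" if "norm y < r" for y
  proof -
    have "\<bar>y \<bullet> b\<bar> \<le> r" if "b \<in> Basis" for b using Basis_le_norm[OF that, of y] \<open>norm y < r\<close> by linarith
    then show ?thesis by (force simp: mem_box abs_le_iff)
  qed
  have pconv: "conv M h x = p x" if "x \<in> ball 0 R" for x
  proof -
    have "integral Q (\<lambda>y. (\<kappa> ((x + y) - x) ^ M / Z M) *\<^sub>R h (x + y)) = p x"
      unfolding p_def
    proof (rule integral_translate_compact_support[OF _ \<theta>(5)])
      show "continuous_on UNIV (\<lambda>u. (\<kappa> (u - x) ^ M / Z M) *\<^sub>R h u)"
      proof (intro continuous_on_scaleR conth continuous_on_divide continuous_on_const continuous_on_power)
        show "continuous_on UNIV (\<lambda>u. \<kappa> (u - x))"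
          by (rule continuous_on_compose2[OF \<kappa>(1)]) (auto intro!: continuous_intros)
      qed (use Z_pos[of M] in auto)
      show "S \<subseteq> Q" using SQ R unfolding r_def by fastforce
      show "(\<lambda>u. u - x) ` S \<subseteq> Q"
      proof safe
        fix u assume "u \<in> S"
        then have "norm u < R" "norm x < R" using R(2) that by auto
        then show "u - x \<in> Q" using norm_triangle_ineq4[of u x] unfolding r_def by (intro SQ[unfolded r_def]) linarith
      qed
    qed (use h(2) in auto)
    then show ?thesis unfolding conv_def by simp
  qed
  \<comment> \<open>The convolution equals \<open>p\<close>, and \<open>h\<close> equals
    \<open>f\<close>, on an open neighborhood of \<open>B\<close>; equality on \<open>B\<close>
    alone would say nothing about derivatives.\<close>
  have "Cbd k B \<epsilon> (\<lambda>x. conv M h x - h x)" using Cbd_mono[OF M] by simp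
  then have "Cbd k B \<epsilon> (\<lambda>x. p x - f x)"
  proof (rule iffD1[OF Cbd_cong[of "N \<inter> ball 0 R"], rotated -1])
    show "open (N \<inter> ball 0 R)" using \<theta> by auto
    show "B \<subseteq> N \<inter> ball 0 R" using \<theta>(3) R(2) by auto
    show "conv M h y - h y = p y - f y" if "y \<in> N \<inter> ball 0 R" for y
      using that pconv \<theta>(4) unfolding h_def by simp
  qed
  then show ?thesis using that p by blast
qed

section \<open>Algebraic dependence of polynomial maps\<close>

text \<open>A Euclidean space of variable dimension is modeled by a coordinate subspace of
  \<open>real ^ 'n\<close>; functions on it are functions invariant under this projection.\<close>

definition coord_proj :: "'n set \<Rightarrow> real ^ 'n \<Rightarrow> real ^ 'n::finite" where
  "coord_proj J x = (\<chi> j. if j \<in> J then x $ j else 0)"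

lemma coord_proj_nth [simp]: "coord_proj J x $ j = (if j \<in> J then x $ j else 0)"
  by (simp add: coord_proj_def)

lemma coord_proj_idem [simp]: "coord_proj J (coord_proj J x) = coord_proj J x"
  by (simp add: vec_eq_iff)

lemma norm_coord_proj_le: "norm (coord_proj J x) \<le> norm x"
  by (rule norm_le_componentwise_cart) simp

lemma linear_coord_proj: "linear (coord_proj J)"
  by (rule linearI) (auto simp: vec_eq_iff)

lemma bounded_linear_coord_proj: "bounded_linear (coord_proj J)"
  using linear_coord_proj by (rule linear_conv_bounded_linear[THEN iffD1])

interpretation fun_space: vector_space "\<lambda>(c :: complex) (f :: 'b \<Rightarrow> complex) x. c * f x"
  by unfold_locales (auto simp: algebra_simps)

definition rmonomial :: "'n set \<Rightarrow> ('n \<Rightarrow> nat) \<Rightarrow> real ^ 'n::finite \<Rightarrow> complex" where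
  "rmonomial J \<beta> x = (\<Prod>j\<in>J. complex_of_real (x $ j) ^ \<beta> j)"

text \<open>The degree is bounded in each variable separately, which gives a simple count. Exponents
  outside \<open>J\<close> are set to 0, so that indices that give the same monomial are not counted
  twice.\<close>

definition mbox :: "'n set \<Rightarrow> nat \<Rightarrow> ('n::finite \<Rightarrow> nat) set" where
  "mbox J D = {\<beta>. (\<forall>j\<in>J. \<beta> j \<le> D) \<and> (\<forall>j. j \<notin> J \<longrightarrow> \<beta> j = 0)}"

definition rpoly :: "'n set \<Rightarrow> nat \<Rightarrow> (real ^ 'n::finite \<Rightarrow> complex) set" where
  "rpoly J D = fun_space.span (rmonomial J ` mbox J D)"

lemma mbox_card: "finite (mbox J D)" "card (mbox J D) = (D + 1) ^ card J"
proof -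
  let ?f = "\<lambda>g j. if j \<in> J then g j else 0 :: nat"
  have "bij_betw (\<lambda>g j. if j \<in> J then g j else 0) (PiE J (\<lambda>_. {..D})) (mbox J D)"
  proof (rule bij_betw_byWitness[where f' = "\<lambda>\<beta>. restrict \<beta> J"])
    show "\<forall>g\<in>PiE J (\<lambda>_. {..D}). restrict (?f g) J = g"
    proof
      fix g assume g: "g \<in> PiE J (\<lambda>_. {..D})"
      show "restrict (?f g) J = g"
      proof
        fix j show "restrict (?f g) J j = g j"
          using PiE_arb[OF g, of j] by (cases "j \<in> J") auto
      qed
    qed
    show "\<forall>\<beta>\<in>mbox J D. ?f (restrict \<beta> J) = \<beta>"
    proof
      fix \<beta> assume \<beta>: "\<beta> \<in> mbox J D"
      show "?f (restrict \<beta> J) = \<beta>"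
      proof
        fix j show "?f (restrict \<beta> J) j = \<beta> j" using \<beta> by (simp add: mbox_def)
      qed
    qed
    show "?f ` PiE J (\<lambda>_. {..D}) \<subseteq> mbox J D"
    proof safe
      fix g assume "g \<in> PiE J (\<lambda>_. {..D})"
      then have "g j \<le> D" if "j \<in> J" for j using PiE_mem that by fastforce
      then show "?f g \<in> mbox J D" by (simp add: mbox_def)
    qed
    show "(\<lambda>\<beta>. restrict \<beta> J) ` mbox J D \<subseteq> PiE J (\<lambda>_. {..D})"
      by (auto simp: mbox_def)
  qed
  note bb = this
  show "finite (mbox J D)" using bij_betw_finite[OF bb] by (simp add: finite_PiE)
  show "card (mbox J D) = (D + 1) ^ card J" using bij_betw_same_card[OF bb] by (simp add: card_PiE)
qed

lemma rpoly_add: "f \<in> rpoly J D \<Longrightarrow> g \<in> rpoly J D \<Longrightarrow> (\<lambda>x. f x + g x) \<in> rpoly J D"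
  unfolding rpoly_def using fun_space.span_add[of f _ g] by (simp add: plus_fun_def)

lemma rpoly_cmult: "f \<in> rpoly J D \<Longrightarrow> (\<lambda>x. c * f x) \<in> rpoly J D"
  unfolding rpoly_def by (rule fun_space.span_scale)

lemma rpoly_mono: "f \<in> rpoly J D \<Longrightarrow> D \<le> E \<Longrightarrow> f \<in> rpoly J E"
  unfolding rpoly_def using fun_space.span_mono[of "rmonomial J ` mbox J D" "rmonomial J ` mbox J E"]
  by (force simp: mbox_def)

lemma rmonomial_in_rpoly: "\<beta> \<in> mbox J D \<Longrightarrow> rmonomial J \<beta> \<in> rpoly J D"
  unfolding rpoly_def by (intro fun_space.span_base imageI)

lemma rpoly_1: "(\<lambda>x. 1) \<in> rpoly J D"
proof -
  have "rmonomial J (\<lambda>_. 0) = (\<lambda>x. 1)" by (simp add: rmonomial_def fun_eq_iff)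
  then show ?thesis using rmonomial_in_rpoly[of "\<lambda>_. 0" J D] by (simp add: mbox_def)
qed

lemma rpoly_const: "(\<lambda>x. c) \<in> rpoly J D"
  using rpoly_cmult[OF rpoly_1, of c] by simp

lemma rpoly_induct [consumes 1, case_names zero add]:
  assumes "f \<in> rpoly J D" "P (\<lambda>x. 0)"
    "\<And>c \<beta> g. \<beta> \<in> mbox J D \<Longrightarrow> P g \<Longrightarrow> P (\<lambda>x. c * rmonomial J \<beta> x + g x)"
  shows "P f"
  using assms(1) unfolding rpoly_def
proof (induction rule: fun_space.span_induct_alt)
  case base
  then show ?case using assms(2) by (simp add: zero_fun_def)
next
  case (step c h g)
  then show ?case using assms(3) by (auto simp: plus_fun_def)
qed

lemma rpoly_mult:
  assumes "f \<in> rpoly J D" "g \<in> rpoly J E" shows "(\<lambda>x. f x * g x) \<in> rpoly J (D + E)"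
  using assms(1)
proof (induction rule: rpoly_induct)
  case zero
  then show ?case using rpoly_const[of 0] by simp
next
  case (add c \<beta> h)
  have "(\<lambda>x. rmonomial J \<beta> x * g x) \<in> rpoly J (D + E)"
    using assms(2)
  proof (induction rule: rpoly_induct)
    case zero
    then show ?case using rpoly_const[of 0] by simp
  next
    case (add c \<gamma> k)
    have "(\<lambda>j. \<beta> j + \<gamma> j) \<in> mbox J (D + E)"
      using \<open>\<beta> \<in> mbox J D\<close> \<open>\<gamma> \<in> mbox J E\<close> by (auto simp: mbox_def add_mono)
    then have "(\<lambda>x. c * rmonomial J (\<lambda>j. \<beta> j + \<gamma> j) x) \<in> rpoly J (D + E)"
      by (intro rpoly_cmult rmonomial_in_rpoly)
    moreover have "rmonomial J (\<lambda>j. \<beta> j + \<gamma> j) x = rmonomial J \<beta> x * rmonomial J \<gamma> x" for x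
      by (simp add: rmonomial_def power_add prod.distrib)
    ultimately have "(\<lambda>x. c * (rmonomial J \<beta> x * rmonomial J \<gamma> x) + rmonomial J \<beta> x * k x) \<in> rpoly J (D + E)"
      using add.IH by (intro rpoly_add) simp_all
    then show ?case by (simp add: algebra_simps)
  qed
  then have "(\<lambda>x. c * (rmonomial J \<beta> x * g x) + h x * g x) \<in> rpoly J (D + E)"
    using add by (intro rpoly_add rpoly_cmult)
  then show ?case by (simp add: algebra_simps)
qed

lemma rpoly_prod:
  assumes "finite I" "\<And>i. i \<in> I \<Longrightarrow> f i \<in> rpoly J (D i)"
  shows "(\<lambda>x. \<Prod>i\<in>I. f i x) \<in> rpoly J (\<Sum>i\<in>I. D i)"
  using assms by (induction I rule: finite_induct) (auto intro: rpoly_mult rpoly_const)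

lemma rpoly_power: "f \<in> rpoly J D \<Longrightarrow> (\<lambda>x. f x ^ k) \<in> rpoly J (k * D)"
  by (induction k) (auto intro: rpoly_mult rpoly_const)

lemma rpoly_sum:
  assumes "finite I" "\<And>i. i \<in> I \<Longrightarrow> f i \<in> rpoly J D"
  shows "(\<lambda>x. \<Sum>i\<in>I. f i x) \<in> rpoly J D"
  using assms by (induction I rule: finite_induct) (auto intro: rpoly_add rpoly_const)

lemma real_polynomial_function_in_rpoly:
  fixes q :: "real ^ 'n::finite \<Rightarrow> real"
  assumes "real_polynomial_function q"
  shows "\<exists>D. (\<lambda>x. complex_of_real (q (coord_proj J x))) \<in> rpoly J D"
  using assms
proof induction
  case (linear f)
  have coord: "(\<lambda>x. complex_of_real (x $ j)) \<in> rpoly J 1" if "j \<in> J" for j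
  proof -
    have "rmonomial J (\<lambda>i. if i = j then 1 else 0) x = (\<Prod>i\<in>J. if i = j then complex_of_real (x $ j) else 1)" for x
      unfolding rmonomial_def by (intro prod.cong) auto
    then have "rmonomial J (\<lambda>i. if i = j then 1 else 0) = (\<lambda>x. complex_of_real (x $ j))"
      using that by (simp add: fun_eq_iff)
    moreover have "(\<lambda>i. if i = j then 1 else 0) \<in> mbox J 1" using that by (auto simp: mbox_def)
    ultimately show ?thesis using rmonomial_in_rpoly by metis
  qed
  have lf: "linear f" using linear by (rule bounded_linear.linear)
  have "f (coord_proj J x) = (\<Sum>j\<in>J. x $ j * f (axis j 1))" for x
  proof -
    have "coord_proj J x = (\<Sum>j\<in>J. x $ j *\<^sub>R axis j 1)"
      by (simp add: vec_eq_iff axis_def if_distrib cong: if_cong)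
    then show ?thesis by (simp add: linear_sum[OF lf] linear_cmul[OF lf])
  qed
  then have "(\<lambda>x. complex_of_real (f (coord_proj J x))) = (\<lambda>x. \<Sum>j\<in>J. complex_of_real (f (axis j 1)) * complex_of_real (x $ j))"
    by (simp add: mult.commute)
  moreover have "(\<lambda>x. \<Sum>j\<in>J. complex_of_real (f (axis j 1)) * complex_of_real (x $ j)) \<in> rpoly J 1"
    by (intro rpoly_sum rpoly_cmult coord finite)
  ultimately show ?case by (intro exI[of _ 1]) simp
next
  case (const c)
  then show ?case using rpoly_const by blast
next
  case (add f g)
  then obtain D E where "(\<lambda>x. complex_of_real (f (coord_proj J x))) \<in> rpoly J D"
    "(\<lambda>x. complex_of_real (g (coord_proj J x))) \<in> rpoly J E" by blast
  then have "(\<lambda>x. complex_of_real (f (coord_proj J x)) + complex_of_real (g (coord_proj J x))) \<in> rpoly J (max D E)"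
    by (intro rpoly_add) (auto intro: rpoly_mono)
  then show ?case by auto
next
  case (mult f g)
  then obtain D E where "(\<lambda>x. complex_of_real (f (coord_proj J x))) \<in> rpoly J D"
    "(\<lambda>x. complex_of_real (g (coord_proj J x))) \<in> rpoly J E" by blast
  then have "(\<lambda>x. complex_of_real (f (coord_proj J x)) * complex_of_real (g (coord_proj J x))) \<in> rpoly J (D + E)"
    by (rule rpoly_mult)
  then show ?case by auto
qed

text \<open>Counting: the monomials of degree \<open>< N\<close> in each of the \<open>n\<close> components of \<open>p\<close> are \<open>N^n\<close> elements of a
  space of dimension \<open>O(N^|J|)\<close>.\<close>
theorem polynomial_map_algebraic_relation:
  fixes p :: "real ^ 'n::finite \<Rightarrow> complex ^ 'n"
  assumes p: "polynomial_function p" "\<And>x. p (coord_proj J x) = p x" and J: "J \<noteq> UNIV"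
  obtains A c \<alpha>\<^sub>0 where "finite A" "\<alpha>\<^sub>0 \<in> A" "c \<alpha>\<^sub>0 \<noteq> 0" "\<And>x. (\<Sum>\<alpha>\<in>A. c \<alpha> * monomial \<alpha> (p x)) = 0"
proof -
  have "\<exists>D. (\<lambda>x. p x $ i) \<in> rpoly J D" for i
  proof -
    have "bounded_linear (\<lambda>z :: complex ^ 'n. Re (z $ i))" "bounded_linear (\<lambda>z :: complex ^ 'n. Im (z $ i))"
      by (intro bounded_linear_compose[OF bounded_linear_Re bounded_linear_vec_nth]
          bounded_linear_compose[OF bounded_linear_Im bounded_linear_vec_nth])+
    then have "real_polynomial_function (\<lambda>x. Re (p x $ i))" "real_polynomial_function (\<lambda>x. Im (p x $ i))"
      using p(1) unfolding polynomial_function_def o_def by blast+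
    from this[THEN real_polynomial_function_in_rpoly]
    obtain D E where "(\<lambda>x. complex_of_real (Re (p (coord_proj J x) $ i))) \<in> rpoly J D"
      "(\<lambda>x. complex_of_real (Im (p (coord_proj J x) $ i))) \<in> rpoly J E"
      by blast
    then have "(\<lambda>x. complex_of_real (Re (p x $ i)) + \<i> * complex_of_real (Im (p x $ i))) \<in> rpoly J (max D E)"
      unfolding p(2) by (intro rpoly_add rpoly_cmult) (auto intro: rpoly_mono)
    then show ?thesis by (auto simp: complex_eq[symmetric])
  qed
  then obtain D where D: "\<And>i. (\<lambda>x. p x $ i) \<in> rpoly J (D i)" by metis
  define D0 where "D0 = (\<Sum>i\<in>UNIV. D i)"
  define d where "d = card J"
  define n where "n = CARD('n)"
  have dn: "d < n" unfolding d_def n_def using J by (intro psubset_card_mono) auto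
  \<comment> \<open>This choice makes \<open>N ^ (d + 1)\<close> exceed
    \<open>(N * (D0 + 1)) ^ d\<close>, a bound for the dimension of the space that contains all the
    monomials in \<open>p\<close>.\<close>
  define N where "N = (D0 + 1) ^ d + 1"
  define g where "g \<alpha> = (\<lambda>x. monomial \<alpha> (p x))" for \<alpha> :: "'n \<Rightarrow> nat"
  define A where "A = mbox (UNIV :: 'n set) (N - 1)"
  have A: "finite A" "card A = N ^ n" unfolding A_def n_def using mbox_card[of UNIV "N - 1"] by (auto simp: N_def)
  have g: "g \<alpha> \<in> rpoly J (N * D0)" if "\<alpha> \<in> A" for \<alpha>
  proof -
    have "g \<alpha> \<in> rpoly J (\<Sum>j\<in>UNIV. \<alpha> j * D j)"
      unfolding g_def by (intro rpoly_prod rpoly_power D) auto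
    moreover have "(\<Sum>j\<in>UNIV. \<alpha> j * D j) \<le> N * D0"
      unfolding D0_def sum_distrib_left using that by (intro sum_mono mult_right_mono) (auto simp: A_def mbox_def N_def intro: le_SucI)
    ultimately show ?thesis by (rule rpoly_mono)
  qed
  have "card (rmonomial J ` mbox J (N * D0)) \<le> (N * D0 + 1) ^ d"
    unfolding d_def using card_image_le[OF mbox_card(1)] mbox_card(2) by metis
  also have "\<dots> \<le> (N * (D0 + 1)) ^ d" by (intro power_mono) (auto simp: N_def)
  also have "\<dots> = N ^ d * (D0 + 1) ^ d" by (rule power_mult_distrib)
  also have "\<dots> < N ^ d * N" unfolding N_def by (intro mult_strict_left_mono) auto
  also have "\<dots> = N ^ Suc d" by simp
  also have "\<dots> \<le> N ^ n" using dn by (intro power_increasing) (auto simp: N_def)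
  finally have card: "card (rmonomial J ` mbox J (N * D0)) < card A" unfolding A(2) .
  \<comment> \<open>Two monomials that agree on the image already give a relation; otherwise there
    are more distinct functions than the dimension allows.\<close>
  show ?thesis
  proof (cases "inj_on g A")
    case False
    then obtain \<alpha> \<beta> where ab: "\<alpha> \<in> A" "\<beta> \<in> A" "\<alpha> \<noteq> \<beta>" "g \<alpha> = g \<beta>" unfolding inj_on_def by blast
    have "(\<Sum>\<gamma>\<in>{\<alpha>, \<beta>}. (if \<gamma> = \<alpha> then 1 else - 1) * monomial \<gamma> (p x)) = 0" for x
      using ab(3) fun_cong[OF ab(4), of x] unfolding g_def by simp
    then show ?thesis using that[of "{\<alpha>, \<beta>}" \<alpha> "\<lambda>\<gamma>. if \<gamma> = \<alpha> then 1 else - 1"] by simp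
  next
    case True
    have "fun_space.dependent (g ` A)"
    proof (rule ccontr)
      assume "\<not> ?thesis"
      moreover have "g ` A \<subseteq> fun_space.span (rmonomial J ` mbox J (N * D0))" using g unfolding rpoly_def by blast
      ultimately have "card (g ` A) \<le> card (rmonomial J ` mbox J (N * D0))"
        using fun_space.independent_span_bound[of "rmonomial J ` mbox J (N * D0)" "g ` A"] mbox_card(1) by blast
      then show False using card card_image[OF True] by simp
    qed
    then obtain t u v where t: "finite t" "t \<subseteq> g ` A" "v \<in> t" "u v \<noteq> 0" "(\<Sum>v\<in>t. (\<lambda>x. u v * v x)) = 0"
      unfolding fun_space.dependent_explicit by blast
    have "(\<Sum>v\<in>t. (\<lambda>x. u v * v x)) x = (\<Sum>v\<in>t. u v * v x)" for x
      using t(1) by induction auto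
    then have eval: "(\<Sum>v\<in>t. u v * v x) = 0" for x
      using fun_cong[OF t(5), of x] by simp
    define B where "B = {\<alpha>\<in>A. g \<alpha> \<in> t}"
    have B: "g ` B = t" "inj_on g B" "finite B" unfolding B_def using t(2) True A(1) by (auto simp: inj_on_def)
    obtain \<alpha>0 where "\<alpha>0 \<in> B" "g \<alpha>0 = v" using B(1) t(3) by blast
    moreover have "(\<Sum>\<alpha>\<in>B. u (g \<alpha>) * monomial \<alpha> (p x)) = 0" for x
    proof -
      have "(\<Sum>\<alpha>\<in>B. u (g \<alpha>) * monomial \<alpha> (p x)) = (\<Sum>\<alpha>\<in>B. u (g \<alpha>) * g \<alpha> x)" unfolding g_def ..
      also have "\<dots> = (\<Sum>v\<in>g ` B. u v * v x)" using sum.reindex[OF B(2), of "\<lambda>v. u v * v x"] by simp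
      finally show ?thesis using eval B(1) by simp
    qed
    ultimately show ?thesis using that[of B \<alpha>0 "\<lambda>\<alpha>. u (g \<alpha>)"] B(3) t(4) by blast
  qed
qed

section \<open>Removing a compact set from the hull\<close>

lemma Cbd_bounded_linear:
  assumes "open U" "B \<subseteq> U" "bounded_linear L" "\<And>x. norm (L x) \<le> K * norm x" "0 \<le> K" "smooth_on U f" "Cbd k B M f"
  shows "Cbd k B (K * M) (\<lambda>x. L (f x))"
  using assms(6,7)
proof (induction k arbitrary: f)
  have *: "norm (L y) \<le> K * M" if "norm y \<le> M" for y
    using order_trans[OF assms(4) mult_left_mono[OF that assms(5)]] .
  {
    case 0
    then show ?case using * by simp
  next
    case (Suc k)
    have "dd b (\<lambda>x. L (f x)) x = L (dd b f x)" if "x \<in> U" for b x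
      using smooth_on_imp_differentiable[OF Suc.prems(1) that]
      by (intro dd_eqI bounded_linear.has_derivative[OF assms(3)] has_derivative_dd)
    then have "Cbd k B (K * M) (dd b (\<lambda>x. L (f x))) \<longleftrightarrow> Cbd k B (K * M) (\<lambda>x. L (dd b f x))" for b
      by (intro Cbd_cong[OF assms(1,2)])
    moreover have "Cbd k B (K * M) (\<lambda>x. L (dd b f x))" if "b \<in> Basis" for b
      using Suc.prems that by (intro Suc.IH smooth_on_dd) auto
    ultimately show ?case using Suc.prems * by simp
  }
qed

lemma smooth_on_holomorphic_polynomial:
  assumes "holomorphic_polynomial p" shows "smooth_on UNIV p"
proof -
  obtain A c where A: "p = (\<lambda>z. \<Sum>\<alpha>\<in>A. c \<alpha> * monomial \<alpha> z)"
    using assms unfolding holomorphic_polynomial_def by blast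
  have "smooth_on UNIV (\<lambda>z :: complex ^ 'a. z $ j)" for j
    by (rule smooth_on_bounded_linear[OF bounded_linear_vec_nth open_UNIV])
  then show ?thesis unfolding A
    by (intro smooth_on_sum smooth_on_mult smooth_on_const smooth_on_prod smooth_on_power open_UNIV)
qed

lemma smooth_on_real_polynomial_function:
  assumes "real_polynomial_function p" shows "smooth_on UNIV p"
  using assms
  by induction (auto intro: smooth_on_bounded_linear smooth_on_const smooth_on_add smooth_on_mult)

lemma smooth_on_polynomial_function:
  fixes p :: "'a::euclidean_space \<Rightarrow> 'b::euclidean_space"
  assumes "polynomial_function p" shows "smooth_on UNIV p"
proof (rule smooth_on_componentwise[OF open_UNIV])
  fix i :: 'b assume "i \<in> Basis"
  have "real_polynomial_function (\<lambda>x. p x \<bullet> i)"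
    using assms bounded_linear_inner_left[of i] unfolding polynomial_function_def o_def by blast
  then show "smooth_on UNIV (\<lambda>x. p x \<bullet> i)" by (rule smooth_on_real_polynomial_function)
qed

text \<open>The projection along \<open>e\<close> onto the hyperplane where coordinate
  \<open>m\<close> vanishes. A function of it is constant along \<open>e\<close>, so that the shear
  with this coefficient is inverted by changing a sign.\<close>

definition dir_proj :: "'n \<Rightarrow> complex ^ 'n \<Rightarrow> complex ^ 'n \<Rightarrow> complex ^ 'n::finite" where
  "dir_proj m e z = z - (z $ m / e $ m) *s e"

lemma dir_proj_invariant:
  assumes "e $ m \<noteq> 0" shows "dir_proj m e (w + t *s e) = dir_proj m e w"
  using assms by (simp add: dir_proj_def vec_eq_iff field_simps)

lemma dir_proj_nth: "dir_proj m e z $ j = z $ j - z $ m / e $ m * e $ j"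
  by (simp add: dir_proj_def)

lemma holomorphic_polynomial_dir_proj:
  assumes "holomorphic_polynomial \<gamma>" shows "holomorphic_polynomial (\<lambda>z. \<gamma> (dir_proj m e z))"
proof (rule holomorphic_polynomial_compose[OF assms])
  show "holomorphic_polynomial (\<lambda>z. dir_proj m e z $ j)" for j
    using holomorphic_polynomial_diff[OF holomorphic_polynomial_coord
        holomorphic_polynomial_cmult[OF holomorphic_polynomial_coord], of j "e $ j / e $ m" m]
    by (simp add: dir_proj_nth mult.commute)
qed

text \<open>Joint continuity matters because the direction is moved slightly later on, to avoid the
  zeros of a leading form.\<close>

lemma continuous_on_dir_proj:
  "continuous_on {x. fst x $ m \<noteq> 0} (\<lambda>x. dir_proj m (fst x) (snd x))"
proof -
  have "dir_proj m e z = (\<chi> j. z $ j - z $ m / e $ m * e $ j)" for e z :: "complex ^ 'a"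
    by (simp add: vec_eq_iff dir_proj_nth)
  then show ?thesis by (auto intro!: continuous_intros)
qed

lemma bounded_linear_smult: "bounded_linear (\<lambda>t :: complex. t *s (e :: complex ^ 'n))"
proof (rule bounded_linear_intro)
  show "norm (t *s e) \<le> norm t * norm e" for t
    by (simp add: norm_vec_def L2_set_right_distrib[symmetric] norm_mult)
qed (auto simp: vec_eq_iff algebra_simps)

text \<open>After an approximation of \<open>p\<^sub>1\<close> by a polynomial map, its image lies in an algebraic hypersurface
  \<open>F = 0\<close>.  The shear \<open>z \<mapsto> z + \<gamma>(\<pi> z)\<^sup>N e\<close> moves the image by an amount that is small with all its derivatives,
  but sweeps the hypersurface away from \<open>Z\<close>.\<close>
theorem hull_avoiding_perturbation:
  fixes p\<^sub>1 :: "real ^ 'n::finite \<Rightarrow> complex ^ 'n"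
  assumes P: "compact P" "polynomially_convex P" and Z: "compact Z" "Z \<inter> P = {}"
    and p\<^sub>1: "smooth_on UNIV p\<^sub>1" "\<And>x. p\<^sub>1 (coord_proj J x) = p\<^sub>1 x" and J: "J \<noteq> UNIV" and B: "compact B"
    and e: "e $ m \<noteq> 0" and \<gamma>: "holomorphic_polynomial \<gamma>"
    and sep: "\<And>x. x \<in> B \<Longrightarrow> norm (\<gamma> (dir_proj m e (p\<^sub>1 x))) < 1" "\<And>z. z \<in> Z \<Longrightarrow> 1 < norm (\<gamma> (dir_proj m e z))"
    and \<epsilon>: "\<epsilon> > 0"
  obtains c where "smooth_on UNIV c" "\<And>x. c (coord_proj J x) = c x" "Cbd k B \<epsilon> c"
    "polynomial_hull (P \<union> (\<lambda>x. p\<^sub>1 x + c x) ` B) \<inter> Z = {}"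
proof -
  let ?g = "\<lambda>e z. \<gamma> (dir_proj m e z)"
  have contg: "continuous_on {x. fst x $ m \<noteq> 0} (\<lambda>x. norm (?g (fst x) (snd x)))"
    by (intro continuous_on_norm continuous_on_compose2[OF continuous_on_holomorphic_polynomial[OF \<gamma>, of UNIV] continuous_on_dir_proj]) auto
  have opm: "open {x :: (complex ^ 'n) \<times> (complex ^ 'n). fst x $ m \<noteq> 0}"
    by (intro open_Collect_neq continuous_intros)
  have O1: "open {x. fst x $ m \<noteq> 0 \<and> norm (?g (fst x) (snd x)) < 1}"
    using continuous_open_preimage[OF contg opm open_lessThan[of 1]] by (simp add: vimage_def Int_def conj_commute)
  have O2: "open {x. fst x $ m \<noteq> 0 \<and> 1 < norm (?g (fst x) (snd x))}"
    using continuous_open_preimage[OF contg opm open_greaterThan[of 1]] by (simp add: vimage_def Int_def conj_commute)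
  have p1B: "compact (p\<^sub>1 ` B)"
    using smooth_on_imp_continuous_on[OF p\<^sub>1(1)] B by (intro compact_continuous_image) (auto intro: continuous_on_subset)
  obtain \<delta>1 where \<delta>1: "\<delta>1 > 0" "\<And>x y. x \<in> {e} \<times> p\<^sub>1 ` B \<Longrightarrow> dist x y < \<delta>1 \<Longrightarrow> y \<in> {x. fst x $ m \<noteq> 0 \<and> norm (?g (fst x) (snd x)) < 1}"
    by (rule compact_subset_open_margin[OF compact_Times[OF compact_sing p1B] O1]) (use sep e in auto)
  obtain \<delta>2 where \<delta>2: "\<delta>2 > 0" "\<And>x y. x \<in> {e} \<times> Z \<Longrightarrow> dist x y < \<delta>2 \<Longrightarrow> y \<in> {x. fst x $ m \<noteq> 0 \<and> 1 < norm (?g (fst x) (snd x))}"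
    by (rule compact_subset_open_margin[OF compact_Times[OF compact_sing Z(1)] O2]) (use sep e in auto)
  \<comment> \<open>One half of \<open>\<epsilon>\<close> is left for the shear. Together with the
    change of direction by less than \<open>\<delta>1 / 3\<close>, the total displacement stays
    below the margin \<open>\<delta>1\<close>.\<close>
  define \<epsilon>1 where "\<epsilon>1 = min (\<epsilon> / 2) (\<delta>1 / 3)"
  have \<epsilon>1: "\<epsilon>1 > 0" "\<epsilon>1 \<le> \<epsilon> / 2" "\<epsilon>1 \<le> \<delta>1 / 3" unfolding \<epsilon>1_def using \<epsilon> \<delta>1 by auto
  have smJ: "smooth_on UNIV (coord_proj J :: real ^ 'n \<Rightarrow> _)"
    by (rule smooth_on_bounded_linear[OF bounded_linear_coord_proj open_UNIV])
  obtain C where C: "C > 0" "\<And>(E :: real ^ 'n \<Rightarrow> complex ^ 'n) M. smooth_on UNIV E \<Longrightarrow> 0 \<le> M \<Longrightarrow>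
      Cbd k (coord_proj J ` B) M E \<Longrightarrow> Cbd k B (C * M) (\<lambda>x. E (coord_proj J x))"
    using Cbd_compose[OF open_UNIV B subset_UNIV smJ open_UNIV subset_UNIV, of k] by blast
  have BJ: "compact (coord_proj J ` B)"
    using smooth_on_imp_continuous_on[OF smJ] B by (intro compact_continuous_image) (auto intro: continuous_on_subset)
  obtain q where q: "polynomial_function q" "Cbd k (coord_proj J ` B) (\<epsilon>1 / C) (\<lambda>x. q x - p\<^sub>1 x)"
    using smooth_polynomial_approximation[OF p\<^sub>1(1) BJ, of "\<epsilon>1 / C" k] \<epsilon>1 C by auto
  \<comment> \<open>The composition makes the approximation depend on the coordinates in
    \<open>J\<close> alone, as the algebraic relation demands.\<close>
  define p where "p = q \<circ> coord_proj J"
  have p: "polynomial_function p"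
    unfolding p_def by (intro polynomial_function_compose polynomial_function_bounded_linear bounded_linear_coord_proj q)
  have pJ: "p (coord_proj J x) = p x" for x by (simp add: p_def)
  have smp: "smooth_on UNIV p" by (rule smooth_on_polynomial_function[OF p])
  have smpp1: "smooth_on UNIV (\<lambda>x. p x - p\<^sub>1 x)" by (rule smooth_on_diff[OF open_UNIV smp p\<^sub>1(1)])
  have "Cbd k B (C * (\<epsilon>1 / C)) (\<lambda>x. q (coord_proj J x) - p\<^sub>1 (coord_proj J x))"
    by (rule C(2)) (use q smooth_on_polynomial_function[OF q(1)] \<epsilon>1 C p\<^sub>1 in \<open>auto intro!: smooth_on_diff\<close>)
  then have pp1: "Cbd k B \<epsilon>1 (\<lambda>x. p x - p\<^sub>1 x)" using C(1) by (simp add: p_def p\<^sub>1(2))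
  obtain A c \<alpha>\<^sub>0 where A: "finite A" "\<alpha>\<^sub>0 \<in> A" "c \<alpha>\<^sub>0 \<noteq> 0" "\<And>x. (\<Sum>\<alpha>\<in>A. c \<alpha> * monomial \<alpha> (p x)) = 0"
    using polynomial_map_algebraic_relation[OF p pJ J] by metis
  define F where "F = (\<lambda>z. \<Sum>\<alpha>\<in>A. c \<alpha> * monomial \<alpha> z)"
  have F: "holomorphic_polynomial F" "\<And>x. F (p x) = 0"
    unfolding F_def using A by (auto intro: holomorphic_polynomialI)
  obtain T where T: "holomorphic_polynomial T" "\<exists>w. T w \<noteq> 0"
    "\<And>e R. T e \<noteq> 0 \<Longrightarrow> \<exists>B>0. \<forall>z t. norm z \<le> R \<longrightarrow> B \<le> norm t \<longrightarrow> F (z - t *s e) \<noteq> 0"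
    unfolding F_def by (rule holomorphic_polynomial_growth[of A \<alpha>\<^sub>0 c, OF A(1-3)]) (rule that[unfolded F_def])
  \<comment> \<open>In a direction where the leading form \<open>T\<close> does not vanish,
    \<open>F\<close> has no zeros far out, uniformly for starting points in
    \<open>Z\<close>.\<close>
  obtain e' where e': "dist e' e < min (\<delta>1 / 3) \<delta>2" "T e' \<noteq> 0"
  proof -
    obtain w where "T w \<noteq> 0" using T(2) by blast
    moreover have "min (\<delta>1 / 3) \<delta>2 > 0" using \<delta>1(1) \<delta>2(1) by simp
    ultimately show ?thesis using holomorphic_polynomial_nonzero_dense[OF T(1)] that by blast
  qed
  have near1: "e' $ m \<noteq> 0 \<and> norm (?g e' (p x)) < 1" if "x \<in> B" for x
  proof -
    have "norm (p x - p\<^sub>1 x) \<le> \<epsilon>1" using Cbd_norm_le[OF pp1 that] .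
    then have "dist (p\<^sub>1 x) (p x) \<le> \<epsilon>1" by (simp add: dist_norm norm_minus_commute)
    moreover have "dist (e, p\<^sub>1 x) (e', p x) \<le> dist e e' + dist (p\<^sub>1 x) (p x)"
      unfolding dist_Pair_Pair by (rule order_trans[OF sqrt_sum_squares_le_sum_abs]) simp
    ultimately have "dist (e, p\<^sub>1 x) (e', p x) < \<delta>1"
      using e'(1) \<epsilon>1 \<delta>1(1) dist_commute[of e e'] by simp
    then show ?thesis using \<delta>1(2)[of "(e, p\<^sub>1 x)" "(e', p x)"] that by auto
  qed
  have near2: "e' $ m \<noteq> 0 \<and> 1 < norm (?g e' z)" if "z \<in> Z" for z
    using \<delta>2(2)[of "(e, z)" "(e', z)"] that e'(1) by (auto simp: dist_Pair_Pair dist_commute)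
  define g where "g z = ?g e' z" for z
  have g: "holomorphic_polynomial g" unfolding g_def by (rule holomorphic_polynomial_dir_proj[OF \<gamma>])
  show ?thesis
  proof (cases "Z = {}")
    case True
    show ?thesis
      by (rule that[of "\<lambda>x. 0"]) (use True \<epsilon> in \<open>auto intro: smooth_on_const Cbd_zero\<close>)
  next
    case False
    then have e'm: "e' $ m \<noteq> 0" using near2 by blast
    have ginv: "g (w + t *s e') = g w" for w t unfolding g_def dir_proj_invariant[OF e'm] ..
    have "continuous_on Z (\<lambda>z. norm (g z))" by (intro continuous_on_norm continuous_on_holomorphic_polynomial g)
    then obtain z0 where z0: "z0 \<in> Z" "\<And>z. z \<in> Z \<Longrightarrow> norm (g z0) \<le> norm (g z)"
      using continuous_attains_inf[OF Z(1) False] by blast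
    have gz0: "1 < norm (g z0)" using near2[OF z0(1)] unfolding g_def by simp
    obtain R where R: "\<And>z. z \<in> Z \<Longrightarrow> norm z \<le> R" using compact_imp_bounded[OF Z(1)] bounded_iff by metis
    obtain t0 where t0: "t0 > 0" "\<And>z t. norm z \<le> R \<Longrightarrow> t0 \<le> norm t \<Longrightarrow> F (z - t *s e') \<noteq> 0"
      using T(3)[OF e'(2)] by blast
    define \<epsilon>2 where "\<epsilon>2 = \<epsilon> / (2 * (norm e' + 1))"
    have e1: "0 < norm e' + 1" by (smt (verit) norm_ge_zero)
    then have \<epsilon>2: "\<epsilon>2 > 0" unfolding \<epsilon>2_def using \<epsilon> by simp
    have smgp: "smooth_on UNIV (\<lambda>x. g (p x))"
      by (rule smooth_on_compose[OF open_UNIV open_UNIV smooth_on_holomorphic_polynomial[OF g] smp]) auto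
    obtain N1 where N1: "\<And>N. N \<ge> N1 \<Longrightarrow> Cbd k B \<epsilon>2 (\<lambda>x. g (p x) ^ N)"
      using Cbd_power_small[OF open_UNIV B subset_UNIV smgp _ \<epsilon>2] near1 unfolding g_def by blast
    obtain N2 where N2: "t0 < norm (g z0) ^ N2" using real_arch_pow[OF gz0] by blast
    define N where "N = max N1 N2"
    have N: "Cbd k B \<epsilon>2 (\<lambda>x. g (p x) ^ N)" "t0 \<le> norm (g z0) ^ N"
    proof -
      show "Cbd k B \<epsilon>2 (\<lambda>x. g (p x) ^ N)" by (rule N1) (simp add: N_def)
      have "norm (g z0) ^ N2 \<le> norm (g z0) ^ N" using gz0 by (intro power_increasing) (auto simp: N_def)
      then show "t0 \<le> norm (g z0) ^ N" using N2 by linarith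
    qed
    define c' where "c' x = (p x - p\<^sub>1 x) + g (p x) ^ N *s e'" for x
    have smpow: "smooth_on UNIV (\<lambda>x. g (p x) ^ N)" by (rule smooth_on_power[OF open_UNIV smgp])
    have smG: "smooth_on UNIV (\<lambda>x. g (p x) ^ N *s e')"
      by (rule smooth_on_bounded_linear_compose[OF open_UNIV bounded_linear_smult smpow])
    have "smooth_on UNIV c'" unfolding c'_def[abs_def] by (rule smooth_on_add[OF open_UNIV smpp1 smG])
    moreover have "c' (coord_proj J x) = c' x" for x unfolding c'_def pJ p\<^sub>1(2) ..
    moreover have "Cbd k B \<epsilon> c'"
    proof -
      have nle: "norm (t *s e') \<le> (norm e' + 1) * norm t" for t :: complex
      proof -
        have "norm (t *s e') = norm t * norm e'"
          by (simp add: norm_vec_def L2_set_right_distrib[symmetric] norm_mult)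
        then show ?thesis by (simp add: algebra_simps)
      qed
      have "Cbd k B ((norm e' + 1) * \<epsilon>2) (\<lambda>x. g (p x) ^ N *s e')"
        by (rule Cbd_bounded_linear[OF open_UNIV subset_UNIV bounded_linear_smult nle _ smpow N(1)]) (use e1 in simp)
      moreover have "(norm e' + 1) * \<epsilon>2 = \<epsilon> / 2" using e1 unfolding \<epsilon>2_def by (simp add: field_simps)
      ultimately have "Cbd k B (\<epsilon> / 2) (\<lambda>x. g (p x) ^ N *s e')" by metis
      then have "Cbd k B (\<epsilon>1 + \<epsilon> / 2) c'"
        unfolding c'_def[abs_def] by (rule Cbd_add[OF open_UNIV subset_UNIV smpp1 smG pp1])
      then show ?thesis using Cbd_mono \<epsilon>1(2) by fastforce
    qed
    moreover have "polynomial_hull (P \<union> (\<lambda>x. p\<^sub>1 x + c' x) ` B) \<inter> Z = {}"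
    proof -
      \<comment> \<open>\<open>F\<close> composed with the inverse shear. It vanishes on the sheared
        image, while for \<open>z \<in> Z\<close> it evaluates \<open>F\<close> at a point displaced
        by at least \<open>t0\<close> in the parameter along \<open>e'\<close>.\<close>
      define F' where "F' z = F (z - g z ^ N *s e')" for z
      have F': "holomorphic_polynomial F'"
        unfolding F'_def
      proof (rule holomorphic_polynomial_compose[OF F(1)])
        show "holomorphic_polynomial (\<lambda>z. (z - g z ^ N *s e') $ j)" for j
          using holomorphic_polynomial_diff[OF holomorphic_polynomial_coord[of j]
              holomorphic_polynomial_cmult[OF holomorphic_polynomial_power[OF g, of N], of "e' $ j"]]
          by (simp add: mult.commute)
      qed
      have zero: "F' w = 0" if w: "w \<in> (\<lambda>x. p\<^sub>1 x + c' x) ` B" for w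
      proof -
        obtain x where "w = p\<^sub>1 x + c' x" using w by blast
        then have "w = p x + g (p x) ^ N *s e'" unfolding c'_def by simp
        then show ?thesis unfolding F'_def using F(2) by (simp add: ginv)
      qed
      have "z \<notin> polynomial_hull (P \<union> (\<lambda>x. p\<^sub>1 x + c' x) ` B)" if z: "z \<in> Z" for z
      proof (rule not_in_polynomial_hull_Un[OF P F' zero])
        show "z \<notin> P" using Z(2) z by blast
        have "t0 \<le> norm (g z ^ N)"
          using N(2) power_mono[OF z0(2)[OF z] norm_ge_zero, of N] by (simp add: norm_power)
        then show "F' z \<noteq> 0" unfolding F'_def using t0(2) R[OF z] by blast
      qed
      then show ?thesis by blast
    qed
    ultimately show ?thesis using that by blast
  qed
qed

section \<open>Separation from totally real graphs\<close>

definition cvec :: "real ^ 'n \<Rightarrow> complex ^ 'n::finite" where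
  "cvec x = (\<chi> j. complex_of_real (x $ j))"

lemma cvec_nth [simp]: "cvec x $ j = complex_of_real (x $ j)"
  by (simp add: cvec_def)

lemma norm_cvec [simp]: "norm (cvec x) = norm x"
  by (simp add: norm_vec_def)

definition Re_vec :: "complex ^ 'n \<Rightarrow> real ^ 'n::finite" where
  "Re_vec z = (\<chi> j. Re (z $ j))"

lemma Re_vec_nth [simp]: "Re_vec z $ j = Re (z $ j)"
  by (simp add: Re_vec_def)

lemma Re_vec_diff: "Re_vec (z - w) = Re_vec z - Re_vec w"
  by (simp add: vec_eq_iff)

lemma Re_vec_cvec [simp]: "Re_vec (cvec x) = x"
  by (simp add: vec_eq_iff)

lemma norm_Re_vec_le: "norm (Re_vec z) \<le> norm z"
  unfolding norm_vec_def by (rule L2_set_mono) (auto simp: abs_Re_le_cmod)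

text \<open>The complex bilinear square, not the Hermitian one: it is a polynomial, positive on
  nonzero real vectors and negative on nonzero imaginary ones.\<close>

definition qform :: "complex ^ 'n::finite \<Rightarrow> complex" where
  "qform u = (\<Sum>j\<in>UNIV. (u $ j)\<^sup>2)"

lemma norm_vec_sq: "(norm (u :: complex ^ 'n::finite))\<^sup>2 = (\<Sum>j\<in>UNIV. (norm (u $ j))\<^sup>2)"
  unfolding norm_vec_def L2_set_def by (simp add: sum_nonneg)

lemma norm_rvec_sq: "(norm (u :: real ^ 'n::finite))\<^sup>2 = (\<Sum>j\<in>UNIV. (u $ j)\<^sup>2)"
  unfolding norm_vec_def L2_set_def by (simp add: sum_nonneg)

lemma norm_qform_le: "norm (qform u) \<le> (norm u)\<^sup>2"
  unfolding qform_def norm_vec_sq by (rule order_trans[OF norm_sum]) (simp add: norm_power)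

text \<open>The real part of \<open>u\<close> has norm at least 4/5 and the imaginary part at most
  1/5 of that of \<open>\<Delta>\<close>, whence 16/25 - 1/25 = 3/5; the upper constant is the
  square of 6/5.\<close>

lemma qform_bounds:
  assumes "norm (u - cvec \<Delta>) \<le> (1/5) * norm \<Delta>"
  shows "(3/5) * (norm \<Delta>)\<^sup>2 \<le> Re (qform u)" "norm (qform u) \<le> (36/25) * (norm \<Delta>)\<^sup>2"
proof -
  let ?D = "norm \<Delta>"
  have "(norm (u - cvec \<Delta>))\<^sup>2 \<le> ((1/5) * ?D)\<^sup>2" using assms by (intro power_mono) auto
  then have split: "(norm (u - cvec \<Delta>))\<^sup>2 \<le> ?D\<^sup>2 / 25" by (simp add: power_mult_distrib power2_eq_square)
  have "norm (Re_vec u - \<Delta>) \<le> norm (u - cvec \<Delta>)" using norm_Re_vec_le[of "u - cvec \<Delta>"] by (simp add: Re_vec_diff)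
  then have "norm (Re_vec u) \<ge> (4/5) * ?D" using assms norm_triangle_ineq2[of \<Delta> "\<Delta> - Re_vec u"]
    by (simp add: norm_minus_commute)
  then have "((4/5) * ?D)\<^sup>2 \<le> (norm (Re_vec u))\<^sup>2" by (intro power_mono) auto
  moreover have "(norm (Re_vec u))\<^sup>2 = (\<Sum>j\<in>UNIV. (Re (u $ j))\<^sup>2)" by (simp add: norm_rvec_sq)
  moreover have "((4/5) * ?D)\<^sup>2 = (16/25) * ?D\<^sup>2" by (simp add: power_mult_distrib power2_eq_square)
  ultimately have re: "(16/25) * ?D\<^sup>2 \<le> (\<Sum>j\<in>UNIV. (Re (u $ j))\<^sup>2)" by metis
  have "(\<Sum>j\<in>UNIV. (Im (u $ j))\<^sup>2) \<le> (norm (u - cvec \<Delta>))\<^sup>2"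
    unfolding norm_vec_sq by (intro sum_mono) (simp add: cmod_power2)
  then have im: "(\<Sum>j\<in>UNIV. (Im (u $ j))\<^sup>2) \<le> ?D\<^sup>2 / 25" using split by linarith
  have "Re (qform u) = (\<Sum>j\<in>UNIV. (Re (u $ j))\<^sup>2) - (\<Sum>j\<in>UNIV. (Im (u $ j))\<^sup>2)"
    unfolding qform_def by (simp add: power2_eq_square sum_subtractf)
  then show "(3/5) * ?D\<^sup>2 \<le> Re (qform u)" using re im by simp
  have "norm u \<le> (6/5) * ?D" using norm_triangle_ineq[of "u - cvec \<Delta>" "cvec \<Delta>"] assms by simp
  then have "(norm u)\<^sup>2 \<le> ((6/5) * ?D)\<^sup>2" by (intro power_mono) auto
  then show "norm (qform u) \<le> (36/25) * ?D\<^sup>2"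
    using norm_qform_le[of u] by (simp add: power_mult_distrib power2_eq_square)
qed

text \<open>The gain, linear in \<open>D / M\<close>, beats the quadratic error once
  \<open>D / M \<le> 1/4\<close>: in the squared modulus, 6/5 - 324/625 is still more than
  1/2.\<close>

lemma norm_one_minus_le:
  fixes q :: complex and D D0 M :: real
  assumes "(3/5) * D \<le> Re q" "norm q \<le> (36/25) * D" "0 \<le> D" "D \<le> D0" "4 * D0 < M"
  shows "norm (1 - q / M) \<le> sqrt (1 - D / (2 * M))"
proof (rule real_le_rsqrt)
  have M: "M > 0" "D / M \<le> 1 / 4" using assms by (auto simp: divide_simps)
  have "(norm (1 - q / M))\<^sup>2 = 1 - 2 * (Re q / M) + (norm (q / M))\<^sup>2"
    unfolding cmod_power2 using M by (simp add: power2_eq_square algebra_simps)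
  also have "norm (q / M) = norm q / M" using M by (simp add: norm_divide)
  also have "(norm q / M)\<^sup>2 \<le> ((36/25) * (D / M))\<^sup>2"
    using assms M by (intro power_mono) (auto simp: divide_simps)
  also have "((36/25) * (D / M))\<^sup>2 = (1296/625) * (D / M) * (D / M)" by (simp add: power2_eq_square)
  also have "\<dots> \<le> (1296/625) * (D / M) * (1 / 4)"
    using M assms by (intro mult_left_mono) auto
  finally have "(norm (1 - q / M))\<^sup>2 \<le> 1 - 2 * (Re q / M) + (324/625) * (D / M)" by simp
  moreover have "(3/5) * (D / M) \<le> Re q / M" using assms(1) M divide_right_mono[of "(3/5) * D" "Re q" M] by simp
  moreover have "0 \<le> D / M" using M assms(3) by simp
  ultimately show "(norm (1 - q / M))\<^sup>2 \<le> 1 - D / (2 * M)" by simp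
qed

text \<open>Total reality in the form in which it survives a \<open>C\<^sup>1\<close>-small perturbation: \<open>p\<close> depends on the coordinates
  in \<open>J\<close> only, and \<open>\<Lambda>\<close>, whose range lies in \<open>\<complex>\<^sup>J\<close>, carries it back to the inclusion \<open>\<real>\<^sup>J \<subseteq> \<complex>\<^sup>J\<close> up to a small
  Lipschitz error.\<close>

definition tr_map :: "complex ^ 'n ^ 'n \<Rightarrow> 'n set \<Rightarrow> real \<Rightarrow> real \<Rightarrow> (real ^ 'n \<Rightarrow> complex ^ 'n::finite) \<Rightarrow> bool" where
  "tr_map \<Lambda> J \<theta> C p \<longleftrightarrow> (\<forall>x. p (coord_proj J x) = p x) \<and>
    (\<forall>x y. norm (p x - p y) \<le> C * norm (coord_proj J (x - y))) \<and>
    (\<forall>x y. norm (\<Lambda> *v (p x - p y) - cvec (coord_proj J (x - y))) \<le> \<theta> * norm (coord_proj J (x - y)))"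

text \<open>Here \<open>e\<close> is a kernel direction of \<open>\<Lambda>\<close> to project
  along, with coordinate \<open>m\<close> available for normalization, and \<open>\<nu>\<close> is
  sent to a real basis vector, so it serves as a nearly tangent direction for tilting
  \<open>e\<close>.\<close>

definition tr_frame :: "complex ^ 'n ^ 'n \<Rightarrow> 'n set \<Rightarrow> 'n \<Rightarrow> complex ^ 'n \<Rightarrow> complex ^ 'n \<Rightarrow> 'n::finite \<Rightarrow> bool" where
  "tr_frame \<Lambda> J m e \<nu> j \<longleftrightarrow> (\<forall>z i. i \<notin> J \<longrightarrow> (\<Lambda> *v z) $ i = 0) \<and> \<Lambda> *v e = 0 \<and> e $ m \<noteq> 0 \<and> j \<in> J \<and> \<Lambda> *v \<nu> = axis j 1"

lemma norm_smult: "norm (t *s (e :: complex ^ 'n::finite)) = norm t * norm e"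
  by (simp add: norm_vec_def L2_set_right_distrib[symmetric] norm_mult)

lemma dir_proj_diff: "dir_proj m e (z - w) = dir_proj m e z - dir_proj m e w"
  by (simp add: vec_eq_iff dir_proj_nth field_simps diff_divide_distrib)

lemma holomorphic_polynomial_matrix_nth: "holomorphic_polynomial (\<lambda>z. (\<Lambda> *v z) $ i)"
  unfolding matrix_vector_mult_def
  by (simp, intro holomorphic_polynomial_sum holomorphic_polynomial_cmult holomorphic_polynomial_coord)

text \<open>With \<open>q (L (z0 - p y)) = - b\<close>, \<open>b \<ge> 0\<close>, the basic
  polynomial \<open>\<gamma>1\<close> gives weak inequalities; three cases make them strict. If
  \<open>b > 0\<close>, the value at \<open>z0\<close> exceeds 1. If \<open>b = 0\<close> and
  \<open>z0\<close> and \<open>p y\<close> have the same projection, the assumption on lines keeps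
  \<open>B\<close> away from \<open>y\<close>. Otherwise a coordinate that distinguishes the
  projections is multiplied by a high power of \<open>\<gamma>1\<close>. The direction
  \<open>e\<close> is only required to be close to the kernel of \<open>\<Lambda>\<close>, so that
  it can be tilted.\<close>

lemma separation_in_direction:
  fixes p :: "real ^ 'n::finite \<Rightarrow> complex ^ 'n"
  assumes tr: "tr_map \<Lambda> J (1/10) C p" and \<Lambda>J: "\<And>z i. i \<notin> J \<Longrightarrow> (\<Lambda> *v z) $ i = 0"
    and e: "e $ m \<noteq> 0" "C * norm (\<Lambda> *v e) \<le> norm (e $ m) / 10" and C: "C > 0"
    and B: "compact B" and no: "\<And>y t. y \<in> B \<Longrightarrow> z0 - p y \<noteq> t *s e"
  obtains \<gamma> where "holomorphic_polynomial \<gamma>" "\<And>x. x \<in> B \<Longrightarrow> norm (\<gamma> (dir_proj m e (p x))) < 1"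
    "1 < norm (\<gamma> (dir_proj m e z0))"
proof -
  define L where "L w = \<Lambda> *v dir_proj m e w" for w
  let ?\<pi> = "coord_proj J"
  have \<pi>d: "?\<pi> (x - y) = ?\<pi> x - ?\<pi> y" for x y by (rule linear_diff[OF linear_coord_proj])
  have pJ: "p (?\<pi> x) = p x" for x using tr unfolding tr_map_def by blast
  have Ldiff: "L (z - w) = L z - L w" for z w unfolding L_def dir_proj_diff by (rule matrix_vector_mult_diff_distrib)
  have LJ: "L w $ i = 0" if "i \<notin> J" for w i unfolding L_def by (rule \<Lambda>J[OF that])
  \<comment> \<open>The constant 1/5 is the sum of the error 1/10 of \<open>\<Lambda>\<close> and of
    the 1/10 allowed for the component removed along \<open>e\<close>.\<close>
  have Ltr: "norm (L (p x - p y) - cvec (?\<pi> (x - y))) \<le> (1/5) * norm (?\<pi> (x - y))" for x y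
  proof -
    let ?w = "p x - p y" and ?D = "norm (?\<pi> (x - y))"
    have "L ?w = \<Lambda> *v ?w - (?w $ m / e $ m) *s (\<Lambda> *v e)"
      unfolding L_def dir_proj_def by (simp add: matrix_vector_mult_diff_distrib vector_scalar_commute)
    then have "L ?w - cvec (?\<pi> (x - y)) = (\<Lambda> *v ?w - cvec (?\<pi> (x - y))) - (?w $ m / e $ m) *s (\<Lambda> *v e)" by simp
    then have "norm (L ?w - cvec (?\<pi> (x - y))) \<le> norm (\<Lambda> *v ?w - cvec (?\<pi> (x - y))) + norm (?w $ m / e $ m) * norm (\<Lambda> *v e)"
      by (metis norm_triangle_ineq4 norm_smult)
    moreover have "norm (\<Lambda> *v ?w - cvec (?\<pi> (x - y))) \<le> (1/10) * ?D" using tr unfolding tr_map_def by blast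
    moreover have "norm (?w $ m / e $ m) * norm (\<Lambda> *v e) \<le> (1/10) * ?D"
    proof -
      have "norm (?w $ m) \<le> C * ?D"
        using tr Finite_Cartesian_Product.norm_nth_le[of ?w m] unfolding tr_map_def by (meson order_trans)
      then have "norm (?w $ m / e $ m) * norm (\<Lambda> *v e) \<le> (C * ?D / norm (e $ m)) * norm (\<Lambda> *v e)"
        unfolding norm_divide by (intro mult_right_mono divide_right_mono) auto
      also have "\<dots> = (?D / norm (e $ m)) * (C * norm (\<Lambda> *v e))" by simp
      also have "\<dots> \<le> (?D / norm (e $ m)) * (norm (e $ m) / 10)" using e by (intro mult_left_mono) auto
      also have "\<dots> = (1/10) * ?D" using e(1) by simp
      finally show ?thesis .
    qed
    ultimately show ?thesis by simp
  qed
  define V where "V = range ?\<pi>"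
  have V: "?\<pi> x = x" if "x \<in> V" for x using that unfolding V_def by auto
  \<comment> \<open>A fixed point of \<open>\<tau>\<close> is a parameter at which
    \<open>L (z0 - p y)\<close> is purely imaginary; \<open>\<tau>\<close> is a contraction because
    \<open>L\<close> followed by the real part nearly inverts \<open>p\<close>.\<close>
  define \<tau> where "\<tau> y = y + Re_vec (L (z0 - p y))" for y
  have "\<exists>!y. y \<in> V \<and> \<tau> y = y"
  proof (rule Banach_fix[where c = "1/5"])
    have "closed V" unfolding V_def using closed_subspace subspace_UNIV linear_subspace_image[OF linear_coord_proj] by blast
    then show "complete V" by (simp add: complete_eq_closed)
    show "V \<noteq> {}" unfolding V_def by blast
    show "\<tau> ` V \<subseteq> V"
    proof safe
      fix y assume y: "y \<in> V"
      have "y $ i = 0" if "i \<notin> J" for i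
        using arg_cong[OF V[OF y], of "\<lambda>u. u $ i"] that by simp
      then have "?\<pi> (\<tau> y) = \<tau> y"
        using LJ by (simp add: vec_eq_iff \<tau>_def)
      then show "\<tau> y \<in> V" unfolding V_def by (metis rangeI)
    qed
    fix x y assume "x \<in> V" "y \<in> V"
    then have xy: "?\<pi> (x - y) = x - y" using V \<pi>d by metis
    have "\<tau> x - \<tau> y = - Re_vec (L (p x - p y) - cvec (x - y))"
      unfolding \<tau>_def by (simp add: Ldiff Re_vec_diff)
    then have "norm (\<tau> x - \<tau> y) \<le> norm (L (p x - p y) - cvec (x - y))"
      using norm_Re_vec_le by (metis norm_minus_cancel)
    also have "\<dots> \<le> (1/5) * norm (x - y)" using Ltr[of x y] unfolding xy .
    finally show "dist (\<tau> x) (\<tau> y) \<le> 1/5 * dist x y" by (simp add: dist_norm)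
  qed auto
  then obtain y where y: "y \<in> V" "\<tau> y = y" by blast
  define v where "v = z0 - p y"
  have Rev: "Re_vec (L v) = 0" using y(2) unfolding \<tau>_def v_def by simp
  define b where "b = (\<Sum>j\<in>UNIV. (Im (L v $ j))\<^sup>2)"
  have qv: "qform (L v) = - complex_of_real b"
  proof -
    have "(L v $ j)\<^sup>2 = - complex_of_real ((Im (L v $ j))\<^sup>2)" for j
    proof -
      have "Re (L v $ j) = 0" using arg_cong[OF Rev, of "\<lambda>u. u $ j"] by simp
      then show ?thesis by (simp add: complex_eq_iff power2_eq_square)
    qed
    then show ?thesis unfolding qform_def b_def by (simp add: sum_negf)
  qed
  have b: "b \<ge> 0" unfolding b_def by (simp add: sum_nonneg)
  define D where "D x = (norm (?\<pi> (x - y)))\<^sup>2" for x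
  have contD: "continuous_on S D" for S
  proof -
    have "continuous_on S (\<lambda>x. ?\<pi> (x - y))"
      by (rule bounded_linear.continuous_on[OF bounded_linear_coord_proj]) (intro continuous_intros)
    then show ?thesis unfolding D_def by (intro continuous_on_power continuous_on_norm)
  qed
  obtain D0 where D0: "D0 > 0" "\<And>x. x \<in> B \<Longrightarrow> D x \<le> D0"
    using compact_bound_pos[OF B contD] unfolding real_norm_def D_def by (metis abs_of_nonneg zero_le_power2)
  define M where "M = 4 * D0 + 1"
  have M: "M > 0" "4 * D0 < M" unfolding M_def using D0 by auto
  define \<gamma>1 where "\<gamma>1 w = 1 - qform (\<Lambda> *v (w - dir_proj m e (p y))) / M" for w
  have \<gamma>1L: "\<gamma>1 (dir_proj m e w) = 1 - qform (L (w - p y)) / M" for w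
    unfolding \<gamma>1_def L_def dir_proj_diff ..
  have h\<gamma>1: "holomorphic_polynomial \<gamma>1"
  proof -
    have "holomorphic_polynomial (\<lambda>w. (\<Lambda> *v w - \<Lambda> *v dir_proj m e (p y)) $ j)" for j
      using holomorphic_polynomial_diff[OF holomorphic_polynomial_matrix_nth holomorphic_polynomial_const] by simp
    then have "holomorphic_polynomial (\<lambda>w. 1 - (1 / M) * qform (\<Lambda> *v w - \<Lambda> *v dir_proj m e (p y)))"
      unfolding qform_def
      by (intro holomorphic_polynomial_diff holomorphic_polynomial_const holomorphic_polynomial_cmult
          holomorphic_polynomial_sum holomorphic_polynomial_power)
    then show ?thesis unfolding \<gamma>1_def[abs_def] by (simp add: matrix_vector_mult_diff_distrib)
  qed
  have \<gamma>1B: "norm (\<gamma>1 (dir_proj m e (p x))) \<le> sqrt (1 - D x / (2 * M))" if "x \<in> B" for x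
    unfolding \<gamma>1L
    by (rule norm_one_minus_le[OF qform_bounds[OF Ltr[of x y], folded D_def] _ D0(2)[OF that] M(2)]) (simp add: D_def)
  have \<gamma>1z: "\<gamma>1 (dir_proj m e z0) = 1 + b / M"
    unfolding \<gamma>1L v_def[symmetric] qv by simp
  have "\<exists>\<gamma> \<rho>. holomorphic_polynomial \<gamma> \<and> (\<forall>x\<in>B. norm (\<gamma> (dir_proj m e (p x))) \<le> \<rho>) \<and> 0 \<le> \<rho> \<and> \<rho> < norm (\<gamma> (dir_proj m e z0))"
  proof (cases "b = 0")
    case False
    have "norm (\<gamma>1 (dir_proj m e (p x))) \<le> 1" if "x \<in> B" for x
    proof -
      have "1 - D x / (2 * M) \<le> 1" using M unfolding D_def by simp
      then have "sqrt (1 - D x / (2 * M)) \<le> 1" by (metis real_sqrt_le_iff real_sqrt_one)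
      then show ?thesis using \<gamma>1B[OF that] by linarith
    qed
    moreover have "1 < norm (\<gamma>1 (dir_proj m e z0))"
    proof -
      have "1 + complex_of_real (b / M) = complex_of_real (1 + b / M)" by simp
      then have "norm (\<gamma>1 (dir_proj m e z0)) = \<bar>1 + b / M\<bar>"
        unfolding \<gamma>1z using norm_of_real by (metis of_real_divide)
      then show ?thesis using False b M by simp
    qed
    ultimately show ?thesis using h\<gamma>1 by (intro exI[of _ \<gamma>1] exI[of _ 1]) auto
  next
    case True
    then have \<gamma>z1: "\<gamma>1 (dir_proj m e z0) = 1" using \<gamma>1z by simp
    define r where "r s = sqrt (1 - s / (2 * M))" for s
    have r0: "0 \<le> r s" if "s \<le> D0" for s unfolding r_def using that M by (auto simp: divide_simps)
    have r1: "r s < 1" if "0 < s" for s unfolding r_def using that M by simp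
    have rm: "r s \<le> r s'" if "s' \<le> s" for s s' unfolding r_def using that M by (simp add: divide_right_mono)
    define v' where "v' = dir_proj m e v"
    show ?thesis
    proof (cases "v' = 0")
      case True
      then have "v = (v $ m / e $ m) *s e" unfolding v'_def dir_proj_def by simp
      then have yB: "?\<pi> x \<noteq> y" if "x \<in> B" for x
        using no[OF that, of "v $ m / e $ m"] pJ[of x] unfolding v_def by metis
      have "D x > 0" if "x \<in> B" for x using yB[OF that] V[OF y(1)] unfolding D_def \<pi>d by simp
      then have "\<exists>d>0. d \<le> D0 \<and> (\<forall>x\<in>B. d \<le> D x)"
      proof (cases "B = {}")
        case False
        then obtain x where "x \<in> B" "\<forall>x'\<in>B. D x \<le> D x'" using continuous_attains_inf[OF B False contD] by blast
        then show ?thesis using \<open>\<And>x. x \<in> B \<Longrightarrow> D x > 0\<close> D0 by blast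
      qed (use D0 in auto)
      then obtain d where d: "d > 0" "d \<le> D0" "\<And>x. x \<in> B \<Longrightarrow> d \<le> D x" by blast
      have "norm (\<gamma>1 (dir_proj m e (p x))) \<le> r d" if "x \<in> B" for x
        using \<gamma>1B[OF that] rm[OF d(3)[OF that]] unfolding r_def by linarith
      then show ?thesis using h\<gamma>1 \<gamma>z1 r0[OF d(2)] r1[OF d(1)] by (intro exI[of _ \<gamma>1] exI[of _ "r d"]) auto
    next
      case False
      then obtain i where i: "v' $ i \<noteq> 0" by (auto simp: vec_eq_iff)
      define K where "K = 1 + norm (e $ i / e $ m)"
      have K: "K > 0" unfolding K_def by (smt (verit) norm_ge_zero)
      have lip: "norm (dir_proj m e (p x) $ i - dir_proj m e (p y) $ i) \<le> C * K * sqrt (D x)" for x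
      proof -
        let ?w = "p x - p y"
        have "dir_proj m e (p x) $ i - dir_proj m e (p y) $ i = ?w $ i - e $ i / e $ m * ?w $ m"
          by (simp add: dir_proj_nth field_simps diff_divide_distrib)
        then have "norm (dir_proj m e (p x) $ i - dir_proj m e (p y) $ i) \<le> norm (?w $ i) + norm (e $ i / e $ m) * norm (?w $ m)"
          by (metis norm_triangle_ineq4 norm_mult)
        also have "\<dots> \<le> norm ?w + norm (e $ i / e $ m) * norm ?w"
          by (intro add_mono mult_left_mono Finite_Cartesian_Product.norm_nth_le) auto
        also have "\<dots> = K * norm ?w" unfolding K_def by (simp add: algebra_simps)
        also have "\<dots> \<le> K * (C * sqrt (D x))"
          using tr K unfolding tr_map_def D_def by (intro mult_left_mono) auto
        finally show ?thesis by (simp add: mult_ac)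
      qed
      \<comment> \<open>Where \<open>D x \<le> d\<close>, the coordinate factor alone is at most
        half of its modulus at \<open>z0\<close>; where \<open>D x > d\<close>, the power of
        \<open>\<gamma>1\<close> is small.\<close>
      define d where "d = min D0 ((norm (v' $ i) / (2 * C * K))\<^sup>2)"
      have d: "d > 0" "d \<le> D0" unfolding d_def using D0 i C K by auto
      have "(\<lambda>N. C * K * sqrt D0 * r d ^ N) \<longlonglongrightarrow> C * K * sqrt D0 * 0"
        using r0[OF d(2)] r1[OF d(1)] by (intro tendsto_mult tendsto_const LIMSEQ_realpow_zero) auto
      then have "\<forall>\<^sub>F N in sequentially. C * K * sqrt D0 * r d ^ N < norm (v' $ i) / 2"
        using i by (intro order_tendstoD(2)) auto
      then obtain N where N: "C * K * sqrt D0 * r d ^ N < norm (v' $ i) / 2"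
        by (auto simp: eventually_sequentially)
      define \<gamma> where "\<gamma> w = (w $ i - dir_proj m e (p y) $ i) * \<gamma>1 w ^ N" for w
      have "holomorphic_polynomial \<gamma>" unfolding \<gamma>_def
        by (intro holomorphic_polynomial_mult holomorphic_polynomial_diff holomorphic_polynomial_coord
            holomorphic_polynomial_const holomorphic_polynomial_power h\<gamma>1)
      moreover have "norm (\<gamma> (dir_proj m e (p x))) \<le> norm (v' $ i) / 2" if x: "x \<in> B" for x
      proof -
        have rB: "norm (\<gamma>1 (dir_proj m e (p x))) \<le> r (D x)" using \<gamma>1B[OF x] unfolding r_def .
        have "0 \<le> D x" unfolding D_def by simp
        have n\<gamma>: "norm (\<gamma> (dir_proj m e (p x))) \<le> C * K * sqrt (D x) * r (D x) ^ N"
          unfolding \<gamma>_def norm_mult norm_power using lip[of x] rB C K \<open>0 \<le> D x\<close>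
          by (intro mult_mono power_mono) auto
        show ?thesis
        proof (cases "D x \<le> d")
          case True
          have "r (D x) ^ N \<le> 1" using r0[OF D0(2)[OF x]] M \<open>0 \<le> D x\<close> unfolding r_def by (intro power_le_one) auto
          moreover have "sqrt (D x) \<le> norm (v' $ i) / (2 * C * K)"
            using True C K unfolding d_def by (intro real_le_lsqrt) auto
          ultimately have "C * K * sqrt (D x) * r (D x) ^ N \<le> C * K * (norm (v' $ i) / (2 * C * K)) * 1"
            using C K \<open>0 \<le> D x\<close> r0[OF D0(2)[OF x]] by (intro mult_mono mult_left_mono) auto
          then show ?thesis using n\<gamma> C K by simp
        next
          case False
          then have "C * K * sqrt (D x) * r (D x) ^ N \<le> C * K * sqrt D0 * r d ^ N"
            using C K D0(2)[OF x] r0[OF D0(2)[OF x]] rm[of d "D x"] D0(1)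
            by (intro mult_mono power_mono mult_left_mono) auto
          then show ?thesis using n\<gamma> N by linarith
        qed
      qed
      moreover have "norm (\<gamma> (dir_proj m e z0)) = norm (v' $ i)"
        unfolding \<gamma>_def \<gamma>z1 v'_def v_def dir_proj_diff by simp
      ultimately show ?thesis using i by (intro exI[of _ \<gamma>] exI[of _ "norm (v' $ i) / 2"]) auto
    qed
  qed
  then obtain \<gamma> \<rho> where \<gamma>: "holomorphic_polynomial \<gamma>" "\<And>x. x \<in> B \<Longrightarrow> norm (\<gamma> (dir_proj m e (p x))) \<le> \<rho>"
    "0 \<le> \<rho>" "\<rho> < norm (\<gamma> (dir_proj m e z0))" by blast
  obtain \<sigma> where \<sigma>: "\<rho> < \<sigma>" "\<sigma> < norm (\<gamma> (dir_proj m e z0))" using dense[OF \<gamma>(4)] by blast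
  have \<sigma>0: "\<sigma> > 0" using \<gamma>(3) \<sigma>(1) by linarith
  have n: "norm (complex_of_real (1 / \<sigma>) * w) = norm w / \<sigma>" for w
    using \<sigma>0 by (simp add: norm_mult norm_divide)
  show ?thesis
  proof (rule that[of "\<lambda>w. complex_of_real (1 / \<sigma>) * \<gamma> w"])
    show "holomorphic_polynomial (\<lambda>w. complex_of_real (1 / \<sigma>) * \<gamma> w)" by (rule holomorphic_polynomial_cmult[OF \<gamma>(1)])
    show "norm (complex_of_real (1 / \<sigma>) * \<gamma> (dir_proj m e (p x))) < 1" if "x \<in> B" for x
      unfolding n using \<gamma>(2)[OF that] \<sigma> \<sigma>0 by (simp add: divide_simps)
    show "1 < norm (complex_of_real (1 / \<sigma>) * \<gamma> (dir_proj m e z0))"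
      unfolding n using \<sigma> \<sigma>0 by (simp add: divide_simps)
  qed
qed

text \<open>If the direction \<open>e\<^sub>0\<close> fails because the line through \<open>z0\<close> meets the graph, tilt it by \<open>\<i> \<nu>\<close>, where \<open>\<nu>\<close>
  is nearly tangent: a second intersection would contradict that the graph is totally real.\<close>
theorem separation_from_graph:
  fixes p :: "real ^ 'n::finite \<Rightarrow> complex ^ 'n"
  assumes tr: "tr_map \<Lambda> J (1/10) C p" and fr: "tr_frame \<Lambda> J m e\<^sub>0 \<nu> j" and C: "C > 0"
    and B: "compact B" and z0: "z0 \<notin> p ` B"
  obtains e \<gamma> where "e $ m \<noteq> 0" "holomorphic_polynomial \<gamma>"
    "\<And>x. x \<in> B \<Longrightarrow> norm (\<gamma> (dir_proj m e (p x))) < 1" "1 < norm (\<gamma> (dir_proj m e z0))"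
proof (cases "\<exists>y t. y \<in> B \<and> z0 - p y = t *s e\<^sub>0")
  case False
  obtain \<gamma> where "holomorphic_polynomial \<gamma>" "\<And>x. x \<in> B \<Longrightarrow> norm (\<gamma> (dir_proj m e\<^sub>0 (p x))) < 1"
    "1 < norm (\<gamma> (dir_proj m e\<^sub>0 z0))"
    by (rule separation_in_direction[OF tr, of e\<^sub>0 m B z0]) (use fr C B False in \<open>auto simp: tr_frame_def\<close>)
  then show ?thesis using that fr unfolding tr_frame_def by blast
next
  case True
  then obtain y\<^sub>0 t\<^sub>0 where y0: "y\<^sub>0 \<in> B" "z0 - p y\<^sub>0 = t\<^sub>0 *s e\<^sub>0" by blast
  have e0: "norm e\<^sub>0 > 0" "norm (e\<^sub>0 $ m) > 0" "\<Lambda> *v e\<^sub>0 = 0" "\<Lambda> *v \<nu> = axis j 1" "j \<in> J"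
    using fr unfolding tr_frame_def by auto
  have t0: "t\<^sub>0 \<noteq> 0" using y0 z0 by auto
  \<comment> \<open>The bounds after 1 ensure, in this order, that the tilt at most halves
    \<open>e $ m\<close>, that \<open>\<Lambda> *v e\<close> is small enough for the projection
    estimate, and that a second intersection would have its parameter near
    \<open>t\<^sub>0\<close>.\<close>
  define s where "s = Min {1, norm t\<^sub>0 * norm (e\<^sub>0 $ m) / (2 * (norm (\<nu> $ m) + 1)),
     norm t\<^sub>0 * norm (e\<^sub>0 $ m) / (20 * C), norm t\<^sub>0 * norm e\<^sub>0 / (2 * (2 * C + norm \<nu> + 1))}"
  have \<nu>pos: "norm (\<nu> $ m) + 1 > 0" "2 * C + norm \<nu> + 1 > 0" using C by (smt (verit) norm_ge_zero)+
  have s: "s > 0" "s \<le> norm t\<^sub>0 * norm (e\<^sub>0 $ m) / (2 * (norm (\<nu> $ m) + 1))"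
    "s \<le> norm t\<^sub>0 * norm (e\<^sub>0 $ m) / (20 * C)" "s \<le> norm t\<^sub>0 * norm e\<^sub>0 / (2 * (2 * C + norm \<nu> + 1))"
    unfolding s_def using e0 t0 C \<nu>pos by auto
  define a where "a = \<i> * s / t\<^sub>0"
  have na: "norm a = s / norm t\<^sub>0" unfolding a_def using s by (simp add: norm_mult norm_divide)
  define e where "e = e\<^sub>0 + a *s \<nu>"
  have em: "norm (e $ m) \<ge> norm (e\<^sub>0 $ m) / 2"
  proof -
    have "norm (a * \<nu> $ m) \<le> norm a * (norm (\<nu> $ m) + 1)" unfolding norm_mult by (intro mult_left_mono) auto
    also have "\<dots> \<le> norm (e\<^sub>0 $ m) / 2" using s(2) \<nu>pos t0 unfolding na by (simp add: field_simps)
    finally show ?thesis using norm_triangle_ineq2[of "e\<^sub>0 $ m" "- (a * \<nu> $ m)"] unfolding e_def by simp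
  qed
  have \<Lambda>e: "\<Lambda> *v e = a *s axis j 1"
    unfolding e_def using e0 by (simp add: matrix_vector_right_distrib vector_scalar_commute)
  have "norm (axis j 1 :: complex ^ 'n) = 1" by simp
  then have n\<Lambda>e: "norm (\<Lambda> *v e) = norm a" unfolding \<Lambda>e norm_smult by simp
  have cond: "C * norm (\<Lambda> *v e) \<le> norm (e $ m) / 10"
  proof -
    have "C * norm a \<le> norm (e\<^sub>0 $ m) / 20" using s(3) C t0 unfolding na by (simp add: field_simps)
    then show ?thesis using em unfolding n\<Lambda>e by linarith
  qed
  have no: "z0 - p y \<noteq> t *s e" if y: "y \<in> B" for y t
  proof
    assume eq: "z0 - p y = t *s e"
    \<comment> \<open>The contradiction: \<open>\<Lambda> *v (p y - p y\<^sub>0)\<close> is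
      \<open>- \<i> * s * \<tau>\<close> times a basis vector and also nearly real, so
      \<open>\<tau>\<close> is nearly imaginary; the smallness of \<open>s\<close> puts
      \<open>\<tau>\<close> near 1.\<close>
    define \<tau> where "\<tau> = t / t\<^sub>0"
    let ?\<Delta> = "coord_proj J (y - y\<^sub>0)"
    have ta: "t * a = \<i> * s * \<tau>" unfolding a_def \<tau>_def by simp
    have pd: "p y - p y\<^sub>0 = (t\<^sub>0 * (1 - \<tau>)) *s e\<^sub>0 - (\<i> * s * \<tau>) *s \<nu>"
    proof -
      have "p y - p y\<^sub>0 = t\<^sub>0 *s e\<^sub>0 - t *s e" unfolding y0(2)[symmetric] eq[symmetric] by simp
      also have "\<dots> = (t\<^sub>0 - t) *s e\<^sub>0 - (t * a) *s \<nu>" unfolding e_def by (simp add: vec_eq_iff algebra_simps)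
      also have "t\<^sub>0 - t = t\<^sub>0 * (1 - \<tau>)" unfolding \<tau>_def using t0 by (simp add: algebra_simps)
      finally show ?thesis unfolding ta .
    qed
    have \<Lambda>pd: "\<Lambda> *v (p y - p y\<^sub>0) = (- \<i> * s * \<tau>) *s axis j 1"
      unfolding pd matrix_vector_mult_diff_distrib vector_scalar_commute e0(3,4) by (simp add: vec_eq_iff)
    have tr1: "norm (\<Lambda> *v (p y - p y\<^sub>0) - cvec ?\<Delta>) \<le> (1/10) * norm ?\<Delta>" using tr unfolding tr_map_def by blast
    have n1: "norm (\<Lambda> *v (p y - p y\<^sub>0)) = s * norm \<tau>" unfolding \<Lambda>pd norm_smult using s(1) by (simp add: norm_mult)
    have "norm (cvec ?\<Delta>) \<le> norm (\<Lambda> *v (p y - p y\<^sub>0)) + norm (\<Lambda> *v (p y - p y\<^sub>0) - cvec ?\<Delta>)"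
      using norm_triangle_ineq4[of "\<Lambda> *v (p y - p y\<^sub>0)" "\<Lambda> *v (p y - p y\<^sub>0) - cvec ?\<Delta>"] by simp
    then have \<Delta>: "norm ?\<Delta> \<le> (10/9) * (s * norm \<tau>)" using tr1 n1 by simp
    have "(\<Lambda> *v (p y - p y\<^sub>0) - cvec ?\<Delta>) $ j = - \<i> * s * \<tau> - complex_of_real (?\<Delta> $ j)" unfolding \<Lambda>pd by simp
    then have "norm (- \<i> * s * \<tau> - complex_of_real (?\<Delta> $ j)) \<le> (1/10) * norm ?\<Delta>"
      using tr1 Finite_Cartesian_Product.norm_nth_le[of "\<Lambda> *v (p y - p y\<^sub>0) - cvec ?\<Delta>" j] by simp
    then have "\<bar>Im (- \<i> * s * \<tau> - complex_of_real (?\<Delta> $ j))\<bar> \<le> (1/10) * norm ?\<Delta>"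
      using abs_Im_le_cmod order_trans by blast
    then have "s * \<bar>Re \<tau>\<bar> \<le> (1/10) * norm ?\<Delta>" using s(1) by (simp add: abs_mult)
    then have "s * \<bar>Re \<tau>\<bar> \<le> s * ((1/9) * norm \<tau>)" using \<Delta> by simp
    then have Re: "\<bar>Re \<tau>\<bar> \<le> (1/9) * norm \<tau>" using s(1) by simp
    have "norm ((t\<^sub>0 * (1 - \<tau>)) *s e\<^sub>0) \<le> norm (p y - p y\<^sub>0) + norm ((\<i> * s * \<tau>) *s \<nu>)"
      using norm_triangle_ineq[of "p y - p y\<^sub>0" "(\<i> * s * \<tau>) *s \<nu>"] unfolding pd by simp
    also have "\<dots> \<le> C * norm ?\<Delta> + s * norm \<tau> * norm \<nu>"
      using tr s(1) unfolding tr_map_def by (intro add_mono) (auto simp: norm_smult norm_mult)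
    also have "\<dots> \<le> C * ((10/9) * (s * norm \<tau>)) + s * norm \<tau> * norm \<nu>" using \<Delta> C by (intro add_right_mono mult_left_mono) auto
    also have "\<dots> \<le> s * (2 * C + norm \<nu> + 1) * norm \<tau>" using s(1) C by (simp add: algebra_simps)
    also have "\<dots> \<le> (norm t\<^sub>0 * norm e\<^sub>0 / 2) * norm \<tau>"
      using s(4) \<nu>pos(2) by (intro mult_right_mono) (auto simp: field_simps)
    finally have "(norm t\<^sub>0 * norm e\<^sub>0) * norm (1 - \<tau>) \<le> (norm t\<^sub>0 * norm e\<^sub>0) * (norm \<tau> / 2)"
      by (simp add: norm_smult norm_mult mult_ac)
    then have "norm (1 - \<tau>) \<le> norm \<tau> / 2" using t0 e0(1) by (subst (asm) mult_le_cancel_left_pos) auto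
    then have "(norm (1 - \<tau>))\<^sup>2 \<le> (norm \<tau> / 2)\<^sup>2" by (intro power_mono) auto
    moreover have "(norm (1 - \<tau>))\<^sup>2 = 1 - 2 * Re \<tau> + (norm \<tau>)\<^sup>2"
      unfolding cmod_power2 by (simp add: power2_eq_square algebra_simps)
    moreover have "(norm \<tau> / 2)\<^sup>2 = (norm \<tau>)\<^sup>2 / 4" by (simp add: power_divide)
    ultimately have "1 - 2 * Re \<tau> + (norm \<tau>)\<^sup>2 \<le> (norm \<tau>)\<^sup>2 / 4" by linarith
    then have "1 + (3/4) * (norm \<tau>)\<^sup>2 \<le> 2 * ((1/9) * norm \<tau>)" using Re by linarith
    moreover have "0 \<le> (norm \<tau>)\<^sup>2 - 2 * norm \<tau> + 1"
      using zero_le_power2[of "norm \<tau> - 1"] by (simp add: power2_diff)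
    ultimately show False using norm_ge_zero[of \<tau>] by linarith
  qed
  obtain \<gamma> where "holomorphic_polynomial \<gamma>" "\<And>x. x \<in> B \<Longrightarrow> norm (\<gamma> (dir_proj m e (p x))) < 1"
    "1 < norm (\<gamma> (dir_proj m e z0))"
    by (rule separation_in_direction[OF tr _ _ cond C B no]) (use fr em e0 in \<open>auto simp: tr_frame_def\<close>)
  moreover have "e $ m \<noteq> 0" using em e0(2) by auto
  ultimately show ?thesis using that by blast
qed

section \<open>Perturbing finitely many cells\<close>

definition nbd :: "real \<Rightarrow> 'a::metric_space set \<Rightarrow> 'a set" where
  "nbd \<delta> Y = (\<Union>w\<in>Y. ball w \<delta>)"

lemma mem_nbd: "z \<in> nbd \<delta> Y \<longleftrightarrow> (\<exists>w\<in>Y. dist w z < \<delta>)"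
  by (auto simp: nbd_def)

lemma open_nbd: "open (nbd \<delta> Y)"
  by (auto simp: nbd_def)

lemma nbd_Un: "nbd \<delta> (X \<union> Y) = nbd \<delta> X \<union> nbd \<delta> Y"
  by (auto simp: nbd_def)

lemma subset_nbd: "\<delta> > 0 \<Longrightarrow> Y \<subseteq> nbd \<delta> Y"
  by (auto simp: nbd_def)

lemma nbd_trans:
  assumes "X \<subseteq> nbd \<alpha> Y" "Y \<subseteq> nbd \<beta> Z" "\<alpha> + \<beta> \<le> \<gamma>"
  shows "X \<subseteq> nbd \<gamma> Z"
proof
  fix x assume "x \<in> X"
  then have "x \<in> nbd \<alpha> Y" using assms(1) by blast
  then obtain y where y: "y \<in> Y" "dist y x < \<alpha>" unfolding mem_nbd by blast
  then have "y \<in> nbd \<beta> Z" using assms(2) by blast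
  then obtain z where z: "z \<in> Z" "dist z y < \<beta>" unfolding mem_nbd by blast
  have "dist z x < \<gamma>" using dist_triangle[of z x y] y z assms(3) by simp
  then show "x \<in> nbd \<gamma> Z" using z by (auto simp: mem_nbd)
qed

lemma compact_image_smooth:
  assumes "smooth_on UNIV f" "compact B" shows "compact (f ` B)"
  using smooth_on_imp_continuous_on[OF assms(1)] assms(2)
  by (intro compact_continuous_image) (auto intro: continuous_on_subset)

text \<open>The points to be expelled from the hull form a compact set. Finitely many balls cover
  it, each with its own direction and separating polynomial, and one shear is made per ball, small
  enough not to spoil the earlier ones.\<close>

lemma cell_hull:
  fixes p\<^sub>0 :: "real ^ 'n::finite \<Rightarrow> complex ^ 'n"
  assumes P: "compact P" "polynomially_convex P" and p\<^sub>0: "smooth_on UNIV p\<^sub>0" "tr_map \<Lambda> J (1/10) C p\<^sub>0"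
    and fr: "tr_frame \<Lambda> J m e \<nu> j" and J: "J \<noteq> UNIV" and C: "C > 0" and B: "compact B"
    and \<epsilon>: "\<epsilon> > 0" and \<delta>: "\<delta> > 0"
  obtains c where "smooth_on UNIV c" "Cbd k B \<epsilon> c"
    "polynomial_hull (P \<union> (\<lambda>x. p\<^sub>0 x + c x) ` B) \<subseteq> nbd \<delta> (P \<union> p\<^sub>0 ` B)"
proof -
  have pJ: "p\<^sub>0 (coord_proj J x) = p\<^sub>0 x" for x using p\<^sub>0(2) unfolding tr_map_def by blast
  have p0B: "compact (p\<^sub>0 ` B)" by (rule compact_image_smooth[OF p\<^sub>0(1) B])
  obtain R where R: "\<And>z. z \<in> P \<union> p\<^sub>0 ` B \<Longrightarrow> norm z \<le> R"
    using compact_imp_bounded[OF compact_Un[OF P(1) p0B]] bounded_iff by metis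
  \<comment> \<open>The hull of a perturbed set stays in the polydisc of radius \<open>R + 1\<close>
    as long as the perturbation is at most 1, so only these points need to be expelled.\<close>
  define W where "W = {z :: complex ^ 'n. \<forall>i. norm (z $ i) \<le> R + 1} - nbd \<delta> (P \<union> p\<^sub>0 ` B)"
  have cl: "closed {z :: complex ^ 'n. \<forall>i. norm (z $ i) \<le> R + 1}"
    by (intro closed_Collect_all closed_Collect_le continuous_intros)
  have "bounded {z :: complex ^ 'n. \<forall>i. norm (z $ i) \<le> R + 1}"
    unfolding bounded_iff using norm_vec_le_coords by blast
  then have compW: "compact W"
    unfolding W_def using cl open_nbd by (intro compact_diff) (auto simp: compact_eq_bounded_closed)
  \<comment> \<open>The margin \<open>\<tau>\<close> lets the separating polynomial chosen for the
    unperturbed cell remain valid after the shears made for other balls.\<close>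
  define good where "good z r \<tau> e \<gamma> \<longleftrightarrow> r > 0 \<and> \<tau> > 0 \<and> cball z r \<inter> P = {} \<and> e $ m \<noteq> 0 \<and> holomorphic_polynomial \<gamma> \<and>
     (\<forall>w\<in>cball z r. 1 < norm (\<gamma> (dir_proj m e w))) \<and>
     (\<forall>x\<in>B. \<forall>w. dist (p\<^sub>0 x) w < \<tau> \<longrightarrow> norm (\<gamma> (dir_proj m e w)) < 1)" for z r \<tau> e \<gamma>
  have ex: "\<exists>r \<tau> e \<gamma>. good z r \<tau> e \<gamma>" if z: "z \<in> W" for z
  proof -
    have zn: "z \<notin> P" "z \<notin> p\<^sub>0 ` B" using z subset_nbd[OF \<delta>, of "P \<union> p\<^sub>0 ` B"] unfolding W_def by auto
    obtain e \<gamma> where e: "e $ m \<noteq> 0" "holomorphic_polynomial \<gamma>"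
      "\<And>x. x \<in> B \<Longrightarrow> norm (\<gamma> (dir_proj m e (p\<^sub>0 x))) < 1" "1 < norm (\<gamma> (dir_proj m e z))"
      by (rule separation_from_graph[OF p\<^sub>0(2) fr C B zn(2)]) blast
    have cont: "continuous_on UNIV (\<lambda>w. norm (\<gamma> (dir_proj m e w)))"
      by (intro continuous_on_norm continuous_on_holomorphic_polynomial holomorphic_polynomial_dir_proj e(2))
    have "open ({w. 1 < norm (\<gamma> (dir_proj m e w))} - P)"
      using cont by (intro open_Diff open_Collect_less compact_imp_closed P(1)) auto
    moreover have "z \<in> {w. 1 < norm (\<gamma> (dir_proj m e w))} - P" using e(4) zn by auto
    ultimately obtain r where r: "r > 0" "cball z r \<subseteq> {w. 1 < norm (\<gamma> (dir_proj m e w))} - P"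
      by (meson open_contains_cball)
    have op: "open {w. norm (\<gamma> (dir_proj m e w)) < 1}" using cont by (intro open_Collect_less) auto
    have "p\<^sub>0 ` B \<subseteq> {w. norm (\<gamma> (dir_proj m e w)) < 1}" using e(3) by auto
    from compact_subset_open_margin[OF p0B op this]
    obtain \<tau> where "\<tau> > 0" "\<And>x y. x \<in> p\<^sub>0 ` B \<Longrightarrow> dist x y < \<tau> \<Longrightarrow> y \<in> {w. norm (\<gamma> (dir_proj m e w)) < 1}" by metis
    then have "good z r \<tau> e \<gamma>" unfolding good_def using r e by auto
    then show ?thesis by blast
  qed
  then obtain r \<tau> E \<Gamma> where good: "\<And>z. z \<in> W \<Longrightarrow> good z (r z) (\<tau> z) (E z) (\<Gamma> z)" by metis
  have "\<exists>F. F \<subseteq> W \<and> finite F \<and> W \<subseteq> (\<Union>z\<in>F. ball z (r z))"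
    by (rule compactE_image[OF compW, of W "\<lambda>z. ball z (r z)"]) (use good in \<open>auto simp: good_def\<close>)
  then obtain F where F: "F \<subseteq> W" "finite F" "W \<subseteq> (\<Union>z\<in>F. ball z (r z))" by blast
  \<comment> \<open>Quantified over all \<open>\<epsilon>\<close>, so that the corrections for the
    earlier balls can be demanded to stay within the margin \<open>\<tau> z\<close> of the ball
    added next.\<close>
  have "\<forall>\<epsilon>>0. \<exists>c. smooth_on UNIV c \<and> (\<forall>x. c (coord_proj J x) = c x) \<and> Cbd k B \<epsilon> c \<and>
     polynomial_hull (P \<union> (\<lambda>x. p\<^sub>0 x + c x) ` B) \<inter> (\<Union>z\<in>F. cball z (r z)) = {}"
    using F(2,1)
  proof (induction F rule: finite_induct)
    case empty
    show ?case
      by (intro allI impI exI[of _ "\<lambda>x. 0"]) (auto intro: smooth_on_const Cbd_zero)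
  next
    case (insert z F)
    show ?case
    proof (intro allI impI)
      fix \<epsilon> :: real assume \<epsilon>: "\<epsilon> > 0"
      have gz: "good z (r z) (\<tau> z) (E z) (\<Gamma> z)" using good insert.prems by auto
      then have "min (\<epsilon> / 2) (\<tau> z / 2) > 0" using \<epsilon> unfolding good_def by auto
      then obtain c1 where c1: "smooth_on UNIV c1" "\<And>x. c1 (coord_proj J x) = c1 x" "Cbd k B (min (\<epsilon> / 2) (\<tau> z / 2)) c1"
        "polynomial_hull (P \<union> (\<lambda>x. p\<^sub>0 x + c1 x) ` B) \<inter> (\<Union>z\<in>F. cball z (r z)) = {}"
        using insert by (meson insert_subset)
      define p\<^sub>1 where "p\<^sub>1 x = p\<^sub>0 x + c1 x" for x
      have p1: "smooth_on UNIV p\<^sub>1" unfolding p\<^sub>1_def[abs_def] by (rule smooth_on_add[OF open_UNIV p\<^sub>0(1) c1(1)])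
      have p1J: "p\<^sub>1 (coord_proj J x) = p\<^sub>1 x" for x unfolding p\<^sub>1_def pJ c1(2) ..
      have X: "compact (P \<union> p\<^sub>1 ` B)" by (intro compact_Un P(1) compact_image_smooth p1 B)
      have av: "polynomial_hull (P \<union> p\<^sub>1 ` B) \<inter> (\<Union>z\<in>F. cball z (r z)) = {}" using c1(4) unfolding p\<^sub>1_def .
      have clF: "closed (\<Union>z\<in>F. cball z (r z))" using insert by auto
      obtain \<delta>' where \<delta>': "\<delta>' > 0" "\<And>X'. compact X' \<Longrightarrow> (\<And>y. y \<in> X' \<Longrightarrow> \<exists>x\<in>P \<union> p\<^sub>1 ` B. dist x y < \<delta>')
        \<Longrightarrow> polynomial_hull X' \<inter> (\<Union>z\<in>F. cball z (r z)) = {}"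
        by (rule polynomial_hull_avoids_stable[OF X clF av], rule that, assumption, blast)
      have sep1: "norm (\<Gamma> z (dir_proj m (E z) (p\<^sub>1 x))) < 1" if "x \<in> B" for x
      proof -
        have "norm (c1 x) \<le> \<tau> z / 2" using Cbd_norm_le[OF c1(3) that] by simp
        then have "dist (p\<^sub>0 x) (p\<^sub>1 x) < \<tau> z" using gz unfolding p\<^sub>1_def good_def by (simp add: dist_norm)
        then show ?thesis using gz that unfolding good_def by blast
      qed
      have sep2: "1 < norm (\<Gamma> z (dir_proj m (E z) w))" if "w \<in> cball z (r z)" for w
        using gz that unfolding good_def by blast
      have em: "E z $ m \<noteq> 0" "holomorphic_polynomial (\<Gamma> z)" "cball z (r z) \<inter> P = {}" using gz unfolding good_def by auto
      have pos: "min (\<epsilon> / 2) (\<delta>' / 2) > 0" using \<epsilon> \<delta>' by simp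
      obtain c2 where c2: "smooth_on UNIV c2" "\<And>x. c2 (coord_proj J x) = c2 x" "Cbd k B (min (\<epsilon> / 2) (\<delta>' / 2)) c2"
        "polynomial_hull (P \<union> (\<lambda>x. p\<^sub>1 x + c2 x) ` B) \<inter> cball z (r z) = {}"
        by (rule hull_avoiding_perturbation[OF P compact_cball em(3) p1 p1J J B em(1,2) sep1 sep2 pos], assumption, assumption, rule that)
      let ?c = "\<lambda>x. c1 x + c2 x"
      have sm: "smooth_on UNIV ?c" by (rule smooth_on_add[OF open_UNIV c1(1) c2(1)])
      have im: "(\<lambda>x. p\<^sub>0 x + ?c x) ` B = (\<lambda>x. p\<^sub>1 x + c2 x) ` B" unfolding p\<^sub>1_def by (simp add: add.assoc)
      have "Cbd k B \<epsilon> ?c"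
        by (rule Cbd_mono[OF Cbd_add[OF open_UNIV subset_UNIV c1(1) c2(1) c1(3) c2(3)]]) auto
      moreover have "polynomial_hull (P \<union> (\<lambda>x. p\<^sub>1 x + c2 x) ` B) \<inter> (\<Union>z\<in>F. cball z (r z)) = {}"
      proof (rule \<delta>'(2))
        show "compact (P \<union> (\<lambda>x. p\<^sub>1 x + c2 x) ` B)"
          by (intro compact_Un P(1) compact_image_smooth smooth_on_add open_UNIV p1 c2(1) B)
        fix y assume "y \<in> P \<union> (\<lambda>x. p\<^sub>1 x + c2 x) ` B"
        then show "\<exists>x\<in>P \<union> p\<^sub>1 ` B. dist x y < \<delta>'"
        proof
          assume "y \<in> P" then show ?thesis using \<delta>'(1) by (intro bexI[of _ y]) auto
        next
          assume "y \<in> (\<lambda>x. p\<^sub>1 x + c2 x) ` B"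
          then obtain x where x: "x \<in> B" "y = p\<^sub>1 x + c2 x" by blast
          have "norm (c2 x) \<le> \<delta>' / 2" using Cbd_norm_le[OF c2(3) x(1)] by simp
          then have "dist (p\<^sub>1 x) y < \<delta>'" using x(2) \<delta>'(1) by (simp add: dist_norm)
          then show ?thesis using x(1) by blast
        qed
      qed
      ultimately show "\<exists>c. smooth_on UNIV c \<and> (\<forall>x. c (coord_proj J x) = c x) \<and> Cbd k B \<epsilon> c \<and>
        polynomial_hull (P \<union> (\<lambda>x. p\<^sub>0 x + c x) ` B) \<inter> (\<Union>z\<in>insert z F. cball z (r z)) = {}"
        using sm c1(2) c2(2) c2(4) im by (intro exI[of _ ?c]) auto
    qed
  qed
  \<comment> \<open>The bound 1 keeps the perturbed cell in the polydisc used for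
    \<open>W\<close>.\<close>
  moreover have "min \<epsilon> 1 > 0" using \<epsilon> by simp
  ultimately obtain c where c: "smooth_on UNIV c" "Cbd k B (min \<epsilon> 1) c"
    "polynomial_hull (P \<union> (\<lambda>x. p\<^sub>0 x + c x) ` B) \<inter> (\<Union>z\<in>F. cball z (r z)) = {}" by meson
  have "polynomial_hull (P \<union> (\<lambda>x. p\<^sub>0 x + c x) ` B) \<subseteq> nbd \<delta> (P \<union> p\<^sub>0 ` B)"
  proof
    fix z assume z: "z \<in> polynomial_hull (P \<union> (\<lambda>x. p\<^sub>0 x + c x) ` B)"
    have nR: "norm (w $ i) \<le> R + 1" if w: "w \<in> P \<union> (\<lambda>x. p\<^sub>0 x + c x) ` B" for w i
    proof -
      have "norm w \<le> R + 1"
        using w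
      proof
        assume "w \<in> P" then show ?thesis using R[of w] by simp
      next
        assume "w \<in> (\<lambda>x. p\<^sub>0 x + c x) ` B"
        then obtain x where x: "x \<in> B" "w = p\<^sub>0 x + c x" by blast
        then show ?thesis using R[of "p\<^sub>0 x"] Cbd_norm_le[OF c(2) x(1)] norm_triangle_ineq[of "p\<^sub>0 x" "c x"] by simp
      qed
      then show ?thesis using Finite_Cartesian_Product.norm_nth_le[of w i] by simp
    qed
    have "norm (z $ i) \<le> R + 1" for i by (rule polynomial_hull_coords[OF nR z])
    moreover have "z \<notin> W" using z c(3) F(3) ball_subset_cball by blast
    ultimately show "z \<in> nbd \<delta> (P \<union> p\<^sub>0 ` B)" unfolding W_def by blast
  qed
  then show ?thesis using that c(1) Cbd_mono[OF c(2)] by simp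
qed

text \<open>The linear map \<open>r\<close> recovers the parameter on \<open>T\<close>, so functions
  of the parameter extend to the ambient space by composition with \<open>r\<close>. The last
  condition is the tolerance of the cell: adding a map of Lipschitz constant \<open>\<kappa>\<close>
  raises the error from 1/20 to at most 1/10.\<close>

definition is_cell :: "real \<Rightarrow> (complex ^ 'n::finite) set \<Rightarrow> bool" where
  "is_cell \<kappa> T \<longleftrightarrow> (\<exists>\<Lambda> J m e \<nu> j s r C L. compact T \<and> J \<noteq> UNIV \<and> tr_frame \<Lambda> J m e \<nu> j \<and> smooth_on UNIV s \<and>
     tr_map \<Lambda> J (1/20) C s \<and> C > 0 \<and> bounded_linear (r :: complex ^ 'n \<Rightarrow> real ^ 'n) \<and> (\<forall>z\<in>T. s (r z) = z) \<and>
     (\<forall>z. norm (\<Lambda> *v z) \<le> L * norm z) \<and> 0 \<le> L \<and> 0 \<le> \<kappa> \<and> \<kappa> * L * C \<le> 1/20)"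

lemma tr_map_perturb:
  assumes s: "tr_map \<Lambda> J (1/20) C s" "C > 0" and L: "\<And>z. norm (\<Lambda> *v z) \<le> L * norm z" "0 \<le> L" "0 \<le> \<kappa>" "\<kappa> * L * C \<le> 1/20"
    and G: "\<And>x y. norm (G x - G y) \<le> \<kappa> * norm (x - y)"
  shows "tr_map \<Lambda> J (1/10) (C + \<kappa> * C) (\<lambda>x. s x + G (s x))"
  unfolding tr_map_def
proof (intro conjI allI)
  fix x y
  let ?D = "norm (coord_proj J (x - y))"
  show "s (coord_proj J x) + G (s (coord_proj J x)) = s x + G (s x)" using s(1) unfolding tr_map_def by simp
  have sxy: "norm (s x - s y) \<le> C * ?D" using s(1) unfolding tr_map_def by blast
  have Gxy: "norm (G (s x) - G (s y)) \<le> \<kappa> * (C * ?D)"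
    using order_trans[OF G mult_left_mono[OF sxy L(3)]] .
  have eq: "s x + G (s x) - (s y + G (s y)) = (s x - s y) + (G (s x) - G (s y))" by simp
  show "norm (s x + G (s x) - (s y + G (s y))) \<le> (C + \<kappa> * C) * ?D"
    unfolding eq using norm_triangle_ineq[of "s x - s y" "G (s x) - G (s y)"] sxy Gxy by (simp add: algebra_simps)
  have 1: "norm (\<Lambda> *v (s x - s y) - cvec (coord_proj J (x - y))) \<le> 1/20 * ?D" using s(1) unfolding tr_map_def by blast
  have "norm (\<Lambda> *v (G (s x) - G (s y))) \<le> L * (\<kappa> * (C * ?D))"
    using order_trans[OF L(1) mult_left_mono[OF Gxy L(2)]] .
  also have "\<dots> = (\<kappa> * L * C) * ?D" by simp
  also have "\<dots> \<le> 1/20 * ?D" by (rule mult_right_mono[OF L(4)]) simp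
  finally have 2: "norm (\<Lambda> *v (G (s x) - G (s y))) \<le> 1/20 * ?D" .
  have eq2: "\<Lambda> *v (s x + G (s x) - (s y + G (s y))) - cvec (coord_proj J (x - y))
      = (\<Lambda> *v (s x - s y) - cvec (coord_proj J (x - y))) + \<Lambda> *v (G (s x) - G (s y))"
    unfolding eq by (simp add: matrix_vector_right_distrib)
  show "norm (\<Lambda> *v (s x + G (s x) - (s y + G (s y))) - cvec (coord_proj J (x - y))) \<le> 1/10 * ?D"
    unfolding eq2 using norm_triangle_ineq[of "\<Lambda> *v (s x - s y) - cvec (coord_proj J (x - y))" "\<Lambda> *v (G (s x) - G (s y))"] 1 2
    by linarith
qed

lemma compact_neighborhood:
  fixes D V :: "'a::euclidean_space set"
  assumes "compact D" "open V" "D \<subseteq> V"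
  obtains B V' where "compact B" "open V'" "D \<subseteq> V'" "V' \<subseteq> B" "B \<subseteq> V"
proof -
  obtain d where d: "d > 0" "\<And>x y. x \<in> D \<Longrightarrow> dist x y < d \<Longrightarrow> y \<in> V"
    using compact_subset_open_margin[OF assms] by blast
  define B where "B = {x + y |x y. x \<in> D \<and> y \<in> cball 0 (d / 2)}"
  have "compact B" unfolding B_def by (rule compact_sums[OF assms(1) compact_cball])
  moreover have "nbd (d / 2) D \<subseteq> B"
  proof
    fix z assume "z \<in> nbd (d / 2) D"
    then obtain w where "w \<in> D" "dist w z < d / 2" by (auto simp: mem_nbd)
    then have "z = w + (z - w) \<and> w \<in> D \<and> z - w \<in> cball 0 (d / 2)" by (simp add: dist_norm norm_minus_commute)
    then show "z \<in> B" unfolding B_def by blast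
  qed
  moreover have "B \<subseteq> V"
  proof
    fix z assume "z \<in> B"
    then obtain x y where "z = x + y" "x \<in> D" "norm y \<le> d / 2" unfolding B_def by auto
    then show "z \<in> V" using d(2)[of x z] d(1) by (simp add: dist_norm)
  qed
  ultimately show ?thesis using that[of B "nbd (d / 2) D"] open_nbd subset_nbd[of "d / 2" D] d(1) by auto
qed

text \<open>A correction \<open>c\<close> on the parameter space is transported as
  \<open>\<theta> z *\<^sub>R c (r z)\<close>. Where the cutoff \<open>\<theta>\<close> may differ
  from 1, the displaced cell lies in the interior of \<open>P\<close> with a margin, so losing part
  of the correction there is harmless.\<close>

lemma cell_perturbation:
  fixes G :: "complex ^ 'n::finite \<Rightarrow> complex ^ 'n"
  assumes T: "is_cell \<kappa> T" and G: "smooth_on UNIV G" "\<And>x y. norm (G x - G y) \<le> \<kappa> * norm (x - y)"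
    and K: "compact K" "\<And>z. z \<in> K \<Longrightarrow> G z = 0" and P: "compact P" "polynomially_convex P" "K \<subseteq> interior P"
    and \<epsilon>: "\<epsilon> > 0" and \<delta>: "\<delta> > 0"
  obtains E where "smooth_on UNIV E" "Cbd k UNIV \<epsilon> E" "\<And>z. z \<in> K \<Longrightarrow> E z = 0"
    "polynomial_hull (P \<union> (\<lambda>z. z + G z + E z) ` T) \<subseteq> nbd \<delta> (P \<union> (\<lambda>z. z + G z) ` T)"
proof -
  obtain \<Lambda> J m e \<nu> j s r C L where cell: "compact T" "J \<noteq> UNIV" "tr_frame \<Lambda> J m e \<nu> j" "smooth_on UNIV s"
     "tr_map \<Lambda> J (1/20) C s" "C > 0" "bounded_linear (r :: complex ^ 'n \<Rightarrow> real ^ 'n)" "\<And>z. z \<in> T \<Longrightarrow> s (r z) = z"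
     "\<And>z. norm (\<Lambda> *v z) \<le> L * norm z" "0 \<le> L" "0 \<le> \<kappa>" "\<kappa> * L * C \<le> 1/20"
    using T unfolding is_cell_def by blast
  define \<Phi> where "\<Phi> z = z + G z" for z
  have sm\<Phi>: "smooth_on UNIV \<Phi>"
    unfolding \<Phi>_def[abs_def] by (rule smooth_on_add[OF open_UNIV smooth_on_bounded_linear[OF bounded_linear_ident open_UNIV] G(1)])
  have cont\<Phi>: "continuous_on S \<Phi>" for S
    using smooth_on_imp_continuous_on[OF sm\<Phi>] continuous_on_subset by blast
  define p\<^sub>0 where "p\<^sub>0 x = \<Phi> (s x)" for x
  have smp: "smooth_on UNIV p\<^sub>0"
    unfolding p\<^sub>0_def[abs_def] by (rule smooth_on_compose[OF open_UNIV open_UNIV sm\<Phi> cell(4)]) auto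
  have trp: "tr_map \<Lambda> J (1/10) (C + \<kappa> * C) p\<^sub>0"
    using tr_map_perturb[OF cell(5,6,9-12) G(2)] unfolding p\<^sub>0_def \<Phi>_def by simp
  have C': "C + \<kappa> * C > 0" using cell(6,11) by (simp add: add_pos_nonneg)
  have smr: "smooth_on UNIV r" by (rule smooth_on_bounded_linear[OF cell(7) open_UNIV])
  have contr: "continuous_on S r" for S using smooth_on_imp_continuous_on[OF smr] continuous_on_subset by blast
  define D where "D = r ` T"
  have D: "compact D" unfolding D_def by (rule compact_image_smooth[OF smr cell(1)])
  have p0D: "p\<^sub>0 ` D = \<Phi> ` T" unfolding D_def p\<^sub>0_def using cell(8) by (force simp: image_iff)
  have "open (p\<^sub>0 -` nbd (\<delta> / 2) (p\<^sub>0 ` D))" using smooth_on_imp_continuous_on[OF smp] open_nbd by (intro open_vimage)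
  moreover have "D \<subseteq> p\<^sub>0 -` nbd (\<delta> / 2) (p\<^sub>0 ` D)" using subset_nbd[of "\<delta> / 2" "p\<^sub>0 ` D"] \<delta> by auto
  \<comment> \<open>The neighborhood \<open>B\<close> of the parameter set leaves room for the
    support of the cutoff, where \<open>c\<close> must be controlled, while its image stays within
    \<open>\<delta> / 2\<close> of that of \<open>D\<close>.\<close>
  ultimately obtain B V' where B: "compact B" "open V'" "D \<subseteq> V'" "V' \<subseteq> B" "B \<subseteq> p\<^sub>0 -` nbd (\<delta> / 2) (p\<^sub>0 ` D)"
    using compact_neighborhood[OF D] by metis
  \<comment> \<open>The part of the cell not yet absorbed by \<open>P\<close>. It avoids
    \<open>K\<close>, because \<open>G = 0\<close> on \<open>K\<close> and \<open>K\<close> lies in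
    the interior of \<open>P\<close>; so a cutoff equal to 1 near \<open>T'\<close> can vanish on
    \<open>K\<close>.\<close>
  define T' where "T' = T \<inter> \<Phi> -` (- interior P)"
  have T': "compact T'"
    unfolding T'_def using cell(1) cont\<Phi> by (intro compact_Int_closed closed_vimage) auto
  define W where "W = r -` V' \<inter> (- K)"
  have W: "open W" unfolding W_def using contr B(2) K(1) by (intro open_Int open_vimage) (auto simp: compact_imp_closed)
  have "T' \<subseteq> W"
  proof
    fix z assume z: "z \<in> T'"
    have "z \<notin> K"
    proof
      assume "z \<in> K"
      then have "\<Phi> z \<in> interior P" using K(2) P(3) unfolding \<Phi>_def by auto
      then show False using z unfolding T'_def by simp
    qed
    then show "z \<in> W" using z B(3) unfolding W_def T'_def D_def by auto
  qed
  from smooth_cutoff[OF T' W this]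
  obtain \<theta> :: "complex ^ 'n \<Rightarrow> real" and N S where \<theta>: "smooth_on UNIV \<theta>" "\<And>x. 0 \<le> \<theta> x" "\<And>x. \<theta> x \<le> 1" "open N" "T' \<subseteq> N"
    "\<And>x. x \<in> N \<Longrightarrow> \<theta> x = 1" "compact S" "S \<subseteq> W" "\<And>x. x \<notin> S \<Longrightarrow> \<theta> x = 0" by metis
  have "compact (\<Phi> ` (T - N))"
    using cell(1) \<theta>(4) cont\<Phi> by (intro compact_continuous_image compact_diff) auto
  moreover have "\<Phi> ` (T - N) \<subseteq> interior P" using \<theta>(5) unfolding T'_def by auto
  ultimately obtain \<mu> where \<mu>: "\<mu> > 0" "\<And>x y. x \<in> \<Phi> ` (T - N) \<Longrightarrow> dist x y < \<mu> \<Longrightarrow> y \<in> interior P"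
    using compact_subset_open_margin[OF _ open_interior] by metis
  obtain A where A: "A > 0" "\<And>(E :: real ^ 'n \<Rightarrow> complex ^ 'n) M. smooth_on UNIV E \<Longrightarrow> 0 \<le> M \<Longrightarrow> Cbd k (r ` S) M E \<Longrightarrow>
      Cbd k S (A * M) (\<lambda>z. \<theta> z *\<^sub>R E (r z))"
    using Cbd_scaleR_compose[OF open_UNIV \<theta>(7) subset_UNIV \<theta>(1) smr open_UNIV subset_UNIV, of k] by blast
  \<comment> \<open>\<open>A\<close> is the cost of the cutoff and of composing with
    \<open>r\<close>; the bound by \<open>\<mu> / 2\<close> keeps the points outside
    \<open>N\<close> in the interior of \<open>P\<close>.\<close>
  define \<epsilon>1 where "\<epsilon>1 = min (\<epsilon> / A) (\<mu> / 2)"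
  have \<epsilon>1: "\<epsilon>1 > 0" unfolding \<epsilon>1_def using \<epsilon> A \<mu> by simp
  obtain c where c: "smooth_on UNIV c" "Cbd k B \<epsilon>1 c"
    "polynomial_hull (P \<union> (\<lambda>x. p\<^sub>0 x + c x) ` B) \<subseteq> nbd (\<delta> / 2) (P \<union> p\<^sub>0 ` B)"
    by (rule cell_hull[OF P(1,2) smp trp cell(3,2) C' B(1) \<epsilon>1, of "\<delta> / 2" k]) (use \<delta> in auto)
  define E where "E z = \<theta> z *\<^sub>R c (r z)" for z
  have rS: "r ` S \<subseteq> B" using \<theta>(8) B(4) unfolding W_def by auto
  have smE: "smooth_on UNIV E"
    unfolding E_def[abs_def]
    by (rule smooth_on_scaleR[OF open_UNIV \<theta>(1) smooth_on_compose[OF open_UNIV open_UNIV c(1) smr]]) auto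
  have E0: "E z = 0" if "z \<notin> S" for z unfolding E_def using \<theta>(9)[OF that] by simp
  have "Cbd k (r ` S) \<epsilon>1 c" by (rule Cbd_mono[OF c(2) order_refl rS])
  then have "Cbd k S (A * \<epsilon>1) E" unfolding E_def[abs_def] using A(2)[OF c(1)] \<epsilon>1 by simp
  moreover have "A * \<epsilon>1 \<le> \<epsilon>"
  proof -
    have "A * \<epsilon>1 \<le> A * (\<epsilon> / A)" unfolding \<epsilon>1_def using A by (intro mult_left_mono) auto
    then show ?thesis using A by simp
  qed
  ultimately have "Cbd k S \<epsilon> E" using Cbd_mono by blast
  then have "Cbd k UNIV \<epsilon> E" using smooth_on_cutoff_Cbd_UNIV[where f = E, OF \<theta>(7) E0] \<epsilon> by auto
  moreover have "E z = 0" if "z \<in> K" for z using that \<theta>(8) E0 unfolding W_def by blast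
  moreover have "polynomial_hull (P \<union> (\<lambda>z. z + G z + E z) ` T) \<subseteq> nbd \<delta> (P \<union> (\<lambda>z. z + G z) ` T)"
  proof -
    have sub: "P \<union> (\<lambda>z. z + G z + E z) ` T \<subseteq> P \<union> (\<lambda>x. p\<^sub>0 x + c x) ` B"
    proof -
      have "z + G z + E z \<in> P \<union> (\<lambda>x. p\<^sub>0 x + c x) ` B" if z: "z \<in> T" for z
      proof (cases "z \<in> N")
        case True
        then have "z + G z + E z = p\<^sub>0 (r z) + c (r z)"
          unfolding E_def p\<^sub>0_def \<Phi>_def using \<theta>(6) cell(8)[OF z] by simp
        moreover have "r z \<in> B" using z B(3,4) unfolding D_def by blast
        ultimately show ?thesis by blast
      next
        case False
        have "norm (E z) < \<mu>"
        proof (cases "z \<in> S")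
          case True
          then have "norm (c (r z)) \<le> \<epsilon>1" using Cbd_norm_le[OF c(2)] rS by blast
          moreover have "norm (E z) \<le> 1 * norm (c (r z))"
            unfolding E_def norm_scaleR using \<theta>(2,3)[of z] by (intro mult_right_mono) auto
          ultimately show ?thesis unfolding \<epsilon>1_def using \<mu>(1) by simp
        qed (use E0 \<mu>(1) in auto)
        then have "dist (\<Phi> z) (z + G z + E z) < \<mu>" unfolding \<Phi>_def by (simp add: dist_norm)
        then have "z + G z + E z \<in> interior P" using \<mu>(2) z False by blast
        then show ?thesis using interior_subset by blast
      qed
      then show ?thesis by blast
    qed
    have c1: "compact (P \<union> (\<lambda>z. z + G z + E z) ` T)"
      using smooth_on_add[OF open_UNIV sm\<Phi> smE] cell(1) unfolding \<Phi>_def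
      by (intro compact_Un P(1) compact_image_smooth)
    have c2: "compact (P \<union> (\<lambda>x. p\<^sub>0 x + c x) ` B)"
      using smooth_on_add[OF open_UNIV smp c(1)] B(1) by (intro compact_Un P(1) compact_image_smooth)
    have "polynomial_hull (P \<union> (\<lambda>z. z + G z + E z) ` T) \<subseteq> nbd (\<delta> / 2) (P \<union> p\<^sub>0 ` B)"
      using polynomial_hull_mono[OF c1 c2 sub] c(3) by blast
    moreover have "P \<union> p\<^sub>0 ` B \<subseteq> nbd (\<delta> / 2) (P \<union> \<Phi> ` T)"
      using B(5) subset_nbd[of "\<delta> / 2" P] \<delta> unfolding p0D nbd_Un by auto
    ultimately have "polynomial_hull (P \<union> (\<lambda>z. z + G z + E z) ` T) \<subseteq> nbd \<delta> (P \<union> \<Phi> ` T)"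
      by (rule nbd_trans) simp
    then show ?thesis unfolding \<Phi>_def .
  qed
  ultimately show ?thesis using that smE by blast
qed

text \<open>Induction over the cells: the neighborhood obtained for the treated cells serves as
  \<open>P\<close> for the next one. The gap between \<open>\<kappa>\<close> and
  \<open>\<kappa>\<^sub>0\<close> is the Lipschitz budget available to the earlier corrections when
  the next cell is treated.\<close>

lemma cells_perturbation:
  fixes G :: "complex ^ 'n::finite \<Rightarrow> complex ^ 'n"
  assumes \<T>: "finite \<T>" "\<And>T. T \<in> \<T> \<Longrightarrow> is_cell \<kappa>\<^sub>0 T" and k: "k \<ge> 1"
    and G: "smooth_on UNIV G" "\<And>x y. norm (G x - G y) \<le> \<kappa> * norm (x - y)" "\<kappa> < \<kappa>\<^sub>0"
    and K: "compact K" "\<And>z. z \<in> K \<Longrightarrow> G z = 0" and P: "compact P" "polynomially_convex P" "K \<subseteq> interior P"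
    and "\<epsilon> > 0" and "\<delta> > 0"
  shows "\<exists>E P'. smooth_on UNIV E \<and> Cbd k UNIV \<epsilon> E \<and> (\<forall>z\<in>K. E z = 0) \<and> compact P' \<and> polynomially_convex P' \<and>
    K \<union> (\<lambda>z. z + G z + E z) ` \<Union>\<T> \<subseteq> interior P' \<and> P' \<subseteq> nbd \<delta> (P \<union> (\<lambda>z. z + G z + E z) ` \<Union>\<T>)"
  using \<T> \<open>\<epsilon> > 0\<close> \<open>\<delta> > 0\<close>
proof (induction \<T> arbitrary: \<epsilon> \<delta> rule: finite_induct)
  case empty
  show ?case
    by (rule exI[of _ "\<lambda>z. 0"], rule exI[of _ P]) (use P subset_nbd empty in \<open>auto intro: smooth_on_const Cbd_zero\<close>)
next
  case (insert T \<T>)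
  let ?d = "real DIM(complex ^ 'n)"
  have "1 \<le> real CARD('n)" by (metis One_nat_def Suc_leI of_nat_1 of_nat_le_iff zero_less_card_finite)
  moreover have "?d = 2 * real CARD('n)" by simp
  ultimately have d1: "?d \<ge> 1" by linarith
  \<comment> \<open>The second bound limits the Lipschitz constant of \<open>E1\<close> to
    \<open>\<kappa>\<^sub>0 - \<kappa>\<close>, so \<open>G + E1\<close> is still tolerated by the
    cell \<open>T\<close>.\<close>
  define \<epsilon>1 where "\<epsilon>1 = min (\<epsilon> / 2) ((\<kappa>\<^sub>0 - \<kappa>) / ?d)"
  have \<epsilon>1: "\<epsilon>1 > 0" "\<epsilon>1 \<le> \<epsilon> / 2" "?d * \<epsilon>1 \<le> \<kappa>\<^sub>0 - \<kappa>"
  proof -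
    show "\<epsilon>1 > 0" "\<epsilon>1 \<le> \<epsilon> / 2" unfolding \<epsilon>1_def using insert.prems G(3) d1 by auto
    have "?d * \<epsilon>1 \<le> ?d * ((\<kappa>\<^sub>0 - \<kappa>) / ?d)" unfolding \<epsilon>1_def using d1 by (intro mult_left_mono) auto
    then show "?d * \<epsilon>1 \<le> \<kappa>\<^sub>0 - \<kappa>" using d1 by simp
  qed
  have \<delta>4: "\<delta> / 4 > 0" using insert.prems by simp
  have cells: "is_cell \<kappa>\<^sub>0 T'" if "T' \<in> \<T>" for T' using insert.prems(1) that by blast
  obtain E1 P1 where E1: "smooth_on UNIV E1" "Cbd k UNIV \<epsilon>1 E1" "\<forall>z\<in>K. E1 z = 0" and
    P1: "compact P1" "polynomially_convex P1" "K \<union> (\<lambda>z. z + G z + E1 z) ` \<Union>\<T> \<subseteq> interior P1"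
     "P1 \<subseteq> nbd (\<delta> / 4) (P \<union> (\<lambda>z. z + G z + E1 z) ` \<Union>\<T>)"
    by (atomize_elim, rule insert.IH[OF cells \<epsilon>1(1) \<delta>4])
  define G1 where "G1 z = G z + E1 z" for z
  have smG1: "smooth_on UNIV G1" unfolding G1_def[abs_def] by (rule smooth_on_add[OF open_UNIV G(1) E1(1)])
  have LipG1: "norm (G1 x - G1 y) \<le> \<kappa>\<^sub>0 * norm (x - y)" for x y
  proof -
    have "Cbd 1 UNIV \<epsilon>1 E1" by (rule Cbd_le[OF E1(2) k])
    then have "norm (E1 x - E1 y) \<le> (?d * \<epsilon>1) * norm (x - y)" by (rule Cbd_imp_Lipschitz[OF E1(1)])
    also have "\<dots> \<le> (\<kappa>\<^sub>0 - \<kappa>) * norm (x - y)" by (rule mult_right_mono[OF \<epsilon>1(3)]) simp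
    finally have "norm (E1 x - E1 y) \<le> (\<kappa>\<^sub>0 - \<kappa>) * norm (x - y)" .
    moreover have eq: "G1 x - G1 y = (G x - G y) + (E1 x - E1 y)" unfolding G1_def by simp
    ultimately have "norm (G1 x - G1 y) \<le> \<kappa> * norm (x - y) + (\<kappa>\<^sub>0 - \<kappa>) * norm (x - y)"
      unfolding eq using norm_triangle_ineq[of "G x - G y" "E1 x - E1 y"] G(2)[of x y] by linarith
    then show ?thesis by (simp add: algebra_simps)
  qed
  have KG1: "G1 z = 0" if "z \<in> K" for z unfolding G1_def using K(2)[OF that] E1(3) that by simp
  have KP1: "K \<subseteq> interior P1" using P1(3) by blast
  have cellT: "is_cell \<kappa>\<^sub>0 T" using insert.prems(1) by blast
  have compF: "compact (\<Union>\<T>)" using insert unfolding is_cell_def by (intro compact_Union) auto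
  let ?\<Phi>1 = "\<lambda>z. z + G1 z"
  have sm\<Phi>1: "smooth_on UNIV ?\<Phi>1"
    by (rule smooth_on_add[OF open_UNIV smooth_on_bounded_linear[OF bounded_linear_ident open_UNIV] smG1])
  have "?\<Phi>1 ` \<Union>\<T> \<subseteq> interior P1" using P1(3) unfolding G1_def by (simp add: add.assoc)
  from compact_subset_open_margin[OF compact_image_smooth[OF sm\<Phi>1 compF] open_interior this]
  obtain \<mu> where \<mu>: "\<mu> > 0" "\<And>x y. x \<in> ?\<Phi>1 ` \<Union>\<T> \<Longrightarrow> dist x y < \<mu> \<Longrightarrow> y \<in> interior P1" by blast
  \<comment> \<open>The bound \<open>\<mu> / 2\<close> keeps the treated cells in the interior of
    \<open>P1\<close>; \<open>\<delta> / 8\<close> makes the images before and after the correction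
    closer than \<open>\<delta> / 4\<close>.\<close>
  define \<epsilon>2 where "\<epsilon>2 = min (\<epsilon> / 2) (min (\<mu> / 2) (\<delta> / 8))"
  have \<epsilon>2: "\<epsilon>2 > 0" unfolding \<epsilon>2_def using insert.prems \<mu> by auto
  have \<delta>8: "\<delta> / 8 > 0" using insert.prems by simp
  have "\<exists>E2. smooth_on UNIV E2 \<and> Cbd k UNIV \<epsilon>2 E2 \<and> (\<forall>z\<in>K. E2 z = 0) \<and>
    polynomial_hull (P1 \<union> (\<lambda>z. z + G1 z + E2 z) ` T) \<subseteq> nbd (\<delta> / 8) (P1 \<union> ?\<Phi>1 ` T)"
    by (rule cell_perturbation[OF cellT smG1 LipG1 K(1) KG1 P1(1,2) KP1 \<epsilon>2 \<delta>8, of k]) (assumption | intro exI conjI ballI)+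
  then obtain E2 where E2: "smooth_on UNIV E2" "Cbd k UNIV \<epsilon>2 E2" "\<forall>z\<in>K. E2 z = 0"
    "polynomial_hull (P1 \<union> (\<lambda>z. z + G1 z + E2 z) ` T) \<subseteq> nbd (\<delta> / 8) (P1 \<union> ?\<Phi>1 ` T)"
    by (elim exE conjE)
  let ?\<Phi>2 = "\<lambda>z. z + G1 z + E2 z"
  have nE2: "norm (E2 z) < \<mu>" "norm (E2 z) < \<delta> / 4" for z
    using Cbd_norm_le[OF E2(2), of z] \<mu>(1) \<delta>8 unfolding \<epsilon>2_def by auto
  have near: "?\<Phi>1 ` Y \<subseteq> nbd (\<delta> / 4) (?\<Phi>2 ` Y)" for Y
  proof
    fix w assume "w \<in> ?\<Phi>1 ` Y"
    then obtain z where "z \<in> Y" "w = ?\<Phi>1 z" by blast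
    then show "w \<in> nbd (\<delta> / 4) (?\<Phi>2 ` Y)" using nE2(2)[of z] by (auto simp: mem_nbd dist_norm intro!: bexI[of _ z])
  qed
  define X where "X = polynomial_hull (P1 \<union> ?\<Phi>2 ` T)"
  have compT: "compact T" using cellT unfolding is_cell_def by blast
  have compPT: "compact (P1 \<union> ?\<Phi>2 ` T)"
    by (intro compact_Un P1(1) compact_image_smooth smooth_on_add[OF open_UNIV sm\<Phi>1 E2(1)] compT)
  have X: "compact X" "polynomially_convex X" "P1 \<union> ?\<Phi>2 ` T \<subseteq> X"
    unfolding X_def using compact_polynomial_hull[OF compPT] polynomially_convex_polynomial_hull[OF compPT]
      subset_polynomial_hull[OF compPT] by auto
  have P1\<Phi>: "P1 \<union> ?\<Phi>1 ` T \<subseteq> nbd (\<delta> / 4) (P1 \<union> ?\<Phi>2 ` T)"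
    using near[of T] subset_nbd[of "\<delta> / 4" P1] \<delta>8 unfolding nbd_Un by auto
  have XU: "X \<subseteq> nbd (\<delta> / 2) (P1 \<union> ?\<Phi>2 ` T)"
    by (rule nbd_trans[OF E2(4)[folded X_def] P1\<Phi>]) (use \<delta>8 in simp)
  obtain P2 where P2: "compact P2" "polynomially_convex P2" "X \<subseteq> interior P2" "P2 \<subseteq> nbd (\<delta> / 2) (P1 \<union> ?\<Phi>2 ` T)"
    by (rule polynomially_convex_neighborhood[OF X(1,2) open_nbd XU])
  define E where "E z = E1 z + E2 z" for z
  have eq: "z + G z + E z = ?\<Phi>2 z" for z unfolding E_def G1_def by simp
  have r1: "smooth_on UNIV E" unfolding E_def[abs_def] by (rule smooth_on_add[OF open_UNIV E1(1) E2(1)])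
  have r2: "Cbd k UNIV \<epsilon> E"
    unfolding E_def[abs_def]
    by (rule Cbd_mono[OF Cbd_add[OF open_UNIV subset_UNIV E1(1) E2(1) E1(2) E2(2)]])
      (use \<epsilon>1(2) in \<open>auto simp: \<epsilon>2_def\<close>)
  have r3: "\<forall>z\<in>K. E z = 0" unfolding E_def using E1(3) E2(3) by simp
  have r4: "K \<union> ?\<Phi>2 ` \<Union>(insert T \<T>) \<subseteq> interior P2"
  proof -
    have "?\<Phi>2 z \<in> interior P1" if "z \<in> \<Union>\<T>" for z
      using \<mu>(2)[of "?\<Phi>1 z" "?\<Phi>2 z"] nE2(1)[of z] that by (auto simp: dist_norm)
    then have "K \<union> ?\<Phi>2 ` \<Union>\<T> \<subseteq> P1" using KP1 interior_subset by blast
    then show ?thesis using X(3) P2(3) unfolding Union_insert image_Un by blast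
  qed
  have r5: "P2 \<subseteq> nbd \<delta> (P \<union> ?\<Phi>2 ` \<Union>(insert T \<T>))"
  proof -
    have n2: "P \<union> ?\<Phi>1 ` \<Union>\<T> \<subseteq> nbd (\<delta> / 4) (P \<union> ?\<Phi>2 ` \<Union>\<T>)"
      using near[of "\<Union>\<T>"] subset_nbd[of "\<delta> / 4" P] \<delta>8 unfolding nbd_Un by auto
    have n1: "P1 \<subseteq> nbd (\<delta> / 4) (P \<union> ?\<Phi>1 ` \<Union>\<T>)" using P1(4) unfolding G1_def by (simp add: add.assoc)
    have "P1 \<subseteq> nbd (\<delta> / 2) (P \<union> ?\<Phi>2 ` \<Union>\<T>)" by (rule nbd_trans[OF n1 n2]) simp
    then have "P1 \<union> ?\<Phi>2 ` T \<subseteq> nbd (\<delta> / 2) (P \<union> ?\<Phi>2 ` \<Union>(insert T \<T>))"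
      using subset_nbd[of "\<delta> / 2" "?\<Phi>2 ` T"] \<delta>8 by (auto simp: nbd_Un image_Un)
    then show ?thesis by (rule nbd_trans[OF P2(4)]) simp
  qed
  show ?case
    by (intro exI[of _ E] exI[of _ P2] conjI r1 r2 r3 P2(1,2) r4[folded eq] r5[folded eq])
qed

section \<open>The limit of infinitely many perturbations\<close>

lemma smooth_on_uniform_limit:
  fixes E :: "nat \<Rightarrow> 'a::euclidean_space \<Rightarrow> 'b::banach"
  assumes sm: "\<And>m. smooth_on UNIV (E m)" and bd: "\<And>m. Cbd (m + k\<^sub>0) UNIV (a m) (E m)" and a: "summable a" "\<And>m. 0 \<le> a m"
  shows "smooth_on UNIV (\<lambda>x. \<Sum>m. E m x)" and "Cbd k\<^sub>0 UNIV (\<Sum>m. a m) (\<lambda>x. \<Sum>m. E m x)"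
proof -
  text \<open>Only the terms with \<open>m \<ge> i\<close> control derivatives of order \<open>k\<^sub>0 + i\<close>, so finitely many initial terms
    need a separate summable majorant.\<close>
  have diff: "(\<lambda>x. \<Sum>m. E m x) differentiable (at x) \<and> dd b (\<lambda>x. \<Sum>m. E m x) x = (\<Sum>m. dd b (E m) x)"
    if sm: "\<And>m. smooth_on UNIV (E m)" and maj: "summable c" "\<And>m. m \<ge> i \<Longrightarrow> Cbd 1 UNIV (c m) (E m)"
    for E :: "nat \<Rightarrow> 'a \<Rightarrow> 'b" and c :: "nat \<Rightarrow> real" and i x b
  proof -
    have der: "(E m has_derivative (\<lambda>v. dd v (E m) x)) (at x within UNIV)" for m x
      using smooth_on_imp_differentiable[OF sm] has_derivative_dd by auto
    have sumi: "summable (\<lambda>m. c (m + i))" using maj(1) by (simp add: summable_iff_shift)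
    have nrm: "norm (E (m + i) x) \<le> c (m + i)" for m x using Cbd_norm_le[OF maj(2)] by simp
    have summE: "summable (\<lambda>m. E (m + i) x)" for x
      by (rule summable_comparison_test'[OF sumi nrm])
    have dnrm: "norm (dd v (E (m + i)) x) \<le> (DIM('a) * c (m + i)) * norm v" for m x v
    proof -
      have "norm (dd v (E (m + i)) x) \<le> (\<Sum>b\<in>Basis. \<bar>v \<bullet> b\<bar> * norm (dd b (E (m + i)) x))"
        by (subst dd_basis_sum[OF smooth_on_imp_differentiable[OF sm UNIV_I]])
          (rule order_trans[OF norm_sum], simp)
      also have "\<dots> \<le> (\<Sum>b\<in>(Basis :: 'a set). norm v * c (m + i))"
        using maj(2)[of "m + i"] by (intro sum_mono mult_mono Basis_le_norm) auto
      finally show ?thesis by (simp add: mult.commute mult.left_commute)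
    qed
    have "summable (\<lambda>m. dd v (E (m + i)) x)" for v x
      by (rule summable_comparison_test'[OF summable_mult[OF summable_mult2[OF sumi, of "norm v"], of "DIM('a)"]])
        (use dnrm in \<open>simp add: mult_ac\<close>)
    then have dsum: "(\<lambda>m. dd v (E (m + i)) x) sums (\<Sum>m. dd v (E (m + i)) x)" for v x by (rule summable_sums)
    have "\<exists>g. \<forall>x\<in>UNIV. (\<lambda>m. E (m + i) x) sums g x \<and> (g has_derivative (\<lambda>v. \<Sum>m. dd v (E (m + i)) x)) (at x within UNIV)"
    proof (rule has_derivative_series)
      show "convex (UNIV :: 'a set)" by simp
      show "(E (m + i) has_derivative (\<lambda>v. dd v (E (m + i)) x)) (at x within UNIV)" for m x by (rule der)
      show "\<forall>\<^sub>F n in sequentially. \<forall>x\<in>UNIV. \<forall>h. norm ((\<Sum>m<n. dd h (E (m + i)) x) - (\<Sum>m. dd h (E (m + i)) x)) \<le> e * norm h"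
        if e: "e > 0" for e
      proof -
        have "summable (\<lambda>m. DIM('a) * c (m + i))" by (rule summable_mult[OF sumi])
        then obtain n0 where n0: "\<And>n. n \<ge> n0 \<Longrightarrow> norm (\<Sum>m. DIM('a) * c (m + n + i)) < e"
          using suminf_exist_split[OF e, of "\<lambda>m. DIM('a) * c (m + i)"] by (auto simp: add.assoc)
        have "norm ((\<Sum>m<n. dd h (E (m + i)) x) - (\<Sum>m. dd h (E (m + i)) x)) \<le> e * norm h" if n: "n \<ge> n0" for n h x
        proof -
          have sh: "summable (\<lambda>m. DIM('a) * c (m + n + i))"
            using summable_mult[OF sumi, of "DIM('a)"] summable_iff_shift[of "\<lambda>m. DIM('a) * c (m + i)" n] by simp
          have "(\<Sum>m. dd h (E (m + i)) x) = (\<Sum>m. dd h (E (m + n + i)) x) + (\<Sum>m<n. dd h (E (m + i)) x)"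
            by (rule suminf_split_initial_segment[OF sums_summable[OF dsum]])
          then have "norm ((\<Sum>m<n. dd h (E (m + i)) x) - (\<Sum>m. dd h (E (m + i)) x)) = norm (\<Sum>m. dd h (E (m + n + i)) x)"
            by (simp add: norm_minus_commute)
          also have "\<dots> \<le> (\<Sum>m. (DIM('a) * c (m + n + i)) * norm h)"
          proof (rule norm_suminf_le)
            show "summable (\<lambda>m. (DIM('a) * c (m + n + i)) * norm h)" by (rule summable_mult2[OF sh])
            show "norm (dd h (E (m + n + i)) x) \<le> (DIM('a) * c (m + n + i)) * norm h" for m by (rule dnrm)
          qed
          also have "\<dots> = (\<Sum>m. DIM('a) * c (m + n + i)) * norm h" by (rule suminf_mult2[OF sh, symmetric])
          also have "\<dots> \<le> e * norm h" using n0[OF n] by (intro mult_right_mono) auto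
          finally show ?thesis .
        qed
        then show ?thesis unfolding eventually_sequentially by blast
      qed
      show "(\<lambda>m. E (m + i) 0) sums (\<Sum>m. E (m + i) 0)" by (rule summable_sums[OF summE])
    qed auto
    then obtain g where g: "\<And>x. (\<lambda>m. E (m + i) x) sums g x"
      "\<And>x. (g has_derivative (\<lambda>v. \<Sum>m. dd v (E (m + i)) x)) (at x within UNIV)" by blast
    have Eg: "(\<lambda>x. \<Sum>m. E m x) = (\<lambda>x. g x + (\<Sum>m<i. E m x))"
    proof
      fix x
      have "summable (\<lambda>m. E m x)" using summE[of x] summable_iff_shift[of "\<lambda>m. E m x" i] by blast
      then show "(\<Sum>m. E m x) = g x + (\<Sum>m<i. E m x)"
        using suminf_split_initial_segment[of "\<lambda>m. E m x" i] sums_unique[OF g(1)[of x]] by simp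
    qed
    have der2: "((\<lambda>x. \<Sum>m. E m x) has_derivative (\<lambda>v. (\<Sum>m. dd v (E (m + i)) x) + (\<Sum>m<i. dd v (E m) x))) (at x within UNIV)"
      unfolding Eg by (intro has_derivative_add g(2) has_derivative_sum der)
    have "summable (\<lambda>m. dd b (E m) x)" using sums_summable[OF dsum] summable_iff_shift[of "\<lambda>m. dd b (E m) x" i] by blast
    then have eq: "(\<Sum>m. dd b (E m) x) = (\<Sum>m. dd b (E (m + i)) x) + (\<Sum>m<i. dd b (E m) x)"
      by (rule suminf_split_initial_segment)
    show ?thesis unfolding eq by (rule conjI[OF differentiableI[OF der2] dd_eqI[OF der2]])
  qed
  have smooth: "Ck k UNIV (\<lambda>x. \<Sum>m. E m x)"
    if "\<And>m. smooth_on UNIV (E m)" "\<And>m. m \<ge> i \<Longrightarrow> Cbd (k + 1) UNIV (a m) (E m)"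
    for E :: "nat \<Rightarrow> 'a \<Rightarrow> 'b" and k i
    using that
  proof (induction k arbitrary: E)
    case 0
    have "(\<lambda>x. \<Sum>m. E m x) differentiable (at x)" for x
      using diff[where E = E and c = a and i = i] 0 a(1) by simp
    then show ?case by (auto intro!: continuous_at_imp_continuous_on differentiable_imp_continuous_within)
  next
    case (Suc k)
    have "Cbd 1 UNIV (a m) (E m)" if "m \<ge> i" for m using Cbd_le[OF Suc.prems(2)[OF that], of 1] by simp
    then have d: "(\<lambda>x. \<Sum>m. E m x) differentiable (at x) \<and> dd b (\<lambda>x. \<Sum>m. E m x) x = (\<Sum>m. dd b (E m) x)" for x b
      by (rule diff[OF Suc.prems(1) a(1)])
    have "Ck k UNIV (\<lambda>x. \<Sum>m. dd b (E m) x)" if "b \<in> Basis" for b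
    proof (rule Suc.IH)
      show "smooth_on UNIV (dd b (E m))" for m by (rule smooth_on_dd[OF Suc.prems(1) that])
      show "Cbd (k + 1) UNIV (a m) (dd b (E m))" if "i \<le> m" for m using Suc.prems(2)[OF that] \<open>b \<in> Basis\<close> by simp
    qed
    moreover have "dd b (\<lambda>x. \<Sum>m. E m x) = (\<lambda>x. \<Sum>m. dd b (E m) x)" for b using d by blast
    ultimately show ?case using d by simp
  qed
  show "smooth_on UNIV (\<lambda>x. \<Sum>m. E m x)"
    unfolding smooth_on_def
  proof
    fix k
    \<comment> \<open>For \<open>m \<ge> k + 1\<close> the available order of control is at least
      the required \<open>k + 1\<close>.\<close>
    show "Ck k UNIV (\<lambda>x. \<Sum>m. E m x)"
      by (rule smooth[where i = "k + 1"], rule sm, rule Cbd_le[OF bd]) simp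
  qed
  have "Cbd k UNIV (\<Sum>m. a m) (\<lambda>x. \<Sum>m. E m x)"
    if "\<And>m. smooth_on UNIV (E m)" "\<And>m. Cbd k UNIV (a m) (E m)" "\<And>m. Cbd (m + k) UNIV (a m) (E m)"
    for E :: "nat \<Rightarrow> 'a \<Rightarrow> 'b" and k
    using that
  proof (induction k arbitrary: E)
    case 0
    have "norm (\<Sum>m. E m x) \<le> (\<Sum>m. a m)" for x
      by (rule norm_suminf_le[OF _ a(1)]) (use 0 Cbd_norm_le in blast)
    then show ?case by simp
  next
    case (Suc k)
    have "norm (\<Sum>m. E m x) \<le> (\<Sum>m. a m)" for x
      by (rule norm_suminf_le[OF _ a(1)]) (use Suc.prems Cbd_norm_le in blast)
    moreover have "Cbd 1 UNIV (a m) (E m)" for m using Cbd_le[OF Suc.prems(2), of 1] by simp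
    then have d: "dd b (\<lambda>x. \<Sum>m. E m x) x = (\<Sum>m. dd b (E m) x)" for x b
      using diff[where E = E and c = a and i = 0, OF Suc.prems(1) a(1)] by blast
    have "Cbd k UNIV (\<Sum>m. a m) (\<lambda>x. \<Sum>m. dd b (E m) x)" if "b \<in> Basis" for b
    proof (rule Suc.IH)
      show "smooth_on UNIV (dd b (E m))" for m by (rule smooth_on_dd[OF Suc.prems(1) that])
      show "Cbd k UNIV (a m) (dd b (E m))" for m using Suc.prems(2)[of m] that by simp
      show "Cbd (m + k) UNIV (a m) (dd b (E m))" for m using Suc.prems(3)[of m] that by simp
    qed
    moreover have "dd b (\<lambda>x. \<Sum>m. E m x) = (\<lambda>x. \<Sum>m. dd b (E m) x)" for b using d by blast
    ultimately show ?case by simp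
  qed
  then show "Cbd k\<^sub>0 UNIV (\<Sum>m. a m) (\<lambda>x. \<Sum>m. E m x)"
    using sm bd Cbd_le[OF bd] by (metis le_add2)
qed

theorem polynomially_convex_perturbation:
  fixes \<T> :: "(complex ^ 'n::finite) set set" and \<epsilon> \<kappa> :: real
  assumes \<T>: "finite \<T>" "\<And>T. T \<in> \<T> \<Longrightarrow> is_cell \<kappa> T" and \<kappa>: "\<kappa> > 0" and K: "compact K" "polynomially_convex K"
    and \<epsilon>: "\<epsilon> > 0" "DIM(complex ^ 'n) * \<epsilon> < \<kappa>" and k: "k \<ge> 1"
  obtains E where "smooth_on UNIV E" "Cbd k UNIV \<epsilon> E" "\<And>z. z \<in> K \<Longrightarrow> E z = 0"
    "polynomial_hull (K \<union> (\<lambda>z. z + E z) ` \<Union>\<T>) = K \<union> (\<lambda>z. z + E z) ` \<Union>\<T>"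
proof -
  define S where "S = \<Union>\<T>"
  have compS: "compact S" unfolding S_def using \<T> unfolding is_cell_def by (intro compact_Union) auto
  define Im where "Im G = K \<union> (\<lambda>z. z + G z) ` S" for G :: "complex ^ 'n \<Rightarrow> complex ^ 'n"
  have compIm: "compact (Im G)" if "smooth_on UNIV G" for G
    unfolding Im_def
    by (intro compact_Un K compact_image_smooth smooth_on_add[OF open_UNIV smooth_on_bounded_linear[OF bounded_linear_ident open_UNIV] that] compS)
  text \<open>A state consists of the last increment, the accumulated perturbation, a polynomially convex
    neighborhood of its image together with \<open>K\<close>, and a margin for all future increments.\<close>
  define inv where "inv m st \<longleftrightarrow> (case st of (E, G, P, \<mu>) \<Rightarrow>
     smooth_on UNIV E \<and> Cbd (m + k) UNIV (\<epsilon> / 2 ^ Suc m) E \<and> smooth_on UNIV G \<and> (\<forall>z\<in>K. E z = 0 \<and> G z = 0) \<and>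
     Cbd k UNIV (\<epsilon> * (1 - 1 / 2 ^ Suc m)) G \<and> compact P \<and> polynomially_convex P \<and> (0::real) < \<mu> \<and>
     nbd \<mu> (Im G) \<subseteq> P \<and> P \<subseteq> nbd (1 / 2 ^ m) (Im G) \<and> \<mu> \<le> 1 / 2 ^ m \<and> (m = 0 \<longrightarrow> G = E))" for m :: nat
     and st :: "(complex ^ 'n \<Rightarrow> complex ^ 'n) \<times> (complex ^ 'n \<Rightarrow> complex ^ 'n) \<times> (complex ^ 'n) set \<times> real"
  \<comment> \<open>Increments of at most a quarter of the margin, with margins at least halved each
    time, add up to at most \<open>\<mu> / 2\<close>: the limit stays within the margin of every
    stage.\<close>
  define step where "step m st st' \<longleftrightarrow> (case st of (E, G, P, \<mu>) \<Rightarrow> case st' of (E', G', P', \<mu>') \<Rightarrow>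
     G' = (\<lambda>z. G z + E' z) \<and> (\<forall>z. norm (E' z) \<le> \<mu> / 4) \<and> \<mu>' \<le> \<mu> / 2)" for m :: nat
     and st st' :: "(complex ^ 'n \<Rightarrow> complex ^ 'n) \<times> (complex ^ 'n \<Rightarrow> complex ^ 'n) \<times> (complex ^ 'n) set \<times> real"
  have advance: "\<exists>E P \<mu>. smooth_on UNIV E \<and> Cbd l UNIV \<epsilon>' E \<and> (\<forall>z\<in>K. E z = 0) \<and> compact P \<and> polynomially_convex P \<and>
      (0::real) < \<mu> \<and> nbd \<mu> (Im (\<lambda>z. G z + E z)) \<subseteq> P \<and> P \<subseteq> nbd \<delta> (Im (\<lambda>z. G z + E z)) \<and> \<mu> \<le> \<mu>'"
    if G: "smooth_on UNIV G" "\<forall>z\<in>K. G z = 0" "Cbd k UNIV \<epsilon> G" and l: "l \<ge> 1" "\<epsilon>' > 0" "\<delta> > 0" "\<mu>' > 0" for G l \<epsilon>' \<delta> \<mu>'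
  proof -
    have Lip: "norm (G x - G y) \<le> (DIM(complex ^ 'n) * \<epsilon>) * norm (x - y)" for x y
      by (rule Cbd_imp_Lipschitz[OF G(1) Cbd_le[OF G(3) k]])
    have "\<delta> / 2 > 0" using l by simp
    \<comment> \<open>Each round restarts from a small neighborhood of \<open>K\<close> and not from
      the previous \<open>P\<close>; otherwise the new neighborhood could not be made to
      shrink.\<close>
    obtain P0 where P0: "compact P0" "polynomially_convex P0" "K \<subseteq> interior P0" "P0 \<subseteq> nbd (\<delta> / 2) K"
      using polynomially_convex_neighborhood[OF K open_nbd subset_nbd[OF \<open>\<delta> / 2 > 0\<close>]] by metis
    have "\<exists>E P'. smooth_on UNIV E \<and> Cbd l UNIV \<epsilon>' E \<and> (\<forall>z\<in>K. E z = 0) \<and> compact P' \<and> polynomially_convex P' \<and>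
      K \<union> (\<lambda>z. z + G z + E z) ` \<Union>\<T> \<subseteq> interior P' \<and> P' \<subseteq> nbd (\<delta> / 2) (P0 \<union> (\<lambda>z. z + G z + E z) ` \<Union>\<T>)"
      by (rule cells_perturbation[OF \<T> l(1) G(1) Lip \<epsilon>(2) K(1) _ P0(1-3) l(2) \<open>\<delta> / 2 > 0\<close>]) (use G(2) in auto)
    then obtain E P where E: "smooth_on UNIV E" "Cbd l UNIV \<epsilon>' E" "\<forall>z\<in>K. E z = 0" "compact P" "polynomially_convex P"
      "Im (\<lambda>z. G z + E z) \<subseteq> interior P" "P \<subseteq> nbd (\<delta> / 2) (P0 \<union> (\<lambda>z. z + (G z + E z)) ` S)"
      unfolding Im_def S_def by (auto simp: add.assoc)
    have smGE: "smooth_on UNIV (\<lambda>z. G z + E z)" by (rule smooth_on_add[OF open_UNIV G(1) E(1)])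
    obtain \<mu> where \<mu>: "\<mu> > 0" "\<And>x y. x \<in> Im (\<lambda>z. G z + E z) \<Longrightarrow> dist x y < \<mu> \<Longrightarrow> y \<in> interior P"
      using compact_subset_open_margin[OF compIm[OF smGE] open_interior E(6)] by blast
    have "nbd (min \<mu> \<mu>') (Im (\<lambda>z. G z + E z)) \<subseteq> P"
    proof
      fix y assume "y \<in> nbd (min \<mu> \<mu>') (Im (\<lambda>z. G z + E z))"
      then obtain x where "x \<in> Im (\<lambda>z. G z + E z)" "dist x y < \<mu>" unfolding mem_nbd by auto
      then show "y \<in> P" using \<mu>(2) interior_subset by blast
    qed
    moreover have "P \<subseteq> nbd \<delta> (Im (\<lambda>z. G z + E z))"
    proof (rule nbd_trans[OF E(7)])
      show "P0 \<union> (\<lambda>z. z + (G z + E z)) ` S \<subseteq> nbd (\<delta> / 2) (Im (\<lambda>z. G z + E z))"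
        unfolding Im_def nbd_Un by (rule Un_mono[OF P0(4) subset_nbd[OF \<open>\<delta> / 2 > 0\<close>]])
    qed simp
    ultimately show ?thesis using E(1-5) \<mu>(1) l(4) by (intro exI[of _ E] exI[of _ P] exI[of _ "min \<mu> \<mu>'"]) auto
  qed
  have "\<exists>st. \<forall>m. inv m (st m) \<and> step m (st m) (st (Suc m))"
  proof (rule dependent_nat_choice)
    have "\<exists>E P \<mu>. smooth_on UNIV E \<and> Cbd k UNIV (\<epsilon> / 2) E \<and> (\<forall>z\<in>K. E z = 0) \<and> compact P \<and> polynomially_convex P \<and>
      (0::real) < \<mu> \<and> nbd \<mu> (Im (\<lambda>z. 0 + E z)) \<subseteq> P \<and> P \<subseteq> nbd 1 (Im (\<lambda>z. 0 + E z)) \<and> \<mu> \<le> 1"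
      by (rule advance) (use \<epsilon> k in \<open>auto intro: smooth_on_const Cbd_zero\<close>)
    then obtain E P \<mu> where "smooth_on UNIV E" "Cbd k UNIV (\<epsilon> / 2) E" "\<forall>z\<in>K. E z = 0" "compact P" "polynomially_convex P"
      "(0::real) < \<mu>" "nbd \<mu> (Im E) \<subseteq> P" "P \<subseteq> nbd 1 (Im E)" "\<mu> \<le> 1" by auto
    then have "inv 0 (E, E, P, \<mu>)" unfolding inv_def by simp
    then show "\<exists>st. inv 0 st" by blast
  next
    fix st :: "(complex ^ 'n \<Rightarrow> complex ^ 'n) \<times> (complex ^ 'n \<Rightarrow> complex ^ 'n) \<times> (complex ^ 'n) set \<times> real" and m
    assume "inv m st"
    obtain E G P \<mu> where st: "st = (E, G, P, \<mu>)" by (cases st)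
    have G: "smooth_on UNIV G" "\<forall>z\<in>K. G z = 0" "Cbd k UNIV (\<epsilon> * (1 - 1 / 2 ^ Suc m)) G" "\<mu> > 0"
      using \<open>inv m st\<close> unfolding st inv_def by auto
    define \<epsilon>' where "\<epsilon>' = min (\<epsilon> / 2 ^ Suc (Suc m)) (\<mu> / 4)"
    have "\<epsilon> * (1 - 1 / 2 ^ Suc m) \<le> \<epsilon>" using \<epsilon>(1) by (simp add: mult_left_le)
    then have c1: "Cbd k UNIV \<epsilon> G" using Cbd_mono[OF G(3)] by simp
    have c2: "\<epsilon>' > 0" unfolding \<epsilon>'_def using \<epsilon> G by simp
    have c3: "Suc m + k \<ge> 1" using k by simp
    have c4: "1 / 2 ^ Suc m > (0::real)" "min (1 / 2 ^ Suc m) (\<mu> / 2) > 0" using G(4) by auto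
    obtain E' P' \<mu>' where E': "smooth_on UNIV E'" "Cbd (Suc m + k) UNIV \<epsilon>' E'" "\<forall>z\<in>K. E' z = 0" "compact P'" "polynomially_convex P'"
      "(0::real) < \<mu>'" "nbd \<mu>' (Im (\<lambda>z. G z + E' z)) \<subseteq> P'" "P' \<subseteq> nbd (1 / 2 ^ Suc m) (Im (\<lambda>z. G z + E' z))" "\<mu>' \<le> min (1 / 2 ^ Suc m) (\<mu> / 2)"
      by (insert advance[OF G(1,2) c1 c3 c2 c4], elim exE conjE, rule that)
    let ?st' = "(E', \<lambda>z. G z + E' z, P', \<mu>')"
    have "Cbd (Suc m + k) UNIV (\<epsilon> / 2 ^ Suc (Suc m)) E'" by (rule Cbd_mono[OF E'(2)]) (auto simp: \<epsilon>'_def)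
    \<comment> \<open>The factor \<open>1 - 1 / 2 ^ Suc m\<close> is the partial sum of the
      geometric series of the allowed increments, so the total never exceeds
      \<open>\<epsilon>\<close>.\<close>
    moreover have "Cbd k UNIV (\<epsilon> * (1 - 1 / 2 ^ Suc (Suc m))) (\<lambda>z. G z + E' z)"
    proof (rule Cbd_mono[OF Cbd_add[OF open_UNIV subset_UNIV G(1) E'(1) G(3) Cbd_le[OF E'(2), of k]]])
      have "\<epsilon>' \<le> \<epsilon> / 2 ^ Suc (Suc m)" unfolding \<epsilon>'_def by simp
      then show "\<epsilon> * (1 - 1 / 2 ^ Suc m) + \<epsilon>' \<le> \<epsilon> * (1 - 1 / 2 ^ Suc (Suc m))" by (simp add: algebra_simps)
    qed auto
    moreover have "smooth_on UNIV (\<lambda>z. G z + E' z)" by (rule smooth_on_add[OF open_UNIV G(1) E'(1)])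
    ultimately have "inv (Suc m) ?st'" unfolding inv_def using E' G(2) by simp
    moreover have "norm (E' z) \<le> \<mu> / 4" for z using Cbd_norm_le[OF E'(2), of z] unfolding \<epsilon>'_def by simp
    then have "step m st ?st'" unfolding step_def st using E'(9) by simp
    ultimately show "\<exists>st'. inv (Suc m) st' \<and> step m st st'" by blast
  qed
  then obtain st where st: "\<And>m. inv m (st m)" "\<And>m. step m (st m) (st (Suc m))" by blast
  define E where "E m = fst (st m)" for m
  define G where "G m = fst (snd (st m))" for m
  define P where "P m = fst (snd (snd (st m)))" for m
  define \<mu> where "\<mu> m = snd (snd (snd (st m)))" for m
  have stm: "st m = (E m, G m, P m, \<mu> m)" for m unfolding E_def G_def P_def \<mu>_def by simp
  have I: "smooth_on UNIV (E m)" "Cbd (m + k) UNIV (\<epsilon> / 2 ^ Suc m) (E m)" "smooth_on UNIV (G m)" "\<forall>z\<in>K. E m z = 0 \<and> G m z = 0"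
     "compact (P m)" "polynomially_convex (P m)" "0 < \<mu> m" "nbd (\<mu> m) (Im (G m)) \<subseteq> P m" "P m \<subseteq> nbd (1 / 2 ^ m) (Im (G m))" "\<mu> m \<le> 1 / 2 ^ m" for m
    using st(1)[of m] unfolding stm inv_def by auto
  have G0: "G 0 = E 0" using st(1)[of 0] unfolding stm inv_def by auto
  have St: "G (Suc m) z = G m z + E (Suc m) z" "norm (E (Suc m) z) \<le> \<mu> m / 4" "\<mu> (Suc m) \<le> \<mu> m / 2" for m z
    using st(2)[of m] unfolding stm step_def by auto
  define a where "a m = \<epsilon> / 2 ^ Suc m" for m
  have "(\<lambda>m. (1 / 2) ^ Suc m) sums (1::real)" by (rule power_half_series)
  then have asums: "a sums \<epsilon>" unfolding a_def using sums_mult[of "\<lambda>m. (1 / 2 :: real) ^ Suc m" 1 \<epsilon>] by (simp add: power_divide)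
  obtain F where F: "smooth_on UNIV F" "Cbd k UNIV \<epsilon> F" "\<And>z. F z = (\<Sum>m. E m z)"
  proof -
    have "summable a" "\<And>m. 0 \<le> a m" using asums \<epsilon>(1) unfolding a_def by (auto simp: sums_iff)
    then show ?thesis
      using smooth_on_uniform_limit[of E k a, OF I(1) I(2)[folded a_def]] that asums by (auto simp: sums_iff)
  qed
  have Gsum: "G m z = (\<Sum>l<Suc m. E l z)" for m z
  proof (induction m)
    case 0
    then show ?case using G0 by simp
  next
    case (Suc m)
    then show ?case using St(1) by simp
  qed
  have \<mu>dec: "\<mu> (m + l) \<le> \<mu> m / 2 ^ l" for m l
  proof (induction l)
    case (Suc l)
    then show ?case using St(3)[of "m + l"] by simp
  qed simp
  have FG: "norm (F z - G m z) \<le> \<mu> m / 2" for m z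
  proof -
    have "summable (\<lambda>m. E m z)"
      by (rule summable_comparison_test'[of a 0]) (use asums Cbd_norm_le[OF I(2)] in \<open>auto simp: sums_iff a_def\<close>)
    from suminf_split_initial_segment[OF this, of "Suc m"]
    have "F z - G m z = (\<Sum>l. E (l + Suc m) z)" unfolding F(3) Gsum by simp
    also have "norm \<dots> \<le> (\<Sum>l. \<mu> m / 4 * (1 / 2) ^ l)"
    proof (rule norm_suminf_le)
      show "summable (\<lambda>l. \<mu> m / 4 * (1 / 2) ^ l)" by (intro summable_mult summable_geometric) simp
      show "norm (E (l + Suc m) z) \<le> \<mu> m / 4 * (1 / 2) ^ l" for l
        using St(2)[where m = "m + l" and z = z] \<mu>dec[of m l] by (simp add: add.commute power_divide)
    qed
    also have "(\<Sum>l. \<mu> m / 4 * (1 / 2) ^ l) = \<mu> m / 4 * (\<Sum>l. (1 / 2) ^ l)"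
      by (rule suminf_mult) (simp add: summable_geometric)
    also have "\<dots> = \<mu> m / 2" by (simp add: suminf_geometric)
    finally show ?thesis .
  qed
  have FK: "F z = 0" if "z \<in> K" for z unfolding F(3) using I(4) that by simp
  have FP: "Im F \<subseteq> P m" for m
  proof
    fix w assume "w \<in> Im F"
    then have "\<exists>v\<in>Im (G m). dist v w < \<mu> m"
      unfolding Im_def
    proof
      assume "w \<in> K" then show "\<exists>v\<in>K \<union> (\<lambda>z. z + G m z) ` S. dist v w < \<mu> m" using I(7)[of m] by (intro bexI[of _ w]) auto
    next
      assume "w \<in> (\<lambda>z. z + F z) ` S"
      then obtain z where z: "z \<in> S" "w = z + F z" by blast
      have "dist (z + G m z) w < \<mu> m"
        unfolding z(2) using FG[of z m] I(7)[of m] by (simp add: dist_norm norm_minus_commute)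
      then show "\<exists>v\<in>K \<union> (\<lambda>z. z + G m z) ` S. dist v w < \<mu> m" using z(1) by blast
    qed
    then show "w \<in> P m" using I(8)[of m] unfolding mem_nbd[symmetric] by blast
  qed
  have GF: "Im (G m) \<subseteq> nbd (1 / 2 ^ m) (Im F)" for m
  proof
    fix w assume "w \<in> Im (G m)"
    then show "w \<in> nbd (1 / 2 ^ m) (Im F)"
      unfolding Im_def
    proof
      assume "w \<in> K" then show "w \<in> nbd (1 / 2 ^ m) (K \<union> (\<lambda>z. z + F z) ` S)" unfolding mem_nbd by (intro bexI[of _ w]) auto
    next
      assume "w \<in> (\<lambda>z. z + G m z) ` S"
      then obtain z where z: "z \<in> S" "w = z + G m z" by blast
      have "dist (z + F z) w < 1 / 2 ^ m"
        unfolding z(2) using FG[of z m] I(7)[of m] I(10)[of m] by (simp add: dist_norm norm_minus_commute)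
      then show "w \<in> nbd (1 / 2 ^ m) (K \<union> (\<lambda>z. z + F z) ` S)" unfolding mem_nbd using z(1) by blast
    qed
  qed
  have cI: "compact (Im F)" by (rule compIm[OF F(1)])
  have "polynomial_hull (Im F) \<subseteq> Im F"
  proof
    fix w assume w: "w \<in> polynomial_hull (Im F)"
    \<comment> \<open>\<open>P m\<close> is within \<open>1 / 2 ^ m\<close> of the image at stage
      \<open>m\<close>, which is within the same distance of the limit image.\<close>
    have near: "w \<in> nbd (2 / 2 ^ m) (Im F)" for m
    proof -
      have "polynomial_hull (Im F) \<subseteq> P m" by (rule polynomial_hull_minimal[OF cI I(5,6) FP])
      also have "\<dots> \<subseteq> nbd (2 / 2 ^ m) (Im F)" by (rule nbd_trans[OF I(9) GF]) simp
      finally show ?thesis using w by blast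
    qed
    have "w \<in> closure (Im F)"
      unfolding closure_approachable
    proof (intro allI impI)
      fix e :: real assume "e > 0"
      then obtain m where m: "(1 / 2) ^ m < e / 2" using real_arch_pow_inv[of "e / 2" "1 / 2"] by auto
      obtain v where "v \<in> Im F" "dist v w < 2 / 2 ^ m" using near[of m] unfolding mem_nbd by blast
      then show "\<exists>y\<in>Im F. dist y w < e" using m by (intro bexI[of _ v]) (auto simp: power_divide)
    qed
    then show "w \<in> Im F" using cI by (simp add: compact_imp_closed)
  qed
  then have "polynomial_hull (Im F) = Im F" using subset_polynomial_hull[OF cI] by blast
  then show ?thesis using that F(1,2) FK unfolding Im_def S_def by blast
qed

section \<open>Inverting small perturbations of the identity\<close>

text \<open>Stated for quotients from the right, which can be kept inside a half-space at boundary
  points.\<close>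

lemma dd_limit:
  assumes "f differentiable (at x)"
  shows "((\<lambda>t. (f (x + t *\<^sub>R v) - f x) /\<^sub>R t) \<longlongrightarrow> dd v f x) (at_right 0)"
proof -
  have "((\<lambda>t. f (x + t *\<^sub>R v)) has_derivative (\<lambda>t. dd (t *\<^sub>R v) f x)) (at 0)"
  proof (rule has_derivative_compose[where s = UNIV and f = "\<lambda>t. x + t *\<^sub>R v" and g = f])
    show "((\<lambda>t. x + t *\<^sub>R v) has_derivative (\<lambda>t. t *\<^sub>R v)) (at 0)"
      by (auto intro!: derivative_eq_intros)
    show "(f has_derivative (\<lambda>v. dd v f x)) (at (x + 0 *\<^sub>R v))" using has_derivative_dd[OF assms] by simp
  qed
  moreover have "dd (t *\<^sub>R v) f x = t *\<^sub>R dd v f x" for t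
    by (rule linear_scale[OF has_derivative_linear[OF has_derivative_dd[OF assms]]])
  ultimately have "((\<lambda>t. f (x + t *\<^sub>R v)) has_derivative (\<lambda>t. t *\<^sub>R dd v f x)) (at 0)" by simp
  then have lim: "(\<lambda>t. norm (f (x + t *\<^sub>R v) - f x - t *\<^sub>R dd v f x) / norm t) \<midarrow>0\<rightarrow> 0"
    unfolding has_derivative_at by simp
  have "((\<lambda>t. (f (x + t *\<^sub>R v) - f x) /\<^sub>R t - dd v f x) \<longlongrightarrow> 0) (at_right 0)"
  proof (rule Lim_null_comparison[OF _ tendsto_mono[OF at_le[OF subset_UNIV] lim]])
    show "\<forall>\<^sub>F t in at_right 0. norm ((f (x + t *\<^sub>R v) - f x) /\<^sub>R t - dd v f x)
        \<le> norm (f (x + t *\<^sub>R v) - f x - t *\<^sub>R dd v f x) / norm t"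
      unfolding eventually_at_right_field
    proof (intro exI[of _ 1] conjI allI impI)
      fix t :: real assume "0 < t"
      then have "(f (x + t *\<^sub>R v) - f x) /\<^sub>R t - dd v f x = (1 / t) *\<^sub>R (f (x + t *\<^sub>R v) - f x - t *\<^sub>R dd v f x)"
        by (simp add: scaleR_diff_right divide_inverse)
      then show "norm ((f (x + t *\<^sub>R v) - f x) /\<^sub>R t - dd v f x) \<le> norm (f (x + t *\<^sub>R v) - f x - t *\<^sub>R dd v f x) / norm t"
        by simp
    qed simp
  qed
  then show ?thesis by (rule LIM_zero_cancel)
qed

lemma norm_dd_le_Lipschitz:
  fixes L :: real
  assumes "f differentiable (at x)" "\<And>x y. norm (f x - f y) \<le> L * norm (x - y)"
  shows "norm (dd v f x) \<le> L * norm v"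
proof (rule tendsto_upperbound[OF tendsto_norm[OF dd_limit[OF assms(1)]]])
  show "\<forall>\<^sub>F t in at_right 0. norm ((f (x + t *\<^sub>R v) - f x) /\<^sub>R t) \<le> L * norm v"
    unfolding eventually_at_right_field
  proof (intro exI[of _ 1] conjI allI impI)
    fix t :: real assume t: "0 < t"
    then show "norm ((f (x + t *\<^sub>R v) - f x) /\<^sub>R t) \<le> L * norm v"
      using assms(2)[of "x + t *\<^sub>R v" x] by (simp add: divide_simps mult_ac)
  qed simp
qed simp

lemma smooth_on_det:
  fixes A :: "'a::euclidean_space \<Rightarrow> real ^ 'n ^ 'n"
  assumes "open U" "\<And>i j. smooth_on U (\<lambda>x. A x $ i $ j)" shows "smooth_on U (\<lambda>x. det (A x))"
  unfolding det_def by (intro smooth_on_sum smooth_on_mult smooth_on_const smooth_on_prod assms)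

lemma smooth_on_vec:
  fixes f :: "'a::euclidean_space \<Rightarrow> 'b::euclidean_space ^ 'n"
  assumes "open U" "\<And>i. smooth_on U (\<lambda>x. f x $ i)" shows "smooth_on U f"
proof (rule smooth_on_componentwise[OF assms(1)])
  fix b :: "'b ^ 'n" assume "b \<in> Basis"
  then obtain i c where b: "b = axis i c" unfolding Basis_vec_def by blast
  show "smooth_on U (\<lambda>x. f x \<bullet> b)"
    unfolding b inner_axis by (rule smooth_on_bilinear[OF assms(1) bounded_bilinear_inner assms(2) smooth_on_const])
qed

text \<open>By Cramer's rule the solution is a quotient of determinants in the entries of
  \<open>A\<close> and \<open>b\<close>.\<close>

lemma smooth_on_linear_solution:
  fixes A :: "'a::euclidean_space \<Rightarrow> real ^ 'n ^ 'n"
  assumes U: "open U" and A: "\<And>i j. smooth_on U (\<lambda>x. A x $ i $ j)" and u: "\<And>x. x \<in> U \<Longrightarrow> A x *v u x = b" "\<And>x. x \<in> U \<Longrightarrow> det (A x) \<noteq> 0"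
  shows "smooth_on U u"
proof -
  let ?u = "\<lambda>x. \<chi> k. det (\<chi> i j. if j = k then b $ i else A x $ i $ j) / det (A x)"
  have "u x = ?u x" if "x \<in> U" for x using u[OF that] cramer by blast
  moreover have "smooth_on U ?u"
  proof (rule smooth_on_vec[OF U])
    fix k
    have "smooth_on U (\<lambda>x. det (\<chi> i j. if j = k then b $ i else A x $ i $ j))"
    proof (rule smooth_on_det[OF U])
      show "smooth_on U (\<lambda>x. (\<chi> i j. if j = k then b $ i else A x $ i $ j) $ i $ j)" for i j
        using A[of i j] smooth_on_const by (cases "j = k") simp_all
    qed
    then have "smooth_on U (\<lambda>x. det (\<chi> i j. if j = k then b $ i else A x $ i $ j) / det (A x))"
      by (rule smooth_on_divide[OF U _ smooth_on_det[OF U A] u(2)])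
    then show "smooth_on U (\<lambda>x. ?u x $ k)" by simp
  qed
  ultimately show ?thesis using smooth_on_cong[OF U, of u ?u] by blast
qed

text \<open>Since \<open>\<rho>\<close> is a contraction with factor 1/2, the inverse exists
  globally by a fixed point argument, without shrinking domains as in the local inverse function
  theorem.\<close>

lemma smooth_inverse_near_identity:
  fixes \<rho> :: "real ^ 'n \<Rightarrow> real ^ 'n"
  assumes sm: "smooth_on UNIV \<rho>" and lip: "\<And>x y. norm (\<rho> x - \<rho> y) \<le> 1/2 * norm (x - y)"
  obtains \<Psi> where "smooth_on UNIV \<Psi>" "\<And>x. \<Psi> x + \<rho> (\<Psi> x) = x" "\<And>x. \<Psi> (x + \<rho> x) = x"
proof -
  define \<Phi> where "\<Phi> x = x + \<rho> x" for x
  have ex: "\<exists>!x. y - \<rho> x = x" for y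
    by (rule banach_fix_type[of "1/2"]) (use lip in \<open>auto simp: dist_norm norm_minus_commute\<close>)
  then have "\<exists>x. \<Phi> x = y" for y unfolding \<Phi>_def by (metis diff_add_cancel)
  then obtain \<Psi> where \<Psi>: "\<And>y. \<Phi> (\<Psi> y) = y" by metis
  have exp: "norm (x - y) \<le> 2 * norm (\<Phi> x - \<Phi> y)" for x y
  proof -
    have "norm (x - y) \<le> norm (\<Phi> x - \<Phi> y) + norm (\<rho> x - \<rho> y)"
      using norm_triangle_ineq4[of "\<Phi> x - \<Phi> y" "\<rho> x - \<rho> y"] unfolding \<Phi>_def by (simp add: algebra_simps)
    then show ?thesis using lip[of x y] by simp
  qed
  then have inj: "\<Phi> x = \<Phi> y \<Longrightarrow> x = y" for x y by (metis cancel_comm_monoid_add_class.diff_cancel mult_zero_right norm_le_zero_iff norm_zero right_minus_eq)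
  have sm\<Phi>: "smooth_on UNIV \<Phi>" unfolding \<Phi>_def[abs_def]
    by (rule smooth_on_add[OF open_UNIV smooth_on_bounded_linear[OF bounded_linear_ident open_UNIV] sm])
  have der: "(\<Phi> has_derivative (\<lambda>v. dd v \<Phi> x)) (at x)" for x
    by (rule has_derivative_dd[OF smooth_on_imp_differentiable[OF sm\<Phi> UNIV_I]])
  have lin: "linear (\<lambda>v. dd v \<Phi> x)" for x by (rule has_derivative_linear[OF der])
  define A where "A x = matrix (\<lambda>v. dd v \<Phi> x)" for x
  have A: "A x *v v = dd v \<Phi> x" for x v unfolding A_def using matrix_works[OF lin[unfolded linear_matrix_vector_mul_eq[symmetric]]]
    by (simp add: matrix_works lin)
  have Anth: "A x $ i $ j = dd (axis j 1) \<Phi> x $ i" for x i j unfolding A_def matrix_def by simp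
  have smA: "smooth_on UNIV (\<lambda>x. A x $ i $ j)" for i j
    unfolding Anth by (rule smooth_on_vec_nth[OF open_UNIV smooth_on_dd[OF sm\<Phi>]]) (auto simp: Basis_vec_def)
  \<comment> \<open>A kernel vector satisfies \<open>v = - dd v \<rho> x\<close>, whose norm is at
    most half of that of \<open>v\<close>.\<close>
  have inv: "invertible (A x)" for x
  proof -
    have "inj ((*v) (A x))"
    proof (rule linear_injective_0[THEN iffD2, OF matrix_vector_mul_linear], intro allI impI)
      fix v assume "A x *v v = 0"
      moreover have "dd v \<Phi> x = v + dd v \<rho> x"
        unfolding \<Phi>_def[abs_def] by (intro dd_eqI has_derivative_add has_derivative_ident has_derivative_dd smooth_on_imp_differentiable[OF sm UNIV_I])
      ultimately have "v = - dd v \<rho> x" using A by (simp add: eq_neg_iff_add_eq_0)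
      then have "norm v = norm (dd v \<rho> x)" by (metis norm_minus_cancel)
      moreover have "norm (dd v \<rho> x) \<le> 1/2 * norm v"
        by (rule norm_dd_le_Lipschitz[OF smooth_on_imp_differentiable[OF sm UNIV_I] lip])
      ultimately show "v = 0" by simp
    qed
    then show ?thesis by (simp add: invertible_left_inverse matrix_left_invertible_injective)
  qed
  have Ai: "A x *v (matrix_inv (A x) *v b) = b" "matrix_inv (A x) *v (A x *v b) = b" for x b
    using someI_ex[OF inv[unfolded invertible_def, of x]] unfolding matrix_inv_def by (simp_all add: matrix_vector_mul_assoc)
  have smN: "smooth_on UNIV (\<lambda>x. matrix_inv (A x) *v b)" for b
    by (rule smooth_on_linear_solution[where A = A and b = b, OF open_UNIV smA Ai(1)]) (use inv in \<open>simp add: invertible_det_nz\<close>)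
  have cont: "continuous (at y) \<Psi>" for y
  proof -
    have "dist (\<Psi> y') (\<Psi> y) \<le> 2 * dist y' y" for y' using exp[of "\<Psi> y'" "\<Psi> y"] \<Psi> unfolding dist_norm by simp
    then have "dist (\<Psi> y') (\<Psi> y) < e" if "dist y' y < e / 2" for y' e
      using that by (smt (verit) field_sum_of_halves)
    then show ?thesis unfolding continuous_at_eps_delta by (metis half_gt_zero)
  qed
  have der\<Psi>: "(\<Psi> has_derivative (\<lambda>b. matrix_inv (A (\<Psi> y)) *v b)) (at y)" for y
    by (rule has_derivative_inverse_basic[where f = \<Phi> and T = UNIV, OF der _ _ cont])
      (use Ai A \<Psi> in \<open>auto simp: fun_eq_iff intro: matrix_vector_mul_bounded_linear\<close>)
  \<comment> \<open>The derivative of \<open>\<Psi>\<close> is a smooth function of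
    \<open>\<Psi>\<close> itself, so each order of differentiability yields the next.\<close>
  have "Ck k UNIV \<Psi>" for k
  proof (induction k)
    case 0
    then show ?case using cont by (simp add: continuous_at_imp_continuous_on)
  next
    case (Suc k)
    have "Ck k UNIV (dd b \<Psi>)" for b
    proof -
      have "dd b \<Psi> = (\<lambda>y. matrix_inv (A (\<Psi> y)) *v b)" using dd_eqI[OF der\<Psi>] by blast
      then show ?thesis using Ck_compose[OF open_UNIV open_UNIV _ Suc, of "\<lambda>x. matrix_inv (A x) *v b"] smN[of b] unfolding smooth_on_def by simp
    qed
    then show ?case using differentiableI[OF der\<Psi>] by simp
  qed
  then have "smooth_on UNIV \<Psi>" unfolding smooth_on_def by blast
  moreover have "\<Psi> (x + \<rho> x) = x" for x using \<Psi>[of "\<Phi> x"] inj unfolding \<Phi>_def by blast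
  ultimately show ?thesis using that \<Psi> unfolding \<Phi>_def by blast
qed

section \<open>Totally real cells\<close>

lemma compact_smooth_on_Cbd:
  assumes "compact B" "B \<subseteq> U" "smooth_on U f" shows "\<exists>M>0. Cbd k B M f"
  using assms(3)
proof (induction k arbitrary: f)
  case 0
  obtain M where "M > 0" "\<And>x. x \<in> B \<Longrightarrow> norm (f x) \<le> M"
    by (rule compact_bound_pos[OF assms(1) continuous_on_subset[OF smooth_on_imp_continuous_on[OF 0] assms(2)]], rule that, assumption, blast)
  then show ?case by auto
next
  case (Suc k)
  obtain M where M: "M > 0" "\<And>x. x \<in> B \<Longrightarrow> norm (f x) \<le> M"
    by (rule compact_bound_pos[OF assms(1) continuous_on_subset[OF smooth_on_imp_continuous_on[OF Suc.prems] assms(2)]], rule that, assumption, blast)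
  have "\<forall>b\<in>Basis. \<exists>N>0. Cbd k B N (dd b f)" using Suc.IH smooth_on_dd[OF Suc.prems] by blast
  then obtain N where N: "\<And>b. b \<in> Basis \<Longrightarrow> 0 < N b" "\<And>b. b \<in> Basis \<Longrightarrow> Cbd k B (N b) (dd b f)" by metis
  have "N b \<le> M + sum N Basis" if "b \<in> Basis" for b
    using member_le_sum[OF that, of N] N(1) M(1) by (force intro: less_imp_le)
  moreover have "0 \<le> sum N Basis" using N(1) by (intro sum_nonneg) (auto intro: less_imp_le)
  ultimately have "Cbd (Suc k) B (M + sum N Basis) f"
    using M Cbd_mono[OF N(2)] by (simp add: add_increasing2)
  moreover have "M + sum N Basis > 0" using M(1) \<open>0 \<le> sum N Basis\<close> by simp
  ultimately show ?case by blast
qed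

text \<open>As \<open>R\<close> vanishes to first order at \<open>a\<close>, on a ball of radius
  \<open>2 * r\<close> it has Lipschitz constant \<open>\<eta>'\<close> and size at most
  \<open>\<eta>' * (2 * r)\<close>. A cutoff at this scale has slope \<open>c / r\<close>, so the
  product has Lipschitz constant \<open>\<eta>' * (1 + 2 * c)\<close>, independently of
  \<open>r\<close>.\<close>

lemma smooth_remainder_cutoff:
  fixes R :: "'a::euclidean_space \<Rightarrow> 'b::real_normed_vector" and \<eta> :: real
  assumes V: "open V" "a \<in> V" and R: "smooth_on V R" "R a = 0" "\<And>b. b \<in> Basis \<Longrightarrow> dd b R a = 0" and \<eta>: "\<eta> > 0"
  obtains r \<psi> where "r > 0" "cball a r \<subseteq> V" "smooth_on UNIV \<psi>" "\<And>y. y \<in> cball a r \<Longrightarrow> \<psi> y = R y"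
    "\<And>x y. norm (\<psi> x - \<psi> y) \<le> \<eta> * norm (x - y)"
proof -
  obtain \<theta> :: "'a \<Rightarrow> real" where \<theta>: "smooth_on UNIV \<theta>" "\<And>x. 0 \<le> \<theta> x" "\<And>x. \<theta> x \<le> 1"
    "\<And>x. dist 0 x \<le> 1 \<Longrightarrow> \<theta> x = 1" "\<And>x. 2 * 1 \<le> dist 0 x \<Longrightarrow> \<theta> x = 0"
    by (rule smooth_bump_ball[of 1 "0 :: 'a"]) auto
  obtain M where "M > 0" "Cbd 1 (cball 0 2) M \<theta>"
    using compact_smooth_on_Cbd[OF compact_cball subset_UNIV \<theta>(1)] by blast
  then have "Cbd 1 UNIV M \<theta>"
    by (intro smooth_on_cutoff_Cbd_UNIV[of "cball 0 2"]) (auto intro: \<theta>(5))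
  then have lip\<theta>: "norm (\<theta> x - \<theta> y) \<le> (DIM('a) * M) * norm (x - y)" for x y by (rule Cbd_imp_Lipschitz[OF \<theta>(1)])
  define D where "D = real (DIM('a))"
  have D: "D \<ge> 1" unfolding D_def by (simp add: DIM_ge_Suc0 Suc_leI)
  define c where "c = D * M"
  have c: "c > 0" using D \<open>M > 0\<close> unfolding c_def by simp
  define \<eta>' where "\<eta>' = \<eta> / (1 + 2 * c)"
  have \<eta>': "\<eta>' > 0" using \<eta> c unfolding \<eta>'_def by simp
  have "\<forall>b\<in>Basis. \<exists>\<delta>>0. \<forall>x. dist x a < \<delta> \<longrightarrow> norm (dd b R x) \<le> \<eta>' / D"
  proof
    fix b :: 'a assume b: "b \<in> Basis"
    have "isCont (dd b R) a"
      using smooth_on_imp_continuous_on[OF smooth_on_dd[OF R(1) b]] V continuous_on_eq_continuous_at by blast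
    then obtain \<delta> where "\<delta> > 0" "\<And>x. dist x a < \<delta> \<Longrightarrow> dist (dd b R x) (dd b R a) < \<eta>' / D"
      unfolding continuous_at_eps_delta using \<eta>' D by (metis divide_pos_pos less_le_trans zero_less_one)
    then show "\<exists>\<delta>>0. \<forall>x. dist x a < \<delta> \<longrightarrow> norm (dd b R x) \<le> \<eta>' / D"
      using R(3)[OF b] by (auto simp: less_imp_le intro!: exI[of _ \<delta>])
  qed
  then obtain \<delta> where \<delta>: "\<And>b. b \<in> Basis \<Longrightarrow> \<delta> b > 0" "\<And>b x. b \<in> Basis \<Longrightarrow> dist x a < \<delta> b \<Longrightarrow> norm (dd b R x) \<le> \<eta>' / D"
    by metis
  obtain e where e: "e > 0" "ball a e \<subseteq> V" using V open_contains_ball by blast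
  define r where "r = min e (Min (\<delta> ` Basis)) / 3"
  have r: "r > 0" unfolding r_def using e(1) \<delta>(1) by (simp add: Min_gr_iff)
  have re: "3 * r \<le> e" and r\<delta>: "3 * r \<le> \<delta> b" if "b \<in> Basis" for b
    using that by (auto simp: r_def min_le_iff_disj)
  have re: "3 * r \<le> e" by (auto simp: r_def)
  have BV: "ball a (3 * r) \<subseteq> V" using e(2) re by auto
  have lipR: "norm (R x - R y) \<le> \<eta>' * norm (x - y)" if "x \<in> ball a (3 * r)" "y \<in> ball a (3 * r)" for x y
  proof -
    have "norm (R x - R y) \<le> (DIM('a) * (\<eta>' / D)) * norm (x - y)"
    proof (rule convex_dd_bound_Lipschitz[OF convex_ball _ _ that])
      show "R differentiable at x" if "x \<in> ball a (3 * r)" for x using smooth_on_imp_differentiable[OF R(1)] BV that by blast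
      show "norm (dd b R x) \<le> \<eta>' / D" if "x \<in> ball a (3 * r)" "b \<in> Basis" for x b
        using \<delta>(2)[OF that(2)] r\<delta>[OF that(2)] that(1) by (simp add: dist_commute)
    qed
    then show ?thesis using D unfolding D_def[symmetric] by simp
  qed
  define \<chi>' where "\<chi>' y = \<theta> ((y - a) /\<^sub>R r)" for y
  have sm\<chi>: "smooth_on UNIV \<chi>'" unfolding \<chi>'_def[abs_def]
    by (rule smooth_on_compose[OF open_UNIV open_UNIV \<theta>(1)], rule smooth_on_scaleR[OF open_UNIV smooth_on_const],
      rule smooth_on_diff[OF open_UNIV smooth_on_bounded_linear[OF bounded_linear_ident open_UNIV] smooth_on_const]) auto
  have lip\<chi>: "\<bar>\<chi>' x - \<chi>' y\<bar> \<le> c / r * norm (x - y)" for x y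
  proof -
    have "(x - a) /\<^sub>R r - (y - a) /\<^sub>R r = (x - y) /\<^sub>R r" by (simp add: scaleR_diff_right)
    then show ?thesis using lip\<theta>[of "(x - a) /\<^sub>R r" "(y - a) /\<^sub>R r"] r unfolding \<chi>'_def c_def D_def by (simp add: divide_inverse mult_ac)
  qed
  have \<chi>1: "\<chi>' y = 1" if "y \<in> cball a r" for y
    unfolding \<chi>'_def using that r by (intro \<theta>(4)) (simp add: dist_norm norm_minus_commute divide_simps)
  have \<chi>0: "\<chi>' y = 0" if "y \<notin> ball a (2 * r)" for y
    unfolding \<chi>'_def using that r by (intro \<theta>(5)) (simp add: dist_norm norm_minus_commute divide_simps)
  define \<psi> where "\<psi> y = (if y \<in> ball a (3 * r) then \<chi>' y *\<^sub>R R y else 0)" for y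
  have \<psi>0: "\<psi> y = 0" if "y \<notin> ball a (2 * r)" for y unfolding \<psi>_def using \<chi>0[OF that] by simp
  have Rbd: "norm (R y) \<le> \<eta>' * (2 * r)" if "y \<in> ball a (2 * r)" for y
  proof -
    have "norm (R y - R a) \<le> \<eta>' * norm (y - a)" by (rule lipR) (use that r in auto)
    also have "\<dots> \<le> \<eta>' * (2 * r)" using \<eta>' that by (intro mult_left_mono) (auto simp: dist_norm norm_minus_commute)
    finally show ?thesis using R(2) by simp
  qed
  have half: "norm (\<psi> x - \<psi> y) \<le> \<eta> * norm (x - y)" if x: "x \<in> ball a (2 * r)" for x y
  proof -
    have "norm (\<psi> x - \<psi> y) \<le> \<eta>' * norm (x - y) + c / r * norm (x - y) * (\<eta>' * (2 * r))"
    proof (cases "y \<in> ball a (2 * r)")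
      case True
      then have y: "y \<in> ball a (3 * r)" and x': "x \<in> ball a (3 * r)" using x r by auto
      then have "\<psi> x - \<psi> y = \<chi>' y *\<^sub>R (R x - R y) + (\<chi>' x - \<chi>' y) *\<^sub>R R x"
        unfolding \<psi>_def by (simp add: algebra_simps)
      also have "norm \<dots> \<le> \<chi>' y * norm (R x - R y) + \<bar>\<chi>' x - \<chi>' y\<bar> * norm (R x)"
        using \<theta>(2) by (intro norm_triangle_le add_mono) (auto simp: \<chi>'_def)
      finally have a: "norm (\<psi> x - \<psi> y) \<le> \<chi>' y * norm (R x - R y) + \<bar>\<chi>' x - \<chi>' y\<bar> * norm (R x)" .
      have "\<chi>' y * norm (R x - R y) \<le> 1 * (\<eta>' * norm (x - y))"
        using \<theta>(2,3) lipR[OF x' y] by (intro mult_mono) (auto simp: \<chi>'_def)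
      moreover have "\<bar>\<chi>' x - \<chi>' y\<bar> * norm (R x) \<le> c / r * norm (x - y) * (\<eta>' * (2 * r))"
        using c r by (intro mult_mono lip\<chi> Rbd x) auto
      ultimately show ?thesis using a by simp
    next
      case False
      have "\<psi> x - \<psi> y = (\<chi>' x - \<chi>' y) *\<^sub>R R x" using \<psi>0[OF False] \<chi>0[OF False] x r unfolding \<psi>_def by simp
      then have "norm (\<psi> x - \<psi> y) = \<bar>\<chi>' x - \<chi>' y\<bar> * norm (R x)" by simp
      also have "\<dots> \<le> c / r * norm (x - y) * (\<eta>' * (2 * r))" using c r by (intro mult_mono lip\<chi> Rbd x) auto
      finally show ?thesis using \<eta>' by (simp add: add_increasing)
    qed
    also have "\<dots> = \<eta>' * (1 + 2 * c) * norm (x - y)" using r by (simp add: field_simps)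
    also have "\<eta>' * (1 + 2 * c) = \<eta>" unfolding \<eta>'_def using c by simp
    finally show ?thesis .
  qed
  have lip: "norm (\<psi> x - \<psi> y) \<le> \<eta> * norm (x - y)" for x y
  proof (cases "x \<in> ball a (2 * r) \<or> y \<in> ball a (2 * r)")
    case True
    then show ?thesis using half[of x y] half[of y x] by (auto simp: norm_minus_commute)
  next
    case False
    then show ?thesis using \<psi>0 \<eta> by simp
  qed
  have sm\<psi>: "smooth_on UNIV \<psi>"
  proof (rule smooth_on_UN)
    fix x :: 'a
    show "\<exists>W. open W \<and> x \<in> W \<and> smooth_on W \<psi>"
    proof (cases "x \<in> ball a (3 * r)")
      case True
      have "smooth_on (ball a (3 * r)) (\<lambda>y. \<chi>' y *\<^sub>R R y)"
        by (rule smooth_on_scaleR[OF open_ball smooth_on_subset[OF sm\<chi> subset_UNIV] smooth_on_subset[OF R(1) BV]])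
      then have "smooth_on (ball a (3 * r)) \<psi>"
        using smooth_on_cong[OF open_ball, of a "3 * r" \<psi> "\<lambda>y. \<chi>' y *\<^sub>R R y"] unfolding \<psi>_def by simp
      then show ?thesis using True open_ball by blast
    next
      case False
      have op: "open (- cball a (2 * r))" by (simp add: open_Compl)
      have "smooth_on (- cball a (2 * r)) \<psi>"
        using smooth_on_cong[OF op, of \<psi> "\<lambda>y. 0"] \<psi>0 smooth_on_const by fastforce
      moreover have "x \<in> - cball a (2 * r)" using False r by simp
      ultimately show ?thesis using op by blast
    qed
  qed
  have "\<psi> y = R y" if "y \<in> cball a r" for y using \<chi>1[OF that] that r unfolding \<psi>_def by simp
  moreover have "cball a r \<subseteq> V" using BV r by force
  ultimately show ?thesis using that r sm\<psi> lip by blast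
qed

lemma linear_complex_matrix_mult: "linear ((*v) (A :: complex ^ 'n::finite ^ 'm::finite))"
  by (rule linearI) (auto simp: vec_eq_iff matrix_vector_mult_def scaleR_sum_right distrib_left sum.distrib)

lemma linear_Re_vec: "linear Re_vec"
  by (rule linearI) (auto simp: vec_eq_iff)

lemma is_cell_subset:
  fixes T :: "(complex ^ 'n::finite) set"
  assumes "is_cell \<kappa> T" "compact T'" "T' \<subseteq> T" "0 \<le> \<kappa>'" "\<kappa>' \<le> \<kappa>" shows "is_cell \<kappa>' T'"
proof -
  obtain \<Lambda> J m e \<nu> j s r C L where *: "J \<noteq> UNIV" "tr_frame \<Lambda> J m e \<nu> j" "smooth_on UNIV s" "tr_map \<Lambda> J (1/20) C s" "C > 0"
    "bounded_linear (r :: complex ^ 'n \<Rightarrow> real ^ 'n)" "\<forall>z\<in>T. s (r z) = z" "\<forall>z. norm (\<Lambda> *v z) \<le> L * norm z" "0 \<le> L" "\<kappa> * L * C \<le> 1/20"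
    using assms(1) unfolding is_cell_def by (elim exE conjE) (rule that)
  have "\<kappa>' * L * C \<le> \<kappa> * L * C" using * assms by (intro mult_right_mono) auto
  then have "\<kappa>' * L * C \<le> 1/20" using *(10) by simp
  moreover have "\<forall>z\<in>T'. s (r z) = z" using *(7) assms(3) by blast
  ultimately show ?thesis unfolding is_cell_def using * assms(2,4)
    by (intro exI[of _ \<Lambda>] exI[of _ J] exI[of _ m] exI[of _ e] exI[of _ \<nu>] exI[of _ j] exI[of _ s] exI[of _ r] exI[of _ C] exI[of _ L]) auto
qed

text \<open>The map is split into its affine part at \<open>a\<close> and a remainder with small
  Lipschitz constant, then reparametrized by \<open>Re_vec (\<Lambda> *v z)\<close>. In the new
  parameter the real part of \<open>\<Lambda>\<close> inverts \<open>s\<close> exactly, up to the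
  projection onto the coordinate subspace, which supplies the linear map \<open>r\<close> and leaves
  only an imaginary error.\<close>

lemma totally_real_cell:
  fixes h :: "real ^ 'n::finite \<Rightarrow> complex ^ 'n"
  assumes V: "open V" "a \<in> V" "smooth_on V h" and hJ: "\<And>y. h (coord_proj J y) = h y" and aJ: "coord_proj J a = a"
    and J: "J \<noteq> UNIV" and fr: "tr_frame \<Lambda> J m e \<nu> j" and D: "\<And>i. i \<in> J \<Longrightarrow> \<Lambda> *v dd (axis i 1) h a = axis i 1"
  obtains r \<kappa> where "r > 0" "\<kappa> > 0" "cball a r \<subseteq> V"
    "\<And>T. compact T \<Longrightarrow> T \<subseteq> h ` (cball a r \<inter> range (coord_proj J)) \<Longrightarrow> is_cell \<kappa> T"
proof -
  have \<Lambda>bl: "bounded_linear ((*v) \<Lambda>)" using linear_complex_matrix_mult by (simp add: linear_conv_bounded_linear)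
  have Rebl: "bounded_linear (Re_vec :: complex ^ 'n \<Rightarrow> _)" using linear_Re_vec by (simp add: linear_conv_bounded_linear)
  obtain L where L: "L > 0" "\<And>z. norm (\<Lambda> *v z) \<le> L * norm z"
    using bounded_linear.pos_bounded[OF \<Lambda>bl] by (auto simp: mult.commute)
  have \<Lambda>J: "(\<Lambda> *v z) $ i = 0" if "i \<notin> J" for z i using fr that unfolding tr_frame_def by blast
  have hd: "h differentiable (at a)" by (rule smooth_on_imp_differentiable[OF V(3,2)])
  define \<iota> where "\<iota> v = dd v h a" for v
  have \<iota>d: "(h has_derivative \<iota>) (at a)" unfolding \<iota>_def by (rule has_derivative_dd[OF hd])
  have \<iota>bl: "bounded_linear \<iota>" by (rule has_derivative_bounded_linear[OF \<iota>d])
  have \<iota>J: "\<iota> (coord_proj J v) = \<iota> v" for v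
  proof -
    have "((\<lambda>y. h (coord_proj J y)) has_derivative (\<lambda>v. \<iota> (coord_proj J v))) (at a)"
      by (rule has_derivative_compose[OF bounded_linear_imp_has_derivative[OF bounded_linear_coord_proj]]) (simp add: aJ \<iota>d)
    then show ?thesis unfolding hJ using has_derivative_unique[OF _ \<iota>d] by metis
  qed
  have \<Lambda>\<iota>: "\<Lambda> *v \<iota> v = cvec (coord_proj J v)" for v
  proof -
    have cp: "coord_proj J v = (\<Sum>i\<in>J. v $ i *\<^sub>R axis i 1)"
      by (simp add: vec_eq_iff axis_def if_distrib cong: if_cong)
    have "\<Lambda> *v \<iota> (coord_proj J v) = (\<Sum>i\<in>J. v $ i *\<^sub>R (\<Lambda> *v \<iota> (axis i 1)))"
      unfolding cp by (simp add: linear_sum[OF bounded_linear.linear[OF \<iota>bl]] linear_sum[OF linear_complex_matrix_mult]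
        linear_scale[OF bounded_linear.linear[OF \<iota>bl]] linear_scale[OF linear_complex_matrix_mult])
    also have "\<dots> = (\<Sum>i\<in>J. v $ i *\<^sub>R axis i 1)" using D unfolding \<iota>_def by simp
    also have "\<dots> = cvec (coord_proj J v)"
      by (simp add: vec_eq_iff axis_def if_distrib scaleR_conv_of_real[where 'a = complex] cong: if_cong)
    finally show ?thesis unfolding \<iota>J .
  qed
  \<comment> \<open>The final error is twice the norm of \<open>\<omega>\<close>, which is at most
    \<open>1/80 * norm \<delta>\<close>, and \<open>\<delta>\<close> is at most twice as long as
    \<open>\<Delta>\<close>: in total 1/20.\<close>
  define \<eta> where "\<eta> = 1 / (80 * (L + 1))"
  have \<eta>: "\<eta> > 0" "\<eta> \<le> 1" "L * \<eta> \<le> 1/80" unfolding \<eta>_def using L(1) by (auto simp: field_simps)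
  define R where "R y = h y - (h a + \<iota> (y - a))" for y
  have smaff: "smooth_on UNIV (\<lambda>y. h a + \<iota> (y - a))"
    by (intro smooth_on_add[OF open_UNIV smooth_on_const] smooth_on_bounded_linear_compose[OF open_UNIV \<iota>bl]
        smooth_on_diff[OF open_UNIV smooth_on_bounded_linear[OF bounded_linear_ident open_UNIV] smooth_on_const])
  have "dd b R a = 0" for b
  proof -
    have "(R has_derivative (\<lambda>v. \<iota> v - (0 + \<iota> (v - 0)))) (at a)" unfolding R_def
      by (intro has_derivative_diff has_derivative_add has_derivative_const bounded_linear.has_derivative[OF \<iota>bl] has_derivative_ident \<iota>d)
    then show ?thesis using dd_eqI by fastforce
  qed
  moreover have "smooth_on V R" unfolding R_def[abs_def]
    by (rule smooth_on_diff[OF V(1,3) smooth_on_subset[OF smaff subset_UNIV]])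
  moreover have "R a = 0" unfolding R_def using linear_0[OF bounded_linear.linear[OF \<iota>bl]] by simp
  ultimately obtain r \<psi> where r: "r > 0" "cball a r \<subseteq> V" and \<psi>: "smooth_on UNIV \<psi>" "\<And>y. y \<in> cball a r \<Longrightarrow> \<psi> y = R y"
    "\<And>x y. norm (\<psi> x - \<psi> y) \<le> \<eta> * norm (x - y)"
    using smooth_remainder_cutoff[OF V(1,2) _ _ _ \<eta>(1)] by metis
  define \<rho> where "\<rho> y = Re_vec (\<Lambda> *v \<psi> (coord_proj J y))" for y
  have \<rho>lip: "norm (\<rho> x - \<rho> y) \<le> 1/2 * norm (x - y)" for x y
  proof -
    have "norm (\<rho> x - \<rho> y) \<le> norm (\<Lambda> *v (\<psi> (coord_proj J x) - \<psi> (coord_proj J y)))"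
      unfolding \<rho>_def Re_vec_diff[symmetric] linear_diff[OF linear_complex_matrix_mult, symmetric] by (rule norm_Re_vec_le)
    also have "\<dots> \<le> L * (\<eta> * norm (coord_proj J x - coord_proj J y))"
      using L by (intro order_trans[OF L(2)] mult_left_mono \<psi>(3)) auto
    also have "\<dots> \<le> 1/80 * norm (coord_proj J x - coord_proj J y)"
      using mult_right_mono[OF \<eta>(3), of "norm (coord_proj J x - coord_proj J y)"] by simp
    also have "\<dots> \<le> 1/80 * norm (x - y)"
      unfolding linear_diff[OF linear_coord_proj, symmetric] using norm_coord_proj_le[of J "x - y"] by simp
    also have "\<dots> \<le> 1/2 * norm (x - y)" by simp
    finally show ?thesis .
  qed
  have sm\<rho>: "smooth_on UNIV \<rho>" unfolding \<rho>_def[abs_def]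
    by (rule smooth_on_bounded_linear_compose[OF open_UNIV Rebl], rule smooth_on_bounded_linear_compose[OF open_UNIV \<Lambda>bl],
      rule smooth_on_compose[OF open_UNIV open_UNIV \<psi>(1) smooth_on_bounded_linear[OF bounded_linear_coord_proj open_UNIV]]) auto
  obtain \<Psi> where \<Psi>: "smooth_on UNIV \<Psi>" "\<And>x. \<Psi> x + \<rho> (\<Psi> x) = x" "\<And>x. \<Psi> (x + \<rho> x) = x"
    using smooth_inverse_near_identity[OF sm\<rho> \<rho>lip] by metis
  have \<rho>J: "coord_proj J (\<rho> y) = \<rho> y" for y using \<Lambda>J unfolding \<rho>_def by (simp add: vec_eq_iff)
  have \<Psi>J: "coord_proj J (\<Psi> x) = \<Psi> x" if "coord_proj J x = x" for x
  proof -
    have eq: "\<Psi> x = x - \<rho> (\<Psi> x)" using \<Psi>(2)[of x] by (simp add: eq_diff_eq)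
    have "coord_proj J (\<Psi> x) = coord_proj J x - coord_proj J (\<rho> (\<Psi> x))"
      by (subst eq) (rule linear_diff[OF linear_coord_proj])
    then show ?thesis using that \<rho>J eq by simp
  qed
  define b where "b = Re_vec (\<Lambda> *v h a) - a"
  have bJ: "coord_proj J b = b"
    unfolding b_def linear_diff[OF linear_coord_proj] aJ using \<Lambda>J by (simp add: vec_eq_iff)
  define g where "g y = h a + \<iota> (y - a) + \<psi> y" for y
  \<comment> \<open>On the coordinate subspace the real part of \<open>\<Lambda> *v g y\<close> is
    \<open>b + (y + \<rho> y)\<close>; \<open>Y\<close> inverts this map.\<close>
  define Y where "Y x = \<Psi> (coord_proj J x - b)" for x
  have YJ: "coord_proj J (Y x) = Y x" for x unfolding Y_def by (rule \<Psi>J) (simp add: linear_diff[OF linear_coord_proj] bJ)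
  define s where "s x = g (Y x)" for x
  obtain B where B: "B > 0" "\<And>v. norm (\<iota> v) \<le> B * norm v"
    using bounded_linear.pos_bounded[OF \<iota>bl] by (auto simp: mult.commute)
  define C where "C = 2 * (B + 1)"
  have C: "C > 0" unfolding C_def using B by simp
  define \<kappa> where "\<kappa> = 1 / (20 * (L + 1) * C)"
  have "\<kappa> * L * C = L / (L + 1) / 20" unfolding \<kappa>_def using C by simp
  moreover have "L / (L + 1) \<le> 1" using L(1) by simp
  ultimately have \<kappa>: "\<kappa> > 0" "\<kappa> * L * C \<le> 1/20" unfolding \<kappa>_def using L(1) C by auto
  have sms: "smooth_on UNIV s"
  proof -
    have smY: "smooth_on UNIV Y" unfolding Y_def[abs_def]
      by (rule smooth_on_compose[OF open_UNIV open_UNIV \<Psi>(1)],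
          rule smooth_on_diff[OF open_UNIV smooth_on_bounded_linear[OF bounded_linear_coord_proj open_UNIV] smooth_on_const]) auto
    have smg: "smooth_on UNIV g" unfolding g_def[abs_def] by (rule smooth_on_add[OF open_UNIV smaff \<psi>(1)])
    show ?thesis unfolding s_def[abs_def] by (rule smooth_on_compose[OF open_UNIV open_UNIV smg smY]) simp
  qed
  have gdiff: "g y - g y' = \<iota> (y - y') + (\<psi> y - \<psi> y')" for y y'
    unfolding g_def by (simp add: linear_diff[OF bounded_linear.linear[OF \<iota>bl]])
  have tr: "tr_map \<Lambda> J (1/20) C s"
    unfolding tr_map_def
  proof (intro conjI allI)
    fix x x'
    show "s (coord_proj J x) = s x" unfolding s_def Y_def by simp
    define \<Delta> where "\<Delta> = coord_proj J (x - x')"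
    define \<delta> where "\<delta> = Y x - Y x'"
    have cpY: "coord_proj J x = b + (Y x + \<rho> (Y x))" for x
      using \<Psi>(2)[of "coord_proj J x - b"] unfolding Y_def by simp
    have \<Delta>: "\<Delta> = \<delta> + (\<rho> (Y x) - \<rho> (Y x'))"
      unfolding \<Delta>_def \<delta>_def linear_diff[OF linear_coord_proj] using cpY[of x] cpY[of x'] by simp
    have "norm \<delta> \<le> norm \<Delta> + norm (\<rho> (Y x) - \<rho> (Y x'))" unfolding \<Delta> using norm_triangle_ineq4[of \<Delta> "\<rho> (Y x) - \<rho> (Y x')"] \<Delta> by simp
    then have \<delta>\<Delta>: "norm \<delta> \<le> 2 * norm \<Delta>" using \<rho>lip[of "Y x" "Y x'"] unfolding \<delta>_def[symmetric] by simp
    have \<psi>\<Delta>: "norm (\<psi> (Y x) - \<psi> (Y x')) \<le> \<eta> * norm \<delta>" unfolding \<delta>_def by (rule \<psi>(3))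
    have sd: "s x - s x' = \<iota> \<delta> + (\<psi> (Y x) - \<psi> (Y x'))" unfolding s_def gdiff \<delta>_def ..
    have "norm (s x - s x') \<le> norm (\<iota> \<delta>) + norm (\<psi> (Y x) - \<psi> (Y x'))" unfolding sd by (rule norm_triangle_ineq)
    also have "\<dots> \<le> B * norm \<delta> + \<eta> * norm \<delta>" using B(2)[of \<delta>] \<psi>\<Delta> by (rule add_mono)
    also have "\<dots> \<le> (B + 1) * norm \<delta>" using mult_right_mono[OF \<eta>(2), of "norm \<delta>"] by (simp add: algebra_simps)
    also have "\<dots> \<le> (B + 1) * (2 * norm \<Delta>)" using B(1) \<delta>\<Delta> by (intro mult_left_mono) auto
    finally show "norm (s x - s x') \<le> C * norm (coord_proj J (x - x'))" unfolding C_def \<Delta>_def by (simp add: algebra_simps)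
    define \<omega> where "\<omega> = \<Lambda> *v (\<psi> (Y x) - \<psi> (Y x'))"
    have "\<rho> (Y x) - \<rho> (Y x') = Re_vec \<omega>"
      unfolding \<rho>_def \<omega>_def YJ Re_vec_diff[symmetric] linear_diff[OF linear_complex_matrix_mult] ..
    moreover have "coord_proj J \<delta> = \<delta>" unfolding \<delta>_def linear_diff[OF linear_coord_proj] YJ ..
    ultimately have "\<Lambda> *v (s x - s x') - cvec \<Delta> = \<omega> - cvec (Re_vec \<omega>)"
      unfolding sd \<Delta> linear_add[OF linear_complex_matrix_mult] \<Lambda>\<iota> \<omega>_def by (simp add: vec_eq_iff)
    then have "norm (\<Lambda> *v (s x - s x') - cvec \<Delta>) \<le> 2 * norm \<omega>"
      using norm_triangle_ineq4[of \<omega> "cvec (Re_vec \<omega>)"] norm_Re_vec_le[of \<omega>] by simp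
    also have "norm \<omega> \<le> L * (\<eta> * norm \<delta>)"
      unfolding \<omega>_def using L by (intro order_trans[OF L(2)] mult_left_mono \<psi>\<Delta>) auto
    also have "L * (\<eta> * norm \<delta>) \<le> 1/80 * norm \<delta>" using mult_right_mono[OF \<eta>(3), of "norm \<delta>"] by simp
    finally show "norm (\<Lambda> *v (s x - s x') - cvec (coord_proj J (x - x'))) \<le> 1/20 * norm (coord_proj J (x - x'))"
      using \<delta>\<Delta> unfolding \<Delta>_def[symmetric] by simp
  qed
  have sec: "s (Re_vec (\<Lambda> *v z)) = z" if z: "z \<in> h ` (cball a r \<inter> range (coord_proj J))" for z
  proof -
    obtain y where y: "z = h y" "y \<in> cball a r" "y \<in> range (coord_proj J)" using z by blast
    have y3: "coord_proj J y = y" using y(3) by auto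
    have zg: "z = g y" unfolding y(1) g_def \<psi>(2)[OF y(2)] R_def by simp
    have "Re_vec (\<Lambda> *v z) = Re_vec (\<Lambda> *v h a) + coord_proj J (y - a) + \<rho> y"
      unfolding zg g_def linear_add[OF linear_complex_matrix_mult] \<Lambda>\<iota> linear_add[OF linear_Re_vec] \<rho>_def y3 by simp
    also have "\<dots> = b + (y + \<rho> y)" unfolding b_def linear_diff[OF linear_coord_proj] y3 aJ by simp
    finally have "Re_vec (\<Lambda> *v z) = b + (y + \<rho> y)" .
    moreover have "coord_proj J (b + (y + \<rho> y)) = b + (y + \<rho> y)" unfolding linear_add[OF linear_coord_proj] bJ y3 \<rho>J ..
    ultimately have "Y (Re_vec (\<Lambda> *v z)) = y" unfolding Y_def using \<Psi>(3) by simp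
    then show ?thesis unfolding s_def zg by simp
  qed
  show ?thesis
  proof (rule that[OF r(1) \<kappa>(1) r(2)])
    fix T assume T: "compact T" "T \<subseteq> h ` (cball a r \<inter> range (coord_proj J))"
    have "bounded_linear (\<lambda>z. Re_vec (\<Lambda> *v z))" by (rule bounded_linear_compose[OF Rebl \<Lambda>bl])
    then show "is_cell \<kappa> T"
      unfolding is_cell_def using T J fr sms tr C sec L \<kappa>
      by (intro exI[of _ \<Lambda>] exI[of _ J] exI[of _ m] exI[of _ e] exI[of _ \<nu>] exI[of _ j] exI[of _ s]
          exI[of _ "\<lambda>z. Re_vec (\<Lambda> *v z)"] exI[of _ C] exI[of _ L]) auto
  qed
qed

section \<open>Partial derivatives in coordinate sequences\<close>

text \<open>The embedding \<open>\<sigma>\<close> of \<open>{..<d}\<close> into the index type identifies \<open>\<real>\<^sup>d\<close>, as a set of sequences,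
  with a coordinate subspace of \<open>\<real>\<^sup>n\<close>.\<close>

definition to_vec :: "(nat \<Rightarrow> 'n::finite) \<Rightarrow> nat \<Rightarrow> (nat \<Rightarrow> real) \<Rightarrow> real ^ 'n" where
  "to_vec \<sigma> d x = (\<chi> j. if j \<in> \<sigma> ` {..<d} then x (inv_into {..<d} \<sigma> j) else 0)"

definition to_seq :: "(nat \<Rightarrow> 'n::finite) \<Rightarrow> nat \<Rightarrow> real ^ 'n \<Rightarrow> nat \<Rightarrow> real" where
  "to_seq \<sigma> d y i = (if i < d then y $ \<sigma> i else 0)"

lemma to_vec_nth:
  assumes "inj_on \<sigma> {..<d}"
  shows "i < d \<Longrightarrow> to_vec \<sigma> d x $ \<sigma> i = x i" and "j \<notin> \<sigma> ` {..<d} \<Longrightarrow> to_vec \<sigma> d x $ j = 0"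
  using assms by (auto simp: to_vec_def inv_into_f_f)

lemma to_vec_to_seq:
  assumes "inj_on \<sigma> {..<d}" shows "to_vec \<sigma> d (to_seq \<sigma> d y) = coord_proj (\<sigma> ` {..<d}) y"
proof -
  have "to_vec \<sigma> d (to_seq \<sigma> d y) $ j = coord_proj (\<sigma> ` {..<d}) y $ j" for j
    using to_vec_nth[OF assms] by (cases "j \<in> \<sigma> ` {..<d}") (auto simp: to_seq_def)
  then show ?thesis by (simp add: vec_eq_iff)
qed

lemma to_seq_to_vec:
  assumes "inj_on \<sigma> {..<d}" "x \<in> topspace (Euclidean_space d)" shows "to_seq \<sigma> d (to_vec \<sigma> d x) = x"
  using assms to_vec_nth[OF assms(1)] by (auto simp: to_seq_def topspace_Euclidean_space fun_eq_iff)

lemma to_seq_coord_proj: "to_seq \<sigma> d (coord_proj (\<sigma> ` {..<d}) y) = to_seq \<sigma> d y"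
  by (auto simp: to_seq_def fun_eq_iff)

lemma to_seq_in_topspace: "to_seq \<sigma> d y \<in> topspace (Euclidean_space d)"
  by (simp add: to_seq_def topspace_Euclidean_space)

lemma coord_proj_to_vec: "coord_proj (\<sigma> ` {..<d}) (to_vec \<sigma> d x) = to_vec \<sigma> d x"
  by (simp add: vec_eq_iff to_vec_def)

lemma to_vec_upd:
  assumes "inj_on \<sigma> {..<d}" "i < d"
  shows "to_vec \<sigma> d (x(i := t)) = to_vec \<sigma> d x + (t - x i) *\<^sub>R axis (\<sigma> i) 1"
proof -
  have "to_vec \<sigma> d (x(i := t)) $ j = (to_vec \<sigma> d x + (t - x i) *\<^sub>R axis (\<sigma> i) 1) $ j" for j
  proof (cases "j \<in> \<sigma> ` {..<d}")
    case True
    then obtain k where k: "k < d" "j = \<sigma> k" by auto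
    then have "j = \<sigma> i \<longleftrightarrow> k = i" using assms by (auto dest: inj_onD)
    then show ?thesis using k to_vec_nth(1)[OF assms(1)] assms(2) by (auto simp: axis_def)
  next
    case False
    then have "j \<noteq> \<sigma> i" using assms(2) by auto
    then show ?thesis using False to_vec_nth(2)[OF assms(1)] by (simp add: axis_def)
  qed
  then show ?thesis by (simp add: vec_eq_iff)
qed

lemma to_seq_upd:
  assumes "inj_on \<sigma> {..<d}" "i < d"
  shows "to_seq \<sigma> d (y + t *\<^sub>R axis (\<sigma> i) 1) = (to_seq \<sigma> d y)(i := y $ \<sigma> i + t)"
  using assms by (auto simp: to_seq_def fun_eq_iff axis_def dest: inj_onD)

lemma continuous_on_to_seq: "continuous_on S (to_seq \<sigma> d)"
proof (rule continuous_on_coordinatewise_then_product)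
  show "continuous_on S (\<lambda>y. to_seq \<sigma> d y i)" for i
    unfolding to_seq_def by (cases "i < d") (auto intro!: continuous_intros)
qed

lemma continuous_on_to_vec: "continuous_on S (to_vec \<sigma> d)"
  unfolding to_vec_def[abs_def]
proof (rule continuous_on_vec_lambda)
  show "continuous_on S (\<lambda>x. if j \<in> \<sigma> ` {..<d} then x (inv_into {..<d} \<sigma> j) else 0)" for j
    by (cases "j \<in> \<sigma> ` {..<d}") (auto intro: continuous_on_subset[OF continuous_on_product_coordinates])
qed

lemma openin_Euclidean_space_iff:
  "openin (Euclidean_space d) W \<longleftrightarrow> (\<exists>U. open U \<and> W = U \<inter> topspace (Euclidean_space d))"
  unfolding Euclidean_space_def by (simp add: openin_subtopology euclidean_product_topology)

lemma openin_half_space_iff: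
  "openin (half_space d) S \<longleftrightarrow> (\<exists>U. open U \<and> S = U \<inter> (topspace (Euclidean_space d) \<inter> {x. 0 \<le> x 0}))"
  unfolding half_space_def openin_subtopology openin_Euclidean_space_iff by (auto simp: Int_assoc)

lemma open_vimage_to_seq:
  assumes "openin (Euclidean_space d) W" shows "open (to_seq \<sigma> d -` W)"
proof -
  obtain U where U: "open U" "W = U \<inter> topspace (Euclidean_space d)" using assms unfolding openin_Euclidean_space_iff by blast
  have "to_seq \<sigma> d -` W = to_seq \<sigma> d -` U" unfolding U(2) using to_seq_in_topspace by blast
  then show ?thesis using open_vimage[OF U(1) continuous_on_to_seq] by simp
qed

text \<open>A condition on the domain under which one-sided derivatives are unique.\<close>

definition coord_accessible :: "nat \<Rightarrow> (nat \<Rightarrow> real) set \<Rightarrow> bool" where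
  "coord_accessible d S \<longleftrightarrow> S \<subseteq> topspace (Euclidean_space d) \<and>
     (\<forall>x\<in>S. \<forall>i<d. \<exists>e>0. \<forall>t. x i \<le> t \<longrightarrow> t < x i + e \<longrightarrow> x(i := t) \<in> S)"

lemma continuous_on_upd: "continuous_on UNIV (\<lambda>t. x(i := t) :: nat \<Rightarrow> real)"
proof (rule continuous_on_coordinatewise_then_product)
  show "continuous_on UNIV (\<lambda>t. (x(i := t)) j)" for j by (cases "j = i") (auto intro: continuous_intros)
qed

lemma open_upd:
  assumes "open U" "x \<in> U" shows "\<exists>e>0. \<forall>t. \<bar>t - x i\<bar> < e \<longrightarrow> x(i := t) \<in> (U :: (nat \<Rightarrow> real) set)"
proof -
  have "open ((\<lambda>t. x(i := t)) -` U)" by (rule open_vimage[OF assms(1) continuous_on_upd])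
  moreover have "x i \<in> (\<lambda>t. x(i := t)) -` U" using assms(2) by simp
  ultimately obtain e where "e > 0" "ball (x i) e \<subseteq> (\<lambda>t. x(i := t)) -` U" unfolding open_contains_ball by blast
  then show ?thesis by (auto simp: subset_iff dist_real_def abs_minus_commute)
qed

lemma coord_accessible_Int:
  assumes U: "open U" and H: "\<And>x i t. x \<in> H \<Longrightarrow> x i \<le> t \<Longrightarrow> x(i := t) \<in> H"
  shows "coord_accessible d (U \<inter> (topspace (Euclidean_space d) \<inter> H))"
  unfolding coord_accessible_def
proof (intro conjI ballI allI impI)
  fix x i assume x: "x \<in> U \<inter> (topspace (Euclidean_space d) \<inter> H)" "i < d"
  then obtain e where "e > 0" "\<And>t. \<bar>t - x i\<bar> < e \<Longrightarrow> x(i := t) \<in> U" using open_upd[OF U, of x i] by blast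
  then show "\<exists>e>0. \<forall>t. x i \<le> t \<longrightarrow> t < x i + e \<longrightarrow> x(i := t) \<in> U \<inter> (topspace (Euclidean_space d) \<inter> H)"
    using x H by (intro exI[of _ e]) (auto simp: topspace_Euclidean_space)
qed auto

lemma coord_accessible_half_space: "openin (half_space d) S \<Longrightarrow> coord_accessible d S"
  unfolding openin_half_space_iff by (auto intro!: coord_accessible_Int)

lemma coord_accessible_Euclidean_space: "openin (Euclidean_space d) S \<Longrightarrow> coord_accessible d S"
  using coord_accessible_Int[of _ UNIV d] unfolding openin_Euclidean_space_iff by auto

lemma has_vector_derivative_line:
  assumes "h differentiable (at (p + s *\<^sub>R v))"
  shows "((\<lambda>t. h (p + t *\<^sub>R v)) has_vector_derivative dd v h (p + s *\<^sub>R v)) (at s within T)"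
proof -
  have "((\<lambda>t. h (p + t *\<^sub>R v)) has_derivative (\<lambda>t. dd (t *\<^sub>R v) h (p + s *\<^sub>R v))) (at s within T)"
    by (rule has_derivative_compose[where f = "\<lambda>t. p + t *\<^sub>R v" and g = h, OF _ has_derivative_dd[OF assms]])
      (auto intro!: derivative_eq_intros)
  moreover have "dd (t *\<^sub>R v) h (p + s *\<^sub>R v) = t *\<^sub>R dd v h (p + s *\<^sub>R v)" for t
    by (rule linear_scale[OF has_derivative_linear[OF has_derivative_dd[OF assms]]])
  ultimately show ?thesis unfolding has_vector_derivative_def by simp
qed

text \<open>Accessibility makes \<open>x i\<close> a limit point of the slice, so the derivative
  within the slice is unique and must be that of any differentiable extension
  \<open>h\<close>.\<close>

lemma partial_eq_dd:
  assumes \<sigma>: "inj_on \<sigma> {..<d}" and S: "coord_accessible d S" and x: "x \<in> S" and i: "i < d"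
    and V: "open V" "to_vec \<sigma> d x \<in> V" and h: "h differentiable (at (to_vec \<sigma> d x))"
    and gh: "\<And>x'. x' \<in> S \<Longrightarrow> to_vec \<sigma> d x' \<in> V \<Longrightarrow> g x' = h (to_vec \<sigma> d x')"
  shows "has_partial S i g x (dd (axis (\<sigma> i) 1) h (to_vec \<sigma> d x))"
    and "partial S i g x = dd (axis (\<sigma> i) 1) h (to_vec \<sigma> d x)"
proof -
  let ?T = "{t. x(i := t) \<in> S}"
  define p where "p = to_vec \<sigma> d x - x i *\<^sub>R axis (\<sigma> i) 1"
  have p: "to_vec \<sigma> d (x(i := t)) = p + t *\<^sub>R axis (\<sigma> i) 1" for t
    unfolding to_vec_upd[OF \<sigma> i] p_def by (simp add: algebra_simps)
  have p0: "p + x i *\<^sub>R axis (\<sigma> i) 1 = to_vec \<sigma> d x" unfolding p_def by simp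
  have "open ((\<lambda>t. p + t *\<^sub>R axis (\<sigma> i) 1) -` V)" by (intro open_vimage V continuous_intros)
  moreover have "x i \<in> (\<lambda>t. p + t *\<^sub>R axis (\<sigma> i) 1) -` V" using V(2) p0 by simp
  ultimately obtain r where r: "r > 0" "ball (x i) r \<subseteq> (\<lambda>t. p + t *\<^sub>R axis (\<sigma> i) 1) -` V" unfolding open_contains_ball by blast
  have "((\<lambda>t. h (p + t *\<^sub>R axis (\<sigma> i) 1)) has_vector_derivative dd (axis (\<sigma> i) 1) h (to_vec \<sigma> d x)) (at (x i) within ?T)"
    using has_vector_derivative_line[of h p "x i" "axis (\<sigma> i) 1" ?T] h unfolding p0 by blast
  then have "((\<lambda>t. g (x(i := t))) has_vector_derivative dd (axis (\<sigma> i) 1) h (to_vec \<sigma> d x)) (at (x i) within ?T)"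
  proof (rule has_vector_derivative_transform_within[OF _ r(1)])
    show "x i \<in> ?T" using x by simp
    show "h (p + t *\<^sub>R axis (\<sigma> i) 1) = g (x(i := t))" if t: "t \<in> ?T" "dist t (x i) < r" for t
      using gh[of "x(i := t)"] t r(2) p[of t] by (auto simp: dist_commute)
  qed
  then show hp: "has_partial S i g x (dd (axis (\<sigma> i) 1) h (to_vec \<sigma> d x))" unfolding has_partial_def .
  obtain e where e: "e > 0" "\<And>t. x i \<le> t \<Longrightarrow> t < x i + e \<Longrightarrow> x(i := t) \<in> S" using S x i unfolding coord_accessible_def by metis
  have "x i islimpt ?T"
    unfolding islimpt_approachable
  proof (intro allI impI)
    fix e' :: real assume "e' > 0"
    then show "\<exists>t\<in>?T. t \<noteq> x i \<and> dist t (x i) < e'"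
      using e by (intro bexI[of _ "x i + min e e' / 2"]) (auto simp: dist_real_def min_def)
  qed
  then have "at (x i) within ?T \<noteq> bot" by (simp add: trivial_limit_within)
  then show "partial S i g x = dd (axis (\<sigma> i) 1) h (to_vec \<sigma> d x)"
    unfolding partial_def using hp unfolding has_partial_def by (rule vector_derivative_within)
qed

section \<open>Comparison of the two notions of differentiability class\<close>

lemma smooth_on_imp_Ck_on:
  assumes \<sigma>: "inj_on \<sigma> {..<d}" and W: "openin (Euclidean_space d) W" and V: "open V" "to_vec \<sigma> d ` W \<subseteq> V"
    and h: "smooth_on V h" and gh: "\<And>x. x \<in> W \<Longrightarrow> g x = h (to_vec \<sigma> d x)"
  shows "Ck_on d W k g"
  using h gh
proof (induction k arbitrary: g h)
  have cont: "continuous_on W g" if "smooth_on V h" "\<And>x. x \<in> W \<Longrightarrow> g x = h (to_vec \<sigma> d x)" for g :: "(nat \<Rightarrow> real) \<Rightarrow> 'b" and h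
    using continuous_on_compose2[OF smooth_on_imp_continuous_on[OF that(1)] continuous_on_to_vec V(2)] that(2)
    by (simp cong: continuous_on_cong)
  {
    case 0
    then show ?case using cont by simp
  next
    case (Suc k)
    have p: "has_partial W i g x (dd (axis (\<sigma> i) 1) h (to_vec \<sigma> d x))" "partial W i g x = dd (axis (\<sigma> i) 1) h (to_vec \<sigma> d x)"
      if "i < d" "x \<in> W" for i x
      using V that
      by (intro partial_eq_dd[OF \<sigma> coord_accessible_Euclidean_space[OF W] that(2,1) V(1)] smooth_on_imp_differentiable[OF Suc.prems(1)] Suc.prems(2); blast)+
    have "Ck_on d W k (partial W i g)" if "i < d" for i
      by (rule Suc.IH[OF smooth_on_dd[OF Suc.prems(1)] p(2)[OF that]]) (auto simp: Basis_vec_def)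
    then show ?case using cont[OF Suc.prems] p(1) by auto
  }
qed

lemma iter_partial_snoc: "iter_partial S (is @ [i]) g = iter_partial S is (partial S i g)"
  by (induction "is") auto

text \<open>The last entry of the list is differentiated first. Induction from the end therefore
  replaces \<open>g\<close> by a partial derivative and its extension \<open>h\<close> by a
  derivative of \<open>h\<close>.\<close>

lemma norm_iter_partial_le:
  assumes \<sigma>: "inj_on \<sigma> {..<d}" and S: "coord_accessible d S" and V: "open V" and h: "smooth_on V h" "Cbd k B M h" and B: "B \<subseteq> V"
    and gh: "\<And>x. x \<in> S \<Longrightarrow> to_vec \<sigma> d x \<in> V \<Longrightarrow> g x = h (to_vec \<sigma> d x)"
    and is': "set is \<subseteq> {..<d}" "length is \<le> k" and x: "x \<in> S" "to_vec \<sigma> d x \<in> B"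
  shows "norm (iter_partial S is g x) \<le> M"
  using h gh is'
proof (induction "is" arbitrary: g h k rule: rev_induct)
  case Nil
  then show ?case using Cbd_norm_le[OF Nil(2) x(2)] x B by auto
next
  case (snoc i "is")
  then obtain l where k: "k = Suc l" by (cases k) auto
  have i: "i < d" using snoc.prems(4) by simp
  have ax: "axis (\<sigma> i) (1::real) \<in> Basis" by (auto simp: Basis_vec_def)
  show ?case
    unfolding iter_partial_snoc
  proof (rule snoc.IH[of "dd (axis (\<sigma> i) 1) h" l])
    show "smooth_on V (dd (axis (\<sigma> i) 1) h)" by (rule smooth_on_dd[OF snoc.prems(1) ax])
    show "Cbd l B M (dd (axis (\<sigma> i) 1) h)" using snoc.prems(2) ax unfolding k by simp
    show "partial S i g y = dd (axis (\<sigma> i) 1) h (to_vec \<sigma> d y)" if "y \<in> S" "to_vec \<sigma> d y \<in> V" for y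
      by (rule partial_eq_dd(2)[OF \<sigma> S that(1) i V that(2) smooth_on_imp_differentiable[OF snoc.prems(1) that(2)] snoc.prems(3)])
  qed (use snoc.prems k in auto)
qed

text \<open>The passage from \<open>a\<close> to \<open>y\<close> changes one coordinate at a time,
  with the mean value inequality on each segment.\<close>

lemma has_derivative_from_partials:
  fixes f :: "real ^ 'n \<Rightarrow> 'b::real_normed_vector"
  assumes U: "open U" "a \<in> U"
    and D: "\<And>x j. x \<in> U \<Longrightarrow> ((\<lambda>t. f (x + t *\<^sub>R axis j 1)) has_vector_derivative D j x) (at 0)"
    and cont: "\<And>j. continuous_on U (D j)"
  shows "(f has_derivative (\<lambda>v. \<Sum>j\<in>UNIV. v $ j *\<^sub>R D j a)) (at a)"
  unfolding has_derivative_at_alt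
proof (intro conjI allI impI)
  show "bounded_linear (\<lambda>v. \<Sum>j\<in>UNIV. v $ j *\<^sub>R D j a)"
    by (intro bounded_linear_sum bounded_linear_compose[OF bounded_linear_scaleR_left bounded_linear_vec_nth])
  fix e :: real assume e: "e > 0"
  define N where "N = real CARD('n)"
  have N: "N \<ge> 1" unfolding N_def using zero_less_card_finite[where 'a = 'n] by linarith
  \<comment> \<open>Each of the \<open>N\<close> coordinate steps costs at most
    \<open>3 * e' * norm v\<close>: twice \<open>e'\<close> for the linearization at
    \<open>p\<close> and once for moving the base point from \<open>p\<close> to
    \<open>a\<close>.\<close>
  define e' where "e' = e / (3 * N)"
  have e': "e' > 0" unfolding e'_def using e N by simp
  have "\<exists>\<delta>>0. \<forall>x. dist x a < \<delta> \<longrightarrow> norm (D j x - D j a) \<le> e'" for j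
  proof -
    have "isCont (D j) a" using cont[of j] U continuous_on_eq_continuous_at by blast
    then obtain \<delta> where "\<delta> > 0" "\<And>x. dist x a < \<delta> \<Longrightarrow> dist (D j x) (D j a) < e'"
      unfolding continuous_at_eps_delta using e' by metis
    then show ?thesis by (auto simp: dist_norm less_imp_le intro!: exI[of _ \<delta>])
  qed
  then obtain \<delta> where \<delta>: "\<And>j. \<delta> j > 0" "\<And>j x. dist x a < \<delta> j \<Longrightarrow> norm (D j x - D j a) \<le> e'" by metis
  obtain r0 where r0: "r0 > 0" "ball a r0 \<subseteq> U" using U open_contains_ball by blast
  define r where "r = min r0 (Min (range \<delta>))"
  have r: "r > 0" "r \<le> r0" "r \<le> \<delta> j" for j unfolding r_def using r0(1) \<delta>(1) by (auto simp: min_le_iff_disj)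
  show "\<exists>d>0. \<forall>y. norm (y - a) < d \<longrightarrow> norm (f y - f a - (\<Sum>j\<in>UNIV. (y - a) $ j *\<^sub>R D j a)) \<le> e * norm (y - a)"
  proof (intro exI[of _ "r / N"] conjI allI impI)
    show "r / N > 0" using r N by simp
    fix y assume y: "norm (y - a) < r / N"
    define v where "v = y - a"
    have vj: "\<bar>v $ j\<bar> \<le> norm v" for j by (rule component_le_norm_cart)
    \<comment> \<open>All points visited on the way stay within \<open>r\<close> of
      \<open>a\<close>, because \<open>norm v < r / N\<close>.\<close>
    have near: "norm (\<Sum>j\<in>S. c j *\<^sub>R axis j (1::real)) < r" if c: "\<And>j. \<bar>c j\<bar> \<le> \<bar>v $ j\<bar>" for S and c :: "'n \<Rightarrow> real"
    proof -
      have "norm (\<Sum>j\<in>S. c j *\<^sub>R axis j (1::real)) \<le> (\<Sum>j\<in>S. norm v)"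
        by (rule sum_norm_le) (simp add: order_trans[OF c vj])
      also have "\<dots> \<le> N * norm v" unfolding N_def by (auto intro!: mult_right_mono card_mono)
      also have "\<dots> < r" using y N unfolding v_def by (simp add: field_simps)
      finally show ?thesis .
    qed
    have "norm (f (a + (\<Sum>j\<in>S. v $ j *\<^sub>R axis j 1)) - f a - (\<Sum>j\<in>S. v $ j *\<^sub>R D j a)) \<le> real (card S) * (3 * e' * norm v)" for S
    proof (induction S rule: infinite_finite_induct)
      case (insert k S)
      define p where "p = a + (\<Sum>j\<in>S. v $ j *\<^sub>R axis j 1)"
      let ?I = "closed_segment 0 (v $ k)"
      have pr: "dist (p + t *\<^sub>R axis k 1) a < r" if t: "t \<in> ?I" for t
      proof -
        have tv: "\<bar>t\<bar> \<le> \<bar>v $ k\<bar>" using t by (auto simp: closed_segment_eq_real_ivl split: if_splits)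
        have "p + t *\<^sub>R axis k 1 - a = (\<Sum>j\<in>insert k S. (if j = k then t else v $ j) *\<^sub>R axis j 1)"
          unfolding p_def sum.insert[OF insert.hyps] using insert.hyps
          by (simp, intro sum.cong) auto
        then show ?thesis unfolding dist_norm using near[of "\<lambda>j. if j = k then t else v $ j" "insert k S"] tv by simp
      qed
      have "norm (f (p + (v $ k) *\<^sub>R axis k 1) - f (p + 0 *\<^sub>R axis k 1) - (v $ k - 0) *\<^sub>R D k (p + 0 *\<^sub>R axis k 1)) \<le> norm (v $ k - 0) * (2 * e')"
      proof (rule vector_differentiable_bound_linearization[where S = ?I and f = "\<lambda>t. f (p + t *\<^sub>R axis k 1)" and f' = "\<lambda>t. D k (p + t *\<^sub>R axis k 1)"])
        fix t assume t: "t \<in> ?I"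
        have "p + t *\<^sub>R axis k 1 \<in> U" using pr[OF t] r(2) r0(2) by (auto simp: dist_commute subset_iff)
        from D[OF this, of k]
        have "((\<lambda>s. f (p + t *\<^sub>R axis k 1 + s *\<^sub>R axis k 1)) has_vector_derivative D k (p + t *\<^sub>R axis k 1)) (at 0)" .
        then have "((\<lambda>s. f (p + t *\<^sub>R axis k 1 + s *\<^sub>R axis k 1)) \<circ> (\<lambda>s. s - t) has_vector_derivative 1 *\<^sub>R D k (p + t *\<^sub>R axis k 1)) (at t)"
          by (intro vector_diff_chain_at) (auto intro!: derivative_eq_intros)
        then have "((\<lambda>s. f (p + s *\<^sub>R axis k 1)) has_vector_derivative D k (p + t *\<^sub>R axis k 1)) (at t)"
          by (simp add: o_def algebra_simps)
        then show "((\<lambda>s. f (p + s *\<^sub>R axis k 1)) has_vector_derivative D k (p + t *\<^sub>R axis k 1)) (at t within ?I)"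
          by (rule has_vector_derivative_at_within)
        have "norm (D k (p + t *\<^sub>R axis k 1) - D k a) \<le> e'" "norm (D k (p + 0 *\<^sub>R axis k 1) - D k a) \<le> e'"
          using pr[OF t] pr[of 0] r(3)[of k] by (auto intro!: \<delta>(2) less_le_trans[of _ r])
        then show "norm (D k (p + t *\<^sub>R axis k 1) - D k (p + 0 *\<^sub>R axis k 1)) \<le> 2 * e'"
          using norm_triangle_ineq4[of "D k (p + t *\<^sub>R axis k 1) - D k a" "D k (p + 0 *\<^sub>R axis k 1) - D k a"] by simp
      qed auto
      then have "norm (f (p + (v $ k) *\<^sub>R axis k 1) - f p - (v $ k) *\<^sub>R D k p) \<le> \<bar>v $ k\<bar> * (2 * e')" by simp
      then have 1: "norm (f (p + (v $ k) *\<^sub>R axis k 1) - f p - (v $ k) *\<^sub>R D k p) \<le> norm v * (2 * e')"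
        by (rule order_trans) (simp add: vj e' less_imp_le mult_right_mono)
      have "dist p a < r" using pr[of 0] by simp
      then have "norm (D k p - D k a) \<le> e'" using r(3)[of k] by (intro \<delta>(2)) simp
      then have 2: "norm ((v $ k) *\<^sub>R D k p - (v $ k) *\<^sub>R D k a) \<le> norm v * e'"
        unfolding scaleR_diff_right[symmetric] norm_scaleR using vj by (intro mult_mono) auto
      have pk: "a + (\<Sum>j\<in>insert k S. v $ j *\<^sub>R axis j 1) = p + (v $ k) *\<^sub>R axis k 1"
        unfolding p_def using insert.hyps by simp
      have "f (a + (\<Sum>j\<in>insert k S. v $ j *\<^sub>R axis j 1)) - f a - (\<Sum>j\<in>insert k S. v $ j *\<^sub>R D j a)
        = (f (p + (v $ k) *\<^sub>R axis k 1) - f p - (v $ k) *\<^sub>R D k p) + ((v $ k) *\<^sub>R D k p - (v $ k) *\<^sub>R D k a)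
          + (f p - f a - (\<Sum>j\<in>S. v $ j *\<^sub>R D j a))"
        unfolding pk using insert.hyps by simp
      then have "norm (f (a + (\<Sum>j\<in>insert k S. v $ j *\<^sub>R axis j 1)) - f a - (\<Sum>j\<in>insert k S. v $ j *\<^sub>R D j a))
        \<le> norm v * (2 * e') + norm v * e' + real (card S) * (3 * e' * norm v)"
        using 1 2 insert.IH unfolding p_def[symmetric]
        by (metis (no_types, lifting) norm_triangle_mono)
      then show ?case using insert.hyps by (simp add: algebra_simps)
    qed auto
    from this[of UNIV] have "norm (f y - f a - (\<Sum>j\<in>UNIV. v $ j *\<^sub>R D j a)) \<le> N * (3 * e' * norm v)"
    proof -
      have "(\<Sum>j\<in>UNIV. v $ j *\<^sub>R axis j (1::real)) = v" by (simp add: vec_eq_iff axis_def if_distrib cong: if_cong)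
      then show ?thesis using \<open>norm (f (a + (\<Sum>j\<in>UNIV. v $ j *\<^sub>R axis j 1)) - f a - (\<Sum>j\<in>UNIV. v $ j *\<^sub>R D j a)) \<le> real (card UNIV) * (3 * e' * norm v)\<close>
        unfolding N_def by (simp add: v_def)
    qed
    also have "\<dots> = e * norm v" unfolding e'_def using N by simp
    finally show "norm (f y - f a - (\<Sum>j\<in>UNIV. (y - a) $ j *\<^sub>R D j a)) \<le> e * norm (y - a)" unfolding v_def .
  qed
qed

text \<open>\<open>Ck_on\<close> provides partial derivatives of functions of sequences,
  \<open>Ck\<close> demands Frechet derivatives on a Euclidean type; continuity of the partial
  derivatives bridges the gap.\<close>

lemma Ck_on_imp_Ck:
  fixes \<sigma> :: "nat \<Rightarrow> 'n::finite" and g :: "(nat \<Rightarrow> real) \<Rightarrow> 'b::real_normed_vector"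
  assumes \<sigma>: "inj_on \<sigma> {..<d}" and W: "openin (Euclidean_space d) W" and g: "Ck_on d W k g"
  shows "Ck k (to_seq \<sigma> d -` W) (\<lambda>y. g (to_seq \<sigma> d y))"
  using g
proof (induction k arbitrary: g)
  let ?U = "to_seq \<sigma> d -` W"
  have cont: "continuous_on ?U (\<lambda>y. g (to_seq \<sigma> d y))" if "Ck_on d W k g" for g :: "(nat \<Rightarrow> real) \<Rightarrow> 'b" and k
  proof -
    have "continuous_on W g" using that by (cases k) auto
    then show ?thesis by (rule continuous_on_compose2[OF _ continuous_on_to_seq[of "to_seq \<sigma> d -` W"]]) blast
  qed
  {
    case 0
    then show ?case using cont[of 0 g] by simp
  next
    case (Suc k)
    \<comment> \<open>The composed function does not depend on coordinates outside the range of
      \<open>\<sigma>\<close>, hence the value 0.\<close>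
    define D where "D j = (\<lambda>y. if j \<in> \<sigma> ` {..<d} then partial W (inv_into {..<d} \<sigma> j) g (to_seq \<sigma> d y) else 0)" for j
    have D\<sigma>: "D (\<sigma> i) = (\<lambda>y. partial W i g (to_seq \<sigma> d y))" if "i < d" for i
      unfolding D_def using that \<sigma> by (auto simp: inv_into_f_f)
    have U: "open ?U" by (rule open_vimage_to_seq[OF W])
    have ddx: "((\<lambda>t. g (to_seq \<sigma> d (y + t *\<^sub>R axis j 1))) has_vector_derivative D j y) (at 0)" if y: "y \<in> ?U" for y j
    proof (cases "j \<in> \<sigma> ` {..<d}")
      case True
      then obtain i where i: "i < d" "j = \<sigma> i" by auto
      let ?x = "to_seq \<sigma> d y"
      have xi: "?x i = y $ \<sigma> i" using i by (simp add: to_seq_def)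
      have inW: "?x(i := y $ \<sigma> i + t) \<in> W \<longleftrightarrow> y + t *\<^sub>R axis (\<sigma> i) 1 \<in> ?U" for t by (simp add: to_seq_upd[OF \<sigma> i(1)])
      obtain D' where "has_partial W i g ?x D'" using Suc.prems i y by auto
      then have D': "((\<lambda>t. g (?x(i := t))) has_vector_derivative D') (at (?x i) within {t. ?x(i := t) \<in> W})"
        unfolding has_partial_def .
      obtain U' where U': "open U'" "W = U' \<inter> topspace (Euclidean_space d)" using W unfolding openin_Euclidean_space_iff by blast
      have "{t. ?x(i := t) \<in> W} = (\<lambda>t. ?x(i := t)) -` U'"
        using i unfolding U'(2) by (auto simp: topspace_Euclidean_space to_seq_def)
      then have op: "open {t. ?x(i := t) \<in> W}" using open_vimage[OF U'(1) continuous_on_upd] by simp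
      have mem: "?x i \<in> {t. ?x(i := t) \<in> W}" using y by simp
      have at: "at (?x i) within {t. ?x(i := t) \<in> W} = at (?x i)" by (rule at_within_open[OF mem op])
      have "partial W i g ?x = D'"
        unfolding partial_def at using D' unfolding at by (rule vector_derivative_at)
      then have "((\<lambda>t. g (?x(i := t))) has_vector_derivative D j y) (at (?x i))"
        using D' unfolding at i(2) D\<sigma>[OF i(1)] by simp
      then have "((\<lambda>t. g (?x(i := t))) \<circ> (\<lambda>t. y $ \<sigma> i + t) has_vector_derivative 1 *\<^sub>R D j y) (at 0)"
        by (intro vector_diff_chain_at) (auto intro!: derivative_eq_intros simp: xi)
      then show ?thesis unfolding i(2) to_seq_upd[OF \<sigma> i(1)] o_def by simp
    next
      case False
      have "to_seq \<sigma> d (y + t *\<^sub>R axis j 1) = to_seq \<sigma> d y" for t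
        using False by (auto simp: to_seq_def axis_def fun_eq_iff)
      then show ?thesis using False unfolding D_def by simp
    qed
    have Ckp: "Ck_on d W k (partial W i g)" if "i < d" for i using Suc.prems that by simp
    have contD: "continuous_on ?U (D j)" for j
    proof (cases "j \<in> \<sigma> ` {..<d}")
      case True
      then obtain i where i: "i < d" "j = \<sigma> i" by auto
      show ?thesis unfolding i(2) D\<sigma>[OF i(1)] by (rule cont[OF Ckp[OF i(1)]])
    next
      case False
      then show ?thesis unfolding D_def by simp
    qed
    have der: "((\<lambda>y. g (to_seq \<sigma> d y)) has_derivative (\<lambda>v. \<Sum>j\<in>UNIV. v $ j *\<^sub>R D j y)) (at y)" if "y \<in> ?U" for y
      by (rule has_derivative_from_partials[OF U that ddx contD])
    have "Ck k ?U (dd b (\<lambda>y. g (to_seq \<sigma> d y)))" if b: "b \<in> Basis" for b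
    proof -
      obtain j where j: "b = axis j 1" using b unfolding Basis_vec_def by auto
      have "dd b (\<lambda>y. g (to_seq \<sigma> d y)) y = D j y" if "y \<in> ?U" for y
        unfolding dd_eqI[OF der[OF that]] j by (simp add: axis_def if_distrib[of "\<lambda>x. x *\<^sub>R _"] cong: if_cong)
      then have eq: "Ck k ?U (dd b (\<lambda>y. g (to_seq \<sigma> d y))) \<longleftrightarrow> Ck k ?U (D j)" by (rule Ck_cong[OF U])
      show ?thesis
      proof (cases "j \<in> \<sigma> ` {..<d}")
        case True
        then obtain i where i: "i < d" "j = \<sigma> i" by auto
        show ?thesis unfolding eq i(2) D\<sigma>[OF i(1)] by (rule Suc.IH[OF Ckp[OF i(1)]])
      next
        case False
        then show ?thesis unfolding eq unfolding D_def using Ck_const[of k ?U 0] by simp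
      qed
    qed
    then show ?case using differentiableI[OF der] by auto
  }
qed

section \<open>Charts and local extensions\<close>

lemma to_vec_sum:
  assumes \<sigma>: "inj_on \<sigma> {..<d}" shows "to_vec \<sigma> d v = (\<Sum>i<d. v i *\<^sub>R axis (\<sigma> i) 1)"
proof -
  have "to_vec \<sigma> d v $ j = (\<Sum>i<d. v i *\<^sub>R axis (\<sigma> i) 1) $ j" for j
  proof (cases "j \<in> \<sigma> ` {..<d}")
    case True
    then obtain k where k: "k < d" "j = \<sigma> k" by auto
    have "(\<Sum>i<d. v i *\<^sub>R axis (\<sigma> i) (1::real)) $ j = (\<Sum>i<d. if i = k then v i else 0)"
      unfolding sum_component k(2) using \<sigma> k(1) by (intro sum.cong) (auto simp: axis_def dest: inj_onD)
    then show ?thesis using k to_vec_nth(1)[OF \<sigma>] by simp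
  next
    case False
    then have "(\<Sum>i<d. v i *\<^sub>R axis (\<sigma> i) (1::real)) $ j = (\<Sum>i<d. 0)"
      unfolding sum_component by (intro sum.cong) (auto simp: axis_def)
    then show ?thesis unfolding to_vec_nth(2)[OF \<sigma> False] by simp
  qed
  then show ?thesis by (simp add: vec_eq_iff)
qed

lemma chart_facts:
  assumes "is_chart d X (U, \<phi>)"
  shows "U \<subseteq> topspace X" and "inj_on \<phi> U" and "openin (half_space d) (\<phi> ` U)" and "coord_accessible d (\<phi> ` U)"
    and "q \<in> U \<Longrightarrow> local_rep (U, \<phi>) g (\<phi> q) = g q" and "openin X U" and "open V \<Longrightarrow> openin X {q \<in> U. to_vec \<sigma> d (\<phi> q) \<in> V}"
proof -
  have c: "openin X U" "openin (half_space d) (\<phi> ` U)"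
    "homeomorphic_map (subtopology X U) (subtopology (half_space d) (\<phi> ` U)) \<phi>"
    using assms unfolding is_chart_def by auto
  show UX: "U \<subseteq> topspace X" by (rule openin_subset[OF c(1)])
  have tU: "topspace (subtopology X U) = U" using UX by auto
  show inj: "inj_on \<phi> U" using homeomorphic_imp_injective_map[OF c(3)] unfolding tU .
  show "q \<in> U \<Longrightarrow> local_rep (U, \<phi>) g (\<phi> q) = g q" using inj by (simp add: local_rep_def inv_into_f_f)
  show "openin (half_space d) (\<phi> ` U)" "openin X U" by fact+
  show "coord_accessible d (\<phi> ` U)" by (rule coord_accessible_half_space[OF c(2)])
  assume V: "open V"
  have "continuous_map euclidean euclidean (to_vec \<sigma> d)" by (simp add: continuous_on_to_vec)
  then have "continuous_map (subtopology (half_space d) (\<phi> ` U)) euclidean (to_vec \<sigma> d)"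
    unfolding half_space_def Euclidean_space_def euclidean_product_topology
    by (intro continuous_map_from_subtopology)
  from continuous_map_compose[OF homeomorphic_imp_continuous_map[OF c(3)] this]
  have "openin (subtopology X U) {q \<in> topspace (subtopology X U). (to_vec \<sigma> d \<circ> \<phi>) q \<in> V}"
    by (rule openin_continuous_map_preimage) (use V in simp)
  then show "openin X {q \<in> U. to_vec \<sigma> d (\<phi> q) \<in> V}"
    unfolding tU using openin_open_subtopology[OF c(1)] by simp
qed

text \<open>The calculus on the manifold is done with such extensions: they are defined on open
  subsets of \<open>real ^ 'n\<close>, also around boundary points, and are constant in the
  directions outside the coordinate subspace.\<close>

lemma smooth_map_extension:
  fixes \<sigma> :: "nat \<Rightarrow> 'n::finite" and g :: "'a \<Rightarrow> 'b::real_normed_vector"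
  assumes \<sigma>: "inj_on \<sigma> {..<d}" and c: "is_chart d X (U, \<phi>)" "(U, \<phi>) \<in> \<A>" and g: "smooth_map d \<A> g" and p: "p \<in> U"
  obtains V h where "open V" "to_vec \<sigma> d (\<phi> p) \<in> V" "smooth_on V h" "\<And>y. h (coord_proj (\<sigma> ` {..<d}) y) = h y"
    "\<And>q. q \<in> U \<Longrightarrow> to_vec \<sigma> d (\<phi> q) \<in> V \<Longrightarrow> g q = h (to_vec \<sigma> d (\<phi> q))"
proof -
  have "smooth_fun_on d (\<phi> ` U) (local_rep (U, \<phi>) g)" using g c(2) unfolding smooth_map_def by auto
  then obtain W h where Wh: "openin (Euclidean_space d) W" "\<phi> p \<in> W" "\<And>k. Ck_on d W k h" "\<And>y. y \<in> \<phi> ` U \<inter> W \<Longrightarrow> h y = local_rep (U, \<phi>) g y"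
    using p unfolding smooth_fun_on_def by (metis imageI)
  have ts: "\<phi> q \<in> topspace (Euclidean_space d)" if "q \<in> U" for q
    using chart_facts(4)[OF c(1)] that unfolding coord_accessible_def by blast
  show ?thesis
  proof (rule that[of "to_seq \<sigma> d -` W" "\<lambda>y. h (to_seq \<sigma> d y)"])
    show "open (to_seq \<sigma> d -` W)" by (rule open_vimage_to_seq[OF Wh(1)])
    show "to_vec \<sigma> d (\<phi> p) \<in> to_seq \<sigma> d -` W" using Wh(2) to_seq_to_vec[OF \<sigma> ts[OF p]] by simp
    show "smooth_on (to_seq \<sigma> d -` W) (\<lambda>y. h (to_seq \<sigma> d y))"
      unfolding smooth_on_def using Ck_on_imp_Ck[OF \<sigma> Wh(1,3)] by blast
    show "h (to_seq \<sigma> d (coord_proj (\<sigma> ` {..<d}) y)) = h (to_seq \<sigma> d y)" for y unfolding to_seq_coord_proj ..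
    show "g q = h (to_seq \<sigma> d (to_vec \<sigma> d (\<phi> q)))" if "q \<in> U" "to_vec \<sigma> d (\<phi> q) \<in> to_seq \<sigma> d -` W" for q
      using that Wh(4)[of "\<phi> q"] chart_facts(5)[OF c(1) that(1), of g] unfolding to_seq_to_vec[OF \<sigma> ts[OF that(1)]] vimage_eq by simp
  qed
qed

lemma smooth_map_from_extensions:
  fixes \<sigma> :: "nat \<Rightarrow> 'n::finite" and g :: "'a \<Rightarrow> 'b::real_normed_vector"
  assumes \<sigma>: "inj_on \<sigma> {..<d}" and \<A>: "\<And>c. c \<in> \<A> \<Longrightarrow> is_chart d X c"
    and ext: "\<And>U \<phi> p. (U, \<phi>) \<in> \<A> \<Longrightarrow> p \<in> U \<Longrightarrow> \<exists>V h. open V \<and> to_vec \<sigma> d (\<phi> p) \<in> V \<and> smooth_on V h \<and>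
      (\<forall>q\<in>U. to_vec \<sigma> d (\<phi> q) \<in> V \<longrightarrow> g q = h (to_vec \<sigma> d (\<phi> q)))"
  shows "smooth_map d \<A> g"
  unfolding smooth_map_def
proof clarify
  fix U \<phi> assume c: "(U, \<phi>) \<in> \<A>"
  show "smooth_fun_on d (\<phi> ` U) (local_rep (U, \<phi>) g)"
    unfolding smooth_fun_on_def
  proof clarify
    fix p assume p: "p \<in> U"
    obtain V h where Vh: "open V" "to_vec \<sigma> d (\<phi> p) \<in> V" "smooth_on V h"
      "\<And>q. q \<in> U \<Longrightarrow> to_vec \<sigma> d (\<phi> q) \<in> V \<Longrightarrow> g q = h (to_vec \<sigma> d (\<phi> q))" using ext[OF c p] by blast
    define W where "W = to_vec \<sigma> d -` V \<inter> topspace (Euclidean_space d)"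
    have "open (to_vec \<sigma> d -` V)" by (rule open_vimage[OF Vh(1) continuous_on_to_vec])
    then have W: "openin (Euclidean_space d) W" unfolding W_def openin_Euclidean_space_iff by blast
    have "Ck_on d W k (\<lambda>x. h (to_vec \<sigma> d x))" for k
      by (rule smooth_on_imp_Ck_on[OF \<sigma> W Vh(1) _ Vh(3)]) (auto simp: W_def)
    moreover have "\<phi> p \<in> W" using Vh(2) chart_facts(4)[OF \<A>[OF c]] p unfolding W_def coord_accessible_def by blast
    moreover have "\<forall>y\<in>\<phi> ` U \<inter> W. h (to_vec \<sigma> d y) = local_rep (U, \<phi>) g y"
      using Vh(4) unfolding W_def by (auto simp: chart_facts(5)[OF \<A>[OF c]])
    ultimately show "\<exists>W h. openin (Euclidean_space d) W \<and> \<phi> p \<in> W \<and> (\<forall>k. Ck_on d W k h) \<and> (\<forall>y\<in>\<phi> ` U \<inter> W. h y = local_rep (U, \<phi>) g y)"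
      using W by (intro exI[of _ W] exI[of _ "\<lambda>x. h (to_vec \<sigma> d x)"]) auto
  qed
qed

lemma differential_eq_dd:
  fixes \<sigma> :: "nat \<Rightarrow> 'n::finite" and g :: "'a \<Rightarrow> 'b::real_normed_vector"
  assumes \<sigma>: "inj_on \<sigma> {..<d}" and c: "is_chart d X (U, \<phi>)" and p: "p \<in> U"
    and V: "open V" "to_vec \<sigma> d (\<phi> p) \<in> V" and h: "smooth_on V h"
    and gh: "\<And>q. q \<in> U \<Longrightarrow> to_vec \<sigma> d (\<phi> q) \<in> V \<Longrightarrow> g q = h (to_vec \<sigma> d (\<phi> q))"
  shows "differential d (U, \<phi>) g p v = dd (to_vec \<sigma> d v) h (to_vec \<sigma> d (\<phi> p))"
proof -
  let ?a = "to_vec \<sigma> d (\<phi> p)"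
  have hd: "h differentiable (at ?a)" by (rule smooth_on_imp_differentiable[OF h V(2)])
  have lin: "linear (\<lambda>v. dd v h ?a)" by (rule has_derivative_linear[OF has_derivative_dd[OF hd]])
  have "partial (\<phi> ` U) i (local_rep (U, \<phi>) g) (\<phi> p) = dd (axis (\<sigma> i) 1) h ?a" if "i < d" for i
    by (rule partial_eq_dd(2)[OF \<sigma> chart_facts(4)[OF c] _ that V hd])
      (use p gh in \<open>auto simp: chart_facts(5)[OF c]\<close>)
  then show ?thesis
    unfolding differential_def to_vec_sum[OF \<sigma>, of v] linear_sum[OF lin] linear_scale[OF lin] by simp
qed

text \<open>The \<open>v i\<close> are linearly independent over the complex numbers, so a complex
  linear map can send them to prescribed basis vectors.\<close>

lemma totally_real_frame:
  fixes \<sigma> :: "nat \<Rightarrow> 'n::finite" and v :: "nat \<Rightarrow> complex ^ 'n"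
  assumes \<sigma>: "inj_on \<sigma> {..<d}" and d: "0 < d" "d < CARD('n)"
    and ind: "\<And>a. (\<Sum>i<d. a i *s v i) = 0 \<Longrightarrow> \<forall>i<d. a i = 0"
  obtains \<Lambda> m e \<nu> j where "tr_frame \<Lambda> (\<sigma> ` {..<d}) m e \<nu> j" "\<And>i. i < d \<Longrightarrow> \<Lambda> *v v i = axis (\<sigma> i) 1"
proof -
  have inj: "inj_on v {..<d}"
  proof (rule inj_onI)
    fix i k assume ik: "i \<in> {..<d}" "k \<in> {..<d}" "v i = v k"
    show "i = k"
    proof (rule ccontr)
      assume "i \<noteq> k"
      define a :: "nat \<Rightarrow> complex" where "a l = (if l = i then 1 else if l = k then - 1 else 0)" for l
      have "(\<Sum>l<d. a l *s v l) = (\<Sum>l<d. (if l = i then v l else 0) + (if l = k then - v l else 0))"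
        using \<open>i \<noteq> k\<close> by (intro sum.cong) (auto simp: a_def)
      then have "(\<Sum>l<d. a l *s v l) = 0" using ik by (simp add: sum.distrib)
      then show False using ind[of a] ik unfolding a_def by force
    qed
  qed
  have "vec.independent (v ` {..<d})"
    unfolding vec.dependent_finite[OF finite_imageI[OF finite_lessThan]] sum.reindex[OF inj]
  proof clarsimp
    fix u i assume "(\<Sum>i<d. u (v i) *s v i) = 0" "i < d" "u (v i) \<noteq> 0"
    then show False using ind[of "\<lambda>i. u (v i)"] by simp
  qed
  from vec.linear_independent_extend[OF this, of "\<lambda>x. axis (\<sigma> (inv_into {..<d} v x)) 1"]
  obtain g :: "complex ^ 'n \<Rightarrow> complex ^ 'n" where g1: "Vector_Spaces.linear (*s) (*s) g" and g0: "\<forall>x\<in>v ` {..<d}. g x = axis (\<sigma> (inv_into {..<d} v x)) 1"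
    by (elim exE conjE) (rule that)
  have g2: "g (v i) = axis (\<sigma> i) 1" if "i < d" for i
    using g0 that by (simp add: inv_into_f_f[OF inj])
  \<comment> \<open>Deleting the rows outside the range of \<open>\<sigma>\<close> puts the range
    into the coordinate subspace and, since \<open>d < CARD('n)\<close>, forces a nontrivial
    kernel.\<close>
  define \<Lambda> :: "complex ^ 'n ^ 'n" where "\<Lambda> = (\<chi> i k. if i \<in> \<sigma> ` {..<d} then matrix g $ i $ k else 0)"
  have \<Lambda>nth: "(\<Lambda> *v z) $ i = (if i \<in> \<sigma> ` {..<d} then g z $ i else 0)" for z i
  proof -
    have "(\<Lambda> *v z) $ i = (if i \<in> \<sigma> ` {..<d} then (matrix g *v z) $ i else 0)"
      by (simp add: \<Lambda>_def matrix_vector_mult_def)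
    then show ?thesis by (simp only: matrix_works[OF g1])
  qed
  have \<Lambda>v: "\<Lambda> *v v i = axis (\<sigma> i) 1" if "i < d" for i
    using that by (auto simp: vec_eq_iff \<Lambda>nth g2 axis_def)
  have "card (\<sigma> ` {..<d}) < CARD('n)" using d(2) card_image[OF \<sigma>] by simp
  then have "\<sigma> ` {..<d} \<noteq> UNIV" by auto
  then obtain i0 where i0: "i0 \<notin> \<sigma> ` {..<d}" by blast
  have "\<exists>e. \<Lambda> *v e = 0 \<and> e \<noteq> 0"
  proof (rule ccontr)
    assume "\<not> ?thesis"
    then obtain B where "B ** \<Lambda> = mat 1" using matrix_left_invertible_ker by blast
    then have "\<Lambda> ** B = mat 1" by (simp add: matrix_left_right_inverse)
    then have "(\<Lambda> *v (B *v axis i0 1)) $ i0 = 1" by (simp add: matrix_vector_mul_assoc axis_def)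
    then show False using i0 by (simp add: \<Lambda>nth)
  qed
  then obtain e where e: "\<Lambda> *v e = 0" "e \<noteq> 0" by blast
  from e(2) have "\<exists>m. e $ m \<noteq> 0" by (simp add: vec_eq_iff)
  then obtain m where m: "e $ m \<noteq> 0" ..
  have "tr_frame \<Lambda> (\<sigma> ` {..<d}) m e (v 0) (\<sigma> 0)"
    unfolding tr_frame_def using e(1) m \<Lambda>v[OF d(1)] d(1) by (auto simp: \<Lambda>nth)
  then show ?thesis by (rule that[OF _ \<Lambda>v])
qed

lemma chart_half_space:
  assumes "is_chart d X (U, \<phi>)" "openin X N"
  obtains \<Omega> where "open \<Omega>" "\<phi> ` (U \<inter> N) = \<Omega> \<inter> (topspace (Euclidean_space d) \<inter> {x. 0 \<le> x 0})"
proof -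
  have c: "openin X U" "openin (half_space d) (\<phi> ` U)" "homeomorphic_map (subtopology X U) (subtopology (half_space d) (\<phi> ` U)) \<phi>"
    using assms(1) unfolding is_chart_def by auto
  have "openin (subtopology X U) (U \<inter> N)" by (simp add: openin_open_subtopology[OF c(1)] openin_Int c(1) assms(2))
  then have "openin (subtopology (half_space d) (\<phi> ` U)) (\<phi> ` (U \<inter> N))"
    using homeomorphic_imp_open_map[OF c(3)] unfolding open_map_def by blast
  then have "openin (half_space d) (\<phi> ` (U \<inter> N))" by (rule openin_trans_full[OF _ c(2)])
  then show ?thesis unfolding openin_half_space_iff using that by blast
qed

text \<open>Splitting the coefficients into real and imaginary parts turns a complex relation into
  an equation between a vector of \<open>V\<close> and \<open>\<i>\<close> times a vector of
  \<open>V\<close>; both vanish, and injectivity finishes.\<close>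

lemma differential_independent:
  fixes v :: "nat \<Rightarrow> complex ^ 'n::finite" and L :: "(nat \<Rightarrow> real) \<Rightarrow> complex ^ 'n"
  assumes L: "\<And>w. L w = (\<Sum>i<d. w i *\<^sub>R v i)" and inj: "inj_on L (topspace (Euclidean_space d))"
    and tr: "L ` topspace (Euclidean_space d) \<inter> (\<lambda>v. \<i> *s v) ` L ` topspace (Euclidean_space d) = {0}"
    and sum: "(\<Sum>i<d. a i *s v i) = 0"
  shows "\<forall>i<d. a i = 0"
proof -
  define x where "x i = (if i < d then Re (a i) else 0)" for i
  define y where "y i = (if i < d then Im (a i) else 0)" for i
  have E: "x \<in> topspace (Euclidean_space d)" "(\<lambda>i. - y i) \<in> topspace (Euclidean_space d)" "(\<lambda>i. 0) \<in> topspace (Euclidean_space d)"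
    unfolding x_def y_def topspace_Euclidean_space by auto
  have L0: "L (\<lambda>i. 0) = 0" unfolding L by simp
  have "a i *s v i = x i *\<^sub>R v i + \<i> *s (y i *\<^sub>R v i)" if "i < d" for i
    using that by (subst complex_eq[of "a i"]) (simp add: vec_eq_iff x_def y_def scaleR_conv_of_real[where 'a = complex] algebra_simps)
  then have "(\<Sum>i<d. a i *s v i) = (\<Sum>i<d. x i *\<^sub>R v i + \<i> *s (y i *\<^sub>R v i))" by (intro sum.cong) auto
  also have "\<dots> = L x + \<i> *s (\<Sum>i<d. y i *\<^sub>R v i)" unfolding L by (simp add: sum.distrib vec.scale_sum_right)
  also have "(\<Sum>i<d. y i *\<^sub>R v i) = - L (\<lambda>i. - y i)" unfolding L by (simp add: sum_negf)
  finally have eq: "L x = \<i> *s L (\<lambda>i. - y i)" using sum by simp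
  have "L x \<in> L ` topspace (Euclidean_space d)" by (rule imageI[OF E(1)])
  moreover have "L x \<in> (\<lambda>v. \<i> *s v) ` L ` topspace (Euclidean_space d)" unfolding eq by (intro imageI E(2))
  ultimately have Lx: "L x = 0" using tr by blast
  then have "L (\<lambda>i. - y i) = 0" using eq by simp
  then have "x = (\<lambda>i. 0)" "(\<lambda>i. - y i) = (\<lambda>i. 0)" using inj_onD[OF inj _ E(1,3)] inj_onD[OF inj _ E(2,3)] Lx L0 by auto
  then have "x i = 0 \<and> y i = 0" for i by (metis neg_equal_0_iff_equal)
  then show ?thesis unfolding x_def y_def by (metis complex_eq_iff zero_complex.sel)
qed

text \<open>The cell is the image of a closed half-ball of parameters: compact, contained in
  \<open>f(M)\<close>, and a neighborhood of \<open>f p\<close> in it also if \<open>p\<close> is a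
  boundary point.\<close>

lemma chart_cell:
  fixes \<sigma> :: "nat \<Rightarrow> 'n::finite" and f :: "'a \<Rightarrow> complex ^ 'n"
  assumes \<sigma>: "inj_on \<sigma> {..<d}" and d: "0 < d" "d < CARD('n)" and c: "is_chart d X (U, \<phi>)" "(U, \<phi>) \<in> \<A>"
    and f: "immersion d \<A> f" "totally_real d \<A> f" and p: "p \<in> U"
  obtains N T \<kappa> where "openin X N" "p \<in> N" "f ` N \<subseteq> T" "T \<subseteq> f ` topspace X" "0 < \<kappa>" "is_cell \<kappa> T"
proof -
  let ?J = "\<sigma> ` {..<d}" and ?E = "topspace (Euclidean_space d)"
  have sm: "smooth_map d \<A> f" using f(1) unfolding immersion_def by blast
  obtain V h where V: "open V" "to_vec \<sigma> d (\<phi> p) \<in> V" "smooth_on V h" "\<And>y. h (coord_proj ?J y) = h y"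
    "\<And>q. q \<in> U \<Longrightarrow> to_vec \<sigma> d (\<phi> q) \<in> V \<Longrightarrow> f q = h (to_vec \<sigma> d (\<phi> q))"
    by (rule smooth_map_extension[OF \<sigma> c sm p], rule that, assumption+)
  define a where "a = to_vec \<sigma> d (\<phi> p)"
  define v where "v i = dd (axis (\<sigma> i) 1) h a" for i
  define L where "L = differential d (U, \<phi>) f p"
  have lin: "linear (\<lambda>v. dd v h a)"
    by (rule has_derivative_linear[OF has_derivative_dd[OF smooth_on_imp_differentiable[OF V(3)]]]) (simp add: a_def V(2))
  have dL: "differential d (U, \<phi>) f p w = dd (to_vec \<sigma> d w) h a" for w
    unfolding a_def by (rule differential_eq_dd[OF \<sigma> c(1) p V(1-3)]) (rule V(5))
  have L: "L w = (\<Sum>i<d. w i *\<^sub>R v i)" for w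
    unfolding L_def v_def dL to_vec_sum[OF \<sigma>] linear_sum[OF lin] linear_scale[OF lin] ..
  have inj: "inj_on L ?E" using f(1) c(2) p unfolding immersion_def L_def by force
  have tr: "L ` ?E \<inter> (\<lambda>v. \<i> *s v) ` L ` ?E = {0}" using f(2) c(2) p unfolding totally_real_def L_def Let_def by force
  have ind: "\<forall>i<d. b i = 0" if "(\<Sum>i<d. b i *s v i) = 0" for b by (rule differential_independent[OF L inj tr that])
  obtain \<Lambda> m e \<nu> j where \<Lambda>: "tr_frame \<Lambda> ?J m e \<nu> j" "\<And>i. i < d \<Longrightarrow> \<Lambda> *v v i = axis (\<sigma> i) 1"
    by (rule totally_real_frame[OF \<sigma> d ind], assumption, rule that, assumption, blast)
  have J: "?J \<noteq> UNIV" using d(2) card_image[OF \<sigma>] by auto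
  have D: "\<Lambda> *v dd (axis i 1) h a = axis i 1" if i: "i \<in> ?J" for i
  proof -
    obtain k where "k < d" "i = \<sigma> k" using i by auto
    then show ?thesis using \<Lambda>(2)[of k] unfolding v_def by simp
  qed
  have aV: "a \<in> V" unfolding a_def by (rule V(2))
  obtain r \<kappa> where r: "r > 0" "\<kappa> > 0" "cball a r \<subseteq> V"
    "\<And>T. compact T \<Longrightarrow> T \<subseteq> h ` (cball a r \<inter> range (coord_proj ?J)) \<Longrightarrow> is_cell \<kappa> T"
    using totally_real_cell[OF V(1) aV V(3,4) _ J \<Lambda>(1) D] unfolding a_def coord_proj_to_vec by metis
  obtain \<Omega> where \<Omega>: "open \<Omega>" "\<phi> ` U = \<Omega> \<inter> (?E \<inter> {x. 0 \<le> x 0})"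
    using chart_facts(3)[OF c(1)] unfolding openin_half_space_iff by blast
  have pE: "\<phi> q \<in> ?E" "0 \<le> \<phi> q 0" if "q \<in> U" for q using \<Omega>(2) that by blast+
  have "open (to_seq \<sigma> d -` \<Omega>)" by (rule open_vimage[OF \<Omega>(1) continuous_on_to_seq])
  moreover have "a \<in> to_seq \<sigma> d -` \<Omega>" using \<Omega>(2) p to_seq_to_vec[OF \<sigma> pE(1)[OF p]] unfolding a_def by auto
  ultimately obtain r1 where r1: "r1 > 0" "ball a r1 \<subseteq> to_seq \<sigma> d -` \<Omega>" unfolding open_contains_ball by blast
  \<comment> \<open>A radius below \<open>r1\<close> guarantees that the parameters in the half-ball
    come from points of the chart; a radius of at most \<open>r\<close> makes its image a
    cell.\<close>
  define r' where "r' = min r (r1 / 2)"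
  have r': "r' > 0" "r' \<le> r" "r' < r1" unfolding r'_def using r(1) r1(1) by auto
  define B where "B = cball a r' \<inter> ({y. coord_proj ?J y = y} \<inter> {y. 0 \<le> y $ \<sigma> 0})"
  have "closed {y. coord_proj ?J y = y}"
    by (intro closed_Collect_eq linear_continuous_on bounded_linear_coord_proj continuous_on_id)
  moreover have "closed {y :: real ^ 'n. 0 \<le> y $ \<sigma> 0}" by (intro closed_Collect_le continuous_intros)
  ultimately have compB: "compact B" unfolding B_def by (intro compact_Int_closed compact_cball closed_Int)
  have Bsub: "B \<subseteq> cball a r \<inter> range (coord_proj ?J)"
  proof
    fix y assume "y \<in> B"
    then have "y \<in> cball a r'" "y = coord_proj ?J y" unfolding B_def by auto
    then show "y \<in> cball a r \<inter> range (coord_proj ?J)" using r'(2) by auto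
  qed
  have "compact (h ` B)"
    by (rule compact_continuous_image[OF continuous_on_subset[OF smooth_on_imp_continuous_on[OF V(3)]] compB]) (use Bsub r(3) in blast)
  then have cell: "is_cell \<kappa> (h ` B)" by (rule r(4)) (use Bsub in blast)
  have sub: "h ` B \<subseteq> f ` topspace X"
  proof clarify
    fix y assume y: "y \<in> B"
    have "y \<in> ball a r1" using y r'(3) unfolding B_def by auto
    then have "to_seq \<sigma> d y \<in> \<Omega>" using r1(2) by blast
    moreover have "0 \<le> to_seq \<sigma> d y 0" using y d(1) unfolding B_def to_seq_def by simp
    ultimately have "to_seq \<sigma> d y \<in> \<phi> ` U" unfolding \<Omega>(2) using to_seq_in_topspace by blast
    then obtain q where q: "q \<in> U" "to_seq \<sigma> d y = \<phi> q" by blast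
    have "to_vec \<sigma> d (\<phi> q) = y" using y unfolding q(2)[symmetric] to_vec_to_seq[OF \<sigma>] B_def by blast
    moreover have "y \<in> V" using y Bsub r(3) by blast
    ultimately have "f q = h y" using V(5)[OF q(1)] by simp
    then show "h y \<in> f ` topspace X" using q(1) chart_facts(1)[OF c(1)] by (metis imageI subsetD)
  qed
  define N where "N = {q \<in> U. to_vec \<sigma> d (\<phi> q) \<in> ball a r'}"
  have "openin X N" unfolding N_def by (rule chart_facts(7)[OF c(1) open_ball])
  moreover have "p \<in> N" unfolding N_def a_def using p r'(1) by simp
  moreover have "f ` N \<subseteq> h ` B"
  proof clarify
    fix q assume q: "q \<in> N"
    let ?y = "to_vec \<sigma> d (\<phi> q)"
    have qU: "q \<in> U" "?y \<in> ball a r'" using q unfolding N_def by auto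
    have "0 \<le> ?y $ \<sigma> 0" unfolding to_vec_nth(1)[OF \<sigma> d(1)] by (rule pE(2)[OF qU(1)])
    then have yB: "?y \<in> B" using qU(2) coord_proj_to_vec unfolding B_def by auto
    then have "?y \<in> V" using Bsub r(3) by blast
    then show "f q \<in> h ` B" using V(5)[OF qU(1)] yB by simp
  qed
  ultimately show ?thesis using that[OF _ _ _ sub r(2) cell] by blast
qed

text \<open>A form of the cell inequalities without parameters. It is homogeneous in differences of
  points, so it passes to limits of difference quotients, that is, to tangent vectors.\<close>

lemma cell_cone:
  fixes T :: "(complex ^ 'n::finite) set"
  assumes T: "is_cell \<kappa> T" and G: "\<And>x y. norm (G x - G y) \<le> \<kappa> * norm (x - y)"
  obtains \<Lambda> :: "complex ^ 'n ^ 'n" and \<rho> :: "complex ^ 'n \<Rightarrow> real ^ 'n" and C where "bounded_linear \<rho>"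
    "\<And>z z'. z \<in> T \<Longrightarrow> z' \<in> T \<Longrightarrow> norm (z - z') \<le> C * norm (\<rho> (z - z'))"
    "\<And>z z'. z \<in> T \<Longrightarrow> z' \<in> T \<Longrightarrow> norm (\<Lambda> *v (z + G z - (z' + G z')) - cvec (\<rho> (z - z'))) \<le> 1/10 * norm (\<rho> (z - z'))"
proof -
  obtain \<Lambda> J m e \<nu> j s r C L where *: "J \<noteq> UNIV" "tr_frame \<Lambda> J m e \<nu> j" "smooth_on UNIV s" "tr_map \<Lambda> J (1/20) C s" "C > 0"
    "bounded_linear (r :: complex ^ 'n \<Rightarrow> real ^ 'n)" "\<forall>z\<in>T. s (r z) = z" "\<forall>z. norm (\<Lambda> *v z) \<le> L * norm z" "0 \<le> L" "0 \<le> \<kappa>" "\<kappa> * L * C \<le> 1/20"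
    using T unfolding is_cell_def by (elim exE conjE) (rule that)
  have tr': "tr_map \<Lambda> J (1/10) (C + \<kappa> * C) (\<lambda>x. s x + G (s x))"
    by (rule tr_map_perturb[OF *(4,5) _ *(9-11) G]) (use *(8) in blast)
  define \<rho> where "\<rho> z = coord_proj J (r z)" for z
  have \<rho>d: "coord_proj J (r z - r z') = \<rho> (z - z')" for z z'
    unfolding \<rho>_def linear_diff[OF bounded_linear.linear[OF *(6)]] ..
  show ?thesis
  proof (rule that[of \<rho> C \<Lambda>])
    show "bounded_linear \<rho>" unfolding \<rho>_def[abs_def] by (rule bounded_linear_compose[OF bounded_linear_coord_proj *(6)])
    fix z z' assume z: "z \<in> T" "z' \<in> T"
    have "norm (s (r z) - s (r z')) \<le> C * norm (coord_proj J (r z - r z'))" using *(4) unfolding tr_map_def by blast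
    then show "norm (z - z') \<le> C * norm (\<rho> (z - z'))" using z *(7) unfolding \<rho>d by simp
    have "norm (\<Lambda> *v (s (r z) + G (s (r z)) - (s (r z') + G (s (r z')))) - cvec (coord_proj J (r z - r z'))) \<le> 1/10 * norm (coord_proj J (r z - r z'))"
      using tr' unfolding tr_map_def by blast
    then show "norm (\<Lambda> *v (z + G z - (z' + G z')) - cvec (\<rho> (z - z'))) \<le> 1/10 * norm (\<rho> (z - z'))"
      using z *(7) unfolding \<rho>d by simp
  qed
qed

text \<open>The condition \<open>0 \<le> w 0\<close> means that \<open>w\<close> points into the
  half-space, so a short segment in this direction stays in the image of the chart.\<close>

lemma eventually_extension_in_cell:
  fixes \<sigma> :: "nat \<Rightarrow> 'n::finite" and f :: "'a \<Rightarrow> 'b::real_normed_vector"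
  assumes \<sigma>: "inj_on \<sigma> {..<d}" and d: "0 < d" and c: "is_chart d X (U, \<phi>)" and p: "p \<in> U" and N: "openin X N" "p \<in> N" "f ` N \<subseteq> T"
    and V: "open V" "to_vec \<sigma> d (\<phi> p) \<in> V" "\<And>q. q \<in> U \<Longrightarrow> to_vec \<sigma> d (\<phi> q) \<in> V \<Longrightarrow> f q = h (to_vec \<sigma> d (\<phi> q))"
    and w: "0 \<le> w 0"
  shows "\<forall>\<^sub>F t in at_right 0. h (to_vec \<sigma> d (\<phi> p) + t *\<^sub>R to_vec \<sigma> d w) \<in> T"
proof -
  define a where "a = to_vec \<sigma> d (\<phi> p)"
  obtain \<Omega> where \<Omega>: "open \<Omega>" "\<phi> ` (U \<inter> N) = \<Omega> \<inter> (topspace (Euclidean_space d) \<inter> {x. 0 \<le> x 0})"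
    by (rule chart_half_space[OF c N(1)], rule that)
  have pp: "\<phi> p \<in> \<Omega>" "\<phi> p \<in> topspace (Euclidean_space d)" "0 \<le> \<phi> p 0" using \<Omega>(2) p N(2) by blast+
  let ?l = "\<lambda>t :: real. a + t *\<^sub>R to_vec \<sigma> d w"
  have "open (V \<inter> to_seq \<sigma> d -` \<Omega>)" by (intro open_Int V(1) open_vimage[OF \<Omega>(1) continuous_on_to_seq])
  then have "open (?l -` (V \<inter> to_seq \<sigma> d -` \<Omega>))" by (rule open_vimage) (intro continuous_intros)
  moreover have "0 \<in> ?l -` (V \<inter> to_seq \<sigma> d -` \<Omega>)"
    using V(2) pp(1) to_seq_to_vec[OF \<sigma> pp(2)] unfolding a_def by simp
  ultimately obtain e where e: "e > 0" "ball 0 e \<subseteq> ?l -` (V \<inter> to_seq \<sigma> d -` \<Omega>)" unfolding open_contains_ball by blast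
  have "h (?l t) \<in> T" if t: "0 < t" "t < e" for t
  proof -
    have tb: "?l t \<in> V" "to_seq \<sigma> d (?l t) \<in> \<Omega>" using e(2) t by (auto simp: subset_iff)
    have "to_seq \<sigma> d (?l t) 0 = \<phi> p 0 + t * w 0" unfolding a_def using d by (simp add: to_seq_def to_vec_nth(1)[OF \<sigma> d])
    then have "0 \<le> to_seq \<sigma> d (?l t) 0" using pp(3) w t by simp
    then have "to_seq \<sigma> d (?l t) \<in> \<phi> ` (U \<inter> N)" unfolding \<Omega>(2) using tb(2) to_seq_in_topspace by blast
    then obtain q where q: "q \<in> U" "q \<in> N" "to_seq \<sigma> d (?l t) = \<phi> q" by blast
    have "to_vec \<sigma> d (\<phi> q) = ?l t"
      unfolding q(3)[symmetric] to_vec_to_seq[OF \<sigma>] linear_add[OF linear_coord_proj] linear_scale[OF linear_coord_proj] a_def coord_proj_to_vec ..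
    then have "f q = h (?l t)" using V(3)[OF q(1)] tb(1) by simp
    then show ?thesis using N(3) q(2) by auto
  qed
  then show ?thesis unfolding a_def[symmetric] eventually_at_right_field using e(1) by blast
qed

text \<open>A nearly real vector is not \<open>\<i>\<close> times a nearly real one unless both real
  approximations vanish: \<open>b\<close> and \<open>- b'\<close> are the real and imaginary parts
  of \<open>u\<close>, yet \<open>u\<close> has norm at most a tenth of the sum of theirs.\<close>

lemma norm_cvec_ii_cancel:
  assumes "norm (z - cvec b) \<le> 1/10 * norm b" "norm (z' - cvec b') \<le> 1/10 * norm b'" "z = \<i> *s z'"
  shows "b = 0 \<and> b' = 0"
proof -
  define u where "u = cvec b - \<i> *s cvec b'"
  have u: "u = \<i> *s (z' - cvec b') - (z - cvec b)" unfolding u_def assms(3) by (simp add: vec_eq_iff algebra_simps)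
  have "norm u \<le> norm (\<i> *s (z' - cvec b')) + norm (z - cvec b)" unfolding u by (rule norm_triangle_ineq4)
  then have 1: "norm u \<le> 1/10 * norm b' + 1/10 * norm b" using assms(1,2) unfolding norm_smult by simp
  have "Re_vec u = b" unfolding u_def by (simp add: vec_eq_iff)
  then have 2: "norm b \<le> norm u" using norm_Re_vec_le[of u] by simp
  have "Re_vec (\<i> *s u) = b'" unfolding u_def by (simp add: vec_eq_iff)
  then have 3: "norm b' \<le> norm u" using norm_Re_vec_le[of "\<i> *s u"] by (simp add: norm_smult)
  have "norm b \<le> 0" "norm b' \<le> 0" using 1 2 3 norm_ge_zero[of b] norm_ge_zero[of b'] by linarith+
  then show ?thesis by simp
qed

text \<open>In the limit the cone inequalities say that \<open>\<Lambda>\<close> maps the perturbed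
  tangent vector \<open>u' w\<close> close to the real vector \<open>\<rho> (u w)\<close>. Each of
  \<open>u' w = 0\<close> and \<open>u' w = \<i> *s u' w'\<close> then forces
  \<open>\<rho> (u w) = 0\<close>, hence \<open>u w = 0\<close> and \<open>w = 0\<close>.\<close>

lemma perturbed_differential:
  fixes \<sigma> :: "nat \<Rightarrow> 'n::finite" and f :: "'a \<Rightarrow> complex ^ 'n"
  assumes \<sigma>: "inj_on \<sigma> {..<d}" and d: "0 < d" and c: "is_chart d X (U, \<phi>)" "(U, \<phi>) \<in> \<A>" and f: "smooth_map d \<A> f" and p: "p \<in> U"
    and inj: "inj_on (differential d (U, \<phi>) f p) (topspace (Euclidean_space d))"
    and T: "is_cell \<kappa> T" and N: "openin X N" "p \<in> N" "f ` N \<subseteq> T"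
    and G: "smooth_on UNIV G" "\<And>x y. norm (G x - G y) \<le> \<kappa> * norm (x - y)"
  defines "F \<equiv> differential d (U, \<phi>) (\<lambda>q. f q + G (f q)) p"
  shows "inj_on F (topspace (Euclidean_space d))"
    and "F ` topspace (Euclidean_space d) \<inter> (\<lambda>v. \<i> *s v) ` F ` topspace (Euclidean_space d) = {0}"
proof -
  let ?E = "topspace (Euclidean_space d)"
  obtain V h where V: "open V" "to_vec \<sigma> d (\<phi> p) \<in> V" "smooth_on V h"
    "\<And>q. q \<in> U \<Longrightarrow> to_vec \<sigma> d (\<phi> q) \<in> V \<Longrightarrow> f q = h (to_vec \<sigma> d (\<phi> q))"
    by (rule smooth_map_extension[OF \<sigma> c f p], rule that, assumption+)
  define a where "a = to_vec \<sigma> d (\<phi> p)"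
  define h' where "h' y = h y + G (h y)" for y
  have h': "smooth_on V h'" unfolding h'_def[abs_def]
    by (rule smooth_on_add[OF V(1,3) smooth_on_compose[OF V(1) open_UNIV G(1) V(3)]]) simp
  have hd: "h differentiable (at a)" "h' differentiable (at a)"
    using smooth_on_imp_differentiable[OF V(3,2)] smooth_on_imp_differentiable[OF h' V(2)] unfolding a_def by auto
  define u where "u w = dd (to_vec \<sigma> d w) h a" for w
  define u' where "u' w = dd (to_vec \<sigma> d w) h' a" for w
  have du: "differential d (U, \<phi>) f p w = u w" for w
    unfolding a_def u_def by (rule differential_eq_dd[OF \<sigma> c(1) p V(1-3)]) (rule V(4))
  have F: "F w = u' w" for w
    unfolding a_def u'_def F_def by (rule differential_eq_dd[OF \<sigma> c(1) p V(1,2) h']) (simp add: V(4) h'_def)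
  obtain \<Lambda> :: "complex ^ 'n ^ 'n" and \<rho> :: "complex ^ 'n \<Rightarrow> real ^ 'n" and C where cone: "bounded_linear \<rho>"
    "\<And>z z'. z \<in> T \<Longrightarrow> z' \<in> T \<Longrightarrow> norm (z - z') \<le> C * norm (\<rho> (z - z'))"
    "\<And>z z'. z \<in> T \<Longrightarrow> z' \<in> T \<Longrightarrow> norm (\<Lambda> *v (z + G z - (z' + G z')) - cvec (\<rho> (z - z'))) \<le> 1/10 * norm (\<rho> (z - z'))"
    by (rule cell_cone[OF T G(2)], rule that, assumption, blast, blast)
  note \<rho>lin = bounded_linear.linear[OF cone(1)]
  have \<Lambda>bl: "bounded_linear ((*v) \<Lambda>)" using linear_complex_matrix_mult by (simp add: linear_conv_bounded_linear)
  have cvbl: "bounded_linear (cvec :: real ^ 'n \<Rightarrow> _)"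
    by (auto simp: linear_conv_bounded_linear[symmetric] vec_eq_iff scaleR_conv_of_real[where 'a = complex] intro!: linearI)
  have key: "norm (u w) \<le> C * norm (\<rho> (u w))" "norm (\<Lambda> *v u' w - cvec (\<rho> (u w))) \<le> 1/10 * norm (\<rho> (u w))" for w
  proof -
    text \<open>Both points of the difference quotients must lie in the half-space, hence the shift by \<open>s\<close>.\<close>
    define s where "s i = (if i = 0 then \<bar>w 0\<bar> else 0)" for i :: nat
    define sw where "sw i = s i + w i" for i
    have add: "to_vec \<sigma> d sw = to_vec \<sigma> d s + to_vec \<sigma> d w" by (simp add: vec_eq_iff to_vec_def sw_def)
    define l where "l t = a + t *\<^sub>R to_vec \<sigma> d s" for t
    define l' where "l' t = a + t *\<^sub>R to_vec \<sigma> d sw" for t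
    have "\<forall>\<^sub>F t in at_right 0. h (l t) \<in> T" unfolding l_def a_def
      by (rule eventually_extension_in_cell[OF \<sigma> d c(1) p N V(1,2,4)]) (simp_all add: s_def)
    moreover have "\<forall>\<^sub>F t in at_right 0. h (l' t) \<in> T" unfolding l'_def a_def
      by (rule eventually_extension_in_cell[OF \<sigma> d c(1) p N V(1,2,4)]) (simp_all add: sw_def s_def)
    moreover have "\<forall>\<^sub>F t in at_right (0::real). 0 < t" unfolding eventually_at_right_field by (intro exI[of _ 1]) simp
    ultimately have ev: "\<forall>\<^sub>F t in at_right 0. h (l t) \<in> T \<and> h (l' t) \<in> T \<and> 0 < t" by eventually_elim simp
    have quot: "((\<lambda>t. (g (l' t) - g (l t)) /\<^sub>R t) \<longlongrightarrow> dd (to_vec \<sigma> d w) g a) (at_right 0)"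
      if g: "g differentiable (at a)" for g :: "real ^ 'n \<Rightarrow> complex ^ 'n"
    proof -
      have "((\<lambda>t. (g (l' t) - g a) /\<^sub>R t - (g (l t) - g a) /\<^sub>R t) \<longlongrightarrow> dd (to_vec \<sigma> d sw) g a - dd (to_vec \<sigma> d s) g a) (at_right 0)"
        unfolding l_def l'_def by (intro tendsto_diff dd_limit g)
      moreover have "dd (to_vec \<sigma> d sw) g a - dd (to_vec \<sigma> d s) g a = dd (to_vec \<sigma> d w) g a"
        unfolding add using linear_add[OF has_derivative_linear[OF has_derivative_dd[OF g]]] by simp
      ultimately show ?thesis by (simp add: scaleR_diff_right)
    qed
    define z where "z t = (h (l' t) - h (l t)) /\<^sub>R t" for t
    define z' where "z' t = (h' (l' t) - h' (l t)) /\<^sub>R t" for t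
    have lim: "(z \<longlongrightarrow> u w) (at_right 0)" "(z' \<longlongrightarrow> u' w) (at_right 0)"
      unfolding z_def z'_def u_def u'_def by (rule quot[OF hd(1)], rule quot[OF hd(2)])
    have lim\<rho>: "((\<lambda>t. \<rho> (z t)) \<longlongrightarrow> \<rho> (u w)) (at_right 0)" by (rule bounded_linear.tendsto[OF cone(1) lim(1)])
    show "norm (u w) \<le> C * norm (\<rho> (u w))"
    proof (rule tendsto_le[OF trivial_limit_at_right_real tendsto_mult[OF tendsto_const tendsto_norm[OF lim\<rho>]] tendsto_norm[OF lim(1)]])
      show "\<forall>\<^sub>F t in at_right 0. norm (z t) \<le> C * norm (\<rho> (z t))"
        using ev
      proof eventually_elim
        case (elim t)
        then have "norm (h (l' t) - h (l t)) \<le> C * norm (\<rho> (h (l' t) - h (l t)))" by (intro cone(2)) auto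
        then show ?case unfolding z_def linear_scale[OF \<rho>lin] norm_scaleR using elim by (simp add: divide_simps mult_ac)
      qed
    qed
    show "norm (\<Lambda> *v u' w - cvec (\<rho> (u w))) \<le> 1/10 * norm (\<rho> (u w))"
    proof (rule tendsto_le[OF trivial_limit_at_right_real tendsto_mult[OF tendsto_const tendsto_norm[OF lim\<rho>]]
          tendsto_norm[OF tendsto_diff[OF bounded_linear.tendsto[OF \<Lambda>bl lim(2)] bounded_linear.tendsto[OF cvbl lim\<rho>]]]])
      show "\<forall>\<^sub>F t in at_right 0. norm (\<Lambda> *v z' t - cvec (\<rho> (z t))) \<le> 1/10 * norm (\<rho> (z t))"
        using ev
      proof eventually_elim
        case (elim t)
        have "norm (\<Lambda> *v (h' (l' t) - h' (l t)) - cvec (\<rho> (h (l' t) - h (l t)))) \<le> 1/10 * norm (\<rho> (h (l' t) - h (l t)))"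
          unfolding h'_def using elim by (intro cone(3)) auto
        moreover have "\<Lambda> *v z' t - cvec (\<rho> (z t)) = (\<Lambda> *v (h' (l' t) - h' (l t)) - cvec (\<rho> (h (l' t) - h (l t)))) /\<^sub>R t"
          unfolding z_def z'_def linear_scale[OF \<rho>lin] linear_scale[OF bounded_linear.linear[OF \<Lambda>bl]]
            linear_scale[OF bounded_linear.linear[OF cvbl]] by (rule scaleR_diff_right[symmetric])
        moreover have "\<rho> (z t) = \<rho> (h (l' t) - h (l t)) /\<^sub>R t" unfolding z_def linear_scale[OF \<rho>lin] ..
        ultimately show ?case using elim by (simp add: divide_simps mult_ac)
      qed
    qed
  qed
  have E0: "(\<lambda>i. 0) \<in> ?E" by (simp add: topspace_Euclidean_space)
  have tv0: "to_vec \<sigma> d (\<lambda>i. 0) = 0" by (simp add: vec_eq_iff to_vec_def)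
  have u0: "u (\<lambda>i. 0) = 0" "u' (\<lambda>i. 0) = 0"
    unfolding u_def u'_def tv0 using hd linear_0[OF has_derivative_linear[OF has_derivative_dd]] by auto
  have zero: "w = (\<lambda>i. 0)" if "\<rho> (u w) = 0" "w \<in> ?E" for w
  proof -
    have "u w = 0" using key(1)[of w] that(1) by simp
    then show ?thesis using inj_onD[OF inj _ that(2) E0] u0(1) unfolding du by simp
  qed
  have lin': "u' (\<lambda>i. w i - w' i) = u' w - u' w'" for w w'
  proof -
    have "to_vec \<sigma> d (\<lambda>i. w i - w' i) = to_vec \<sigma> d w - to_vec \<sigma> d w'" by (simp add: vec_eq_iff to_vec_def)
    then show ?thesis unfolding u'_def using linear_diff[OF has_derivative_linear[OF has_derivative_dd[OF hd(2)]]] by simp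
  qed
  show "inj_on F ?E"
  proof (rule inj_onI)
    fix w w' assume w: "w \<in> ?E" "w' \<in> ?E" "F w = F w'"
    let ?w = "\<lambda>i. w i - w' i"
    have "u' ?w = 0" unfolding lin' using w(3) F by simp
    then have "\<rho> (u ?w) = 0"
      using key(2)[of ?w] linear_0[OF bounded_linear.linear[OF \<Lambda>bl]] norm_ge_zero[of "\<rho> (u ?w)"] by (simp add: norm_minus_cancel)
    then have "?w = (\<lambda>i. 0)" by (rule zero) (use w in \<open>simp add: topspace_Euclidean_space\<close>)
    then show "w = w'" by (simp add: fun_eq_iff)
  qed
  show "F ` ?E \<inter> (\<lambda>v. \<i> *s v) ` F ` ?E = {0}"
  proof (intro equalityI subsetI)
    fix x assume "x \<in> F ` ?E \<inter> (\<lambda>v. \<i> *s v) ` F ` ?E"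
    then obtain w w' where w: "w \<in> ?E" "w' \<in> ?E" "x = u' w" "x = \<i> *s u' w'" unfolding F[abs_def] by blast
    have "\<Lambda> *v u' w = \<i> *s (\<Lambda> *v u' w')" using w(3,4) vector_scalar_commute by metis
    then have "\<rho> (u w) = 0" using norm_cvec_ii_cancel[OF key(2)[of w] key(2)[of w']] by blast
    then have "w = (\<lambda>i. 0)" by (rule zero[OF _ w(1)])
    then show "x \<in> {0}" using w(3) u0(2) by simp
  next
    fix x :: "complex ^ 'n" assume "x \<in> {0}"
    moreover have "0 \<in> F ` ?E" using E0 F u0(2) by (metis image_eqI)
    moreover from this have "0 \<in> (\<lambda>v. \<i> *s v) ` F ` ?E" by (metis image_eqI vec.scale_zero_right)
    ultimately show "x \<in> F ` ?E \<inter> (\<lambda>v. \<i> *s v) ` F ` ?E" by simp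
  qed
qed

section \<open>Perturbing the embedding\<close>

lemma iter_partial_local_bound:
  fixes \<sigma> :: "nat \<Rightarrow> 'n::finite" and f :: "'a \<Rightarrow> complex ^ 'n"
  assumes \<sigma>: "inj_on \<sigma> {..<d}" and c: "is_chart d X (U, \<phi>)" "(U, \<phi>) \<in> \<A>" and f: "smooth_map d \<A> f" and p: "p \<in> U"
  shows "\<exists>N C. openin X N \<and> p \<in> N \<and> 0 < C \<and> (\<forall>(E :: complex ^ 'n \<Rightarrow> complex ^ 'n) M q is. smooth_on UNIV E \<longrightarrow> 0 \<le> M \<longrightarrow> Cbd k UNIV M E \<longrightarrow>
    q \<in> U \<inter> N \<longrightarrow> set is \<subseteq> {..<d} \<longrightarrow> length is \<le> k \<longrightarrow> norm (iter_partial (\<phi> ` U) is (local_rep (U, \<phi>) (\<lambda>x. E (f x))) (\<phi> q)) \<le> C * M)"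
proof -
  obtain V h where V: "open V" "to_vec \<sigma> d (\<phi> p) \<in> V" "smooth_on V h"
    "\<And>q. q \<in> U \<Longrightarrow> to_vec \<sigma> d (\<phi> q) \<in> V \<Longrightarrow> f q = h (to_vec \<sigma> d (\<phi> q))"
    by (rule smooth_map_extension[OF \<sigma> c f p], rule that, assumption+)
  define a where "a = to_vec \<sigma> d (\<phi> p)"
  obtain r where r: "r > 0" "cball a r \<subseteq> V" using V(1,2) unfolding a_def open_contains_cball by blast
  obtain C where C: "C > 0" "\<And>(E :: complex ^ 'n \<Rightarrow> complex ^ 'n) M. smooth_on UNIV E \<Longrightarrow> 0 \<le> M \<Longrightarrow> Cbd k (h ` cball a r) M E \<Longrightarrow>
      Cbd k (cball a r) (C * M) (\<lambda>x. E (h x))"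
    using Cbd_compose[OF V(1) compact_cball r(2) V(3) open_UNIV subset_UNIV, where k = k] by blast
  define N where "N = {q \<in> U. to_vec \<sigma> d (\<phi> q) \<in> ball a r}"
  have "norm (iter_partial (\<phi> ` U) is (local_rep (U, \<phi>) (\<lambda>x. E (f x))) (\<phi> q)) \<le> C * M"
    if E: "smooth_on UNIV E" "0 \<le> M" "Cbd k UNIV M E" and q: "q \<in> U \<inter> N" and is': "set is \<subseteq> {..<d}" "length is \<le> k"
    for E :: "complex ^ 'n \<Rightarrow> complex ^ 'n" and M q "is"
  proof (rule norm_iter_partial_le[OF \<sigma> chart_facts(4)[OF c(1)] V(1) _ _ r(2) _ is'])
    show "smooth_on V (\<lambda>y. E (h y))" by (rule smooth_on_compose[OF V(1) open_UNIV E(1) V(3)]) simp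
    show "Cbd k (cball a r) (C * M) (\<lambda>y. E (h y))" by (rule C(2)[OF E(1,2) Cbd_mono[OF E(3)]]) auto
    show "local_rep (U, \<phi>) (\<lambda>x. E (f x)) x = E (h (to_vec \<sigma> d x))" if x: "x \<in> \<phi> ` U" "to_vec \<sigma> d x \<in> V" for x
    proof -
      obtain q' where "q' \<in> U" "x = \<phi> q'" using x(1) by blast
      then show ?thesis using V(4)[of q'] x(2) by (simp add: chart_facts(5)[OF c(1)])
    qed
    show "\<phi> q \<in> \<phi> ` U" "to_vec \<sigma> d (\<phi> q) \<in> cball a r" using q unfolding N_def by auto
  qed
  moreover have "openin X N" unfolding N_def by (rule chart_facts(7)[OF c(1) open_ball])
  moreover have "p \<in> N" unfolding N_def a_def using p r(1) by simp
  ultimately show ?thesis using C(1) by (intro exI[of _ N] exI[of _ C]) auto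
qed

text \<open>The constant depends on \<open>f\<close>, \<open>k\<close> and the cover, not on
  \<open>E\<close>, so the size of \<open>E\<close> can be fixed before \<open>E\<close> is
  constructed. It is uniform by compactness of the sets in the finite cover.\<close>

lemma Ck_norm_compose_le:
  fixes \<sigma> :: "nat \<Rightarrow> 'n::finite" and f :: "'a \<Rightarrow> complex ^ 'n"
  assumes \<sigma>: "inj_on \<sigma> {..<d}" and \<A>: "\<And>c. c \<in> \<A> \<Longrightarrow> is_chart d X c" and f: "smooth_map d \<A> f" and \<C>: "compact_chart_cover X \<A> \<C>"
  obtains B where "0 < B" "\<And>(E :: complex ^ 'n \<Rightarrow> complex ^ 'n) M. smooth_on UNIV E \<Longrightarrow> 0 \<le> M \<Longrightarrow> Cbd k UNIV M E \<Longrightarrow>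
    Ck_norm d \<C> k (\<lambda>x. E (f x)) \<le> B * M"
proof -
  define P where "P U \<phi> C S \<longleftrightarrow> (\<forall>(E :: complex ^ 'n \<Rightarrow> complex ^ 'n) M q is. smooth_on UNIV E \<longrightarrow> 0 \<le> M \<longrightarrow> Cbd k UNIV M E \<longrightarrow>
    q \<in> S \<longrightarrow> set is \<subseteq> {..<d} \<longrightarrow> length is \<le> k \<longrightarrow> norm (iter_partial (\<phi> ` U) is (local_rep (U, \<phi>) (\<lambda>x. E (f x))) (\<phi> q)) \<le> C * M)"
    for U \<phi> and C :: real and S
  have Pmono: "P U \<phi> C' S'" if "P U \<phi> C S" "C \<le> C'" "S' \<subseteq> S" for U \<phi> C C' S S'
    unfolding P_def
  proof (intro allI impI)
    fix E :: "complex ^ 'n \<Rightarrow> complex ^ 'n" and M q "is"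
    assume *: "smooth_on UNIV E" "0 \<le> M" "Cbd k UNIV M E" "q \<in> S'" "set is \<subseteq> {..<d}" "length is \<le> k"
    then have "norm (iter_partial (\<phi> ` U) is (local_rep (U, \<phi>) (\<lambda>x. E (f x))) (\<phi> q)) \<le> C * M"
      using that(1,3) unfolding P_def by blast
    also have "\<dots> \<le> C' * M" using that(2) *(2) by (rule mult_right_mono)
    finally show "norm (iter_partial (\<phi> ` U) is (local_rep (U, \<phi>) (\<lambda>x. E (f x))) (\<phi> q)) \<le> C' * M" .
  qed
  have "\<exists>C. 0 < C \<and> P (fst (fst cL)) (snd (fst cL)) C (snd cL)" if cL: "cL \<in> \<C>" for cL
  proof -
    obtain U \<phi> L where cL': "cL = ((U, \<phi>), L)" by (metis surj_pair)
    have c: "(U, \<phi>) \<in> \<A>" "compactin X L" "L \<subseteq> U" using \<C> cL unfolding compact_chart_cover_def cL' by force+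
    define \<U> where "\<U> = {N. openin X N \<and> (\<exists>C. 0 < C \<and> P U \<phi> C (U \<inter> N))}"
    have "L \<subseteq> \<Union>\<U>"
    proof
      fix p assume "p \<in> L"
      then have "p \<in> U" using c(3) by blast
      from iter_partial_local_bound[OF \<sigma> \<A>[OF c(1)] c(1) f this, of k]
      show "p \<in> \<Union>\<U>" unfolding \<U>_def P_def by blast
    qed
    moreover have "\<forall>N\<in>\<U>. openin X N" unfolding \<U>_def by blast
    ultimately obtain \<F> where \<F>: "finite \<F>" "\<F> \<subseteq> \<U>" "L \<subseteq> \<Union>\<F>" using c(2) unfolding compactin_def by meson
    have "\<forall>N\<in>\<F>. \<exists>C. 0 < C \<and> P U \<phi> C (U \<inter> N)" using \<F>(2) unfolding \<U>_def by blast
    then obtain C where C: "\<And>N. N \<in> \<F> \<Longrightarrow> 0 < C N \<and> P U \<phi> (C N) (U \<inter> N)" by metis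
    define D where "D = 1 + sum C \<F>"
    have "C N \<le> D" if "N \<in> \<F>" for N
      using member_le_sum[OF that _ \<F>(1), of C] C unfolding D_def by (force intro: less_imp_le)
    then have PN: "P U \<phi> D (U \<inter> N)" if "N \<in> \<F>" for N using Pmono[of U \<phi> "C N" "U \<inter> N" D "U \<inter> N"] C that by blast
    have "L \<subseteq> (\<Union>N\<in>\<F>. U \<inter> N)" using \<F>(3) c(3) by blast
    moreover have "P U \<phi> D (\<Union>N\<in>\<F>. U \<inter> N)" using PN unfolding P_def by blast
    ultimately have "P U \<phi> D L" using Pmono by blast
    moreover have "0 < D" unfolding D_def using C by (intro add_pos_nonneg sum_nonneg) (auto intro: less_imp_le)
    ultimately show ?thesis unfolding cL' by auto
  qed
  then obtain C where C: "\<And>cL. cL \<in> \<C> \<Longrightarrow> 0 < C cL \<and> P (fst (fst cL)) (snd (fst cL)) (C cL) (snd cL)" by metis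
  have fin: "finite \<C>" using \<C> unfolding compact_chart_cover_def by blast
  define B where "B = 1 + sum C \<C>"
  have B: "0 < B" unfolding B_def using C by (intro add_pos_nonneg sum_nonneg) (auto intro: less_imp_le)
  have CB: "C cL \<le> B" if "cL \<in> \<C>" for cL
    using member_le_sum[OF that _ fin, of C] C unfolding B_def by (force intro: less_imp_le)
  have PB: "P U \<phi> B L" if "((U, \<phi>), L) \<in> \<C>" for U \<phi> L
    using Pmono[OF _ CB[OF that] order_refl] C[OF that] by simp
  show ?thesis
  proof (rule that[OF B])
    fix E :: "complex ^ 'n \<Rightarrow> complex ^ 'n" and M
    assume E: "smooth_on UNIV E" "0 \<le> M" "Cbd k UNIV M E"
    show "Ck_norm d \<C> k (\<lambda>x. E (f x)) \<le> B * M"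
      unfolding Ck_norm_def
    proof (rule cSup_least)
      fix y assume "y \<in> insert 0 {norm (iter_partial (\<phi> ` U) is (local_rep (U, \<phi>) (\<lambda>x. E (f x))) (\<phi> x)) | U \<phi> L is x.
       ((U, \<phi>), L) \<in> \<C> \<and> x \<in> L \<and> length is \<le> k \<and> set is \<subseteq> {..<d}}"
      then consider "y = 0" | U \<phi> L "is" x where "y = norm (iter_partial (\<phi> ` U) is (local_rep (U, \<phi>) (\<lambda>x. E (f x))) (\<phi> x))"
        "((U, \<phi>), L) \<in> \<C>" "x \<in> L" "length is \<le> k" "set is \<subseteq> {..<d}" by blast
      then show "y \<le> B * M"
      proof cases
        case 1
        then show ?thesis using B E(2) by simp
      next
        case 2
        then show ?thesis using PB[OF 2(2)] E unfolding P_def by blast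
      qed
    qed simp
  qed
qed

text \<open>Serves the case of dimension 0. For each point of \<open>S\<close> some coordinate
  differs from that of \<open>z\<close>; the product of the coordinate differences vanishes on
  \<open>S\<close> but not at \<open>z\<close>.\<close>

lemma polynomially_convex_Un_finite:
  fixes K S :: "(complex ^ 'n::finite) set"
  assumes K: "compact K" "polynomially_convex K" and S: "finite S"
  shows "polynomial_hull (K \<union> S) = K \<union> S"
proof (rule equalityI)
  show "polynomial_hull (K \<union> S) \<subseteq> K \<union> S"
  proof (rule subsetI, rule ccontr)
    fix z assume z: "z \<in> polynomial_hull (K \<union> S)" "z \<notin> K \<union> S"
    have "\<forall>w\<in>S. \<exists>j. z $ j \<noteq> w $ j" using z(2) by (metis UnI2 vec_eq_iff)
    then obtain j where j: "\<And>w. w \<in> S \<Longrightarrow> z $ j w \<noteq> w $ j w" by metis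
    define F where "F x = (\<Prod>w\<in>S. x $ j w - w $ j w)" for x :: "complex ^ 'n"
    have "holomorphic_polynomial F" unfolding F_def[abs_def]
      by (intro holomorphic_polynomial_prod holomorphic_polynomial_diff holomorphic_polynomial_coord holomorphic_polynomial_const)
    moreover have "F w = 0" if "w \<in> S" for w unfolding F_def using S that by (auto simp: prod_zero_iff)
    moreover have "F z \<noteq> 0" unfolding F_def using S j by (simp add: prod_zero_iff)
    ultimately show False using not_in_polynomial_hull_Un[OF K, of F S z] z by blast
  qed
  show "K \<union> S \<subseteq> polynomial_hull (K \<union> S)" by (rule subset_polynomial_hull) (use K S in \<open>auto intro: finite_imp_compact\<close>)
qed

text \<open>A chart maps its domain injectively into a one-point space, and finitely many domains
  cover.\<close>

lemma finite_zero_dimensional_manifold: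
  assumes X: "compact_space X" "\<And>c. c \<in> \<A> \<Longrightarrow> is_chart 0 X c" "(\<Union>c\<in>\<A>. fst c) = topspace X"
  shows "finite (topspace X)"
proof -
  have fin: "finite (fst c)" if "c \<in> \<A>" for c
  proof -
    obtain U \<phi> where c: "c = (U, \<phi>)" by (cases c)
    have ch: "is_chart 0 X (U, \<phi>)" using X(2)[OF that] unfolding c .
    have "\<phi> ` U \<subseteq> {\<lambda>i. 0}"
      using chart_facts(4)[OF ch] unfolding coord_accessible_def topspace_Euclidean_space by auto
    then have "finite (\<phi> ` U)" by (rule finite_subset) simp
    then show ?thesis using chart_facts(2)[OF ch] unfolding c by (simp add: finite_image_iff)
  qed
  have "\<forall>N\<in>fst ` \<A>. openin X N" using chart_facts(6) X(2) by fastforce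
  then obtain \<F> where \<F>: "finite \<F>" "\<F> \<subseteq> fst ` \<A>" "topspace X \<subseteq> \<Union>\<F>"
    using X(1,3) unfolding compact_space_def compactin_def by (metis order_refl)
  have "finite (\<Union>\<F>)" using \<F> fin by (intro finite_Union) auto
  then show ?thesis using \<F>(3) finite_subset by blast
qed

section \<open>Assembly of the perturbed embedding\<close>

lemma manifold_cells:
  fixes \<sigma> :: "nat \<Rightarrow> 'n::finite" and f :: "'a \<Rightarrow> complex ^ 'n"
  assumes \<sigma>: "inj_on \<sigma> {..<d}" and d: "0 < d" "d < CARD('n)" and X: "compact_space X" and \<A>: "\<And>c. c \<in> \<A> \<Longrightarrow> is_chart d X c" "(\<Union>c\<in>\<A>. fst c) = topspace X"
    and f: "immersion d \<A> f" "totally_real d \<A> f"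
  obtains \<T> \<kappa> where "finite \<T>" "0 < \<kappa>" "\<And>T. T \<in> \<T> \<Longrightarrow> is_cell \<kappa> T" "\<Union>\<T> = f ` topspace X"
    "\<And>p. p \<in> topspace X \<Longrightarrow> \<exists>N T. T \<in> \<T> \<and> openin X N \<and> p \<in> N \<and> f ` N \<subseteq> T"
proof -
  define \<U> where "\<U> = {N. openin X N \<and> (\<exists>T \<kappa>. f ` N \<subseteq> T \<and> T \<subseteq> f ` topspace X \<and> 0 < \<kappa> \<and> is_cell \<kappa> T)}"
  have "topspace X \<subseteq> \<Union>\<U>"
  proof
    fix p assume "p \<in> topspace X"
    then obtain U \<phi> where c: "(U, \<phi>) \<in> \<A>" "p \<in> U" using \<A>(2) by fastforce
    obtain N T \<kappa> where "openin X N" "p \<in> N" "f ` N \<subseteq> T" "T \<subseteq> f ` topspace X" "0 < \<kappa>" "is_cell \<kappa> T"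
      by (rule chart_cell[OF \<sigma> d \<A>(1)[OF c(1)] c(1) f c(2)], rule that, assumption+)
    then show "p \<in> \<Union>\<U>" unfolding \<U>_def by blast
  qed
  moreover have "\<forall>N\<in>\<U>. openin X N" unfolding \<U>_def by blast
  ultimately obtain \<F> where \<F>: "finite \<F>" "\<F> \<subseteq> \<U>" "topspace X \<subseteq> \<Union>\<F>"
    using X unfolding compact_space_def compactin_def by meson
  have "\<forall>N\<in>\<F>. \<exists>T \<kappa>. f ` N \<subseteq> T \<and> T \<subseteq> f ` topspace X \<and> 0 < \<kappa> \<and> is_cell \<kappa> T" using \<F>(2) unfolding \<U>_def by blast
  then obtain T \<kappa> where T: "\<And>N. N \<in> \<F> \<Longrightarrow> f ` N \<subseteq> T N" "\<And>N. N \<in> \<F> \<Longrightarrow> T N \<subseteq> f ` topspace X" "\<And>N. N \<in> \<F> \<Longrightarrow> 0 < \<kappa> N"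
    "\<And>N. N \<in> \<F> \<Longrightarrow> is_cell (\<kappa> N) (T N)" by metis
  \<comment> \<open>Inserting 1 keeps the minimum meaningful when the manifold is empty.\<close>
  define \<kappa>0 :: real where "\<kappa>0 = Min (insert 1 (\<kappa> ` \<F>))"
  have \<kappa>0: "0 < \<kappa>0" unfolding \<kappa>0_def using \<F>(1) T(3) by (subst Min_gr_iff) auto
  have cell: "is_cell \<kappa>0 (T N)" if N: "N \<in> \<F>" for N
  proof (rule is_cell_subset[OF T(4)[OF N]])
    show "compact (T N)" using T(4)[OF N] unfolding is_cell_def by blast
    show "\<kappa>0 \<le> \<kappa> N" unfolding \<kappa>0_def using \<F>(1) N by simp
  qed (use \<kappa>0 in auto)
  show ?thesis
  proof (rule that[of "T ` \<F>" \<kappa>0])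
    show "\<Union>(T ` \<F>) = f ` topspace X"
    proof (rule equalityI)
      show "\<Union>(T ` \<F>) \<subseteq> f ` topspace X" using T(2) by blast
      show "f ` topspace X \<subseteq> \<Union>(T ` \<F>)"
      proof clarify
        fix p assume "p \<in> topspace X"
        then obtain N where "N \<in> \<F>" "p \<in> N" using \<F>(3) by blast
        then show "f p \<in> \<Union>(T ` \<F>)" using T(1)[of N] by blast
      qed
    qed
    show "\<exists>N S. S \<in> T ` \<F> \<and> openin X N \<and> p \<in> N \<and> f ` N \<subseteq> S" if p: "p \<in> topspace X" for p
    proof -
      obtain N where N: "N \<in> \<F>" "p \<in> N" using \<F>(3) p by blast
      then have "openin X N" using \<F>(2) unfolding \<U>_def by blast
      then show ?thesis using N T(1)[OF N(1)] by blast
    qed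
  qed (use \<F>(1) \<kappa>0 cell in auto)
qed

lemma totally_real_perturbation:
  fixes f :: "'a \<Rightarrow> complex ^ 'n::finite" and K :: "(complex ^ 'n) set" and \<epsilon> :: real
  assumes d: "0 < d" "d < CARD('n)" and X: "compact_space X" and \<A>: "\<And>c. c \<in> \<A> \<Longrightarrow> is_chart d X c" "(\<Union>c\<in>\<A>. fst c) = topspace X"
    and f: "smooth_embedding d X \<A> f" "totally_real d \<A> f" and K: "compact K" "polynomially_convex K"
    and \<C>: "compact_chart_cover X \<A> \<C>" and k: "k \<ge> 1" and \<epsilon>: "\<epsilon> > 0"
  shows "\<exists>g. smooth_embedding d X \<A> g \<and> totally_real d \<A> g \<and> Ck_norm d \<C> k (\<lambda>x. g x - f x) < \<epsilon> \<and>
    (\<forall>x\<in>topspace X. f x \<in> K \<longrightarrow> g x - f x = 0) \<and> polynomial_hull (K \<union> g ` topspace X) = K \<union> g ` topspace X"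
proof -
  obtain \<sigma> where "bij_betw \<sigma> {0..<CARD('n)} (UNIV :: 'n set)"
    using ex_bij_betw_nat_finite[OF finite_class.finite_UNIV] by blast
  then have \<sigma>: "inj_on \<sigma> {..<d}" by (rule inj_on_subset[OF bij_betw_imp_inj_on]) (use d(2) in auto)
  have imm: "immersion d \<A> f" and emb: "embedding_map X euclidean f" using f(1) unfolding smooth_embedding_def by auto
  have sm: "smooth_map d \<A> f" using imm unfolding immersion_def by blast
  obtain \<T> \<kappa> where \<T>: "finite \<T>" "0 < \<kappa>" "\<And>T. T \<in> \<T> \<Longrightarrow> is_cell \<kappa> T" "\<Union>\<T> = f ` topspace X"
    "\<And>p. p \<in> topspace X \<Longrightarrow> \<exists>N T. T \<in> \<T> \<and> openin X N \<and> p \<in> N \<and> f ` N \<subseteq> T"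
    by (rule manifold_cells[OF \<sigma> d X \<A> imm f(2)], assumption, rule that, assumption+)
  obtain B where B: "0 < B" "\<And>(E :: complex ^ 'n \<Rightarrow> complex ^ 'n) M. smooth_on UNIV E \<Longrightarrow> 0 \<le> M \<Longrightarrow> Cbd k UNIV M E \<Longrightarrow>
    Ck_norm d \<C> k (\<lambda>x. E (f x)) \<le> B * M"
    by (rule Ck_norm_compose_le[OF \<sigma> \<A>(1) sm \<C>], assumption, rule that, assumption, blast)
  \<comment> \<open>A Lipschitz constant of at most 1/2 makes \<open>z + E z\<close>
    injective.\<close>
  define \<kappa>' where "\<kappa>' = min \<kappa> (1/2)"
  have \<kappa>': "0 < \<kappa>'" "\<kappa>' \<le> 1/2" unfolding \<kappa>'_def using \<T>(2) by auto
  have cell: "is_cell \<kappa>' T" if T: "T \<in> \<T>" for T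
  proof (rule is_cell_subset[OF \<T>(3)[OF T]])
    show "compact T" using \<T>(3)[OF T] unfolding is_cell_def by blast
  qed (use \<kappa>' in \<open>auto simp: \<kappa>'_def\<close>)
  define D where "D = real (DIM(complex ^ 'n))"
  have D: "D > 0" unfolding D_def by simp
  \<comment> \<open>The first bound makes the Lipschitz constant of \<open>E\<close> smaller than
    the tolerance of the cells, the second makes the norm of the perturbation smaller than
    \<open>\<epsilon>\<close>.\<close>
  define \<delta> where "\<delta> = min (\<kappa>' / (2 * D)) (\<epsilon> / (2 * B))"
  have \<delta>: "\<delta> > 0" unfolding \<delta>_def using \<kappa>'(1) D \<epsilon> B(1) by simp
  have "D * \<delta> \<le> D * (\<kappa>' / (2 * D))" using D unfolding \<delta>_def by (intro mult_left_mono) auto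
  then have D\<delta>: "D * \<delta> < \<kappa>'" using D \<kappa>'(1) by simp
  have "B * \<delta> \<le> B * (\<epsilon> / (2 * B))" using B(1) unfolding \<delta>_def by (intro mult_left_mono) auto
  then have B\<delta>: "B * \<delta> < \<epsilon>" using B(1) \<epsilon> by simp
  obtain E where E: "smooth_on UNIV E" "Cbd k UNIV \<delta> E" "\<And>z. z \<in> K \<Longrightarrow> E z = 0"
    "polynomial_hull (K \<union> (\<lambda>z. z + E z) ` \<Union>\<T>) = K \<union> (\<lambda>z. z + E z) ` \<Union>\<T>"
    by (rule polynomially_convex_perturbation[OF \<T>(1) cell \<kappa>'(1) K \<delta> D\<delta>[unfolded D_def] k], assumption, rule that, assumption, assumption, blast, assumption)
  have lip: "norm (E x - E y) \<le> \<kappa>' * norm (x - y)" for x y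
  proof -
    have "norm (E x - E y) \<le> (D * \<delta>) * norm (x - y)" unfolding D_def by (rule Cbd_imp_Lipschitz[OF E(1) Cbd_le[OF E(2) k]])
    also have "\<dots> \<le> \<kappa>' * norm (x - y)" using D\<delta> by (intro mult_right_mono) auto
    finally show ?thesis .
  qed
  define g where "g x = f x + E (f x)" for x
  have smg: "smooth_map d \<A> g"
  proof (rule smooth_map_from_extensions[OF \<sigma> \<A>(1)])
    fix U \<phi> p assume c: "(U, \<phi>) \<in> \<A>" and p: "p \<in> U"
    obtain V h where V: "open V" "to_vec \<sigma> d (\<phi> p) \<in> V" "smooth_on V h"
      "\<And>q. q \<in> U \<Longrightarrow> to_vec \<sigma> d (\<phi> q) \<in> V \<Longrightarrow> f q = h (to_vec \<sigma> d (\<phi> q))"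
      by (rule smooth_map_extension[OF \<sigma> \<A>(1)[OF c] c sm p], rule that, assumption+)
    have "smooth_on V (\<lambda>y. h y + E (h y))"
      by (rule smooth_on_add[OF V(1,3) smooth_on_compose[OF V(1) open_UNIV E(1) V(3)]]) simp
    then show "\<exists>V h. open V \<and> to_vec \<sigma> d (\<phi> p) \<in> V \<and> smooth_on V h \<and> (\<forall>q\<in>U. to_vec \<sigma> d (\<phi> q) \<in> V \<longrightarrow> g q = h (to_vec \<sigma> d (\<phi> q)))"
      using V unfolding g_def by (intro exI[of _ V] exI[of _ "\<lambda>y. h y + E (h y)"]) auto
  qed
  have diff: "inj_on (differential d (U, \<phi>) g p) (topspace (Euclidean_space d)) \<and>
     differential d (U, \<phi>) g p ` topspace (Euclidean_space d) \<inter> (\<lambda>v. \<i> *s v) ` differential d (U, \<phi>) g p ` topspace (Euclidean_space d) = {0}"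
    if c: "(U, \<phi>) \<in> \<A>" and p: "p \<in> U" for U \<phi> p
  proof -
    have "p \<in> topspace X" using \<A>(2) c p by force
    then obtain N T where N: "T \<in> \<T>" "openin X N" "p \<in> N" "f ` N \<subseteq> T" using \<T>(5) by blast
    have inj: "inj_on (differential d (U, \<phi>) f p) (topspace (Euclidean_space d))" using imm c p unfolding immersion_def by force
    show ?thesis unfolding g_def[abs_def]
      by (rule conjI; rule perturbed_differential[OF \<sigma> d(1) \<A>(1)[OF c] c sm p inj cell[OF N(1)] N(2-4) E(1) lip])
  qed
  have "immersion d \<A> g" unfolding immersion_def using smg diff by force
  moreover have "embedding_map X euclidean g"
  proof (rule continuous_imp_embedding_map[OF _ X Hausdorff_space_euclidean])
    have "continuous_map X euclidean f" 
      by (rule continuous_map_into_fulltopology[OF homeomorphic_imp_continuous_map[OF emb[unfolded embedding_map_def]]])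
    moreover have "continuous_map euclidean euclidean (\<lambda>z. z + E z)"
      using smooth_on_imp_continuous_on[OF E(1)] by (auto intro!: continuous_intros)
    ultimately show "continuous_map X euclidean g"
      using continuous_map_compose[of X euclidean f euclidean "\<lambda>z. z + E z"] unfolding g_def[abs_def] o_def by blast
    show "inj_on g (topspace X)"
    proof (rule inj_onI)
      fix x y assume xy: "x \<in> topspace X" "y \<in> topspace X" "g x = g y"
      have "f x - f y = - (E (f x) - E (f y))" using xy(3) unfolding g_def by (simp add: algebra_simps)
      then have "norm (f x - f y) = norm (E (f x) - E (f y))" by (metis norm_minus_cancel)
      also have "\<dots> \<le> 1/2 * norm (f x - f y)" using order_trans[OF lip mult_right_mono[OF \<kappa>'(2)]] by simp
      finally have "f x = f y" by simp
      moreover have "inj_on f (topspace X)" using emb unfolding embedding_map_def by (rule homeomorphic_imp_injective_map)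
      ultimately show "x = y" using xy(1,2) by (simp add: inj_on_eq_iff)
    qed
  qed
  ultimately have "smooth_embedding d X \<A> g" unfolding smooth_embedding_def by blast
  moreover have "totally_real d \<A> g" unfolding totally_real_def Let_def using diff by force
  moreover have "Ck_norm d \<C> k (\<lambda>x. g x - f x) < \<epsilon>"
    using B(2)[OF E(1) less_imp_le[OF \<delta>] E(2)] B\<delta> unfolding g_def by simp
  moreover have "\<forall>x\<in>topspace X. f x \<in> K \<longrightarrow> g x - f x = 0" using E(3) unfolding g_def by simp
  moreover have "g ` topspace X = (\<lambda>z. z + E z) ` \<Union>\<T>" unfolding \<T>(4) g_def image_image ..
  then have "polynomial_hull (K \<union> g ` topspace X) = K \<union> g ` topspace X" using E(4) by simp
  ultimately show ?thesis by blast
qed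

theorem theorem1p4:
  fixes X :: "'a topology" and \<A> :: "'a chart set" and d :: nat
    and f :: "'a \<Rightarrow> complex ^ 'n::finite" and K :: "(complex ^ 'n) set"
    and \<C> :: "('a chart \<times> 'a set) set" and k :: nat and \<epsilon> :: real
  assumes "smooth_manifold_with_boundary d X \<A>" and "compact_space X" and "d < CARD('n)"
    and "smooth_embedding d X \<A> f" and "totally_real d \<A> f"
    and "compact K" and "polynomially_convex K"
    and "compact_chart_cover X \<A> \<C>" and "k \<ge> 1" and "\<epsilon> > 0"
  shows "\<exists>f\<^sub>\<epsilon> :: 'a \<Rightarrow> complex ^ 'n.
           smooth_embedding d X \<A> f\<^sub>\<epsilon> \<and> totally_real d \<A> f\<^sub>\<epsilon> \<and>
           Ck_norm d \<C> k (\<lambda>x. f\<^sub>\<epsilon> x - f x) < \<epsilon> \<and>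
           (\<forall>x\<in>topspace X. f x \<in> K \<longrightarrow> f\<^sub>\<epsilon> x - f x = 0) \<and>
           polynomial_hull (K \<union> f\<^sub>\<epsilon> ` topspace X) = K \<union> f\<^sub>\<epsilon> ` topspace X"
proof (cases "d = 0")
  case False
  have "\<And>c. c \<in> \<A> \<Longrightarrow> is_chart d X c" "(\<Union>c\<in>\<A>. fst c) = topspace X"
    using assms(1) unfolding smooth_manifold_with_boundary_def by auto
  then show ?thesis using False assms by (intro totally_real_perturbation) auto
next
  case True
  have "finite (topspace X)"
    using assms(1,2) unfolding True smooth_manifold_with_boundary_def by (intro finite_zero_dimensional_manifold[of X \<A>]) auto
  then have "polynomial_hull (K \<union> f ` topspace X) = K \<union> f ` topspace X"
    by (intro polynomially_convex_Un_finite assms(6,7) finite_imageI)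
  \<comment> \<open>In dimension 0 the only admissible list of derivatives is empty, so just the
    value 0 of the difference is collected.\<close>
  moreover have "Ck_norm d \<C> k (\<lambda>x. f x - f x) \<le> 0"
    unfolding Ck_norm_def True by (rule cSup_least) (auto simp: local_rep_def)
  ultimately show ?thesis using assms by (intro exI[of _ f]) auto
qed

end
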